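(* Let $M$ be a filtered manifold equipped with a Riemannian metric $g_{TM}$, let $(d_0,\delta_0)$ be a pair of base differential and codifferential on $M$, and let $(E_0^\bullet, D)$ be the complex defined by $E_0=\ker d_0\cap\ker\delta_0$ and $D=L^{-1}dL\Pi_0$. Then the cohomology of $(E_0^\bullet,D)$ is linearly isomorphic to the de Rham cohomology of the manifold $M$.
   Context: **Filtered manifold.** $M$ is a smooth $n$-dimensional manifold with a filtration of $TM$ by vector subbundles $M\times\{0\}=H^0\subseteq H^1\subseteq\dots\subseteq H^s=TM$ such that $[\Gamma(H^i),\Gamma(H^j)]\subseteq\Gamma(H^{i+j})$ (with $H^i=TM$ for $i>s$); $g_{TM}$ is a Riemannian metric. **Weights and gr.** Write $(H^i)^\perp\subset T^*M$ for the annihilator of $H^i$. $\mathrm{gr}(TM)=\oplus_i H^i/H^{i-1}$, and $\mathrm{gr}(T^*M)=\oplus_{i=1}^s (H^{i-1})^\perp/(H^i)^\perp\cong \mathrm{gr}(TM)^*$, the $i$-th summand having weight $i$; weights add under wedge products, giving $\wedge^k\mathrm{gr}(T^*M)=\oplus_w\wedge^{k,w}\mathrm{gr}(T^*M)$ (functions have weight $0$). $\Omega^{k,\ge w}(M)$ is the space of $k$-forms $\alpha$ with $\alpha(V_1,\dots,V_k)=0$ whenever $V_j\in\Gamma(H^{i_j})$ and $i_1+\dots+i_k<w$; $\Omega^{0,\ge 0}(M)=C^\infty(M)$, $\Omega^{0,\ge1}(M)=\{0\}$; $\Omega^{\bullet,\ge w}=\oplus_k\Omega^{k,\ge w}$.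 Canonically $\Omega^{k,\ge w}(M)/\Omega^{k,\ge w+1}(M)\cong\Gamma(\wedge^{k,w}\mathrm{gr}(T^*M))$. A linear map $A$ on $\Omega^\bullet(M)$ respects the filtration if $A\,\Omega^{\bullet,\ge w}\subseteq\Omega^{\bullet,\ge w}$ for all $w$; then $\mathrm{gr}(A)$ is the induced map on $\Gamma(\wedge^\bullet\mathrm{gr}(T^*M))$. A map is algebraic if it is induced by a smooth bundle map (pointwise linear). **Osculating objects.** The Lie bracket of vector fields induces a Lie bracket on each $\mathrm{gr}(T_xM)$, giving a graded nilpotent Lie algebra $\mathfrak g_xM$. $d_{\mathfrak gM}$ is the algebraic map on $\Gamma(\wedge^\bullet\mathrm{gr}(T^*M))$ equal at $x$ to the Chevalley–Eilenberg differential of $\mathfrak g_xM$: $d_{\mathfrak g_xM}\alpha(V_0,\dots,V_k)=\sum_{i<j}(-1)^{i+j}\alpha([V_i,V_j],V_0,\dots,\hat V_i,\dots,\hat V_j,\dots,V_k)$ (zero in degree $0$). The metric $g_{TM}$ induces a metric on $\mathrm{gr}(TM)$: the summands are orthogonal and $H^i/H^{i-1}$ is identified isometrically with the orthogonal complement of $H^{i-1}$ in $H^i$; hence a metric on $\wedge^\bullet \mathrm{gr}(T^*M)$ (different degrees orthogonal, determinant formula). $d_{\mathfrak gM}^t$ is the pointwise transpose. **Base pair.** $(d_0,\delta_0)$ is a pair of base differential and codifferential when $d_0,\delta_0$ are algebraic maps on $\Omega^\bullet(M)$ with $d_0^2=0=\delta_0^2$; $d_0$ raises and $\delta_0$ lowers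 the degree by one and both respect the filtration; they are disjoint, i.e. $\delta_0d_0\alpha=0\Rightarrow d_0\alpha=0$ and $d_0\delta_0\alpha=0\Rightarrow\delta_0\alpha=0$; and $\mathrm{gr}(d_0)=d_{\mathfrak gM}$, $\mathrm{gr}(\delta_0)=d_{\mathfrak gM}^t$. Set $F_0=\mathrm{Im}\,d_0+\mathrm{Im}\,\delta_0$, $\Box_0=d_0\delta_0+\delta_0d_0$; $\Pi_0=\frac1{2\pi i}\oint_{|z|=\varepsilon}(z-\Box_0)^{-1}dz$ (pointwise, $\varepsilon>0$ small enough), which is the projection onto $E_0$ along $F_0$. **$P$, $L$, $D$.** $d$ is the de Rham differential, $\Box=d\delta_0+\delta_0d$, and $P=\frac1{2\pi i}\oint_{|z|=\varepsilon}(z-\Box)^{-1}dz$ for $\varepsilon>0$ small enough. $L=P\Pi_0+(\mathrm I-P)(\mathrm I-\Pi_0)$, an invertible differential operator. $L^{-1}dL$ commutes with $\Pi_0$, and $D=L^{-1}dL\Pi_0=\Pi_0L^{-1}dL\Pi_0$, which satisfies $D^2=0$ and acts on (sections of) $E_0$, graded by the degree of forms.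
   Formalization: Adds that near each point one radius ε isolates the eigenvalue 0 of □₀; without it Π₀ need not preserve smooth forms (H¹=ker(dz−y²dx) on R³), so L and D are undefined. The resolvent in P is taken on germs, so ε may depend on the point. M is nonempty, of dimension at least 1. *)

theory Defs
  imports
    "HOL-Analysis.Analysis"
    "HOL-Complex_Analysis.Contour_Integration"
    "HOL-Library.Function_Algebras"
begin

section \<open>Linear algebra\<close>

instantiation "fun" :: (type, real_vector) real_vector
begin

definition scaleR_fun :: "real \<Rightarrow> ('a \<Rightarrow> 'b) \<Rightarrow> 'a \<Rightarrow> 'b"
  where "scaleR_fun r f = (\<lambda>x. r *\<^sub>R f x)"

instance
  by standard (auto simp: scaleR_fun_def plus_fun_def fun_eq_iff scaleR_add_right scaleR_add_left)

end

text \<open>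
  An element of the exterior algebra of the dual of a vector space is represented by one function
  on finite lists of vectors; its component of degree \<open>k\<close> is the restriction to lists of length
  \<open>k\<close>. The set \<open>alt_forms W N\<close> is the exterior algebra of \<open>(W/N)\<^sup>*\<close> (with values in
  \<open>\<real>\<close> or \<open>\<complex>\<close>): alternating multilinear functions on the subspace \<open>W\<close> which
  vanish as soon as one argument lies in the subspace \<open>N\<close>, extended by zero to lists that
  are not contained in \<open>W\<close>. When \<open>W/N\<close> has finite dimension \<open>n\<close>, alternation makes
  the components of degree larger than \<open>n\<close> vanish.
\<close>

definition alt_forms :: "'v::real_vector set \<Rightarrow> 'v set \<Rightarrow> ('v list \<Rightarrow> 'b::real_vector) set" where
  "alt_forms W N = {a.
     (\<forall>vs. \<not> set vs \<subseteq> W \<longrightarrow> a vs = 0) \<and>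
     (\<forall>us v v' ws r r'. set us \<subseteq> W \<and> v \<in> W \<and> v' \<in> W \<and> set ws \<subseteq> W \<longrightarrow>
        a (us @ (r *\<^sub>R v + r' *\<^sub>R v') # ws) = r *\<^sub>R a (us @ v # ws) + r' *\<^sub>R a (us @ v' # ws)) \<and>
     (\<forall>us v vs ws. a (us @ v # vs @ v # ws) = 0) \<and>
     (\<forall>vs. set vs \<inter> N \<noteq> {} \<longrightarrow> a vs = 0)}"

definition has_degree :: "nat \<Rightarrow> ('v list \<Rightarrow> 'b::zero) \<Rightarrow> bool" where
  "has_degree k a \<longleftrightarrow> (\<forall>vs. length vs \<noteq> k \<longrightarrow> a vs = 0)"

text \<open>The complex linear extension to complex-valued forms of an operator on real-valued forms.\<close>

definition cext :: "(('v list \<Rightarrow> real) \<Rightarrow> 'v list \<Rightarrow> real) \<Rightarrow> ('v list \<Rightarrow> complex) \<Rightarrow> 'v list \<Rightarrow> complex" where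
  "cext T b = (\<lambda>vs. Complex (T (\<lambda>us. Re (b us)) vs) (T (\<lambda>us. Im (b us)) vs))"

definition gram_det :: "('v \<Rightarrow> 'v \<Rightarrow> real) \<Rightarrow> 'v list \<Rightarrow> 'v list \<Rightarrow> real" where
  "gram_det ip us vs = (\<Sum>p | p permutes {..<length us}.
     of_int (sign p) * (\<Prod>i<length us. ip (us ! i) (vs ! p i)))"

definition coset :: "'a::real_vector set \<Rightarrow> 'a \<Rightarrow> 'a set" where
  "coset B a = (\<lambda>b. a + b) ` B"

text \<open>Existence of a linear isomorphism between the quotient vector spaces \<open>Z/B\<close> and \<open>Z'/B'\<close>.\<close>

definition quotients_isomorphic ::
  "'a::real_vector set \<Rightarrow> 'a set \<Rightarrow> 'b::real_vector set \<Rightarrow> 'b set \<Rightarrow> bool" where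
  "quotients_isomorphic Z B Z' B' \<longleftrightarrow>
     (\<exists>F. bij_betw F (coset B ` Z) (coset B' ` Z') \<and>
        (\<forall>a\<in>Z. \<forall>b\<in>Z. \<forall>a'\<in>Z'. \<forall>b'\<in>Z'. \<forall>r t.
           F (coset B a) = coset B' a' \<and> F (coset B b) = coset B' b' \<longrightarrow>
           F (coset B (r *\<^sub>R a + t *\<^sub>R b)) = coset B' (r *\<^sub>R a' + t *\<^sub>R b')))"

text \<open>Cocycles and coboundaries of a complex with terms \<open>C k\<close>, \<open>k = 0, 1, \<dots>\<close>.\<close>

definition cocycles :: "(nat \<Rightarrow> 'a::real_vector set) \<Rightarrow> ('a \<Rightarrow> 'a) \<Rightarrow> nat \<Rightarrow> 'a set" where
  "cocycles C D k = {a \<in> C k. D a = 0}"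

definition coboundaries :: "(nat \<Rightarrow> 'a::real_vector set) \<Rightarrow> ('a \<Rightarrow> 'a) \<Rightarrow> nat \<Rightarrow> 'a set" where
  "coboundaries C D k = (case k of 0 \<Rightarrow> {0} | Suc j \<Rightarrow> D ` C j)"


section \<open>Smooth manifolds\<close>

text \<open>Functions of class \<open>C\<^sup>n\<close> and \<open>C\<^sup>\<infinity>\<close> on an open subset of a Euclidean space.\<close>

primrec Ck_on :: "nat \<Rightarrow> 'e::euclidean_space set \<Rightarrow> ('e \<Rightarrow> 'f::real_normed_vector) \<Rightarrow> bool" where
  "Ck_on 0 S f \<longleftrightarrow> continuous_on S f"
| "Ck_on (Suc n) S f \<longleftrightarrow> (\<forall>x\<in>S. f differentiable (at x)) \<and>
     (\<forall>v. Ck_on n S (\<lambda>x. frechet_derivative f (at x) v))"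

definition smooth_on :: "'e::euclidean_space set \<Rightarrow> ('e \<Rightarrow> 'f::real_normed_vector) \<Rightarrow> bool" where
  "smooth_on S f \<longleftrightarrow> (\<forall>n. Ck_on n S f)"

type_synonym ('m, 'e) chart = "'m set \<times> ('m \<Rightarrow> 'e)"

text \<open>
  The manifold is the whole type \<open>'m\<close>, whose topology is Hausdorff and second countable by its
  type class. Its dimension is \<open>DIM('e)\<close>.
\<close>

definition smooth_atlas :: "('m::{t2_space,second_countable_topology}, 'e::euclidean_space) chart set \<Rightarrow> bool" where
  "smooth_atlas A \<longleftrightarrow>
     (\<Union>(U,\<phi>)\<in>A. U) = UNIV \<and>
     (\<forall>(U,\<phi>)\<in>A. open U \<and> open (\<phi> ` U) \<and> homeomorphism U (\<phi> ` U) \<phi> (inv_into U \<phi>)) \<and>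
     (\<forall>(U,\<phi>)\<in>A. \<forall>(V,\<psi>)\<in>A. smooth_on (\<phi> ` (U \<inter> V)) (\<psi> \<circ> inv_into U \<phi>))"

definition smooth_functions :: "('m, 'e::euclidean_space) chart set \<Rightarrow> ('m \<Rightarrow> real) set" where
  "smooth_functions A = {f. \<forall>(U,\<phi>)\<in>A. smooth_on (\<phi> ` U) (f \<circ> inv_into U \<phi>)}"

text \<open>
  Tangent vectors at \<open>x\<close> are the derivations at \<open>x\<close> of the algebra of smooth functions, extended
  by zero to functions that are not smooth.
\<close>

type_synonym 'm tvec = "('m \<Rightarrow> real) \<Rightarrow> real"

definition tangent :: "('m, 'e::euclidean_space) chart set \<Rightarrow> 'm \<Rightarrow> 'm tvec set" where
  "tangent A x = {v.
     (\<forall>f. f \<notin> smooth_functions A \<longrightarrow> v f = 0) \<and>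
     (\<forall>f\<in>smooth_functions A. \<forall>g\<in>smooth_functions A. \<forall>a b.
        v (\<lambda>y. a * f y + b * g y) = a * v f + b * v g) \<and>
     (\<forall>f\<in>smooth_functions A. \<forall>g\<in>smooth_functions A.
        v (\<lambda>y. f y * g y) = f x * v g + g x * v f)}"

type_synonym 'm vfield = "'m \<Rightarrow> 'm tvec"

definition vector_fields :: "('m, 'e::euclidean_space) chart set \<Rightarrow> 'm vfield set" where
  "vector_fields A = {X. (\<forall>x. X x \<in> tangent A x) \<and>
     (\<forall>f\<in>smooth_functions A. (\<lambda>x. X x f) \<in> smooth_functions A)}"

definition bracket :: "'m vfield \<Rightarrow> 'm vfield \<Rightarrow> 'm vfield" where
  "bracket X Y = (\<lambda>x f. X x (\<lambda>y. Y y f) - Y x (\<lambda>y. X y f))"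

definition riemannian_metric ::
  "('m, 'e::euclidean_space) chart set \<Rightarrow> ('m \<Rightarrow> 'm tvec \<Rightarrow> 'm tvec \<Rightarrow> real) \<Rightarrow> bool" where
  "riemannian_metric A g \<longleftrightarrow>
     (\<forall>x. \<forall>u\<in>tangent A x. \<forall>v\<in>tangent A x.
        g x u v = g x v u \<and> (u \<noteq> 0 \<longrightarrow> g x u u > 0) \<and>
        (\<forall>w\<in>tangent A x. \<forall>r t. g x (r *\<^sub>R u + t *\<^sub>R v) w = r * g x u w + t * g x v w)) \<and>
     (\<forall>X\<in>vector_fields A. \<forall>Y\<in>vector_fields A. (\<lambda>x. g x (X x) (Y x)) \<in> smooth_functions A)"


section \<open>Differential forms\<close>

type_synonym ('m, 'b) form = "'m \<Rightarrow> 'm tvec list \<Rightarrow> 'b"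

definition eval_form :: "('m, 'b) form \<Rightarrow> 'm vfield list \<Rightarrow> 'm \<Rightarrow> 'b" where
  "eval_form \<omega> Xs = (\<lambda>x. \<omega> x (map (\<lambda>X. X x) Xs))"

text \<open>\<open>cotensors A x\<close> is the exterior algebra of \<open>T\<^sub>x\<^sup>*M\<close>, or its complexification,
  depending on the type of values.\<close>

definition cotensors :: "('m, 'e::euclidean_space) chart set \<Rightarrow> 'm \<Rightarrow> ('m tvec list \<Rightarrow> 'b::real_vector) set" where
  "cotensors A x = alt_forms (tangent A x) {0}"

definition forms :: "('m, 'e::euclidean_space) chart set \<Rightarrow> ('m, real) form set" where
  "forms A = {\<omega>. (\<forall>x. \<omega> x \<in> cotensors A x) \<and>
     (\<forall>Xs. set Xs \<subseteq> vector_fields A \<longrightarrow> eval_form \<omega> Xs \<in> smooth_functions A)}"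

definition complex_forms :: "('m, 'e::euclidean_space) chart set \<Rightarrow> ('m, complex) form set" where
  "complex_forms A = {\<omega>. (\<lambda>x vs. Re (\<omega> x vs)) \<in> forms A \<and> (\<lambda>x vs. Im (\<omega> x vs)) \<in> forms A}"

definition forms_deg :: "('m, 'e::euclidean_space) chart set \<Rightarrow> nat \<Rightarrow> ('m, real) form set" where
  "forms_deg A k = {\<omega> \<in> forms A. \<forall>x. has_degree k (\<omega> x)}"

definition deRham_formula :: "('m, real) form \<Rightarrow> 'm vfield list \<Rightarrow> 'm \<Rightarrow> real" where
  "deRham_formula \<omega> Xs x =
     (\<Sum>i<length Xs. (-1) ^ i * (Xs ! i) x (eval_form \<omega> (nths Xs (- {i})))) +
     (\<Sum>j<length Xs. \<Sum>i<j. (-1) ^ (i + j) *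
        eval_form \<omega> (bracket (Xs ! i) (Xs ! j) # nths Xs (- {i, j})) x)"

text \<open>The exterior derivative of a form, given by its invariant formula.\<close>

definition deRham :: "('m, 'e::euclidean_space) chart set \<Rightarrow> ('m, real) form \<Rightarrow> ('m, real) form" where
  "deRham A \<omega> = (THE \<eta>. \<eta> \<in> forms A \<and>
     (\<forall>Xs. set Xs \<subseteq> vector_fields A \<longrightarrow> eval_form \<eta> Xs = deRham_formula \<omega> Xs))"

text \<open>
  An algebraic map is given by its underlying bundle map, a family of linear maps of the fibres;
  smoothness of the bundle map means that it takes smooth sections to smooth sections.
\<close>

type_synonym 'm bundle_map = "'m \<Rightarrow> ('m tvec list \<Rightarrow> real) \<Rightarrow> 'm tvec list \<Rightarrow> real"

definition on_forms :: "'m bundle_map \<Rightarrow> ('m, real) form \<Rightarrow> ('m, real) form" where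
  "on_forms T \<alpha> = (\<lambda>x. T x (\<alpha> x))"

definition smooth_bundle_map :: "('m, 'e::euclidean_space) chart set \<Rightarrow> 'm bundle_map \<Rightarrow> bool" where
  "smooth_bundle_map A T \<longleftrightarrow>
     (\<forall>x. \<forall>a\<in>cotensors A x. T x a \<in> cotensors A x \<and>
        (\<forall>b\<in>cotensors A x. \<forall>r t. T x (r *\<^sub>R a + t *\<^sub>R b) = r *\<^sub>R T x a + t *\<^sub>R T x b)) \<and>
     (\<forall>\<alpha>\<in>forms A. on_forms T \<alpha> \<in> forms A)"


section \<open>Filtered manifolds\<close>

definition sections :: "('m, 'e::euclidean_space) chart set \<Rightarrow> ('m \<Rightarrow> 'm tvec set) \<Rightarrow> 'm vfield set" where
  "sections A V = {X \<in> vector_fields A. \<forall>x. X x \<in> V x}"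

text \<open>Smooth subbundles of the tangent bundle are given by local frames. The frame fields may be
  taken to be defined on all of the manifold.\<close>

definition subbundle ::
  "('m::topological_space, 'e::euclidean_space) chart set \<Rightarrow> ('m \<Rightarrow> 'm tvec set) \<Rightarrow> bool" where
  "subbundle A V \<longleftrightarrow> (\<forall>x. \<exists>U r (X :: nat \<Rightarrow> 'm vfield). open U \<and> x \<in> U \<and>
     (\<forall>j<r. X j \<in> vector_fields A) \<and>
     (\<forall>y\<in>U. inj_on (\<lambda>j. X j y) {..<r} \<and> independent ((\<lambda>j. X j y) ` {..<r}) \<and>
        V y = span ((\<lambda>j. X j y) ` {..<r})))"

definition filtration ::
  "('m::topological_space, 'e::euclidean_space) chart set \<Rightarrow> (nat \<Rightarrow> 'm \<Rightarrow> 'm tvec set) \<Rightarrow> nat \<Rightarrow> bool" where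
  "filtration A H s \<longleftrightarrow>
     (\<forall>i. subbundle A (H i)) \<and>
     (\<forall>x. H 0 x = {0}) \<and>
     (\<forall>i x. H i x \<subseteq> H (Suc i) x) \<and>
     (\<forall>i x. i \<ge> s \<longrightarrow> H i x = tangent A x) \<and>
     (\<forall>i j. \<forall>X\<in>sections A (H i). \<forall>Y\<in>sections A (H j). bracket X Y \<in> sections A (H (i + j)))"

definition forms_weight_ge ::
  "('m, 'e::euclidean_space) chart set \<Rightarrow> (nat \<Rightarrow> 'm \<Rightarrow> 'm tvec set) \<Rightarrow> nat \<Rightarrow> ('m, real) form set" where
  "forms_weight_ge A H w = {\<alpha> \<in> forms A. \<forall>Xs is.
     list_all2 (\<lambda>X i. X \<in> sections A (H i)) Xs is \<and> sum_list is < w \<longrightarrow> eval_form \<alpha> Xs = 0}"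

definition respects_filtration ::
  "('m, 'e::euclidean_space) chart set \<Rightarrow> (nat \<Rightarrow> 'm \<Rightarrow> 'm tvec set) \<Rightarrow>
   (('m, real) form \<Rightarrow> ('m, real) form) \<Rightarrow> bool" where
  "respects_filtration A H T \<longleftrightarrow> (\<forall>w. T ` forms_weight_ge A H w \<subseteq> forms_weight_ge A H w)"

text \<open>
  The graded space \<open>gr(T\<^sub>xM) = \<Oplus>\<^sub>i H\<^sup>i\<^sub>x/H\<^sup>i\<^sup>-\<^sup>1\<^sub>x\<close> is written as the quotient of
  \<open>gr_total H x\<close>, the families \<open>u\<close> with \<open>u i \<in> H i x\<close>, by \<open>gr_null H x\<close>, the families with
  \<open>u i \<in> H (i - 1) x\<close>. Components with \<open>i = 0\<close> or \<open>i > s\<close> do not contribute to the quotient.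
  Accordingly \<open>gr_cotensors H x\<close> is the exterior algebra of \<open>gr(T\<^sub>xM)\<^sup>* = gr(T\<^sub>x\<^sup>*M)\<close>.
\<close>

type_synonym 'm gvec = "nat \<Rightarrow> 'm tvec"

definition gr_total :: "(nat \<Rightarrow> 'm \<Rightarrow> 'm tvec set) \<Rightarrow> 'm \<Rightarrow> 'm gvec set" where
  "gr_total H x = {u. \<forall>i. u i \<in> H i x}"

definition gr_null :: "(nat \<Rightarrow> 'm \<Rightarrow> 'm tvec set) \<Rightarrow> 'm \<Rightarrow> 'm gvec set" where
  "gr_null H x = {u. \<forall>i. u i \<in> H (i - 1) x}"

definition gr_cotensors :: "(nat \<Rightarrow> 'm \<Rightarrow> 'm tvec set) \<Rightarrow> 'm \<Rightarrow> ('m gvec list \<Rightarrow> real) set" where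
  "gr_cotensors H x = alt_forms (gr_total H x) (gr_null H x)"

text \<open>
  The image of \<open>\<alpha> \<in> \<Omega>\<^sup>\<bullet>\<^sup>,\<^sup>\<ge>\<^sup>w\<close> under the canonical isomorphism from
  \<open>\<Omega>\<^sup>\<bullet>\<^sup>,\<^sup>\<ge>\<^sup>w/\<Omega>\<^sup>\<bullet>\<^sup>,\<^sup>\<ge>\<^sup>w\<^sup>+\<^sup>1\<close> to the sections of weight \<open>w\<close>: on homogeneous vectors
  whose weights add up to \<open>w\<close> it is given by \<open>\<alpha>\<close>, on all other homogeneous vectors by zero.
\<close>

definition symbol ::
  "(nat \<Rightarrow> 'm \<Rightarrow> 'm tvec set) \<Rightarrow> nat \<Rightarrow> ('m, real) form \<Rightarrow> 'm \<Rightarrow> 'm gvec list \<Rightarrow> real" where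
  "symbol H w \<alpha> x us = (if set us \<subseteq> gr_total H x
     then \<Sum>is | length is = length us \<and> sum_list is = w. \<alpha> x (map2 (\<lambda>u i. u i) us is)
     else 0)"

text \<open>\<open>gr(T)\<close> is the algebraic map given by the fibre maps \<open>S x\<close>. Every section of the exterior
  algebra of \<open>gr(T\<^sup>*M)\<close> is a finite sum of symbols, so this determines \<open>S\<close> on all sections.\<close>

definition gr_is ::
  "('m, 'e::euclidean_space) chart set \<Rightarrow> (nat \<Rightarrow> 'm \<Rightarrow> 'm tvec set) \<Rightarrow>
   (('m, real) form \<Rightarrow> ('m, real) form) \<Rightarrow>
   ('m \<Rightarrow> ('m gvec list \<Rightarrow> real) \<Rightarrow> 'm gvec list \<Rightarrow> real) \<Rightarrow> bool" where
  "gr_is A H T S \<longleftrightarrow> (\<forall>w. \<forall>\<alpha>\<in>forms_weight_ge A H w. \<forall>x. symbol H w (T \<alpha>) x = S x (symbol H w \<alpha> x))"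

text \<open>
  The Lie bracket of the osculating Lie algebra. For \<open>v \<in> H\<^sup>i\<^sub>x\<close> and \<open>w \<in> H\<^sup>j\<^sub>x\<close>,
  \<open>osc_bracket_hom\<close> picks a representative of their bracket in \<open>H\<^sup>i\<^sup>+\<^sup>j\<^sub>x/H\<^sup>i\<^sup>+\<^sup>j\<^sup>-\<^sup>1\<^sub>x\<close>;
  only its class is independent of the vector fields chosen.
\<close>

definition osc_bracket_hom ::
  "('m, 'e::euclidean_space) chart set \<Rightarrow> (nat \<Rightarrow> 'm \<Rightarrow> 'm tvec set) \<Rightarrow> 'm \<Rightarrow>
   nat \<Rightarrow> nat \<Rightarrow> 'm tvec \<Rightarrow> 'm tvec \<Rightarrow> 'm tvec" where
  "osc_bracket_hom A H x i j v w = (SOME z. \<exists>X\<in>sections A (H i). \<exists>Y\<in>sections A (H j).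
     X x = v \<and> Y x = w \<and> z = bracket X Y x)"

definition osc_bracket ::
  "('m, 'e::euclidean_space) chart set \<Rightarrow> (nat \<Rightarrow> 'm \<Rightarrow> 'm tvec set) \<Rightarrow> 'm \<Rightarrow>
   'm gvec \<Rightarrow> 'm gvec \<Rightarrow> 'm gvec" where
  "osc_bracket A H x u v = (\<lambda>k. \<Sum>i\<le>k. osc_bracket_hom A H x i (k - i) (u i) (v (k - i)))"

definition osc_differential ::
  "('m, 'e::euclidean_space) chart set \<Rightarrow> (nat \<Rightarrow> 'm \<Rightarrow> 'm tvec set) \<Rightarrow> 'm \<Rightarrow>
   ('m gvec list \<Rightarrow> real) \<Rightarrow> 'm gvec list \<Rightarrow> real" where
  "osc_differential A H x \<phi> us = (if set us \<subseteq> gr_total H x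
     then \<Sum>j<length us. \<Sum>i<j. (-1) ^ (i + j) *
       \<phi> (osc_bracket A H x (us ! i) (us ! j) # nths us (- {i, j}))
     else 0)"

text \<open>The metric on \<open>gr(T\<^sub>xM)\<close>, as a semi-definite form on \<open>gr_total H x\<close> with kernel
  \<open>gr_null H x\<close>; \<open>orth_rep\<close> is the representative in the orthogonal complement of
  \<open>H\<^sup>i\<^sup>-\<^sup>1\<^sub>x\<close> of the class of a vector of \<open>H\<^sup>i\<^sub>x\<close>.\<close>

definition orth_rep ::
  "(nat \<Rightarrow> 'm \<Rightarrow> 'm tvec set) \<Rightarrow> ('m \<Rightarrow> 'm tvec \<Rightarrow> 'm tvec \<Rightarrow> real) \<Rightarrow> 'm \<Rightarrow> nat \<Rightarrow> 'm tvec \<Rightarrow> 'm tvec" where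
  "orth_rep H g x i v = (THE p. p \<in> H i x \<and> p - v \<in> H (i - 1) x \<and> (\<forall>w\<in>H (i - 1) x. g x p w = 0))"

definition gr_metric ::
  "(nat \<Rightarrow> 'm \<Rightarrow> 'm tvec set) \<Rightarrow> nat \<Rightarrow> ('m \<Rightarrow> 'm tvec \<Rightarrow> 'm tvec \<Rightarrow> real) \<Rightarrow> 'm \<Rightarrow>
   'm gvec \<Rightarrow> 'm gvec \<Rightarrow> real" where
  "gr_metric H s g x u v = (\<Sum>i=1..s. g x (orth_rep H g x i (u i)) (orth_rep H g x i (v i)))"

text \<open>\<open>flat_wedge [u\<^sub>1, \<dots>, u\<^sub>k]\<close> is the wedge product of the covectors \<open>\<langle>u\<^sub>i, \<cdot>\<rangle>\<close>,
  with the normalisation \<open>(a\<^sub>1 \<and> \<dots> \<and> a\<^sub>k)(v\<^sub>1, \<dots>, v\<^sub>k) = det (a\<^sub>i(v\<^sub>j))\<close>. Since the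
  metric on covectors is dual to the one on vectors, \<open>u \<mapsto> \<langle>u, \<cdot>\<rangle>\<close> is an isometry onto the
  covectors, which gives the determinant formula in \<open>gr_form_metric\<close>.\<close>

definition flat_wedge ::
  "(nat \<Rightarrow> 'm \<Rightarrow> 'm tvec set) \<Rightarrow> nat \<Rightarrow> ('m \<Rightarrow> 'm tvec \<Rightarrow> 'm tvec \<Rightarrow> real) \<Rightarrow> 'm \<Rightarrow>
   'm gvec list \<Rightarrow> 'm gvec list \<Rightarrow> real" where
  "flat_wedge H s g x us vs = (if set vs \<subseteq> gr_total H x \<and> length vs = length us
     then gram_det (gr_metric H s g x) us vs else 0)"

definition gr_form_metric ::
  "(nat \<Rightarrow> 'm \<Rightarrow> 'm tvec set) \<Rightarrow> nat \<Rightarrow> ('m \<Rightarrow> 'm tvec \<Rightarrow> 'm tvec \<Rightarrow> real) \<Rightarrow> 'm \<Rightarrow>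
   ('m gvec list \<Rightarrow> real) \<Rightarrow> ('m gvec list \<Rightarrow> real) \<Rightarrow> real" where
  "gr_form_metric H s g x = (THE ip.
     (\<forall>a b. a \<notin> gr_cotensors H x \<or> b \<notin> gr_cotensors H x \<longrightarrow> ip a b = 0) \<and>
     (\<forall>a\<in>gr_cotensors H x. \<forall>b\<in>gr_cotensors H x. \<forall>c\<in>gr_cotensors H x. \<forall>r t.
        ip (r *\<^sub>R a + t *\<^sub>R b) c = r * ip a c + t * ip b c \<and>
        ip c (r *\<^sub>R a + t *\<^sub>R b) = r * ip c a + t * ip c b) \<and>
     (\<forall>us vs. set us \<subseteq> gr_total H x \<and> set vs \<subseteq> gr_total H x \<longrightarrow>
        ip (flat_wedge H s g x us) (flat_wedge H s g x vs) =
          (if length us = length vs then gram_det (gr_metric H s g x) us vs else 0)))"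

definition osc_codifferential ::
  "('m, 'e::euclidean_space) chart set \<Rightarrow> (nat \<Rightarrow> 'm \<Rightarrow> 'm tvec set) \<Rightarrow> nat \<Rightarrow>
   ('m \<Rightarrow> 'm tvec \<Rightarrow> 'm tvec \<Rightarrow> real) \<Rightarrow> 'm \<Rightarrow> ('m gvec list \<Rightarrow> real) \<Rightarrow> 'm gvec list \<Rightarrow> real" where
  "osc_codifferential A H s g x \<psi> = (THE \<theta>. \<theta> \<in> gr_cotensors H x \<and>
     (\<forall>\<phi>\<in>gr_cotensors H x.
        gr_form_metric H s g x \<phi> \<theta> = gr_form_metric H s g x (osc_differential A H x \<phi>) \<psi>))"

definition base_pair ::
  "('m, 'e::euclidean_space) chart set \<Rightarrow> (nat \<Rightarrow> 'm \<Rightarrow> 'm tvec set) \<Rightarrow> nat \<Rightarrow>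
   ('m \<Rightarrow> 'm tvec \<Rightarrow> 'm tvec \<Rightarrow> real) \<Rightarrow> 'm bundle_map \<Rightarrow> 'm bundle_map \<Rightarrow> bool" where
  "base_pair A H s g d\<^sub>0 \<delta>\<^sub>0 \<longleftrightarrow>
     smooth_bundle_map A d\<^sub>0 \<and> smooth_bundle_map A \<delta>\<^sub>0 \<and>
     (\<forall>\<alpha>\<in>forms A. on_forms d\<^sub>0 (on_forms d\<^sub>0 \<alpha>) = 0 \<and> on_forms \<delta>\<^sub>0 (on_forms \<delta>\<^sub>0 \<alpha>) = 0) \<and>
     (\<forall>k. \<forall>\<alpha>\<in>forms_deg A k. on_forms d\<^sub>0 \<alpha> \<in> forms_deg A (Suc k)) \<and>
     (\<forall>k. \<forall>\<alpha>\<in>forms_deg A (Suc k). on_forms \<delta>\<^sub>0 \<alpha> \<in> forms_deg A k) \<and>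
     (\<forall>\<alpha>\<in>forms_deg A 0. on_forms \<delta>\<^sub>0 \<alpha> = 0) \<and>
     respects_filtration A H (on_forms d\<^sub>0) \<and> respects_filtration A H (on_forms \<delta>\<^sub>0) \<and>
     (\<forall>\<alpha>\<in>forms A. on_forms \<delta>\<^sub>0 (on_forms d\<^sub>0 \<alpha>) = 0 \<longrightarrow> on_forms d\<^sub>0 \<alpha> = 0) \<and>
     (\<forall>\<alpha>\<in>forms A. on_forms d\<^sub>0 (on_forms \<delta>\<^sub>0 \<alpha>) = 0 \<longrightarrow> on_forms \<delta>\<^sub>0 \<alpha> = 0) \<and>
     gr_is A H (on_forms d\<^sub>0) (osc_differential A H) \<and>
     gr_is A H (on_forms \<delta>\<^sub>0) (osc_codifferential A H s g)"


section \<open>The projections, the operator L and the complex\<close>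

definition box0 :: "'m bundle_map \<Rightarrow> 'm bundle_map \<Rightarrow> 'm bundle_map" where
  "box0 d\<^sub>0 \<delta>\<^sub>0 x a = d\<^sub>0 x (\<delta>\<^sub>0 x a) + \<delta>\<^sub>0 x (d\<^sub>0 x a)"

definition z_minus_box0 ::
  "'m bundle_map \<Rightarrow> 'm bundle_map \<Rightarrow> complex \<Rightarrow> 'm \<Rightarrow> ('m tvec list \<Rightarrow> complex) \<Rightarrow> 'm tvec list \<Rightarrow> complex" where
  "z_minus_box0 d\<^sub>0 \<delta>\<^sub>0 z x b = (\<lambda>vs. z * b vs - cext (box0 d\<^sub>0 \<delta>\<^sub>0 x) b vs)"

definition resolvent0 ::
  "('m, 'e::euclidean_space) chart set \<Rightarrow> 'm bundle_map \<Rightarrow> 'm bundle_map \<Rightarrow> complex \<Rightarrow> 'm \<Rightarrow>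
   ('m tvec list \<Rightarrow> real) \<Rightarrow> 'm tvec list \<Rightarrow> complex" where
  "resolvent0 A d\<^sub>0 \<delta>\<^sub>0 z x a =
     (THE b. b \<in> cotensors A x \<and> z_minus_box0 d\<^sub>0 \<delta>\<^sub>0 z x b = (\<lambda>vs. of_real (a vs)))"

text \<open>
  The value of \<open>1/(2\<pi>i)\<close> times the integral of \<open>f\<close> along the circle \<open>\<bar>z\<bar> = \<epsilon>\<close>, for every
  sufficiently small \<open>\<epsilon> > 0\<close>.
\<close>

definition small_circle_integral :: "(complex \<Rightarrow> complex) \<Rightarrow> complex" where
  "small_circle_integral f = (THE c. \<forall>\<^sub>F \<epsilon> in at_right 0.
     contour_integral (circlepath 0 \<epsilon>) f / (2 * of_real pi * \<i>) = c)"

text \<open>The contour integrals of resolvents of real operators are real; the real part below only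
  converts the type.\<close>

definition Pi0 :: "('m, 'e::euclidean_space) chart set \<Rightarrow> 'm bundle_map \<Rightarrow> 'm bundle_map \<Rightarrow> 'm bundle_map" where
  "Pi0 A d\<^sub>0 \<delta>\<^sub>0 x a vs = Re (small_circle_integral (\<lambda>z. resolvent0 A d\<^sub>0 \<delta>\<^sub>0 z x a vs))"

text \<open>
  The radius \<open>\<epsilon>\<close> in the definition of \<open>\<Pi>\<^sub>0\<close> can be chosen locally uniformly:
  near every point, \<open>0\<close> is the only eigenvalue of \<open>\<box>\<^sub>0\<close> of modulus at most \<open>\<epsilon>\<close>.
  This is what makes \<open>\<Pi>\<^sub>0\<close> and \<open>P\<close> act on smooth forms, so that \<open>L\<close> and \<open>D\<close> are
  defined, and \<open>E\<^sub>0\<close> a vector bundle. It does not follow from the constant ranks of the \<open>H\<^sup>i\<close>: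
  on \<open>\<real>\<^sup>3\<close> with \<open>H\<^sup>1 = ker (dz - y\<^sup>2 dx)\<close> and \<open>H\<^sup>2 = TM\<close> the rank of the osculating
  differential drops along \<open>y = 0\<close>, so that \<open>\<Pi>\<^sub>0\<close> is discontinuous there.
\<close>

definition locally_uniform_radius ::
  "('m::topological_space, 'e::euclidean_space) chart set \<Rightarrow> 'm bundle_map \<Rightarrow> 'm bundle_map \<Rightarrow> bool" where
  "locally_uniform_radius A d\<^sub>0 \<delta>\<^sub>0 \<longleftrightarrow> (\<forall>x. \<exists>\<epsilon>>0. \<forall>\<^sub>F y in nhds x. \<forall>z. 0 < cmod z \<and> cmod z \<le> \<epsilon> \<longrightarrow>
     bij_betw (z_minus_box0 d\<^sub>0 \<delta>\<^sub>0 z y) (cotensors A y) (cotensors A y))"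

definition box ::
  "('m, 'e::euclidean_space) chart set \<Rightarrow> 'm bundle_map \<Rightarrow> ('m, real) form \<Rightarrow> ('m, real) form" where
  "box A \<delta>\<^sub>0 \<alpha> = deRham A (on_forms \<delta>\<^sub>0 \<alpha>) + on_forms \<delta>\<^sub>0 (deRham A \<alpha>)"

definition box_complex ::
  "('m, 'e::euclidean_space) chart set \<Rightarrow> 'm bundle_map \<Rightarrow> ('m, complex) form \<Rightarrow> ('m, complex) form" where
  "box_complex A \<delta>\<^sub>0 \<beta> = (\<lambda>x vs. Complex
     (box A \<delta>\<^sub>0 (\<lambda>y us. Re (\<beta> y us)) x vs) (box A \<delta>\<^sub>0 (\<lambda>y us. Im (\<beta> y us)) x vs))"

text \<open>
  The value at \<open>x\<close> of \<open>(z - \<box>)\<^sup>-\<^sup>1 \<alpha>\<close>. The resolvent is taken on germs of forms at \<open>x\<close>: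
  the equation \<open>(z - \<box>) \<beta> = \<alpha>\<close> is only required near \<open>x\<close>, so that the radius of the contour
  may depend on \<open>x\<close> and need not be uniform on a noncompact manifold. If \<open>z - \<box>\<close> is
  invertible on all forms, this is the value at \<open>x\<close> of the global inverse.
\<close>

definition resolvent ::
  "('m::topological_space, 'e::euclidean_space) chart set \<Rightarrow> 'm bundle_map \<Rightarrow> complex \<Rightarrow>
   ('m, real) form \<Rightarrow> 'm \<Rightarrow> 'm tvec list \<Rightarrow> complex" where
  "resolvent A \<delta>\<^sub>0 z \<alpha> x = (THE b. \<exists>\<beta>\<in>complex_forms A. b = \<beta> x \<and>
     (\<forall>\<^sub>F y in nhds x. \<forall>vs. z * \<beta> y vs - box_complex A \<delta>\<^sub>0 \<beta> y vs = of_real (\<alpha> y vs)))"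

definition P_proj ::
  "('m::topological_space, 'e::euclidean_space) chart set \<Rightarrow> 'm bundle_map \<Rightarrow>
   ('m, real) form \<Rightarrow> ('m, real) form" where
  "P_proj A \<delta>\<^sub>0 \<alpha> = (\<lambda>x vs. Re (small_circle_integral (\<lambda>z. resolvent A \<delta>\<^sub>0 z \<alpha> x vs)))"

definition L_op ::
  "('m::topological_space, 'e::euclidean_space) chart set \<Rightarrow> 'm bundle_map \<Rightarrow> 'm bundle_map \<Rightarrow>
   ('m, real) form \<Rightarrow> ('m, real) form" where
  "L_op A d\<^sub>0 \<delta>\<^sub>0 \<alpha> =
     (let \<beta> = on_forms (Pi0 A d\<^sub>0 \<delta>\<^sub>0) \<alpha>; \<gamma> = \<alpha> - \<beta>
      in P_proj A \<delta>\<^sub>0 \<beta> + (\<gamma> - P_proj A \<delta>\<^sub>0 \<gamma>))"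

definition D_op ::
  "('m::topological_space, 'e::euclidean_space) chart set \<Rightarrow> 'm bundle_map \<Rightarrow> 'm bundle_map \<Rightarrow>
   ('m, real) form \<Rightarrow> ('m, real) form" where
  "D_op A d\<^sub>0 \<delta>\<^sub>0 \<alpha> =
     inv_into (forms A) (L_op A d\<^sub>0 \<delta>\<^sub>0) (deRham A (L_op A d\<^sub>0 \<delta>\<^sub>0 (on_forms (Pi0 A d\<^sub>0 \<delta>\<^sub>0) \<alpha>)))"

definition E0 ::
  "('m, 'e::euclidean_space) chart set \<Rightarrow> 'm bundle_map \<Rightarrow> 'm bundle_map \<Rightarrow> nat \<Rightarrow> ('m, real) form set" where
  "E0 A d\<^sub>0 \<delta>\<^sub>0 k = {\<alpha> \<in> forms_deg A k. on_forms d\<^sub>0 \<alpha> = 0 \<and> on_forms \<delta>\<^sub>0 \<alpha> = 0}"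

end

theory Submission
  imports Defs "Jordan_Normal_Form.Char_Poly" "HOL-Complex_Analysis.Cauchy_Integral_Formula"
begin

text \<open>
  Write \<open>\<Pi>\<^sub>0 = u(\<box>\<^sub>0)/u(0)\<close> near a point, where \<open>u\<close> is the characteristic polynomial of
  \<open>\<box>\<^sub>0\<close> divided by its power of \<open>z\<close>; the locally uniform radius makes that power locally
  constant, so that \<open>\<Pi>\<^sub>0\<close> and the Green operator \<open>Q\<close> of \<open>\<box>\<^sub>0\<close> are smooth. As
  \<open>gr(d\<^sub>0)\<close> is the osculating differential, \<open>d - d\<^sub>0\<close> raises the weight, and operators
  \<open>1 + T\<close> with \<open>T\<close> local and weight raising are inverted by locally finite Neumann series.
  With \<open>K = (1 + Q (d - d\<^sub>0) \<delta>\<^sub>0)\<^sup>-\<^sup>1\<close> and \<open>h = \<delta>\<^sub>0 K Q\<close> the homological perturbation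
  lemma gives a projection \<open>1 - h d - d h\<close>. Solving \<open>(z - \<box>) \<beta> = \<alpha>\<close> on germs, weight by weight,
  shows that the resolvent has a pole of uniformly bounded order at \<open>0\<close> and that its residue is
  this projection, which is therefore \<open>P\<close>. So \<open>P\<close> is chain homotopic to the identity, and
  \<open>L - 1\<close> raises the weight. Hence \<open>L\<close> is invertible and \<open>\<alpha> \<mapsto> L \<alpha>\<close> identifies
  \<open>(E\<^sub>0, D)\<close> with the de Rham complex on the image of \<open>P\<close>.
\<close>

section \<open>Smooth functions\<close>

text \<open>The obstacle is that \<open>Pi0\<close> and \<open>P_proj\<close> are contour integrals
  of resolvents given by definite descriptions, on fibres and on germs, so existence, uniqueness and
  the pole at 0 must be settled before anything can be computed with them. Disjointness takes the
  place of Hodge theory: it makes the kernel of d0 delta0 + delta0 d0 the intersection of the two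
  kernels and the eigenvalue 0 semisimple, hence the pole of the algebraic resolvent simple. For box
  = d delta0 + delta0 d the perturbation lemma also supplies R with box R = 1 - P, P R = 0 and box P
  = 0; this determines the Laurent expansion up to a remainder, for which a bound on the order of
  the pole suffices. Radii and weight bounds may depend on the point, but all operators are local
  and forms of large weight vanish near a given point, so the arguments run near one point, with
  functions and forms extended by bump functions. The factor 1/u(z) of the algebraic resolvent is a
  function on M that does not commute with d; its commutators with box raise the weight, so the
  recursion for the resolvent still terminates.\<close>

lemma frechet_derivative_cong_near:
  assumes "\<forall>\<^sub>F y in nhds x. f y = g y"
  shows "frechet_derivative f (at x) = frechet_derivative g (at x)"
proof -
  have ev: "\<forall>\<^sub>F y in at x. f y = g y"
    using assms unfolding eventually_at_filter by (auto elim: eventually_mono)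
  have "f x = g x"
    using eventually_nhds_x_imp_x[OF assms] .
  have "(f has_derivative D) (at x) \<longleftrightarrow> (g has_derivative D) (at x)" for D
    using has_derivative_transform_eventually[of f D x UNIV g] has_derivative_transform_eventually[of g D x UNIV f]
      ev \<open>f x = g x\<close> by (auto simp: eq_commute)
  then show ?thesis
    unfolding frechet_derivative_def by auto
qed

lemma differentiable_cong_near:
  assumes "\<forall>\<^sub>F y in nhds x. f y = g y" "f differentiable (at x)"
  shows "g differentiable (at x)"
proof -
  have ev: "\<forall>\<^sub>F y in at x. f y = g y"
    using assms unfolding eventually_at_filter by (auto elim: eventually_mono)
  have "f x = g x"
    using eventually_nhds_x_imp_x[OF assms(1)] .
  then show ?thesis
    using assms(2) ev has_derivative_transform_eventually[of f _ x UNIV g] unfolding differentiable_def by auto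
qed

lemma Ck_on_cong:
  assumes "open S" "\<And>x. x \<in> S \<Longrightarrow> f x = g x"
  shows "Ck_on n S f \<longleftrightarrow> Ck_on n S g"
  using assms(2)
proof (induction n arbitrary: f g)
  case 0
  then show ?case using continuous_on_cong[OF refl 0] by simp
next
  case (Suc n)
  have ev: "\<forall>\<^sub>F y in nhds x. f y = g y" "\<forall>\<^sub>F y in nhds x. g y = f y" if "x \<in> S" for x
    unfolding eventually_nhds using Suc.prems \<open>open S\<close> that by auto
  have "Ck_on n S (\<lambda>x. frechet_derivative f (at x) v) \<longleftrightarrow> Ck_on n S (\<lambda>x. frechet_derivative g (at x) v)" for v
    by (rule Suc.IH) (simp add: frechet_derivative_cong_near[OF ev(1)])
  then show ?case
    using differentiable_cong_near[OF ev(1)] differentiable_cong_near[OF ev(2)] by auto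
qed

lemma Ck_on_transform:
  assumes "Ck_on n S g" "open S" "\<And>x. x \<in> S \<Longrightarrow> f x = g x"
  shows "Ck_on n S f"
  using Ck_on_cong[OF assms(2), of f g n] assms(1,3) by blast

lemma Ck_on_subset: "Ck_on n S f \<Longrightarrow> T \<subseteq> S \<Longrightarrow> Ck_on n T f"
  by (induction n arbitrary: f) (auto intro: continuous_on_subset)

lemma Ck_on_local:
  assumes "\<And>x. x \<in> S \<Longrightarrow> \<exists>T. open T \<and> x \<in> T \<and> Ck_on n T f"
  shows "Ck_on n S f"
  using assms
proof (induction n arbitrary: f)
  case 0
  show ?case
    unfolding Ck_on.simps continuous_on_eq_continuous_within
  proof
    fix x assume "x \<in> S"
    then obtain T where "open T" "x \<in> T" "continuous_on T f" using 0 by auto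
    then show "continuous (at x within S) f"
      using continuous_on_eq_continuous_at continuous_at_imp_continuous_at_within by blast
  qed
next
  case (Suc n)
  have "Ck_on n S (\<lambda>x. frechet_derivative f (at x) v)" for v
  proof (rule Suc.IH)
    fix x assume "x \<in> S"
    then obtain T where "open T" "x \<in> T" "Ck_on (Suc n) T f"
      using Suc.prems by blast
    then show "\<exists>T. open T \<and> x \<in> T \<and> Ck_on n T (\<lambda>x. frechet_derivative f (at x) v)"
      by auto
  qed
  moreover have "f differentiable (at x)" if "x \<in> S" for x
    using Suc.prems[OF that] by auto
  ultimately show ?case by simp
qed

lemma Ck_on_SucD: "Ck_on (Suc n) S f \<Longrightarrow> Ck_on n S f"
proof (induction n arbitrary: f)
  case 0
  then show ?case
    by (auto intro!: continuous_at_imp_continuous_on differentiable_imp_continuous_within)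
next
  case (Suc n)
  then show ?case by auto
qed

lemma Ck_on_linear_comp:
  assumes L: "bounded_linear L" and "open S" "Ck_on n S f"
  shows "Ck_on n S (\<lambda>x. L (f x))"
  using assms(3)
proof (induction n arbitrary: f)
  case 0
  then show ?case by (simp add: bounded_linear.continuous_on[OF L])
next
  case (Suc n)
  have der: "((\<lambda>x. L (f x)) has_derivative (\<lambda>v. L (frechet_derivative f (at x) v))) (at x)" if "x \<in> S" for x
    using Suc.prems that by (auto intro!: bounded_linear.has_derivative[OF L] simp: frechet_derivative_works)
  have "Ck_on n S (\<lambda>x. frechet_derivative (\<lambda>x. L (f x)) (at x) v)" for v
  proof (rule Ck_on_transform[OF _ \<open>open S\<close>])
    show "Ck_on n S (\<lambda>x. L (frechet_derivative f (at x) v))"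
      using Suc by simp
  qed (simp add: frechet_derivative_at[OF der, symmetric])
  then show ?case using der by (auto simp: differentiable_def)
qed

lemma Ck_on_const: "Ck_on n S (\<lambda>x. c)"
proof (induction n arbitrary: c)
  case (Suc n)
  then show ?case by (simp add: frechet_derivative_const)
qed simp

lemma Ck_on_add:
  assumes "open S" "Ck_on n S f" "Ck_on n S g"
  shows "Ck_on n S (\<lambda>x. f x + g x)"
  using assms(2,3)
proof (induction n arbitrary: f g)
  case 0
  then show ?case by (simp add: continuous_on_add)
next
  case (Suc n)
  have der: "((\<lambda>x. f x + g x) has_derivative
      (\<lambda>v. frechet_derivative f (at x) v + frechet_derivative g (at x) v)) (at x)" if "x \<in> S" for x
    using Suc.prems that by (auto intro!: has_derivative_add simp: frechet_derivative_works)
  have "Ck_on n S (\<lambda>x. frechet_derivative (\<lambda>x. f x + g x) (at x) v)" for v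
  proof (rule Ck_on_transform[OF _ \<open>open S\<close>])
    show "Ck_on n S (\<lambda>x. frechet_derivative f (at x) v + frechet_derivative g (at x) v)"
      using Suc.prems by (intro Suc.IH) simp_all
  qed (simp add: frechet_derivative_at[OF der, symmetric])
  then show ?case using der by (auto simp: differentiable_def)
qed

lemma Ck_on_sum:
  assumes "open S" "\<And>i. i \<in> I \<Longrightarrow> Ck_on n S (f i)"
  shows "Ck_on n S (\<lambda>x. \<Sum>i\<in>I. f i x)"
  using assms(2) by (induction I rule: infinite_finite_induct) (auto intro: Ck_on_const Ck_on_add[OF assms(1)])

lemma Ck_on_mult:
  fixes f g :: "'e::euclidean_space \<Rightarrow> real"
  assumes "open S" "Ck_on n S f" "Ck_on n S g"
  shows "Ck_on n S (\<lambda>x. f x * g x)"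
  using assms(2,3)
proof (induction n arbitrary: f g)
  case 0
  then show ?case by (simp add: continuous_on_mult)
next
  case (Suc n)
  have der: "((\<lambda>x. f x * g x) has_derivative
      (\<lambda>v. f x * frechet_derivative g (at x) v + frechet_derivative f (at x) v * g x)) (at x)" if "x \<in> S" for x
    using Suc.prems that by (auto intro!: has_derivative_mult simp: frechet_derivative_works)
  have "Ck_on n S (\<lambda>x. frechet_derivative (\<lambda>x. f x * g x) (at x) v)" for v
  proof (rule Ck_on_transform[OF _ \<open>open S\<close>])
    show "Ck_on n S (\<lambda>x. f x * frechet_derivative g (at x) v + frechet_derivative f (at x) v * g x)"
      using Suc.prems Ck_on_SucD[OF Suc.prems(1)] Ck_on_SucD[OF Suc.prems(2)]
      by (intro Ck_on_add[OF \<open>open S\<close>] Suc.IH) simp_all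
  qed (simp add: frechet_derivative_at[OF der, symmetric])
  then show ?case using der by (auto simp: differentiable_def)
qed

lemma Ck_on_inverse:
  fixes f :: "'e::euclidean_space \<Rightarrow> real"
  assumes "open S" "Ck_on n S f" "\<And>x. x \<in> S \<Longrightarrow> f x \<noteq> 0"
  shows "Ck_on n S (\<lambda>x. inverse (f x))"
  using assms(2,3)
proof (induction n arbitrary: f)
  case 0
  then show ?case by (simp add: continuous_on_inverse)
next
  case (Suc n)
  have der: "((\<lambda>x. inverse (f x)) has_derivative
      (\<lambda>v. - (inverse (f x) * frechet_derivative f (at x) v * inverse (f x)))) (at x)" if "x \<in> S" for x
    using Suc.prems that by (auto intro!: has_derivative_inverse simp: frechet_derivative_works)
  have inv: "Ck_on n S (\<lambda>x. inverse (f x))"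
    using Suc.IH[OF Ck_on_SucD[OF Suc.prems(1)]] Suc.prems(2) by blast
  have "Ck_on n S (\<lambda>x. frechet_derivative (\<lambda>x. inverse (f x)) (at x) v)" for v
  proof (rule Ck_on_transform[OF _ \<open>open S\<close>])
    show "Ck_on n S (\<lambda>x. (- 1) * (inverse (f x) * frechet_derivative f (at x) v * inverse (f x)))"
      using inv Suc.prems(1) by (intro Ck_on_mult[OF \<open>open S\<close>] Ck_on_const) auto
  qed (simp add: frechet_derivative_at[OF der, symmetric])
  then show ?case using der by (auto simp: differentiable_def)
qed

lemma Ck_on_compose:
  fixes f :: "'f::euclidean_space \<Rightarrow> real" and g :: "'e::euclidean_space \<Rightarrow> 'f"
  assumes "open S" "open T" "Ck_on n T f" "Ck_on n S g" "g ` S \<subseteq> T"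
  shows "Ck_on n S (\<lambda>x. f (g x))"
  using assms(3,4)
proof (induction n arbitrary: f)
  case 0
  then show ?case using continuous_on_compose2[of T f S g] assms by simp
next
  case (Suc n)
  \<comment> \<open>\<open>Ck_on\<close> sees a derivative one direction at a time. Expanding the
    inner derivative in \<open>Basis\<close> turns the chain rule into a finite sum of products of
    real functions; the partial derivatives of \<open>f\<close> fall under the induction hypothesis,
    with \<open>g\<close> used at one order of smoothness less.\<close>
  let ?D = "\<lambda>x v. \<Sum>b\<in>Basis. (frechet_derivative g (at x) v \<bullet> b) * frechet_derivative f (at (g x)) b"
  have der: "((\<lambda>x. f (g x)) has_derivative ?D x) (at x)" if "x \<in> S" for x
  proof -
    have f: "(f has_derivative frechet_derivative f (at (g x))) (at (g x))"
      and g: "(g has_derivative frechet_derivative g (at x)) (at x)"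
      using Suc.prems that \<open>g ` S \<subseteq> T\<close> by (auto simp: frechet_derivative_works)
    have lin: "linear (frechet_derivative f (at (g x)))"
      using f by (simp add: has_derivative_linear)
    have "frechet_derivative f (at (g x)) w = (\<Sum>b\<in>Basis. (w \<bullet> b) * frechet_derivative f (at (g x)) b)" for w
    proof -
      have "frechet_derivative f (at (g x)) w = frechet_derivative f (at (g x)) (\<Sum>b\<in>Basis. (w \<bullet> b) *\<^sub>R b)"
        by (simp add: euclidean_representation)
      also have "\<dots> = (\<Sum>b\<in>Basis. (w \<bullet> b) * frechet_derivative f (at (g x)) b)"
        by (simp add: linear_sum[OF lin] linear_scale[OF lin])
      finally show ?thesis .
    qed
    then have "(\<lambda>v. frechet_derivative f (at (g x)) (frechet_derivative g (at x) v)) = ?D x"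
      by (intro ext)
    with has_derivative_compose[OF g f] show ?thesis by (simp add: o_def)
  qed
  have "Ck_on n S (\<lambda>x. frechet_derivative (\<lambda>x. f (g x)) (at x) v)" for v
  proof (rule Ck_on_transform[OF _ \<open>open S\<close>])
    show "Ck_on n S (\<lambda>x. ?D x v)"
    proof (intro Ck_on_sum[OF \<open>open S\<close>] Ck_on_mult[OF \<open>open S\<close>])
      fix b :: 'f
      show "Ck_on n S (\<lambda>x. frechet_derivative g (at x) v \<bullet> b)"
        using Suc.prems by (intro Ck_on_linear_comp[OF bounded_linear_inner_left \<open>open S\<close>]) auto
      show "Ck_on n S (\<lambda>x. frechet_derivative f (at (g x)) b)"
        using Suc.prems(1) Ck_on_SucD[OF Suc.prems(2)] by (intro Suc.IH) auto
    qed
  qed (simp add: frechet_derivative_at[OF der, symmetric])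
  then show ?case using der by (auto simp: differentiable_def)
qed

lemma Ck_on_bounded_linear:
  assumes "bounded_linear L" "open S"
  shows "Ck_on n S L"
proof (cases n)
  case 0
  then show ?thesis using linear_continuous_on[OF assms(1)] by simp
next
  case (Suc m)
  have "frechet_derivative L (at x) v = L v" for x v
    using frechet_derivative_at[OF bounded_linear_imp_has_derivative[OF assms(1), of "at x"]] by simp
  then show ?thesis
    using Suc bounded_linear_imp_has_derivative[OF assms(1)] by (auto simp: differentiable_def intro: Ck_on_const)
qed

section \<open>A smooth cutoff function on the real line\<close>

definition flat_function :: "nat \<Rightarrow> real \<Rightarrow> real" where
  "flat_function k t = (if t \<le> 0 then 0 else exp (- 1 / t) / t ^ k)"

lemma flat_function_tendsto_0: "(flat_function k \<longlongrightarrow> 0) (at 0)"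
  unfolding filterlim_at_split
proof
  show "(flat_function k \<longlongrightarrow> 0) (at_left 0)"
    by (rule tendsto_eventually) (auto simp: eventually_at_filter flat_function_def)
  have "((\<lambda>t::real. (inverse t) ^ k / exp (inverse t)) \<longlongrightarrow> 0) (at_right 0)"
    by (rule filterlim_compose[OF tendsto_power_div_exp_0 filterlim_inverse_at_top_right])
  moreover have "\<forall>\<^sub>F t in at_right 0. (inverse t) ^ k / exp (inverse t) = flat_function k t"
    by (auto simp: eventually_at_filter flat_function_def exp_minus divide_simps power_inverse)
  ultimately show "(flat_function k \<longlongrightarrow> 0) (at_right 0)"
    by (rule Lim_transform_eventually)
qed

text \<open>The powers of t in the denominator make the family closed under differentiation, so that
  smoothness of all members follows from one induction with \<open>k\<close> arbitrary. At 0 the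
  difference quotient of member k is member k + 1, which tends to 0.\<close>

lemma flat_function_has_derivative:
  "(flat_function k has_real_derivative flat_function (k + 2) t - k * flat_function (k + 1) t) (at t)"
proof (cases t "0 :: real" rule: linorder_cases)
  case less
  have "((\<lambda>t. 0) has_real_derivative 0) (at t)" by simp
  then have "(flat_function k has_real_derivative 0) (at t)"
    by (rule DERIV_cong_ev[THEN iffD1, rotated 3])
       (use less in \<open>auto intro!: eventually_nhds_in_open[of "{..<0}", THEN eventually_mono] simp: flat_function_def\<close>)
  then show ?thesis using less by (simp add: flat_function_def)
next
  case equal
  have "((\<lambda>h. (flat_function k (0 + h) - flat_function k 0) / h) \<longlongrightarrow> 0) (at 0)"
    by (rule Lim_transform_eventually[OF flat_function_tendsto_0[of "Suc k"]])
       (auto simp: eventually_at_filter flat_function_def)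
  then show ?thesis using equal by (simp add: DERIV_def flat_function_def)
next
  case greater
  have "((\<lambda>t. exp (- 1 / t) / t ^ k) has_real_derivative
      (exp (- 1 / t) * (1 / t\<^sup>2) * t ^ k - exp (- 1 / t) * (k * t ^ (k - 1))) / (t ^ k * t ^ k)) (at t)"
    using greater by (auto intro!: derivative_eq_intros simp: power2_eq_square)
  moreover have "(exp (- 1 / t) * (1 / t\<^sup>2) * t ^ k - exp (- 1 / t) * (k * t ^ (k - 1))) / (t ^ k * t ^ k)
      = flat_function (k + 2) t - k * flat_function (k + 1) t"
    using greater by (cases k) (auto simp: flat_function_def divide_simps power2_eq_square, simp_all add: algebra_simps power_add)
  ultimately have "((\<lambda>t. exp (- 1 / t) / t ^ k) has_real_derivative flat_function (k + 2) t - k * flat_function (k + 1) t) (at t)"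
    by simp
  then show ?thesis
    by (rule DERIV_cong_ev[THEN iffD1, rotated 3])
       (use greater in \<open>auto intro!: eventually_nhds_in_open[of "{0<..}", THEN eventually_mono] simp: flat_function_def\<close>)
qed

lemma Ck_on_flat_function: "Ck_on n UNIV (flat_function k)"
proof (induction n arbitrary: k)
  case 0
  then show ?case
    using DERIV_isCont[OF flat_function_has_derivative] by (simp add: continuous_on_eq_continuous_at)
next
  case (Suc n)
  note der = flat_function_has_derivative[unfolded has_field_derivative_def]
  have "Ck_on n UNIV (\<lambda>x. frechet_derivative (flat_function k) (at x) v)" for v
  proof (rule Ck_on_transform)
    show "Ck_on n UNIV (\<lambda>x. (flat_function (k + 2) x + (- real k) * flat_function (k + 1) x) * v)"
      by (intro Ck_on_mult Ck_on_add Ck_on_const Suc.IH open_UNIV)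
  qed (simp_all add: frechet_derivative_at[OF der, symmetric])
  then show ?case using der by (auto simp: differentiable_def)
qed

text \<open>The denominator is positive everywhere because \<open>2 - t\<close> and
  \<open>t - 1\<close> are never both nonpositive.\<close>

definition cutoff :: "real \<Rightarrow> real" where
  "cutoff t = flat_function 0 (2 - t) * inverse (flat_function 0 (2 - t) + flat_function 0 (t - 1))"

lemma cutoff_eq_1: "t \<le> 1 \<Longrightarrow> cutoff t = 1"
  and cutoff_eq_0: "t \<ge> 2 \<Longrightarrow> cutoff t = 0"
  by (auto simp: cutoff_def flat_function_def)

lemma Ck_on_cutoff: "Ck_on n UNIV cutoff"
proof -
  have id: "Ck_on n UNIV (\<lambda>t::real. t)"
    by (rule Ck_on_bounded_linear) auto
  have "Ck_on n UNIV (\<lambda>t::real. 2 + (- 1) * t)" "Ck_on n UNIV (\<lambda>t::real. t + (- 1))"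
    by (intro Ck_on_add Ck_on_mult Ck_on_const id open_UNIV)+
  then have a: "Ck_on n UNIV (\<lambda>t::real. 2 - t)" "Ck_on n UNIV (\<lambda>t::real. t - 1)" by simp_all
  have f: "Ck_on n UNIV (\<lambda>t. flat_function 0 (2 - t))" "Ck_on n UNIV (\<lambda>t. flat_function 0 (t - 1))"
    by (rule Ck_on_compose[OF _ _ Ck_on_flat_function]; use a in simp)+
  have "flat_function 0 (2 - t) + flat_function 0 (t - 1) > 0" for t
    by (auto simp: flat_function_def add_pos_nonneg)
  then have "flat_function 0 (2 - t) + flat_function 0 (t - 1) \<noteq> 0" for t
    by (metis less_irrefl)
  then show ?thesis
    unfolding cutoff_def by (intro Ck_on_mult Ck_on_inverse Ck_on_add f open_UNIV)
qed

text \<open>Smoothness of a germ. It is asked in every chart around \<open>x\<close>, as in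
  \<open>smooth_functions\<close>, so that sums, products and inverses involve no change of charts;
  transition maps enter when a bump function built in one chart is examined in the others.\<close>

definition smooth_near :: "('m::topological_space, 'e::euclidean_space) chart set \<Rightarrow> 'm \<Rightarrow> ('m \<Rightarrow> real) \<Rightarrow> bool" where
  "smooth_near A x f \<longleftrightarrow> (\<forall>(U,\<phi>)\<in>A. x \<in> U \<longrightarrow>
     (\<exists>V. open V \<and> x \<in> V \<and> V \<subseteq> U \<and> smooth_on (\<phi> ` V) (f \<circ> inv_into U \<phi>)))"

locale manifold =
  fixes A :: "('m::{t2_space,second_countable_topology}, 'e::euclidean_space) chart set"
  assumes atlas: "smooth_atlas A"
begin

lemma chart_cover: obtains U \<phi> where "(U, \<phi>) \<in> A" "x \<in> U"
proof -
  have "x \<in> (\<Union>(U, \<phi>)\<in>A. U)"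
    using conjunct1[OF atlas[unfolded smooth_atlas_def]] by simp
  then show ?thesis using that by blast
qed

context
  fixes U \<phi> assumes chart: "(U, \<phi>) \<in> A"
begin

lemma chart_open: "open U"
  and chart_homeomorphism: "homeomorphism U (\<phi> ` U) \<phi> (inv_into U \<phi>)"
  and chart_image_open: "open (\<phi> ` U)"
  using bspec[OF conjunct1[OF conjunct2[OF atlas[unfolded smooth_atlas_def]]] chart] by auto

lemma chart_inj: "inj_on \<phi> U"
  using chart_homeomorphism unfolding homeomorphism_def by (metis inj_on_inverseI)

lemma chart_continuous: "continuous_on U \<phi>"
  using chart_homeomorphism unfolding homeomorphism_def by blast

lemma chart_open_image:
  assumes "open V" "V \<subseteq> U"
  shows "open (\<phi> ` V)"
proof -
  have "\<phi> ` V = \<phi> ` U \<inter> inv_into U \<phi> -` V"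
    using assms(2) chart_inj by (auto simp: inv_into_f_f subset_iff)
  moreover have "open (\<phi> ` U \<inter> inv_into U \<phi> -` V)"
    using chart_homeomorphism chart_image_open assms(1) unfolding homeomorphism_def
    by (auto intro: continuous_open_preimage)
  ultimately show ?thesis by simp
qed

end

lemma transition_smooth:
  assumes "(U, \<phi>) \<in> A" "(V, \<psi>) \<in> A"
  shows "smooth_on (\<phi> ` (U \<inter> V)) (\<psi> \<circ> inv_into U \<phi>)"
proof -
  have "\<forall>(V, \<psi>)\<in>A. smooth_on (\<phi> ` (U \<inter> V)) (\<psi> \<circ> inv_into U \<phi>)"
    using bspec[OF conjunct2[OF conjunct2[OF atlas[unfolded smooth_atlas_def]]] assms(1)] by simp
  from bspec[OF this assms(2)] show ?thesis by simp
qed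

lemma smooth_nearD:
  assumes "smooth_near A x f" "(U, \<phi>) \<in> A" "x \<in> U"
  obtains V where "open V" "x \<in> V" "V \<subseteq> U" "smooth_on (\<phi> ` V) (f \<circ> inv_into U \<phi>)"
  using bspec[OF assms(1)[unfolded smooth_near_def] assms(2)] assms(3) by auto

lemma smooth_functions_iff: "f \<in> smooth_functions A \<longleftrightarrow> (\<forall>x. smooth_near A x f)"
proof
  assume f: "f \<in> smooth_functions A"
  show "\<forall>x. smooth_near A x f"
    unfolding smooth_near_def
  proof clarify
    fix x U \<phi> assume c: "(U, \<phi>) \<in> A" "x \<in> U"
    have "smooth_on (\<phi> ` U) (f \<circ> inv_into U \<phi>)"
      using f c(1) unfolding smooth_functions_def by auto
    then show "\<exists>V. open V \<and> x \<in> V \<and> V \<subseteq> U \<and> smooth_on (\<phi> ` V) (f \<circ> inv_into U \<phi>)"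
      using c(2) chart_open[OF c(1)] by (intro exI[of _ U]) simp
  qed
next
  assume *: "\<forall>x. smooth_near A x f"
  show "f \<in> smooth_functions A"
    unfolding smooth_functions_def smooth_on_def
  proof (clarify, rule Ck_on_local)
    fix U \<phi> n u assume c: "(U, \<phi>) \<in> A" "u \<in> \<phi> ` U"
    then obtain x where x: "x \<in> U" "u = \<phi> x" by blast
    obtain V where V: "open V" "x \<in> V" "V \<subseteq> U" "smooth_on (\<phi> ` V) (f \<circ> inv_into U \<phi>)"
      using smooth_nearD[OF *[rule_format] c(1) x(1)] .
    then show "\<exists>T. open T \<and> u \<in> T \<and> Ck_on n T (f \<circ> inv_into U \<phi>)"
      using chart_open_image[OF c(1) V(1,3)] x(2) unfolding smooth_on_def
      by (intro exI[of _ "\<phi> ` V"]) auto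
  qed
qed

lemma smooth_near_of_smooth: "f \<in> smooth_functions A \<Longrightarrow> smooth_near A x f"
  by (simp add: smooth_functions_iff)

lemma smooth_near_cong:
  assumes "smooth_near A x f" "\<forall>\<^sub>F y in nhds x. f y = g y"
  shows "smooth_near A x g"
  unfolding smooth_near_def
proof clarify
  fix U \<phi> assume c: "(U, \<phi>) \<in> A" "x \<in> U"
  obtain V where V: "open V" "x \<in> V" "V \<subseteq> U" "smooth_on (\<phi> ` V) (f \<circ> inv_into U \<phi>)"
    using smooth_nearD[OF assms(1) c] .
  obtain W where W: "open W" "x \<in> W" "\<And>y. y \<in> W \<Longrightarrow> f y = g y"
    using assms(2) unfolding eventually_nhds by blast
  have "smooth_on (\<phi> ` (V \<inter> W)) (g \<circ> inv_into U \<phi>)"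
    unfolding smooth_on_def
  proof
    fix n
    have "Ck_on n (\<phi> ` (V \<inter> W)) (f \<circ> inv_into U \<phi>)"
      by (rule Ck_on_subset[where S = "\<phi> ` V"]) (use V in \<open>auto simp: smooth_on_def\<close>)
    then show "Ck_on n (\<phi> ` (V \<inter> W)) (g \<circ> inv_into U \<phi>)"
      by (rule Ck_on_transform)
         (use V W chart_inj[OF c(1)] in \<open>auto intro!: chart_open_image[OF c(1)] simp: inv_into_f_f subset_iff\<close>)
  qed
  then show "\<exists>V. open V \<and> x \<in> V \<and> V \<subseteq> U \<and> smooth_on (\<phi> ` V) (g \<circ> inv_into U \<phi>)"
    using V W by (intro exI[of _ "V \<inter> W"]) auto
qed

lemma smooth_near_isCont:
  assumes "smooth_near A x f"
  shows "isCont f x"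
proof -
  obtain U \<phi> where c: "(U, \<phi>) \<in> A" "x \<in> U" using chart_cover .
  obtain V where V: "open V" "x \<in> V" "V \<subseteq> U" "smooth_on (\<phi> ` V) (f \<circ> inv_into U \<phi>)"
    using smooth_nearD[OF assms c] .
  have "continuous_on (\<phi> ` V) (f \<circ> inv_into U \<phi>)"
    using V(4)[unfolded smooth_on_def, rule_format, of 0] by simp
  then have "continuous_on V (\<lambda>y. (f \<circ> inv_into U \<phi>) (\<phi> y))"
    using continuous_on_compose2[OF _ continuous_on_subset[OF chart_continuous[OF c(1)] V(3)]] by blast
  then have "continuous_on V f"
    by (rule continuous_on_cong[THEN iffD1, rotated -1])
       (use V(3) chart_inj[OF c(1)] in \<open>auto simp: inv_into_f_f subset_iff\<close>)
  then show ?thesis using V continuous_on_eq_continuous_at by blast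
qed

lemma smooth_near_const: "smooth_near A x (\<lambda>_. c)"
  unfolding smooth_near_def smooth_on_def
proof clarify
  fix U \<phi> assume "(U, \<phi>) \<in> A" "x \<in> U"
  then show "\<exists>V. open V \<and> x \<in> V \<and> V \<subseteq> U \<and> (\<forall>n. Ck_on n (\<phi> ` V) ((\<lambda>_. c) \<circ> inv_into U \<phi>))"
    using chart_open by (intro exI[of _ U]) (auto simp: o_def Ck_on_const)
qed

lemma smooth_near_binop:
  assumes f: "smooth_near A x f" and g: "smooth_near A x g"
    and op: "\<And>n S f g. open S \<Longrightarrow> Ck_on n S f \<Longrightarrow> Ck_on n S g \<Longrightarrow> Ck_on n S (\<lambda>x::'e. op (f x) (g x))"
  shows "smooth_near A x (\<lambda>y. op (f y) (g y))"
  unfolding smooth_near_def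
proof clarify
  fix U \<phi> assume c: "(U, \<phi>) \<in> A" "x \<in> U"
  obtain V where V: "open V" "x \<in> V" "V \<subseteq> U" "smooth_on (\<phi> ` V) (f \<circ> inv_into U \<phi>)"
    using smooth_nearD[OF f c] .
  obtain W where W: "open W" "x \<in> W" "W \<subseteq> U" "smooth_on (\<phi> ` W) (g \<circ> inv_into U \<phi>)"
    using smooth_nearD[OF g c] .
  have "Ck_on n (\<phi> ` (V \<inter> W)) (\<lambda>u. op ((f \<circ> inv_into U \<phi>) u) ((g \<circ> inv_into U \<phi>) u))" for n
  proof (rule op)
    show "open (\<phi> ` (V \<inter> W))" using V W by (intro chart_open_image[OF c(1)]) auto
    show "Ck_on n (\<phi> ` (V \<inter> W)) (f \<circ> inv_into U \<phi>)"
      by (rule Ck_on_subset[where S = "\<phi> ` V"]) (use V in \<open>auto simp: smooth_on_def\<close>)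
    show "Ck_on n (\<phi> ` (V \<inter> W)) (g \<circ> inv_into U \<phi>)"
      by (rule Ck_on_subset[where S = "\<phi> ` W"]) (use W in \<open>auto simp: smooth_on_def\<close>)
  qed
  then have "smooth_on (\<phi> ` (V \<inter> W)) ((\<lambda>y. op (f y) (g y)) \<circ> inv_into U \<phi>)"
    by (simp add: smooth_on_def o_def)
  then show "\<exists>V. open V \<and> x \<in> V \<and> V \<subseteq> U \<and> smooth_on (\<phi> ` V) ((\<lambda>y. op (f y) (g y)) \<circ> inv_into U \<phi>)"
    using V W by (intro exI[of _ "V \<inter> W"]) auto
qed

lemma smooth_near_add: "smooth_near A x f \<Longrightarrow> smooth_near A x g \<Longrightarrow> smooth_near A x (\<lambda>y. f y + g y)"
  by (rule smooth_near_binop[where op = "(+)"]) (auto intro: Ck_on_add)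

lemma smooth_near_mult: "smooth_near A x f \<Longrightarrow> smooth_near A x g \<Longrightarrow> smooth_near A x (\<lambda>y. f y * g y)"
  by (rule smooth_near_binop[where op = "(*)"]) (auto intro: Ck_on_mult)

lemma smooth_near_inverse:
  assumes f: "smooth_near A x f" and "f x \<noteq> 0"
  shows "smooth_near A x (\<lambda>y. inverse (f y))"
  unfolding smooth_near_def
proof clarify
  fix U \<phi> assume c: "(U, \<phi>) \<in> A" "x \<in> U"
  obtain V where V: "open V" "x \<in> V" "V \<subseteq> U" "smooth_on (\<phi> ` V) (f \<circ> inv_into U \<phi>)"
    using smooth_nearD[OF f c] .
  have "\<forall>\<^sub>F y in nhds x. f y \<noteq> 0"
    using tendsto_imp_eventually_ne[OF smooth_near_isCont[OF f, unfolded isCont_def] assms(2)] assms(2)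
    unfolding eventually_at_filter by (auto elim: eventually_mono)
  then obtain W where W: "open W" "x \<in> W" "\<And>y. y \<in> W \<Longrightarrow> f y \<noteq> 0"
    unfolding eventually_nhds by blast
  have "Ck_on n (\<phi> ` (V \<inter> W)) (\<lambda>u. inverse ((f \<circ> inv_into U \<phi>) u))" for n
  proof (rule Ck_on_inverse)
    show "open (\<phi> ` (V \<inter> W))" using V W by (intro chart_open_image[OF c(1)]) auto
    show "Ck_on n (\<phi> ` (V \<inter> W)) (f \<circ> inv_into U \<phi>)"
      by (rule Ck_on_subset[where S = "\<phi> ` V"]) (use V in \<open>auto simp: smooth_on_def\<close>)
  qed (use V W chart_inj[OF c(1)] in \<open>auto simp: inv_into_f_f subset_iff\<close>)
  then have "smooth_on (\<phi> ` (V \<inter> W)) ((\<lambda>y. inverse (f y)) \<circ> inv_into U \<phi>)"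
    by (simp add: smooth_on_def o_def)
  then show "\<exists>V. open V \<and> x \<in> V \<and> V \<subseteq> U \<and> smooth_on (\<phi> ` V) ((\<lambda>y. inverse (f y)) \<circ> inv_into U \<phi>)"
    using V W by (intro exI[of _ "V \<inter> W"]) auto
qed

lemma smooth_near_sum: "(\<And>i. i \<in> I \<Longrightarrow> smooth_near A x (f i)) \<Longrightarrow> smooth_near A x (\<lambda>y. \<Sum>i\<in>I. f i y)"
  by (induction I rule: infinite_finite_induct) (auto intro: smooth_near_const smooth_near_add)

lemma smooth_near_prod: "(\<And>i. i \<in> I \<Longrightarrow> smooth_near A x (f i)) \<Longrightarrow> smooth_near A x (\<lambda>y. \<Prod>i\<in>I. f i y)"
  by (induction I rule: infinite_finite_induct) (auto intro: smooth_near_const smooth_near_mult)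

lemma smooth_const: "(\<lambda>_. c) \<in> smooth_functions A"
  and smooth_add: "f \<in> smooth_functions A \<Longrightarrow> g \<in> smooth_functions A \<Longrightarrow> (\<lambda>y. f y + g y) \<in> smooth_functions A"
  and smooth_mult: "f \<in> smooth_functions A \<Longrightarrow> g \<in> smooth_functions A \<Longrightarrow> (\<lambda>y. f y * g y) \<in> smooth_functions A"
  and smooth_sum: "(\<And>i. i \<in> I \<Longrightarrow> F i \<in> smooth_functions A) \<Longrightarrow> (\<lambda>y. \<Sum>i\<in>I. F i y) \<in> smooth_functions A"
  by (simp_all add: smooth_functions_iff smooth_near_const smooth_near_add smooth_near_mult smooth_near_sum smooth_near_prod)

lemma smooth_uminus: "f \<in> smooth_functions A \<Longrightarrow> (\<lambda>y. - f y) \<in> smooth_functions A"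
  using smooth_mult[OF smooth_const[of "- 1"]] by simp

lemma smooth_diff: "f \<in> smooth_functions A \<Longrightarrow> g \<in> smooth_functions A \<Longrightarrow> (\<lambda>y. f y - g y) \<in> smooth_functions A"
  using smooth_add[of f "\<lambda>y. - g y"] smooth_uminus[of g] by simp

text \<open>The last conclusion concerns germs and covers the boundary of \<open>W\<close>: a
  product of the bump function with something smooth on \<open>W\<close> only is then smooth
  everywhere, being identically zero near all other points.\<close>

lemma bump_function:
  assumes "open W" "x \<in> W"
  obtains bmp where "bmp \<in> smooth_functions A" "\<forall>\<^sub>F y in nhds x. bmp y = 1"
    "\<forall>y. y \<notin> W \<longrightarrow> (\<forall>\<^sub>F z in nhds y. bmp z = 0)"
proof -
  obtain U \<phi> where c: "(U, \<phi>) \<in> A" "x \<in> U" using chart_cover .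
  have oUW: "open (\<phi> ` (U \<inter> W))"
    using chart_open[OF c(1)] assms(1) by (intro chart_open_image[OF c(1)]) auto
  then obtain \<rho> where \<rho>: "\<rho> > 0" "cball (\<phi> x) \<rho> \<subseteq> \<phi> ` (U \<inter> W)"
    using open_contains_cball[THEN iffD1, OF oUW, rule_format, of "\<phi> x"] c assms(2) by auto
  \<comment> \<open>The squared distance is smooth at the centre, unlike the distance. The factor
    makes \<open>q\<close> reach the value 2, from which on \<open>cutoff\<close> vanishes, exactly
    on the sphere of radius \<rho>.\<close>
  define q where "q u = (\<Sum>b\<in>Basis. ((u - \<phi> x) \<bullet> b) * ((u - \<phi> x) \<bullet> b)) * (2 / \<rho>\<^sup>2)" for u
  have q_norm: "q u = 2 * (dist (\<phi> x) u / \<rho>)\<^sup>2" for u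
  proof -
    have "(dist (\<phi> x) u)\<^sup>2 = (\<Sum>b\<in>Basis. ((u - \<phi> x) \<bullet> b) * ((u - \<phi> x) \<bullet> b))"
      unfolding dist_commute[of "\<phi> x" u] unfolding dist_norm power2_norm_eq_inner by (rule euclidean_inner)
    then show ?thesis unfolding q_def by (simp add: power_divide)
  qed
  have q_Ck: "Ck_on n UNIV q" for n
  proof -
    have "Ck_on n UNIV (\<lambda>u. (u \<bullet> b + (- (\<phi> x \<bullet> b))))" for b
      by (intro Ck_on_add Ck_on_const Ck_on_bounded_linear bounded_linear_inner_left open_UNIV)
    then show ?thesis
      unfolding q_def by (intro Ck_on_mult Ck_on_sum Ck_on_const open_UNIV) (simp_all add: inner_diff_left)
  qed
  define K where "K = inv_into U \<phi> ` cball (\<phi> x) \<rho>"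
  have "compact K"
    unfolding K_def using chart_homeomorphism[OF c(1)] \<rho>(2)
    by (intro compact_continuous_image) (auto simp: homeomorphism_def intro: continuous_on_subset)
  \<comment> \<open>Hausdorffness enters here: the preimage of a closed ball is compact, hence
    closed in the manifold and not only in the chart, so the extension by zero is smooth at points
    outside \<open>K\<close>.\<close>
  then have "closed K" by (rule compact_imp_closed)
  have K: "K \<subseteq> U \<inter> W"
  proof
    fix y assume "y \<in> K"
    then obtain w where "w \<in> U \<inter> W" "y = inv_into U \<phi> (\<phi> w)"
      using \<rho>(2) unfolding K_def by blast
    then show "y \<in> U \<inter> W" using inv_into_f_f[OF chart_inj[OF c(1)]] by simp
  qed
  have in_K: "y \<in> K" if "y \<in> U" "dist (\<phi> x) (\<phi> y) \<le> \<rho>" for y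
    unfolding K_def using that chart_inj[OF c(1)] by (intro image_eqI[of _ _ "\<phi> y"]) auto
  define bmp where "bmp y = (if y \<in> U then cutoff (q (\<phi> y)) else 0)" for y
  have bmp_out: "bmp y = 0" if "y \<notin> K" for y
  proof (cases "y \<in> U")
    case True
    then have "dist (\<phi> x) (\<phi> y) \<ge> \<rho>" using in_K that by force
    then have "q (\<phi> y) \<ge> 2" using \<rho>(1) power_mono[of \<rho> "dist (\<phi> x) (\<phi> y)" 2]
      unfolding q_norm by (simp add: power_divide le_divide_eq)
    then show ?thesis using True by (simp add: bmp_def cutoff_eq_0)
  qed (simp add: bmp_def)
  have out_ev: "\<forall>\<^sub>F z in nhds y. bmp z = 0" if "y \<notin> K" for y
  proof -
    have "\<forall>\<^sub>F z in nhds y. z \<in> - K"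
      using \<open>closed K\<close> that by (intro eventually_nhds_in_open) auto
    then show ?thesis by eventually_elim (simp add: bmp_out)
  qed
  have "smooth_near A y bmp" for y
  proof (cases "y \<in> K")
    case True
    show ?thesis
      unfolding smooth_near_def
    proof clarify
      fix V \<psi> assume v: "(V, \<psi>) \<in> A" "y \<in> V"
      have o: "open (\<psi> ` (V \<inter> U))"
        using chart_open v c by (intro chart_open_image[OF v(1)]) auto
      have "Ck_on n (\<psi> ` (V \<inter> U)) (bmp \<circ> inv_into V \<psi>)" for n
      proof (rule Ck_on_transform[OF _ o])
        have cq: "Ck_on n UNIV (\<lambda>u. cutoff (q u))"
          by (rule Ck_on_compose[OF _ _ Ck_on_cutoff q_Ck]) auto
        show "Ck_on n (\<psi> ` (V \<inter> U)) (\<lambda>u. cutoff (q ((\<phi> \<circ> inv_into V \<psi>) u)))"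
          using Ck_on_compose[OF o open_UNIV cq, of "\<phi> \<circ> inv_into V \<psi>"] transition_smooth[OF v(1) c(1)]
          by (simp add: smooth_on_def)
      qed (use chart_inj[OF v(1)] in \<open>auto simp: bmp_def inv_into_f_f\<close>)
      then show "\<exists>Va. open Va \<and> y \<in> Va \<and> Va \<subseteq> V \<and> smooth_on (\<psi> ` Va) (bmp \<circ> inv_into V \<psi>)"
        using True K v chart_open c by (intro exI[of _ "V \<inter> U"]) (auto simp: smooth_on_def)
    qed
  next
    case False
    have "\<forall>\<^sub>F z in nhds y. 0 = bmp z"
      using out_ev[OF False] by eventually_elim simp
    then show ?thesis
      by (rule smooth_near_cong[OF smooth_near_const])
  qed
  then have "bmp \<in> smooth_functions A" by (simp add: smooth_functions_iff)
  moreover have "\<forall>\<^sub>F y in nhds x. bmp y = 1"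
  proof -
    have "isCont \<phi> x" using continuous_on_eq_continuous_at[OF chart_open[OF c(1)], THEN iffD1, OF chart_continuous[OF c(1)]] c(2) by blast
    then have "isCont (\<lambda>y. q (\<phi> y)) x" unfolding q_norm using \<rho>(1) by (intro continuous_intros) auto
    then have "((\<lambda>y. q (\<phi> y)) \<longlongrightarrow> 0) (at x)" by (simp add: q_norm isCont_def)
    then have "\<forall>\<^sub>F y in at x. q (\<phi> y) < 1" by (rule order_tendstoD) simp
    then have "\<forall>\<^sub>F y in nhds x. q (\<phi> y) < 1"
      unfolding eventually_at_filter by eventually_elim (force simp: q_norm)
    then show ?thesis
      using eventually_nhds_in_open[OF chart_open[OF c(1)] c(2)]
      by eventually_elim (simp add: bmp_def cutoff_eq_1)
  qed
  moreover have "\<forall>y. y \<notin> W \<longrightarrow> (\<forall>\<^sub>F z in nhds y. bmp z = 0)"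
    using out_ev K by auto
  ultimately show ?thesis by (rule that)
qed

text \<open>Every germ of a smooth function has a global representative, so local constructions can
  use elements of \<open>smooth_functions\<close> and the manifold never has to be restricted to an
  open subset.\<close>

lemma smooth_extension:
  assumes "open W" "x \<in> W" "\<And>y. y \<in> W \<Longrightarrow> smooth_near A y f"
  obtains g where "g \<in> smooth_functions A" "\<forall>\<^sub>F y in nhds x. g y = f y"
proof -
  obtain bmp where bmp: "bmp \<in> smooth_functions A" "\<forall>\<^sub>F y in nhds x. bmp y = 1"
    "\<forall>y. y \<notin> W \<longrightarrow> (\<forall>\<^sub>F z in nhds y. bmp z = 0)"
    using bump_function[OF assms(1,2)] .
  have "smooth_near A y (\<lambda>y. bmp y * f y)" for y
  proof (cases "y \<in> W")
    case True
    show ?thesis by (rule smooth_near_mult[OF smooth_near_of_smooth[OF bmp(1)] assms(3)[OF True]])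
  next
    case False
    have "\<forall>\<^sub>F z in nhds y. 0 = bmp z * f z" using bmp(3)[rule_format, OF False] by eventually_elim simp
    then show ?thesis by (rule smooth_near_cong[OF smooth_near_const])
  qed
  then have "(\<lambda>y. bmp y * f y) \<in> smooth_functions A" by (simp add: smooth_functions_iff)
  moreover have "\<forall>\<^sub>F y in nhds x. bmp y * f y = f y" using bmp(2) by eventually_elim simp
  ultimately show ?thesis by (rule that)
qed

end

lemma scaleR_fun_apply [simp]: "(r *\<^sub>R f) x = r *\<^sub>R f x"
  by (simp add: scaleR_fun_def)

lemma sum_fun_apply: "(\<Sum>i\<in>I. F i) x = (\<Sum>i\<in>I. F i x)"
  by (induction I rule: infinite_finite_induct) simp_all

section \<open>Tangent vectors and vector fields\<close>

context manifold
begin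

abbreviation "SF \<equiv> smooth_functions A"
abbreviation "VF \<equiv> vector_fields A"

lemma tangent_not_smooth: "v \<in> tangent A x \<Longrightarrow> f \<notin> SF \<Longrightarrow> v f = 0"
  and tangent_lincomb: "v \<in> tangent A x \<Longrightarrow> f \<in> SF \<Longrightarrow> g \<in> SF \<Longrightarrow> v (\<lambda>y. a * f y + b * g y) = a * v f + b * v g"
  and tangent_mult: "v \<in> tangent A x \<Longrightarrow> f \<in> SF \<Longrightarrow> g \<in> SF \<Longrightarrow> v (\<lambda>y. f y * g y) = f x * v g + g x * v f"
  by (simp_all add: tangent_def)

lemma tangentI:
  assumes "\<And>f. f \<notin> SF \<Longrightarrow> v f = 0"
    and "\<And>f g a b. f \<in> SF \<Longrightarrow> g \<in> SF \<Longrightarrow> v (\<lambda>y. a * f y + b * g y) = a * v f + b * v g"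
    and "\<And>f g. f \<in> SF \<Longrightarrow> g \<in> SF \<Longrightarrow> v (\<lambda>y. f y * g y) = f x * v g + g x * v f"
  shows "v \<in> tangent A x"
  using assms unfolding tangent_def by simp

lemma tangent_add: "v \<in> tangent A x \<Longrightarrow> f \<in> SF \<Longrightarrow> g \<in> SF \<Longrightarrow> v (\<lambda>y. f y + g y) = v f + v g"
  using tangent_lincomb[of v x f g 1 1] by simp

lemma tangent_diff: "v \<in> tangent A x \<Longrightarrow> f \<in> SF \<Longrightarrow> g \<in> SF \<Longrightarrow> v (\<lambda>y. f y - g y) = v f - v g"
  using tangent_lincomb[of v x f g 1 "- 1"] by simp

lemma tangent_cmult: "v \<in> tangent A x \<Longrightarrow> f \<in> SF \<Longrightarrow> v (\<lambda>y. a * f y) = a * v f"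
  using tangent_lincomb[of v x f f a 0] by simp

lemma tangent_const: assumes "v \<in> tangent A x" shows "v (\<lambda>_. c) = 0"
proof -
  have "v (\<lambda>_. 1) = 0"
    using tangent_mult[OF assms smooth_const[of 1] smooth_const[of 1]] by simp
  then show ?thesis using tangent_cmult[OF assms smooth_const[of 1], of c] by simp
qed

text \<open>Derivations are local: a bump function times \<open>f - g\<close> is the zero function,
  and the Leibniz rule at \<open>x\<close>, where the bump function is 1 and \<open>f - g\<close> is
  0, leaves exactly the difference of the two values.\<close>

lemma tangent_cong_near:
  assumes v: "v \<in> tangent A x" and fg: "f \<in> SF" "g \<in> SF" and ev: "\<forall>\<^sub>F y in nhds x. f y = g y"
  shows "v f = v g"
proof -
  obtain W where W: "open W" "x \<in> W" "\<And>y. y \<in> W \<Longrightarrow> f y = g y"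
    using ev unfolding eventually_nhds by blast
  obtain bmp where bmp: "bmp \<in> SF" "\<forall>\<^sub>F y in nhds x. bmp y = 1"
    "\<forall>y. y \<notin> W \<longrightarrow> (\<forall>\<^sub>F z in nhds y. bmp z = 0)"
    using bump_function[OF W(1,2)] .
  have b1: "bmp x = 1" using eventually_nhds_x_imp_x[OF bmp(2)] .
  have b0: "bmp y = 0" if "y \<notin> W" for y
    using eventually_nhds_x_imp_x[OF bmp(3)[rule_format, OF that]] .
  have "bmp y * (f y - g y) = 0" for y
    using W(3)[of y] b0[of y] by (cases "y \<in> W") auto
  then have "(\<lambda>y. bmp y * (f y - g y)) = (\<lambda>_. 0)"
    by (intro ext)
  then have "v (\<lambda>y. bmp y * (f y - g y)) = 0"
    using tangent_const[OF v, of 0] by (simp only:)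
  moreover have "v (\<lambda>y. bmp y * (f y - g y)) = v f - v g"
    using tangent_mult[OF v bmp(1) smooth_diff[OF fg]] tangent_diff[OF v fg] b1 W by simp
  ultimately show ?thesis by simp
qed

lemma tangent_zero: "0 \<in> tangent A x"
  by (rule tangentI) simp_all

lemma tangent_subspace: "subspace (tangent A x)"
proof (rule subspaceI)
  show "0 \<in> tangent A x" by (rule tangent_zero)
next
  fix u v assume u: "u \<in> tangent A x" and v: "v \<in> tangent A x"
  show "u + v \<in> tangent A x"
    by (rule tangentI)
       (simp_all add: tangent_not_smooth[OF u] tangent_not_smooth[OF v] tangent_lincomb[OF u] tangent_lincomb[OF v]
         tangent_mult[OF u] tangent_mult[OF v] algebra_simps)
next
  fix c u assume u: "u \<in> tangent A x"
  show "c *\<^sub>R u \<in> tangent A x"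
    by (rule tangentI)
       (simp_all add: tangent_not_smooth[OF u] tangent_lincomb[OF u] tangent_mult[OF u] algebra_simps)
qed

lemma vfD: "X \<in> VF \<Longrightarrow> X x \<in> tangent A x"
  and vf_smooth: "X \<in> VF \<Longrightarrow> f \<in> SF \<Longrightarrow> (\<lambda>x. X x f) \<in> SF"
  by (simp_all add: vector_fields_def)

lemma vfI: "(\<And>x. X x \<in> tangent A x) \<Longrightarrow> (\<And>f. f \<in> SF \<Longrightarrow> (\<lambda>x. X x f) \<in> SF) \<Longrightarrow> X \<in> VF"
  by (simp add: vector_fields_def)

lemma vf_zero: "(\<lambda>_. 0) \<in> VF"
  by (rule vfI) (simp_all add: tangent_zero smooth_const)

lemma vf_add: "X \<in> VF \<Longrightarrow> Y \<in> VF \<Longrightarrow> (\<lambda>x. X x + Y x) \<in> VF"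
  by (rule vfI) (simp_all add: subspace_add[OF tangent_subspace] vfD smooth_add vf_smooth)

lemma vf_scale: "f \<in> SF \<Longrightarrow> X \<in> VF \<Longrightarrow> (\<lambda>x. f x *\<^sub>R X x) \<in> VF"
  by (rule vfI) (simp_all add: subspace_scale[OF tangent_subspace] vfD smooth_mult vf_smooth)

lemma vf_cscale: "X \<in> VF \<Longrightarrow> (\<lambda>x. c *\<^sub>R X x) \<in> VF"
  using vf_scale[OF smooth_const] .

lemma vf_uminus: "X \<in> VF \<Longrightarrow> (\<lambda>x. - X x) \<in> VF"
  using vf_cscale[of X "- 1"] by simp

lemma vf_diff: "X \<in> VF \<Longrightarrow> Y \<in> VF \<Longrightarrow> (\<lambda>x. X x - Y x) \<in> VF"
  using vf_add[OF _ vf_uminus] by (simp only: diff_conv_add_uminus)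

lemma vf_sum: "(\<And>i. i \<in> I \<Longrightarrow> F i \<in> VF) \<Longrightarrow> (\<lambda>x. \<Sum>i\<in>I. F i x) \<in> VF"
  by (induction I rule: infinite_finite_induct) (simp_all add: vf_zero vf_add)

text \<open>Tangent vectors are extended by zero to functions that are not smooth, so every identity
  between brackets has to be checked on those as well; there both iterated derivatives are
  derivatives of the zero function.\<close>

lemma bracket_not_smooth:
  assumes "X \<in> VF" "Y \<in> VF" "h \<notin> SF"
  shows "bracket X Y x h = 0"
  by (simp add: bracket_def tangent_not_smooth[OF vfD[OF assms(1)] assms(3)]
      tangent_not_smooth[OF vfD[OF assms(2)] assms(3)] tangent_const[OF vfD[OF assms(1)]] tangent_const[OF vfD[OF assms(2)]])

lemma bracket_anti: "bracket Y X = (\<lambda>x. - bracket X Y x)"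
  by (simp add: bracket_def fun_eq_iff)

lemma bracket_self: "bracket X X = (\<lambda>_. 0)"
  by (simp add: bracket_def fun_eq_iff)

lemma bracket_zero:
  assumes "Y \<in> VF"
  shows "bracket (\<lambda>_. 0) Y = (\<lambda>_. 0)"
  by (simp add: bracket_def fun_eq_iff tangent_const[OF vfD[OF assms]])

lemma bracket_add_right:
  assumes X: "X \<in> VF" and Y: "Y \<in> VF" "Z \<in> VF"
  shows "bracket X (\<lambda>x. Y x + Z x) = (\<lambda>x. bracket X Y x + bracket X Z x)"
proof (intro ext)
  fix x h
  show "bracket X (\<lambda>x. Y x + Z x) x h = (bracket X Y x + bracket X Z x) h"
  proof (cases "h \<in> SF")
    case True
    then show ?thesis
      by (simp add: bracket_def tangent_add[OF vfD[OF X]] vf_smooth[OF Y(1)] vf_smooth[OF Y(2)])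
  qed (simp add: bracket_not_smooth X Y vf_add)
qed

lemma bracket_scale_right:
  assumes X: "X \<in> VF" and Y: "Y \<in> VF" and f: "f \<in> SF"
  shows "bracket X (\<lambda>x. f x *\<^sub>R Y x) = (\<lambda>x. f x *\<^sub>R bracket X Y x + X x f *\<^sub>R Y x)"
proof (intro ext)
  fix x h
  show "bracket X (\<lambda>x. f x *\<^sub>R Y x) x h = (f x *\<^sub>R bracket X Y x + X x f *\<^sub>R Y x) h"
  proof (cases "h \<in> SF")
    case True
    then show ?thesis
      by (simp add: bracket_def tangent_mult[OF vfD[OF X] f vf_smooth[OF Y]] algebra_simps)
  next
    case False
    then show ?thesis
      by (simp add: bracket_not_smooth X Y f vf_scale tangent_not_smooth[OF vfD[OF Y]])
  qed
qed

lemma bracket_add_left: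
  assumes "X \<in> VF" "Y \<in> VF" "Z \<in> VF"
  shows "bracket (\<lambda>x. Y x + Z x) X = (\<lambda>x. bracket Y X x + bracket Z X x)"
proof -
  have "bracket (\<lambda>x. Y x + Z x) X = (\<lambda>x. - bracket X (\<lambda>x. Y x + Z x) x)"
    by (rule bracket_anti)
  also have "\<dots> = (\<lambda>x. bracket Y X x + bracket Z X x)"
    by (simp add: bracket_add_right[OF assms] bracket_anti[of Y X] bracket_anti[of Z X])
  finally show ?thesis .
qed

lemma bracket_scale_left:
  assumes "X \<in> VF" "Y \<in> VF" "f \<in> SF"
  shows "bracket (\<lambda>x. f x *\<^sub>R Y x) X = (\<lambda>x. f x *\<^sub>R bracket Y X x - X x f *\<^sub>R Y x)"
proof -
  have "bracket (\<lambda>x. f x *\<^sub>R Y x) X = (\<lambda>x. - bracket X (\<lambda>x. f x *\<^sub>R Y x) x)"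
    by (rule bracket_anti)
  also have "\<dots> = (\<lambda>x. f x *\<^sub>R bracket Y X x - X x f *\<^sub>R Y x)"
    by (simp add: bracket_scale_right[OF assms] bracket_anti[of Y X])
  finally show ?thesis .
qed

lemma jacobi:
  assumes X: "X \<in> VF" and Y: "Y \<in> VF" and Z: "Z \<in> VF"
  shows "bracket (bracket X Y) Z x = bracket X (bracket Y Z) x - bracket Y (bracket X Z) x"
proof
  fix h
  show "bracket (bracket X Y) Z x h = (bracket X (bracket Y Z) x - bracket Y (bracket X Z) x) h"
  proof (cases "h \<in> SF")
    case True
    then show ?thesis
      by (simp add: bracket_def tangent_diff[OF vfD[OF X]] tangent_diff[OF vfD[OF Y]] tangent_diff[OF vfD[OF Z]]
          vf_smooth X Y Z)
  next
    case False
    then show ?thesis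
      by (simp add: bracket_def tangent_not_smooth[OF vfD[OF X]] tangent_not_smooth[OF vfD[OF Y]] tangent_not_smooth[OF vfD[OF Z]]
          tangent_const[OF vfD[OF X]] tangent_const[OF vfD[OF Y]] tangent_const[OF vfD[OF Z]])
  qed
qed

end

section \<open>The filtration\<close>

lemma span_image_obtain:
  assumes "finite I" "v \<in> span (F ` I)"
  obtains c where "v = (\<Sum>i\<in>I. c i *\<^sub>R F i)"
proof -
  have "\<exists>c. v = (\<Sum>i\<in>I. c i *\<^sub>R F i)"
    using assms(2)
  proof (induction rule: span_induct_alt)
    case base
    then show ?case by (intro exI[of _ "\<lambda>_. 0"]) simp
  next
    case (step a u w)
    then obtain i c where "i \<in> I" "u = F i" "w = (\<Sum>i\<in>I. c i *\<^sub>R F i)" by blast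
    then have "a *\<^sub>R u + w = (\<Sum>j\<in>I. (if j = i then a + c j else c j) *\<^sub>R F j)"
      using assms(1) sum.remove[of I i "\<lambda>j. (if j = i then a + c j else c j) *\<^sub>R F j"] sum.remove[of I i "\<lambda>j. c j *\<^sub>R F j"]
      by (simp add: scaleR_add_left)
    then show ?case by (intro exI[of _ "\<lambda>j. if j = i then a + c j else c j"])
  qed
  then show ?thesis using that by blast
qed

locale filtered_manifold = manifold A
  for A :: "('m::{t2_space,second_countable_topology}, 'e::euclidean_space) chart set" +
  fixes H :: "nat \<Rightarrow> 'm \<Rightarrow> 'm tvec set" and s :: nat
    and g :: "'m \<Rightarrow> 'm tvec \<Rightarrow> 'm tvec \<Rightarrow> real"
  assumes filt: "filtration A H s" and metric: "riemannian_metric A g"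
begin

lemma H_subbundle: "subbundle A (H i)"
  and H_0: "H 0 x = {0}"
  and H_step: "H i x \<subseteq> H (Suc i) x"
  and H_top: "i \<ge> s \<Longrightarrow> H i x = tangent A x"
  and H_bracket: "X \<in> sections A (H i) \<Longrightarrow> Y \<in> sections A (H j) \<Longrightarrow> bracket X Y \<in> sections A (H (i + j))"
  using filt unfolding filtration_def by simp_all

lemma H_mono: "i \<le> j \<Longrightarrow> H i x \<subseteq> H j x"
  by (rule lift_Suc_mono_le[of "\<lambda>i. H i x"]) (rule H_step)

lemma H_tangent: "H i x \<subseteq> tangent A x"
  using H_mono[of i "max i s" x] H_top[of "max i s" x] by simp

definition local_frame :: "nat \<Rightarrow> 'm set \<Rightarrow> nat \<Rightarrow> (nat \<Rightarrow> 'm vfield) \<Rightarrow> bool" where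
  "local_frame i U r X \<longleftrightarrow> open U \<and> (\<forall>j<r. X j \<in> VF) \<and>
     (\<forall>y\<in>U. inj_on (\<lambda>j. X j y) {..<r} \<and> independent ((\<lambda>j. X j y) ` {..<r}) \<and>
        H i y = span ((\<lambda>j. X j y) ` {..<r}))"

lemma H_frame: obtains U r X where "local_frame i U r X" "x \<in> U"
proof -
  have "\<exists>U r (X :: nat \<Rightarrow> 'm vfield). local_frame i U r X \<and> x \<in> U"
    using H_subbundle[of i, unfolded subbundle_def, THEN spec, of x] unfolding local_frame_def by metis
  then show ?thesis using that by blast
qed

lemma local_frame_open: "local_frame i U r X \<Longrightarrow> open U"
  and local_frame_vf: "local_frame i U r X \<Longrightarrow> j < r \<Longrightarrow> X j \<in> VF"
  and local_frame_inj: "local_frame i U r X \<Longrightarrow> y \<in> U \<Longrightarrow> inj_on (\<lambda>j. X j y) {..<r}"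
  and local_frame_indep: "local_frame i U r X \<Longrightarrow> y \<in> U \<Longrightarrow> independent ((\<lambda>j. X j y) ` {..<r})"
  and local_frame_span: "local_frame i U r X \<Longrightarrow> y \<in> U \<Longrightarrow> H i y = span ((\<lambda>j. X j y) ` {..<r})"
  by (simp_all add: local_frame_def)

lemma H_subspace: "subspace (H i x)"
proof -
  obtain U r X where *: "local_frame i U r X" "x \<in> U"
    using H_frame .
  show ?thesis unfolding local_frame_span[OF *] by (rule subspace_span)
qed

lemma local_frame_expansion:
  assumes "local_frame i U r X" "y \<in> U" "v \<in> H i y"
  obtains c where "v = (\<Sum>j<r. c j *\<^sub>R X j y)"
  using span_image_obtain[of "{..<r}" v "\<lambda>j. X j y"] assms(3) local_frame_span[OF assms(1,2)] by auto

lemma sections_vf: "X \<in> sections A (H i) \<Longrightarrow> X \<in> VF"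
  and sections_H: "X \<in> sections A (H i) \<Longrightarrow> X x \<in> H i x"
  by (simp_all add: sections_def)

lemma sections_top: "i \<ge> s \<Longrightarrow> sections A (H i) = VF"
  using H_top vfD by (auto simp: sections_def)

text \<open>Read off the bracket condition of the filtration at \<open>i = j = s\<close>, where the
  subbundle is the whole tangent bundle.\<close>

lemma vf_bracket: "X \<in> VF \<Longrightarrow> Y \<in> VF \<Longrightarrow> bracket X Y \<in> VF"
  using H_bracket[of X s Y s] by (simp add: sections_top)

text \<open>A combination of frame fields with constant coefficients, multiplied by a bump function.
  Where the bump function vanishes the value is 0, which lies in every subspace, so the section is
  global.\<close>

lemma section_through:
  assumes "v \<in> H i x"
  obtains X where "X \<in> sections A (H i)" "X x = v"
proof -
  obtain U r X where *: "local_frame i U r X" "x \<in> U"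
    using H_frame .
  obtain c where c: "v = (\<Sum>j<r. c j *\<^sub>R X j x)"
    using local_frame_expansion[OF * assms] .
  obtain bmp where bmp: "bmp \<in> SF" "\<forall>\<^sub>F y in nhds x. bmp y = 1"
    "\<forall>y. y \<notin> U \<longrightarrow> (\<forall>\<^sub>F z in nhds y. bmp z = 0)"
    using bump_function[OF local_frame_open[OF *(1)] *(2)] .
  have b1: "bmp x = 1" using eventually_nhds_x_imp_x[OF bmp(2)] .
  have b0: "bmp y = 0" if "y \<notin> U" for y
    using eventually_nhds_x_imp_x[OF bmp(3)[rule_format, OF that]] .
  define Y where "Y y = bmp y *\<^sub>R (\<Sum>j<r. c j *\<^sub>R X j y)" for y
  have "Y \<in> VF"
    unfolding Y_def[abs_def] by (intro vf_scale bmp(1) vf_sum vf_cscale local_frame_vf[OF *(1)]) simp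
  moreover have "Y y \<in> H i y" for y
  proof (cases "y \<in> U")
    case True
    then show ?thesis
      unfolding Y_def local_frame_span[OF *(1) True]
      by (intro subspace_scale[OF subspace_span] subspace_sum[OF subspace_span] span_base imageI) simp
  next
    case False
    then show ?thesis by (simp add: Y_def b0 subspace_0[OF H_subspace])
  qed
  ultimately have "Y \<in> sections A (H i)" by (simp add: sections_def)
  moreover have "Y x = v" by (simp add: Y_def b1 c)
  ultimately show ?thesis by (rule that)
qed

lemma vf_through:
  assumes "v \<in> tangent A x"
  obtains X where "X \<in> VF" "X x = v"
  using section_through[of v s x] assms sections_top[of s] H_top[of s x] by auto

end

section \<open>Determinants of families of matrices\<close>

text \<open>The Leibniz formula uses ring operations only. The predicate \<open>Q\<close> is
  abstract because two instances are needed: smooth functions, for Gram determinants, and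
  polynomials with smooth coefficients, for characteristic polynomials.\<close>

lemma det_family:
  fixes Q :: "('x \<Rightarrow> 'a::comm_ring_1) \<Rightarrow> bool"
  assumes add: "\<And>f g. Q f \<Longrightarrow> Q g \<Longrightarrow> Q (\<lambda>x. f x + g x)"
    and mult: "\<And>f g. Q f \<Longrightarrow> Q g \<Longrightarrow> Q (\<lambda>x. f x * g x)"
    and const: "\<And>c::int. Q (\<lambda>_. of_int c)"
    and entries: "\<And>i j. i < n \<Longrightarrow> j < n \<Longrightarrow> Q (F i j)"
  shows "Q (\<lambda>x. Determinant.det (mat n n (\<lambda>(i, j). F i j x)))"
proof -
  have prod: "Q (\<lambda>x. \<Prod>i\<in>I. G i x)" if "finite I" "\<And>i. i \<in> I \<Longrightarrow> Q (G i)" for I :: "nat set" and G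
    using that by (induction I rule: finite_induct) (use const[of 1] mult in simp_all)
  have sum: "Q (\<lambda>x. \<Sum>p\<in>I. G p x)" if "finite I" "\<And>p. p \<in> I \<Longrightarrow> Q (G p)" for I :: "(nat \<Rightarrow> nat) set" and G
    using that by (induction I rule: finite_induct) (use const[of 0] add in simp_all)
  have "Q (\<lambda>x. \<Sum>p | p permutes {0..<n}. of_int (sign p) * (\<Prod>i = 0..<n. F i (p i) x))"
    by (intro sum mult const prod entries finite_permutations) (auto dest: permutes_in_image)
  moreover have "Determinant.det (mat n n (\<lambda>(i, j). F i j x)) =
      (\<Sum>p | p permutes {0..<n}. of_int (sign p) * (\<Prod>i = 0..<n. F i (p i) x))" for x
    unfolding det_def'[OF mat_carrier]
    by (intro sum.cong refl arg_cong2[of _ _ _ _ "(*)"] prod.cong)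
       (auto dest: permutes_in_image)
  ultimately show ?thesis by simp
qed

lemma adj_family:
  fixes Q :: "('x \<Rightarrow> 'a::comm_ring_1) \<Rightarrow> bool"
  assumes add: "\<And>f g. Q f \<Longrightarrow> Q g \<Longrightarrow> Q (\<lambda>x. f x + g x)"
    and mult: "\<And>f g. Q f \<Longrightarrow> Q g \<Longrightarrow> Q (\<lambda>x. f x * g x)"
    and const: "\<And>c::int. Q (\<lambda>_. of_int c)"
    and entries: "\<And>i j. i < n \<Longrightarrow> j < n \<Longrightarrow> Q (F i j)"
    and kl: "k < n" "l < n"
  shows "Q (\<lambda>x. adj_mat (mat n n (\<lambda>(i, j). F i j x)) $$ (k, l))"
proof -
  let ?s = "\<lambda>i (j::nat). if j < i then j else Suc j"
  have "mat_delete (mat n n (\<lambda>(i, j). F i j x)) l k = mat (n - 1) (n - 1) (\<lambda>(i, j). F (?s l i) (?s k j) x)" for x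
    unfolding mat_delete_def by (rule eq_matI) auto
  then have "adj_mat (mat n n (\<lambda>(i, j). F i j x)) $$ (k, l) =
      of_int ((- 1) ^ (l + k)) * Determinant.det (mat (n - 1) (n - 1) (\<lambda>(i, j). F (?s l i) (?s k j) x))" for x
    using kl by (simp add: adj_mat_def cofactor_def)
  moreover have "Q (\<lambda>x. of_int ((- 1) ^ (l + k)) * Determinant.det (mat (n - 1) (n - 1) (\<lambda>(i, j). F (?s l i) (?s k j) x)))"
    by (rule mult[OF const det_family[of Q, OF add mult const]]) (use kl in \<open>auto intro!: entries\<close>)
  ultimately show ?thesis by simp
qed

lemma mat_mult_entry:
  assumes "B \<in> carrier_mat n n" "C \<in> carrier_mat n n" "i < n" "j < n"
  shows "(B * C) $$ (i, j) = (\<Sum>k<n. B $$ (i, k) * C $$ (k, j))"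
  using assms by (simp add: times_mat_def scalar_prod_def lessThan_atLeast0)

section \<open>Alternating forms\<close>

lemma linear_on_subspace_sum:
  fixes h :: "'a::real_vector \<Rightarrow> 'b::real_vector"
  assumes V: "subspace V" and h: "\<And>u v r t. u \<in> V \<Longrightarrow> v \<in> V \<Longrightarrow> h (r *\<^sub>R u + t *\<^sub>R v) = r *\<^sub>R h u + t *\<^sub>R h v"
    and F: "\<And>i. i \<in> I \<Longrightarrow> F i \<in> V"
  shows "h (\<Sum>i\<in>I. c i *\<^sub>R F i) = (\<Sum>i\<in>I. c i *\<^sub>R h (F i))"
  using F
proof (induction I rule: infinite_finite_induct)
  case (insert i I)
  have "(\<Sum>i\<in>I. c i *\<^sub>R F i) \<in> V"
    using insert.prems by (intro subspace_sum[OF V] subspace_scale[OF V]) simp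
  then have "h (c i *\<^sub>R F i + 1 *\<^sub>R (\<Sum>i\<in>I. c i *\<^sub>R F i)) = c i *\<^sub>R h (F i) + 1 *\<^sub>R h (\<Sum>i\<in>I. c i *\<^sub>R F i)"
    using insert.prems by (intro h) simp_all
  then show ?case using insert by simp
qed (use h[of 0 0 0 0] subspace_0[OF V] in simp_all)

lemma alt_outside: "a \<in> alt_forms W N \<Longrightarrow> \<not> set vs \<subseteq> W \<Longrightarrow> a vs = 0"
  and alt_lin: "a \<in> alt_forms W N \<Longrightarrow> set us \<subseteq> W \<Longrightarrow> v \<in> W \<Longrightarrow> v' \<in> W \<Longrightarrow> set ws \<subseteq> W \<Longrightarrow>
      a (us @ (r *\<^sub>R v + r' *\<^sub>R v') # ws) = r *\<^sub>R a (us @ v # ws) + r' *\<^sub>R a (us @ v' # ws)"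
  and alt_repeat: "a \<in> alt_forms W N \<Longrightarrow> a (us @ v # vs @ v # ws) = 0"
  and alt_null: "a \<in> alt_forms W N \<Longrightarrow> set vs \<inter> N \<noteq> {} \<Longrightarrow> a vs = 0"
  unfolding alt_forms_def by blast+

lemma alt_formsI:
  assumes "\<And>vs. \<not> set vs \<subseteq> W \<Longrightarrow> a vs = 0"
    and "\<And>us v v' ws r r'. set us \<subseteq> W \<Longrightarrow> v \<in> W \<Longrightarrow> v' \<in> W \<Longrightarrow> set ws \<subseteq> W \<Longrightarrow>
      a (us @ (r *\<^sub>R v + r' *\<^sub>R v') # ws) = r *\<^sub>R a (us @ v # ws) + r' *\<^sub>R a (us @ v' # ws)"
    and "\<And>us v vs ws. a (us @ v # vs @ v # ws) = 0"
    and "\<And>vs. set vs \<inter> N \<noteq> {} \<Longrightarrow> a vs = 0"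
  shows "a \<in> alt_forms W N"
  using assms unfolding alt_forms_def by simp

lemma alt_forms_subspace: "subspace (alt_forms W N :: ('a::real_vector list \<Rightarrow> 'b::real_vector) set)"
proof (rule subspaceI)
  show "0 \<in> (alt_forms W N :: ('a list \<Rightarrow> 'b) set)" by (rule alt_formsI) simp_all
next
  fix a b :: "'a list \<Rightarrow> 'b" assume a: "a \<in> alt_forms W N" and b: "b \<in> alt_forms W N"
  show "a + b \<in> alt_forms W N"
    by (rule alt_formsI)
       (simp_all add: alt_outside[OF a] alt_outside[OF b] alt_lin[OF a] alt_lin[OF b] alt_repeat[OF a] alt_repeat[OF b]
         alt_null[OF a] alt_null[OF b] algebra_simps)
next
  fix c :: real and a :: "'a list \<Rightarrow> 'b" assume a: "a \<in> alt_forms W N"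
  show "c *\<^sub>R a \<in> alt_forms W N"
    by (rule alt_formsI)
       (simp_all add: alt_outside[OF a] alt_lin[OF a] alt_repeat[OF a] alt_null[OF a] algebra_simps)
qed

lemma alt_slot_zero:
  assumes a: "a \<in> alt_forms W N" and W: "subspace W" and "set us \<subseteq> W" "set ws \<subseteq> W"
  shows "a (us @ 0 # ws) = 0"
  using alt_lin[OF a assms(3) subspace_0[OF W] subspace_0[OF W] assms(4), of 0 0] by simp

lemma alt_slot_sum:
  assumes a: "a \<in> alt_forms W N" and W: "subspace W" and us: "set us \<subseteq> W" "set ws \<subseteq> W"
    and "finite I" "\<And>i. i \<in> I \<Longrightarrow> F i \<in> W"
  shows "a (us @ (\<Sum>i\<in>I. c i *\<^sub>R F i) # ws) = (\<Sum>i\<in>I. c i *\<^sub>R a (us @ F i # ws))"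
  using assms(5,6)
proof (induction I rule: finite_induct)
  case empty
  show ?case using alt_slot_zero[OF a W us] by simp
next
  case (insert i I)
  have "(\<Sum>i\<in>I. c i *\<^sub>R F i) \<in> W"
    using insert.prems by (intro subspace_sum[OF W] subspace_scale[OF W]) simp
  then have "a (us @ (c i *\<^sub>R F i + 1 *\<^sub>R (\<Sum>i\<in>I. c i *\<^sub>R F i)) # ws)
      = c i *\<^sub>R a (us @ F i # ws) + 1 *\<^sub>R a (us @ (\<Sum>i\<in>I. c i *\<^sub>R F i) # ws)"
    using insert.prems by (intro alt_lin[OF a us(1) _ _ us(2)]) simp_all
  then show ?case using insert by simp
qed

text \<open>Multilinearity reduces all values to those on the spanning family and alternation
  discards repetitions, so finitely many evaluations separate the elements of a fibre. They are
  redundant, since permuted lists all occur; \<open>dual_basis\<close> selects among them.\<close>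

lemma alt_forms_determined:
  assumes a: "a \<in> alt_forms W N" and W: "W = span (F ` I)" and I: "finite I"
    and zero: "\<And>js. set js \<subseteq> I \<Longrightarrow> distinct js \<Longrightarrow> a (map F js) = 0"
  shows "a = 0"
proof
  have sW: "subspace W" unfolding W by (rule subspace_span)
  have FW: "F i \<in> W" if "i \<in> I" for i unfolding W using that by (simp add: span_base)
  have 1: "a (map F js) = 0" if "set js \<subseteq> I" for js
  proof (cases "distinct js")
    case False
    then obtain us v vs ws where "js = us @ [v] @ vs @ [v] @ ws"
      using not_distinct_decomp by blast
    then show ?thesis using alt_repeat[OF a, of "map F us" "F v" "map F vs" "map F ws"] by simp
  qed (use zero that in simp)
  \<comment> \<open>The prefix holds the arguments already replaced by members of the family; the
    induction expands the remaining ones slot by slot.\<close>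
  have 2: "a (map F js @ vs) = 0" if "set js \<subseteq> I" "set vs \<subseteq> W" for js vs
    using that
  proof (induction vs arbitrary: js)
    case Nil
    then show ?case using 1 by simp
  next
    case (Cons v vs)
    obtain c where c: "v = (\<Sum>i\<in>I. c i *\<^sub>R F i)"
      using span_image_obtain[of I v F] I Cons.prems W by auto
    have js: "set (map F js) \<subseteq> W" using Cons.prems FW by auto
    have "a (map F js @ F i # vs) = 0" if "i \<in> I" for i
      using Cons.IH[of "js @ [i]"] Cons.prems that by simp
    moreover have "set vs \<subseteq> W" using Cons.prems by simp
    ultimately show ?case
      unfolding c using alt_slot_sum[OF a sW js _ I FW, where ws = vs and c = c] by simp
  qed
  show "a vs = 0 vs" for vs
    using 2[of "[]" vs] alt_outside[OF a, of vs] by (cases "set vs \<subseteq> W") auto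
qed

lemma alt_forms_pullback:
  fixes W' :: "'c::real_vector set"
  assumes a: "a \<in> alt_forms W {0}" and W': "subspace W'"
    and LW: "\<And>v. v \<in> W' \<Longrightarrow> L v \<in> W"
    and L: "\<And>u v r t. u \<in> W' \<Longrightarrow> v \<in> W' \<Longrightarrow> L (r *\<^sub>R u + t *\<^sub>R v) = r *\<^sub>R L u + t *\<^sub>R L v"
  shows "(\<lambda>vs. if set vs \<subseteq> W' then a (map L vs) else 0) \<in> alt_forms W' {0}"
proof (rule alt_formsI)
  fix us ws :: "'c list" and v v' r r'
  assume *: "set us \<subseteq> W'" "v \<in> W'" "v' \<in> W'" "set ws \<subseteq> W'"
  have "r *\<^sub>R v + r' *\<^sub>R v' \<in> W'"
    using * by (intro subspace_add[OF W'] subspace_scale[OF W'])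
  moreover have "set (map L us) \<subseteq> W" "set (map L ws) \<subseteq> W" using * LW by auto
  ultimately show "(if set (us @ (r *\<^sub>R v + r' *\<^sub>R v') # ws) \<subseteq> W' then a (map L (us @ (r *\<^sub>R v + r' *\<^sub>R v') # ws)) else 0)
      = r *\<^sub>R (if set (us @ v # ws) \<subseteq> W' then a (map L (us @ v # ws)) else 0)
        + r' *\<^sub>R (if set (us @ v' # ws) \<subseteq> W' then a (map L (us @ v' # ws)) else 0)"
    using * L LW alt_lin[OF a, of "map L us" "L v" "L v'" "map L ws" r r'] by simp
next
  have "L 0 = 0" using L[of 0 0 0 0] subspace_0[OF W'] by simp
  fix vs :: "'c list" assume "set vs \<inter> {0} \<noteq> {}"
  then have "0 \<in> set (map L vs)" using \<open>L 0 = 0\<close> by force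
  then show "(if set vs \<subseteq> W' then a (map L vs) else 0) = 0"
    using alt_null[OF a, of "map L vs"] by auto
qed (auto simp: alt_repeat[OF a])

text \<open>A separating set of functionals of least cardinality is a basis of the dual: dropping
  \<open>j\<close> destroys separation, and a vector witnessing this is, after rescaling, the basis
  vector dual to \<open>j\<close>.\<close>

lemma dual_basis:
  fixes V :: "'a::real_vector set" and \<phi> :: "'i \<Rightarrow> 'a \<Rightarrow> real"
  assumes V: "subspace V" and I: "finite I"
    and add: "\<And>i u v. i \<in> I \<Longrightarrow> u \<in> V \<Longrightarrow> v \<in> V \<Longrightarrow> \<phi> i (u + v) = \<phi> i u + \<phi> i v"
    and scale: "\<And>i c v. i \<in> I \<Longrightarrow> v \<in> V \<Longrightarrow> \<phi> i (c *\<^sub>R v) = c * \<phi> i v"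
    and sep: "\<And>v. v \<in> V \<Longrightarrow> (\<forall>i\<in>I. \<phi> i v = 0) \<Longrightarrow> v = 0"
  obtains J b where "J \<subseteq> I" "\<forall>j\<in>J. b j \<in> V" "\<forall>j\<in>J. \<forall>k\<in>J. \<phi> k (b j) = (if j = k then 1 else 0)"
    "\<forall>v\<in>V. v = (\<Sum>j\<in>J. \<phi> j v *\<^sub>R b j)"
proof -
  let ?sep = "\<lambda>J. J \<subseteq> I \<and> (\<forall>v\<in>V. (\<forall>i\<in>J. \<phi> i v = 0) \<longrightarrow> v = 0)"
  obtain J where J: "?sep J" and min: "\<And>J'. ?sep J' \<Longrightarrow> card J \<le> card J'"
  proof -
    have "?sep I" using sep by simp
    then have "\<exists>J. ?sep J \<and> (\<forall>J'. ?sep J' \<longrightarrow> card J \<le> card J')"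
      by (rule ex_has_least_nat)
    then show ?thesis using that by (elim exE conjE) simp
  qed
  have fJ: "finite J" using J I finite_subset by blast
  have "\<exists>b. b \<in> V \<and> (\<forall>k\<in>J. \<phi> k b = (if j = k then 1 else 0))" if j: "j \<in> J" for j
  proof -
    have "\<not> ?sep (J - {j})"
      using min[of "J - {j}"] card_Diff1_less[OF fJ j] by linarith
    moreover have "J - {j} \<subseteq> I" using J by auto
    ultimately have "\<exists>v\<in>V. (\<forall>i\<in>J - {j}. \<phi> i v = 0) \<and> v \<noteq> 0" by simp
    then obtain v where v: "v \<in> V" "\<forall>i\<in>J - {j}. \<phi> i v = 0" "v \<noteq> 0" by (elim bexE conjE)
    have "\<phi> j v \<noteq> 0"
    proof
      assume "\<phi> j v = 0"
      then have "\<forall>i\<in>J. \<phi> i v = 0" using v(2) by auto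
      then show False using J v(1,3) by simp
    qed
    then have "\<forall>k\<in>J. \<phi> k ((1 / \<phi> j v) *\<^sub>R v) = (if j = k then 1 else 0)"
      using v J scale by auto
    then show ?thesis using subspace_scale[OF V v(1)] by blast
  qed
  then obtain b where b: "\<And>j. j \<in> J \<Longrightarrow> b j \<in> V" "\<And>j k. j \<in> J \<Longrightarrow> k \<in> J \<Longrightarrow> \<phi> k (b j) = (if j = k then 1 else 0)"
    by metis
  have sum: "\<phi> k (\<Sum>j\<in>S. c j *\<^sub>R b j) = (\<Sum>j\<in>S. c j * \<phi> k (b j))" if "k \<in> J" "S \<subseteq> J" for k S c
  proof -
    have "finite S" using that fJ finite_subset by blast
    then show ?thesis using that(2)
    proof (induction S rule: finite_induct)
      case empty
      show ?case using scale[of k 0 0] that J subspace_0[OF V] by auto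
    next
      case (insert j S)
      then have "(\<Sum>j\<in>S. c j *\<^sub>R b j) \<in> V" "c j *\<^sub>R b j \<in> V"
        using b(1) by (auto intro!: subspace_sum[OF V] subspace_scale[OF V])
      then show ?case using insert add[of k] scale[of k] that J b(1) by auto
    qed
  qed
  have "v = (\<Sum>j\<in>J. \<phi> j v *\<^sub>R b j)" if v: "v \<in> V" for v
  proof -
    let ?w = "\<Sum>j\<in>J. \<phi> j v *\<^sub>R b j"
    have w: "?w \<in> V" using b(1) by (intro subspace_sum[OF V] subspace_scale[OF V]) simp
    have "\<phi> k (v - ?w) = 0" if k: "k \<in> J" for k
    proof -
      have kI: "k \<in> I" using k J by blast
      have "\<phi> k ?w = (\<Sum>j\<in>J. if j = k then \<phi> k v else 0)"
        unfolding sum[OF k subset_refl] using b(2) k by (intro sum.cong refl) simp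
      also have "\<dots> = \<phi> k v" using k fJ by simp
      finally show ?thesis
        using add[OF kI v subspace_scale[OF V w, of "- 1"]] scale[OF kI w, of "- 1"] by simp
    qed
    then have "v - ?w = 0" using conjunct2[OF J, rule_format, OF subspace_diff[OF V v w]] by simp
    then show ?thesis by simp
  qed
  then show ?thesis using that[of J b] J b by auto
qed

abbreviation vals :: "'m vfield list \<Rightarrow> 'm \<Rightarrow> 'm tvec list" where
  "vals Xs y \<equiv> map (\<lambda>X. X y) Xs"

section \<open>Local frames\<close>

context filtered_manifold
begin

lemma metric_sym: "u \<in> tangent A x \<Longrightarrow> v \<in> tangent A x \<Longrightarrow> g x u v = g x v u"
  and metric_pos: "u \<in> tangent A x \<Longrightarrow> u \<noteq> 0 \<Longrightarrow> g x u u > 0"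
  and metric_lin: "u \<in> tangent A x \<Longrightarrow> v \<in> tangent A x \<Longrightarrow> w \<in> tangent A x \<Longrightarrow>
     g x (r *\<^sub>R u + t *\<^sub>R v) w = r * g x u w + t * g x v w"
  and metric_smooth: "X \<in> VF \<Longrightarrow> Y \<in> VF \<Longrightarrow> (\<lambda>x. g x (X x) (Y x)) \<in> SF"
  using metric unfolding riemannian_metric_def by auto

lemma metric_sum:
  assumes "\<And>i. i \<in> I \<Longrightarrow> F i \<in> tangent A x" "w \<in> tangent A x"
  shows "g x (\<Sum>i\<in>I. c i *\<^sub>R F i) w = (\<Sum>i\<in>I. c i * g x (F i) w)"
  using linear_on_subspace_sum[OF tangent_subspace, of x "\<lambda>u. g x u w" I F c] metric_lin[of _ x _ w] assms by simp

definition gram :: "nat \<Rightarrow> (nat \<Rightarrow> 'm vfield) \<Rightarrow> 'm \<Rightarrow> real mat" where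
  "gram r X y = mat r r (\<lambda>(j, k). g y (X j y) (X k y))"

text \<open>Cramer's rule for the system with the Gram matrix of the frame. Unlike coefficients
  picked from an expansion, this expression is visibly smooth. Over the domain of the frame, for
  \<open>v\<close> outside the span, it gives the coefficients of the orthogonal projection of
  \<open>v\<close>.\<close>

definition frame_coeff :: "nat \<Rightarrow> (nat \<Rightarrow> 'm vfield) \<Rightarrow> 'm \<Rightarrow> nat \<Rightarrow> 'm tvec \<Rightarrow> real" where
  "frame_coeff r X y j v =
     (\<Sum>k<r. g y v (X k y) * adj_mat (gram r X y) $$ (k, j)) * inverse (Determinant.det (gram r X y))"

lemma gram_entry: "j < r \<Longrightarrow> k < r \<Longrightarrow> gram r X y $$ (j, k) = g y (X j y) (X k y)"
  by (simp add: gram_def)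

lemma gram_carrier: "gram r X y \<in> carrier_mat r r"
  by (simp add: gram_def)

context
  fixes i U r X assumes frame: "local_frame i U r X"
begin

lemma frame_tangent: "j < r \<Longrightarrow> X j y \<in> tangent A y"
  using local_frame_vf[OF frame] vfD by blast

lemma frame_unique:
  assumes y: "y \<in> U" and eq: "(\<Sum>j<r. c j *\<^sub>R X j y) = (\<Sum>j<r. c' j *\<^sub>R X j y)" and "j < r"
  shows "c j = c' j"
proof -
  let ?F = "\<lambda>j. X j y"
  define u where "u v = c (the_inv_into {..<r} ?F v) - c' (the_inv_into {..<r} ?F v)" for v
  have u: "u (?F j) = c j - c' j" if "j < r" for j
    using that by (simp add: u_def the_inv_into_f_f[OF local_frame_inj[OF frame y]])
  have "(\<Sum>v\<in>?F ` {..<r}. u v *\<^sub>R v) = (\<Sum>j<r. u (?F j) *\<^sub>R ?F j)"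
    by (simp add: sum.reindex[OF local_frame_inj[OF frame y]])
  also have "\<dots> = (\<Sum>j<r. c j *\<^sub>R X j y) - (\<Sum>j<r. c' j *\<^sub>R X j y)"
    unfolding sum_subtractf[symmetric] by (intro sum.cong refl) (simp add: u scaleR_diff_left)
  finally have "(\<Sum>v\<in>?F ` {..<r}. u v *\<^sub>R v) = 0" using eq by simp
  then have "u (?F j) = 0"
    using independentD[OF local_frame_indep[OF frame y], of "?F ` {..<r}" u "?F j"] \<open>j < r\<close> by simp
  then show ?thesis using u[OF \<open>j < r\<close>] by simp
qed

text \<open>A kernel vector of the Gram matrix yields a combination of frame fields orthogonal to
  each of them, hence to itself; positivity and independence make its coefficients zero.\<close>

lemma gram_det_nonzero:
  assumes y: "y \<in> U"
  shows "Determinant.det (gram r X y) \<noteq> 0"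
proof
  assume "Determinant.det (gram r X y) = 0"
  then obtain v where v: "v \<in> carrier_vec r" "v \<noteq> 0\<^sub>v r" "gram r X y *\<^sub>v v = 0\<^sub>v r"
    using det_0_iff_vec_prod_zero[OF gram_carrier] by blast
  let ?w = "\<Sum>k<r. vec_index v k *\<^sub>R X k y"
  have w: "?w \<in> tangent A y"
    by (intro subspace_sum[OF tangent_subspace] subspace_scale[OF tangent_subspace] frame_tangent) simp
  have row: "g y ?w (X j y) = 0" if j: "j < r" for j
  proof -
    have "g y ?w (X j y) = (\<Sum>k<r. vec_index v k * g y (X k y) (X j y))"
      by (rule metric_sum) (auto intro: frame_tangent j)
    also have "\<dots> = (\<Sum>k<r. g y (X j y) (X k y) * vec_index v k)"
      by (intro sum.cong refl) (simp add: metric_sym[OF frame_tangent frame_tangent, of _ j] j)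
    also have "\<dots> = vec_index (gram r X y *\<^sub>v v) j"
      using j v(1) by (simp add: gram_def scalar_prod_def lessThan_atLeast0)
    finally show ?thesis using v(3) j by simp
  qed
  have "g y ?w ?w = (\<Sum>k<r. vec_index v k * g y (X k y) ?w)"
    by (rule metric_sum) (auto intro: frame_tangent w)
  also have "\<dots> = 0"
    using row metric_sym[OF w frame_tangent] by simp
  finally have "?w = 0" using metric_pos[OF w] by force
  then have eq: "(\<Sum>k<r. vec_index v k *\<^sub>R X k y) = (\<Sum>k<r. (\<lambda>_. 0) k *\<^sub>R X k y)" by simp
  have "vec_index v k = 0" if "k < r" for k
    using frame_unique[OF y eq that] .
  then have "v = 0\<^sub>v r" using v(1) by (intro eq_vecI) auto
  then show False using v(2) by simp
qed

lemma frame_coeff_eq: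
  assumes y: "y \<in> U" and j: "j < r" and v: "v = (\<Sum>l<r. c l *\<^sub>R X l y)"
  shows "frame_coeff r X y j v = c j"
proof -
  have adj: "(\<Sum>k<r. g y (X l y) (X k y) * adj_mat (gram r X y) $$ (k, j)) =
      (if l = j then Determinant.det (gram r X y) else 0)" if l: "l < r" for l
  proof -
    have "(gram r X y * adj_mat (gram r X y)) $$ (l, j) = (\<Sum>k<r. g y (X l y) (X k y) * adj_mat (gram r X y) $$ (k, j))"
      unfolding mat_mult_entry[OF gram_carrier adj_mat(1)[OF gram_carrier] l j]
      by (intro sum.cong refl) (simp add: gram_entry l)
    then show ?thesis
      using l j adj_mat(2)[OF gram_carrier[of r X y]] by (cases "l = j") simp_all
  qed
  have "(\<Sum>k<r. g y v (X k y) * adj_mat (gram r X y) $$ (k, j)) =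
      (\<Sum>k<r. (\<Sum>l<r. c l * g y (X l y) (X k y)) * adj_mat (gram r X y) $$ (k, j))"
    unfolding v by (intro sum.cong refl arg_cong2[of _ _ _ _ "(*)"] metric_sum frame_tangent) auto
  also have "\<dots> = (\<Sum>k<r. \<Sum>l<r. c l * (g y (X l y) (X k y) * adj_mat (gram r X y) $$ (k, j)))"
    by (simp add: sum_distrib_right mult.assoc)
  also have "\<dots> = (\<Sum>l<r. c l * (\<Sum>k<r. g y (X l y) (X k y) * adj_mat (gram r X y) $$ (k, j)))"
    unfolding sum_distrib_left by (rule sum.swap)
  also have "\<dots> = (\<Sum>l<r. if l = j then c j * Determinant.det (gram r X y) else 0)"
    using adj by (intro sum.cong refl) simp
  also have "\<dots> = c j * Determinant.det (gram r X y)" using j by simp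
  finally show ?thesis
    using gram_det_nonzero[OF y] by (simp add: frame_coeff_def)
qed

lemma frame_expansion:
  assumes y: "y \<in> U" and v: "v \<in> H i y"
  shows "v = (\<Sum>j<r. frame_coeff r X y j v *\<^sub>R X j y)"
proof -
  obtain c where c: "v = (\<Sum>j<r. c j *\<^sub>R X j y)"
    using local_frame_expansion[OF frame y v] .
  also have "\<dots> = (\<Sum>j<r. frame_coeff r X y j v *\<^sub>R X j y)"
    by (intro sum.cong refl) (simp add: frame_coeff_eq[OF y _ c])
  finally show ?thesis .
qed

lemma frame_coeff_frame:
  assumes y: "y \<in> U" and "j < r" "k < r"
  shows "frame_coeff r X y j (X k y) = (if j = k then 1 else 0)"
proof -
  have "X k y = (\<Sum>l<r. (if l = k then 1 else 0) *\<^sub>R X l y)"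
    using \<open>k < r\<close> by (simp add: if_distrib[of "\<lambda>c. c *\<^sub>R _"] cong: if_cong)
  then show ?thesis by (rule frame_coeff_eq[OF y \<open>j < r\<close>])
qed

lemma frame_coeff_lin:
  assumes "u \<in> tangent A y" "v \<in> tangent A y"
  shows "frame_coeff r X y j (a *\<^sub>R u + b *\<^sub>R v) = a * frame_coeff r X y j u + b * frame_coeff r X y j v"
proof -
  have "(\<Sum>k<r. g y (a *\<^sub>R u + b *\<^sub>R v) (X k y) * adj_mat (gram r X y) $$ (k, j)) =
     (\<Sum>k<r. (a * g y u (X k y) + b * g y v (X k y)) * adj_mat (gram r X y) $$ (k, j))"
    by (intro sum.cong refl) (simp add: metric_lin[OF assms frame_tangent])
  then show ?thesis
    by (simp add: frame_coeff_def algebra_simps sum.distrib sum_distrib_left)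
qed

lemma frame_coeff_smooth:
  assumes y: "y \<in> U" and Y: "Y \<in> VF" and j: "j < r"
  shows "smooth_near A y (\<lambda>y. frame_coeff r X y j (Y y))"
proof -
  have gram_entry: "(\<lambda>y. g y (X j y) (X k y)) \<in> SF" if "j < r" "k < r" for j k
    using that by (intro metric_smooth local_frame_vf[OF frame])
  have "(\<lambda>y. Determinant.det (gram r X y)) \<in> SF"
    unfolding gram_def
    by (rule det_family[where Q = "\<lambda>f. f \<in> SF"]) (auto intro: smooth_add smooth_mult smooth_const gram_entry)
  moreover have "(\<lambda>y. adj_mat (gram r X y) $$ (k, j)) \<in> SF" if "k < r" for k
    unfolding gram_def
    by (rule adj_family[where Q = "\<lambda>f. f \<in> SF"]) (auto intro: smooth_add smooth_mult smooth_const gram_entry that j)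
  moreover have "(\<lambda>y. g y (Y y) (X k y)) \<in> SF" if "k < r" for k
    using that by (intro metric_smooth local_frame_vf[OF frame] Y)
  ultimately show ?thesis
    unfolding frame_coeff_def
    by (intro smooth_near_mult smooth_near_inverse smooth_near_sum gram_det_nonzero[OF y] smooth_near_of_smooth) auto
qed

end

end

section \<open>Differential forms\<close>

context manifold
begin

lemma eval_form_vals: "eval_form \<omega> Xs x = \<omega> x (vals Xs x)"
  by (simp add: eval_form_def)

lemma formsD: "\<omega> \<in> forms A \<Longrightarrow> \<omega> x \<in> cotensors A x"
  and forms_smooth: "\<omega> \<in> forms A \<Longrightarrow> set Xs \<subseteq> VF \<Longrightarrow> (\<lambda>x. \<omega> x (vals Xs x)) \<in> SF"
  by (simp_all add: forms_def eval_form_def)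

lemma formsI:
  assumes "\<And>x. \<omega> x \<in> cotensors A x"
    and "\<And>x Xs. set Xs \<subseteq> VF \<Longrightarrow> smooth_near A x (\<lambda>x. \<omega> x (vals Xs x))"
  shows "\<omega> \<in> forms A"
  using assms by (simp add: forms_def eval_form_def smooth_functions_iff)

lemma cotensors_subspace: "subspace (cotensors A x)"
  unfolding cotensors_def by (rule alt_forms_subspace)

lemma forms_subspace: "subspace (forms A)"
proof (rule subspaceI)
  show "0 \<in> forms A"
    by (rule formsI) (simp_all add: subspace_0[OF cotensors_subspace] smooth_near_const)
next
  fix \<alpha> \<beta> assume "\<alpha> \<in> forms A" "\<beta> \<in> forms A"
  then show "\<alpha> + \<beta> \<in> forms A"
    by (intro formsI) (simp_all add: subspace_add[OF cotensors_subspace] formsD smooth_near_add smooth_near_of_smooth forms_smooth)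
next
  fix c \<alpha> assume "\<alpha> \<in> forms A"
  then show "c *\<^sub>R \<alpha> \<in> forms A"
    by (intro formsI) (simp_all add: subspace_scale[OF cotensors_subspace] formsD smooth_near_mult smooth_near_const smooth_near_of_smooth forms_smooth)
qed

definition fmul :: "('m \<Rightarrow> real) \<Rightarrow> ('m, real) form \<Rightarrow> ('m, real) form" where
  "fmul f \<alpha> = (\<lambda>x. f x *\<^sub>R \<alpha> x)"

lemma fmul_apply [simp]: "fmul f \<alpha> x = f x *\<^sub>R \<alpha> x"
  by (simp add: fmul_def)

lemma fmul_forms: "f \<in> SF \<Longrightarrow> \<alpha> \<in> forms A \<Longrightarrow> fmul f \<alpha> \<in> forms A"
  by (rule formsI) (simp_all add: subspace_scale[OF cotensors_subspace] formsD smooth_near_mult smooth_near_of_smooth forms_smooth)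

lemma forms_glue:
  assumes "\<And>x. \<exists>\<eta>\<in>forms A. \<forall>\<^sub>F y in nhds x. \<eta> y = \<omega> y"
  shows "\<omega> \<in> forms A"
proof (rule formsI)
  fix x
  obtain \<eta> where \<eta>: "\<eta> \<in> forms A" "\<forall>\<^sub>F y in nhds x. \<eta> y = \<omega> y" using assms by blast
  have "\<eta> x = \<omega> x" using eventually_nhds_x_imp_x[OF \<eta>(2)] .
  then show "\<omega> x \<in> cotensors A x" using formsD[OF \<eta>(1), of x] by simp
  fix Xs assume Xs: "set Xs \<subseteq> VF"
  have "\<forall>\<^sub>F y in nhds x. \<eta> y (vals Xs y) = \<omega> y (vals Xs y)"
    using \<eta>(2) by eventually_elim simp
  then show "smooth_near A x (\<lambda>x. \<omega> x (vals Xs x))"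
    by (rule smooth_near_cong[OF smooth_near_of_smooth[OF forms_smooth[OF \<eta>(1) Xs]]])
qed

end

context filtered_manifold
begin

lemma vals_tangent: "set Xs \<subseteq> VF \<Longrightarrow> set (vals Xs y) \<subseteq> tangent A y"
  using vfD by auto

lemma vals_through:
  assumes "set vs \<subseteq> tangent A x"
  obtains Xs where "set Xs \<subseteq> VF" "vals Xs x = vs" "length Xs = length vs"
proof -
  have "\<exists>Xs. set Xs \<subseteq> VF \<and> vals Xs x = vs"
    using assms
  proof (induction vs)
    case (Cons v vs)
    then obtain Xs where Xs: "set Xs \<subseteq> VF" "vals Xs x = vs" by auto
    obtain X where "X \<in> VF" "X x = v" using vf_through[of v x] Cons.prems by auto
    then show ?case using Xs by (intro exI[of _ "X # Xs"]) simp
  qed simp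
  then show ?thesis using that by (metis length_map)
qed

lemma cotensor_eqI:
  assumes "a \<in> cotensors A x" "b \<in> cotensors A x" "\<And>Xs. set Xs \<subseteq> VF \<Longrightarrow> a (vals Xs x) = b (vals Xs x)"
  shows "a = b"
proof
  fix vs show "a vs = b vs"
  proof (cases "set vs \<subseteq> tangent A x")
    case True
    then show ?thesis using vals_through[OF True] assms(3) by metis
  next
    case False
    then show ?thesis using assms(1,2) alt_outside unfolding cotensors_def by metis
  qed
qed

text \<open>The fibre at \<open>x\<close> has a basis dual to evaluations on lists of frame fields.
  Transported to nearby fibres along the tangent frame it becomes a frame of the exterior algebra.
  Coefficients are read off by evaluation on fixed global fields, which makes them smooth for smooth
  forms.\<close>

lemma forms_frame:
  obtains U N J \<beta> where "open U" "x \<in> U"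
    "\<forall>k<N::nat. set (J k) \<subseteq> VF" "\<forall>k<N. \<beta> k \<in> forms A"
    "\<forall>y\<in>U. \<forall>k<N. \<forall>l<N. \<beta> k y (vals (J l) y) = (if k = l then 1 else 0)"
    "\<forall>y\<in>U. \<forall>a\<in>cotensors A y. a = (\<Sum>k<N. a (vals (J k) y) *\<^sub>R \<beta> k y)"
proof -
  obtain U r X where fr: "local_frame s U r X" and x: "x \<in> U" using H_frame .
  note top = H_top[OF order_refl]
  let ?c = "frame_coeff r X"
  have Xt: "X j y \<in> tangent A y" if "j < r" for j y using frame_tangent[OF fr that] .
  \<comment> \<open>Identifies tangent vectors at different points that have the same coordinates in
    the frame.\<close>
  define fl where "fl y x v = (\<Sum>j<r. ?c y j v *\<^sub>R X j x)" for y x v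
  have fl_t: "fl y x v \<in> tangent A x" for y x v
    unfolding fl_def by (intro subspace_sum[OF tangent_subspace] subspace_scale[OF tangent_subspace] Xt) simp
  have fl_lin: "fl y x (a *\<^sub>R u + b *\<^sub>R v) = a *\<^sub>R fl y x u + b *\<^sub>R fl y x v"
    if "u \<in> tangent A y" "v \<in> tangent A y" for y x a b u v
    by (simp add: fl_def frame_coeff_lin[OF fr that] scaleR_add_left sum.distrib scaleR_sum_right)
  have fl_X: "fl y x (X j y) = X j x" if "y \<in> U" "j < r" for y x j
  proof -
    have "fl y x (X j y) = (\<Sum>k<r. (if k = j then X j x else 0))"
      unfolding fl_def by (intro sum.cong refl) (simp add: frame_coeff_frame[OF fr that(1) _ that(2)])
    then show ?thesis using that(2) by simp
  qed
  define pull where "pull y x a = (\<lambda>vs. if set vs \<subseteq> tangent A y then a (map (fl y x) vs) else 0)"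
    for y x and a :: "'m tvec list \<Rightarrow> real"
  have pull: "pull y x a \<in> cotensors A y" if "a \<in> cotensors A x" for y x a
    unfolding pull_def cotensors_def
    by (rule alt_forms_pullback[OF that[unfolded cotensors_def] tangent_subspace]) (simp_all add: fl_t fl_lin)
  define I where "I = {js :: nat list. set js \<subseteq> {..<r} \<and> distinct js}"
  have "finite I"
    by (rule finite_subset[OF _ finite_lists_length_le[of "{..<r}" r]])
       (auto simp: I_def distinct_card[symmetric] dest: card_mono[rotated])
  have span: "tangent A y = span ((\<lambda>j. X j y) ` {..<r})" if "y \<in> U" for y
    using local_frame_span[OF fr that] top by simp
  define Y where "Y js = map X js" for js :: "nat list"
  have vY: "vals (Y js) y = map (\<lambda>j. X j y) js" for js y by (simp add: Y_def)
  have Y_VF: "set (Y js) \<subseteq> VF" if "js \<in> I" for js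
    using that local_frame_vf[OF fr] by (auto simp: Y_def I_def)
  have sep: "a = 0" if "y \<in> U" "a \<in> cotensors A y" "\<forall>js\<in>I. a (vals (Y js) y) = 0" for y and a :: "'m tvec list \<Rightarrow> real"
    by (rule alt_forms_determined[OF that(2)[unfolded cotensors_def] span[OF that(1)]])
       (use that(3) in \<open>auto simp: I_def vY\<close>)
  obtain J b where J: "J \<subseteq> I" and bJ: "\<forall>js\<in>J. b js \<in> cotensors A x"
    and dual: "\<forall>js\<in>J. \<forall>ks\<in>J. b js (vals (Y ks) x) = (if js = ks then 1 else 0)"
    and expand: "\<forall>a\<in>cotensors A x. a = (\<Sum>js\<in>J. a (vals (Y js) x) *\<^sub>R b js)"
    by (rule dual_basis[OF cotensors_subspace \<open>finite I\<close>, where \<phi> = "\<lambda>js a. a (vals (Y js) x)"])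
       (use sep[OF x] in auto)
  have pull_Y: "pull y x a (vals (Y js) y) = a (vals (Y js) x)" if "y \<in> U" "js \<in> I" for y x a js
  proof -
    have "map (fl y x) (vals (Y js) y) = vals (Y js) x"
      using fl_X[OF that(1)] that(2) by (auto simp: vY I_def)
    moreover have "pull y x a (vals (Y js) y) = a (map (fl y x) (vals (Y js) y))"
      unfolding pull_def using vals_tangent[OF Y_VF[OF that(2)]] by (simp only: if_True)
    ultimately show ?thesis by (simp only:)
  qed
  obtain bmp where bmp: "bmp \<in> SF" "\<forall>\<^sub>F y in nhds x. bmp y = 1"
    "\<forall>y. y \<notin> U \<longrightarrow> (\<forall>\<^sub>F z in nhds y. bmp z = 0)"
    using bump_function[OF local_frame_open[OF fr] x] .
  define \<beta> where "\<beta> js y = bmp y *\<^sub>R pull y x (b js)" for js y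
  have \<beta>_forms: "\<beta> js \<in> forms A" if "js \<in> J" for js
  proof (rule formsI)
    have b: "b js \<in> cotensors A x" using bJ[rule_format, OF that] .
    fix y
    show "\<beta> js y \<in> cotensors A y"
      unfolding \<beta>_def by (intro subspace_scale[OF cotensors_subspace] pull b)
    fix Xs assume Xs: "set Xs \<subseteq> VF"
    have eq: "\<beta> js y (vals Xs y) = bmp y * b js (map (fl y x) (vals Xs y))" for y
      using vals_tangent[OF Xs] by (simp add: \<beta>_def pull_def)
    show "smooth_near A y (\<lambda>y. \<beta> js y (vals Xs y))"
    proof (cases "y \<in> U")
      case False
      have "\<forall>\<^sub>F z in nhds y. 0 = \<beta> js z (vals Xs z)"
        using bmp(3)[rule_format, OF False] unfolding eq by eventually_elim simp
      then show ?thesis by (rule smooth_near_cong[OF smooth_near_const])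
    next
      case True
      \<comment> \<open>The transported arguments move inside one fixed fibre. Expanding them one at
        a time in the fixed basis \<open>X j x\<close> leaves smooth frame coefficients times
        constants; \<open>us\<close> collects the basis vectors already inserted.\<close>
      have "smooth_near A y (\<lambda>y. b js (us @ map (fl y x) (vals Xs y)))" if "set us \<subseteq> tangent A x" for us
        using Xs that
      proof (induction Xs arbitrary: us)
        case Nil
        then show ?case by (simp add: smooth_near_const)
      next
        case (Cons Z Zs)
        have "b js (us @ map (fl z x) (vals (Z # Zs) z)) =
            (\<Sum>j<r. ?c z j (Z z) * b js ((us @ [X j x]) @ map (fl z x) (vals Zs z)))" for z
        proof -
          have "b js (us @ (\<Sum>j<r. ?c z j (Z z) *\<^sub>R X j x) # map (fl z x) (vals Zs z)) =
             (\<Sum>j<r. ?c z j (Z z) *\<^sub>R b js (us @ X j x # map (fl z x) (vals Zs z)))"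
            by (rule alt_slot_sum[OF b[unfolded cotensors_def] tangent_subspace])
               (use Cons.prems Xt fl_t in auto)
          then show ?thesis by (simp add: fl_def[of z x "Z z"])
        qed
        moreover have "smooth_near A y (\<lambda>z. \<Sum>j<r. ?c z j (Z z) * b js ((us @ [X j x]) @ map (fl z x) (vals Zs z)))"
        proof (rule smooth_near_sum, rule smooth_near_mult)
          fix j assume "j \<in> {..<r}"
          then show "smooth_near A y (\<lambda>z. ?c z j (Z z))"
            using Cons.prems by (intro frame_coeff_smooth[OF fr True]) auto
          show "smooth_near A y (\<lambda>z. b js ((us @ [X j x]) @ map (fl z x) (vals Zs z)))"
            using Cons.prems Xt[of j] \<open>j \<in> {..<r}\<close> by (intro Cons.IH) auto
        qed
        ultimately show ?case by simp
      qed
      from this[of "[]"] show ?thesis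
        unfolding eq using smooth_near_mult[OF smooth_near_of_smooth[OF bmp(1)]] by simp
    qed
  qed
  obtain V where V: "open V" "x \<in> V" "\<And>y. y \<in> V \<Longrightarrow> bmp y = 1"
    using bmp(2) unfolding eventually_nhds by blast
  have fJ: "finite J" using J \<open>finite I\<close> finite_subset by blast
  have dual_y: "\<beta> js y (vals (Y ks) y) = (if js = ks then 1 else 0)"
    if "y \<in> U \<inter> V" "js \<in> J" "ks \<in> J" for y js ks
    using that J dual V(3)[of y] pull_Y[of y ks x "b js"] by (auto simp: \<beta>_def)
  have expand_y: "a = (\<Sum>js\<in>J. a (vals (Y js) y) *\<^sub>R \<beta> js y)" if y: "y \<in> U \<inter> V" and a: "a \<in> cotensors A y" for y a
  proof -
    let ?a = "a - (\<Sum>js\<in>J. a (vals (Y js) y) *\<^sub>R \<beta> js y)"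
    have a': "?a \<in> cotensors A y"
      using a \<beta>_forms formsD by (intro subspace_diff[OF cotensors_subspace] subspace_sum[OF cotensors_subspace] subspace_scale[OF cotensors_subspace]) auto
    have zeroJ: "?a (vals (Y ks) y) = 0" if "ks \<in> J" for ks
    proof -
      have "(\<Sum>js\<in>J. a (vals (Y js) y) *\<^sub>R \<beta> js y) (vals (Y ks) y) = (\<Sum>js\<in>J. if js = ks then a (vals (Y ks) y) else 0)"
        unfolding sum_fun_apply by (intro sum.cong refl) (simp add: dual_y[OF y _ that])
      then show ?thesis using fJ that by simp
    qed
    \<comment> \<open>The remainder of the expansion is carried back to the fibre at
      \<open>x\<close>, where the dual basis detects it. The redundant evaluations over
      \<open>I\<close> then vanish as well, and these separate the fibre at
      \<open>y\<close>.\<close>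
    have "pull x y ?a = 0"
    proof -
      have "pull x y ?a (vals (Y js) x) = 0" if "js \<in> J" for js
        using pull_Y[OF x, of js y ?a] zeroJ[OF that] J that by auto
      then show ?thesis using bspec[OF expand pull[OF a', of x]] by simp
    qed
    then have "\<forall>js\<in>I. ?a (vals (Y js) y) = 0"
      using pull_Y[OF x, of _ y ?a] by simp
    then have "?a = 0" using sep[of y ?a] y a' by blast
    then show ?thesis by simp
  qed
  obtain e where e: "bij_betw e {..<card J} J"
    using ex_bij_betw_nat_finite[OF fJ] by (auto simp: lessThan_atLeast0)
  have eJ: "e k \<in> J" if "k < card J" for k using e that by (auto simp: bij_betw_def)
  have einj: "e k = e l \<longleftrightarrow> k = l" if "k < card J" "l < card J" for k l
    using e that by (auto simp: bij_betw_def inj_on_def)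
  show ?thesis
  proof (rule that[of "U \<inter> V" "card J" "\<lambda>k. Y (e k)" "\<lambda>k. \<beta> (e k)"])
    show "open (U \<inter> V)" using local_frame_open[OF fr] V(1) by auto
    show "x \<in> U \<inter> V" using x V(2) by simp
    show "\<forall>k<card J. set (Y (e k)) \<subseteq> VF" using eJ J Y_VF by blast
    show "\<forall>k<card J. \<beta> (e k) \<in> forms A" using eJ \<beta>_forms by blast
    show "\<forall>y\<in>U \<inter> V. \<forall>k<card J. \<forall>l<card J. \<beta> (e k) y (vals (Y (e l)) y) = (if k = l then 1 else 0)"
      using dual_y eJ einj by auto
    show "\<forall>y\<in>U \<inter> V. \<forall>a\<in>cotensors A y. a = (\<Sum>k<card J. a (vals (Y (e k)) y) *\<^sub>R \<beta> (e k) y)"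
      using expand_y sum.reindex_bij_betw[OF e, of "\<lambda>js. a (vals (Y js) y) *\<^sub>R \<beta> js y" for a y] by auto
  qed
qed

lemma form_through:
  assumes "a \<in> cotensors A x"
  obtains \<alpha> where "\<alpha> \<in> forms A" "\<alpha> x = a"
proof -
  obtain U N J \<beta> where *: "open U" "x \<in> U"
    "\<forall>k<N::nat. set (J k) \<subseteq> VF" "\<forall>k<N. \<beta> k \<in> forms A"
    "\<forall>y\<in>U. \<forall>k<N. \<forall>l<N. \<beta> k y (vals (J l) y) = (if k = l then 1 else 0)"
    "\<forall>y\<in>U. \<forall>a\<in>cotensors A y. a = (\<Sum>k<N. a (vals (J k) y) *\<^sub>R \<beta> k y)"
    using forms_frame[of x] .
  let ?\<alpha> = "\<Sum>k<N. a (vals (J k) x) *\<^sub>R \<beta> k"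
  have "?\<alpha> \<in> forms A"
    using *(4) by (intro subspace_sum[OF forms_subspace] subspace_scale[OF forms_subspace]) auto
  moreover have "?\<alpha> x = a"
    using *(6)[rule_format, OF *(2) assms] by (simp add: sum_fun_apply)
  ultimately show ?thesis by (rule that)
qed

end

section \<open>Cartan calculus\<close>

text \<open>The separate terms of Cartan's formula depend on more than the values of the fields at a
  point, so the calculus runs on functions of lists of fields; forms are recovered at the end
  through tensoriality.\<close>

type_synonym 'm cochain = "'m vfield list \<Rightarrow> 'm \<Rightarrow> real"

text \<open>The derivation on lists of arguments induced by \<open>G\<close>. The recursion moves
  the head into the cochain, that is, it contracts with it, so identities are proved by induction on
  the list with the cochain arbitrary.\<close>

primrec slot_sum :: "('m vfield \<Rightarrow> 'm vfield) \<Rightarrow> 'm vfield list \<Rightarrow> 'm cochain \<Rightarrow> 'm \<Rightarrow> real" where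
  "slot_sum G [] = (\<lambda>c x. 0)"
| "slot_sum G (Y # Ys) = (\<lambda>c x. c (G Y # Ys) x + slot_sum G Ys (\<lambda>Zs. c (Y # Zs)) x)"

definition lie :: "'m vfield \<Rightarrow> 'm cochain \<Rightarrow> 'm cochain" where
  "lie X c Ys = (\<lambda>x. X x (c Ys) - slot_sum (bracket X) Ys c x)"

text \<open>The exterior derivative, by recursion on the list of arguments through Cartan's formula
  \<open>i\<^sub>X d = L\<^sub>X - d i\<^sub>X\<close>; the recursion replaces the signs of the invariant formula.\<close>

primrec ext_d :: "'m vfield list \<Rightarrow> 'm cochain \<Rightarrow> 'm \<Rightarrow> real" where
  "ext_d [] = (\<lambda>c x. 0)"
| "ext_d (X # Xs) = (\<lambda>c x. lie X c Xs x - ext_d Xs (\<lambda>Ys. c (X # Ys)) x)"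

text \<open>The wedge product of df with the cochain, through its contraction rule: contracting with
  X gives (X f) c minus the wedge product of df with the contraction of c.\<close>

primrec wedge_d :: "('m \<Rightarrow> real) \<Rightarrow> 'm vfield list \<Rightarrow> 'm cochain \<Rightarrow> 'm \<Rightarrow> real" where
  "wedge_d f [] = (\<lambda>c x. 0)"
| "wedge_d f (X # Xs) = (\<lambda>c x. X x f * c Xs x - wedge_d f Xs (\<lambda>Ys. c (X # Ys)) x)"

context filtered_manifold
begin

definition smooth_cochain :: "'m cochain \<Rightarrow> bool" where
  "smooth_cochain c \<longleftrightarrow> (\<forall>Xs. set Xs \<subseteq> VF \<longrightarrow> c Xs \<in> SF)"

definition vadd :: "'m vfield \<Rightarrow> 'm vfield \<Rightarrow> 'm vfield" where
  "vadd X Y = (\<lambda>x. X x + Y x)"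

definition vmul :: "('m \<Rightarrow> real) \<Rightarrow> 'm vfield \<Rightarrow> 'm vfield" where
  "vmul f X = (\<lambda>x. f x *\<^sub>R X x)"

lemma vadd_apply: "vadd X Y x h = X x h + Y x h"
  and vmul_apply: "vmul f X x h = f x * X x h"
  by (simp_all add: vadd_def vmul_def)

lemma vadd_VF: "X \<in> VF \<Longrightarrow> Y \<in> VF \<Longrightarrow> vadd X Y \<in> VF"
  and vmul_VF: "f \<in> SF \<Longrightarrow> X \<in> VF \<Longrightarrow> vmul f X \<in> VF"
  by (simp_all add: vadd_def vmul_def vf_add vf_scale)

lemma bracket_vadd_right: "X \<in> VF \<Longrightarrow> Y \<in> VF \<Longrightarrow> Z \<in> VF \<Longrightarrow> bracket X (vadd Y Z) = vadd (bracket X Y) (bracket X Z)"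
  and bracket_vadd_left: "X \<in> VF \<Longrightarrow> Y \<in> VF \<Longrightarrow> Z \<in> VF \<Longrightarrow> bracket (vadd Y Z) X = vadd (bracket Y X) (bracket Z X)"
  unfolding vadd_def by (fact bracket_add_right bracket_add_left)+

lemma bracket_vmul_right:
  "X \<in> VF \<Longrightarrow> Y \<in> VF \<Longrightarrow> f \<in> SF \<Longrightarrow> bracket X (vmul f Y) = vadd (vmul f (bracket X Y)) (vmul (\<lambda>x. X x f) Y)"
  unfolding vadd_def vmul_def by (fact bracket_scale_right)

lemma bracket_vmul_left:
  "X \<in> VF \<Longrightarrow> Y \<in> VF \<Longrightarrow> f \<in> SF \<Longrightarrow>
    bracket (vmul f Y) X = (\<lambda>x. vmul f (bracket Y X) x - vmul (\<lambda>x. X x f) Y x)"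
  unfolding vmul_def by (fact bracket_scale_left)

text \<open>Alternation is demanded for adjacent slots only, the form that passes most easily
  through the recursion of \<open>ext_d\<close>; arbitrary repetitions are treated in
  \<open>tensorial_repeat\<close>.\<close>

definition tensorial :: "'m cochain \<Rightarrow> bool" where
  "tensorial c \<longleftrightarrow> smooth_cochain c \<and>
     (\<forall>us X Y ws. set us \<subseteq> VF \<longrightarrow> X \<in> VF \<longrightarrow> Y \<in> VF \<longrightarrow> set ws \<subseteq> VF \<longrightarrow>
        c (us @ (vadd X Y) # ws) = (\<lambda>x. c (us @ X # ws) x + c (us @ Y # ws) x)) \<and>
     (\<forall>us f X ws. set us \<subseteq> VF \<longrightarrow> f \<in> SF \<longrightarrow> X \<in> VF \<longrightarrow> set ws \<subseteq> VF \<longrightarrow>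
        c (us @ (vmul f X) # ws) = (\<lambda>x. f x * c (us @ X # ws) x)) \<and>
     (\<forall>us X ws. set us \<subseteq> VF \<longrightarrow> X \<in> VF \<longrightarrow> set ws \<subseteq> VF \<longrightarrow> c (us @ X # X # ws) = (\<lambda>_. 0))"

lemma smooth_cochainD: "smooth_cochain c \<Longrightarrow> set Xs \<subseteq> VF \<Longrightarrow> c Xs \<in> SF"
  by (simp add: smooth_cochain_def)

lemma tensorial_smooth: "tensorial c \<Longrightarrow> smooth_cochain c"
  and tensorial_add: "tensorial c \<Longrightarrow> set us \<subseteq> VF \<Longrightarrow> X \<in> VF \<Longrightarrow> Y \<in> VF \<Longrightarrow> set ws \<subseteq> VF \<Longrightarrow>
        c (us @ (vadd X Y) # ws) = (\<lambda>x. c (us @ X # ws) x + c (us @ Y # ws) x)"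
  and tensorial_scale: "tensorial c \<Longrightarrow> set us \<subseteq> VF \<Longrightarrow> f \<in> SF \<Longrightarrow> X \<in> VF \<Longrightarrow> set ws \<subseteq> VF \<Longrightarrow>
        c (us @ (vmul f X) # ws) = (\<lambda>x. f x * c (us @ X # ws) x)"
  and tensorial_alt: "tensorial c \<Longrightarrow> set us \<subseteq> VF \<Longrightarrow> X \<in> VF \<Longrightarrow> set ws \<subseteq> VF \<Longrightarrow> c (us @ X # X # ws) = (\<lambda>_. 0)"
  by (simp_all add: tensorial_def)

lemma tensorial_inner:
  assumes c: "tensorial c" and X: "X \<in> VF"
  shows "tensorial (\<lambda>Ys. c (X # Ys))"
  unfolding tensorial_def smooth_cochain_def
proof (intro conjI allI impI)
  fix Xs assume "set Xs \<subseteq> VF"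
  then show "c (X # Xs) \<in> SF" using smooth_cochainD[OF tensorial_smooth[OF c], of "X # Xs"] X by simp
next
  fix us ws :: "'m vfield list" and Y Z assume "set us \<subseteq> VF" "Y \<in> VF" "Z \<in> VF" "set ws \<subseteq> VF"
  then show "c (X # us @ (vadd Y Z) # ws) = (\<lambda>x. c (X # us @ Y # ws) x + c (X # us @ Z # ws) x)"
    using tensorial_add[OF c, of "X # us"] X by simp
next
  fix us ws :: "'m vfield list" and f Y assume "set us \<subseteq> VF" "f \<in> SF" "Y \<in> VF" "set ws \<subseteq> VF"
  then show "c (X # us @ (vmul f Y) # ws) = (\<lambda>x. f x * c (X # us @ Y # ws) x)"
    using tensorial_scale[OF c, of "X # us"] X by simp
next
  fix us ws :: "'m vfield list" and Y assume "set us \<subseteq> VF" "Y \<in> VF" "set ws \<subseteq> VF"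
  then show "c (X # us @ Y # Y # ws) = (\<lambda>_. 0)"
    using tensorial_alt[OF c, of "X # us"] X by simp
qed

lemma tensorial_swap:
  assumes c: "tensorial c" and us: "set us \<subseteq> VF" and X: "X \<in> VF" and Y: "Y \<in> VF" and ws: "set ws \<subseteq> VF"
  shows "c (us @ X # Y # ws) x = - c (us @ Y # X # ws) x"
proof -
  let ?Z = "vadd X Y"
  have Z: "?Z \<in> VF" using X Y by (rule vadd_VF)
  have "c (us @ ?Z # ?Z # ws) x = c (us @ X # ?Z # ws) x + c (us @ Y # ?Z # ws) x"
    using tensorial_add[OF c us X Y, of "?Z # ws"] Z ws by (simp add: fun_eq_iff)
  moreover have "c (us @ X # ?Z # ws) x = c (us @ X # X # ws) x + c (us @ X # Y # ws) x"
    using tensorial_add[OF c _ X Y ws, of "us @ [X]"] us X by (simp add: fun_eq_iff)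
  moreover have "c (us @ Y # ?Z # ws) x = c (us @ Y # X # ws) x + c (us @ Y # Y # ws) x"
    using tensorial_add[OF c _ X Y ws, of "us @ [Y]"] us Y by (simp add: fun_eq_iff)
  ultimately show ?thesis
    using tensorial_alt[OF c us Z ws] tensorial_alt[OF c us X ws] tensorial_alt[OF c us Y ws] by (simp add: fun_eq_iff)
qed

lemma tensorial_zero_slot:
  assumes c: "tensorial c" and us: "set us \<subseteq> VF" and ws: "set ws \<subseteq> VF"
  shows "c (us @ (\<lambda>_. 0) # ws) x = 0"
  using tensorial_scale[OF c us smooth_const[of 0] vf_zero ws] by (simp add: fun_eq_iff vmul_def)

lemma tensorial_diff:
  assumes c: "tensorial c" and us: "set us \<subseteq> VF" and X: "X \<in> VF" and Y: "Y \<in> VF" and ws: "set ws \<subseteq> VF"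
  shows "c (us @ (\<lambda>x. X x - Y x) # ws) x = c (us @ X # ws) x - c (us @ Y # ws) x"
proof -
  have "(\<lambda>x. X x - Y x) = vadd X (vmul (\<lambda>_. - 1) Y)" by (simp add: vadd_def vmul_def)
  then show ?thesis
    by (simp add: tensorial_add[OF c us X vmul_VF[OF smooth_const[of "- 1"] Y] ws] tensorial_scale[OF c us smooth_const[of "- 1"] Y ws])
qed

section \<open>Linearity, product rules and smoothness for the Lie derivative and the exterior
  derivative\<close>

lemma slot_sum_lincomb:
  "slot_sum G Xs (\<lambda>Ys x. a * c Ys x + b * c' Ys x) x = a * slot_sum G Xs c x + b * slot_sum G Xs c' x"
  by (induction Xs arbitrary: c c') (simp_all add: algebra_simps)

lemma slot_sum_mult: "slot_sum G Xs (\<lambda>Ys x. f x * c Ys x) x = f x * slot_sum G Xs c x"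
  by (induction Xs arbitrary: c) (simp_all add: algebra_simps)

lemma slot_sum_cong:
  assumes "\<And>Y. Y \<in> VF \<Longrightarrow> G Y \<in> VF" "\<And>Ys. set Ys \<subseteq> VF \<Longrightarrow> c Ys = c' Ys" "set Xs \<subseteq> VF"
  shows "slot_sum G Xs c = slot_sum G Xs c'"
  using assms(2,3)
proof (induction Xs arbitrary: c c')
  case (Cons X Xs)
  have "slot_sum G Xs (\<lambda>Zs. c (X # Zs)) = slot_sum G Xs (\<lambda>Zs. c' (X # Zs))"
    using Cons.prems by (intro Cons.IH) simp_all
  then show ?case using Cons.prems assms(1)[of X] by simp
qed simp

lemma slot_sum_smooth:
  assumes "\<And>Y. Y \<in> VF \<Longrightarrow> G Y \<in> VF" "smooth_cochain c" "set Xs \<subseteq> VF"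
  shows "slot_sum G Xs c \<in> SF"
  using assms(2,3)
proof (induction Xs arbitrary: c)
  case Nil
  then show ?case by (simp add: smooth_const)
next
  case (Cons X Xs)
  have "slot_sum G Xs (\<lambda>Zs. c (X # Zs)) \<in> SF"
    using Cons.prems by (intro Cons.IH) (auto simp: smooth_cochain_def)
  moreover have "c (G X # Xs) \<in> SF"
    using Cons.prems assms(1)[of X] by (auto simp: smooth_cochain_def)
  ultimately show ?case by (simp add: smooth_add)
qed

lemma lie_Cons: "lie X c (Y # Ys) x = lie X (\<lambda>Zs. c (Y # Zs)) Ys x - c (bracket X Y # Ys) x"
  by (simp add: lie_def)

lemma lie_smooth:
  assumes "X \<in> VF" "smooth_cochain c"
  shows "smooth_cochain (lie X c)"
  unfolding smooth_cochain_def lie_def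
  by (intro allI impI smooth_diff vf_smooth[OF assms(1)] slot_sum_smooth vf_bracket[OF assms(1)] assms(2) smooth_cochainD[OF assms(2)])

lemma lie_lincomb:
  assumes "X \<in> VF" "smooth_cochain c" "smooth_cochain c'" "set Ys \<subseteq> VF"
  shows "lie X (\<lambda>Zs x. a * c Zs x + b * c' Zs x) Ys x = a * lie X c Ys x + b * lie X c' Ys x"
  using tangent_lincomb[OF vfD[OF assms(1)] smooth_cochainD[OF assms(2,4)] smooth_cochainD[OF assms(3,4)], of x a b]
  by (simp add: lie_def slot_sum_lincomb algebra_simps)

lemma lie_diff:
  assumes "X \<in> VF" "smooth_cochain c" "smooth_cochain c'" "set Ys \<subseteq> VF"
  shows "lie X (\<lambda>Zs x. c Zs x - c' Zs x) Ys x = lie X c Ys x - lie X c' Ys x"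
  using lie_lincomb[OF assms, of 1 "- 1" x] by simp

lemma lie_mult:
  assumes "X \<in> VF" "f \<in> SF" "smooth_cochain c" "set Ys \<subseteq> VF"
  shows "lie X (\<lambda>Zs x. f x * c Zs x) Ys x = f x * lie X c Ys x + X x f * c Ys x"
  using tangent_mult[OF vfD[OF assms(1)] assms(2) smooth_cochainD[OF assms(3,4)], of x]
  by (simp add: lie_def slot_sum_mult algebra_simps)

lemma smooth_cochain_inner: "smooth_cochain c \<Longrightarrow> X \<in> VF \<Longrightarrow> smooth_cochain (\<lambda>Ys. c (X # Ys))"
  by (simp add: smooth_cochain_def)

lemma lie_cong:
  assumes "X \<in> VF" "\<And>Ys. set Ys \<subseteq> VF \<Longrightarrow> c Ys = c' Ys" "set Ys \<subseteq> VF"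
  shows "lie X c Ys = lie X c' Ys"
proof -
  have "slot_sum (bracket X) Ys c = slot_sum (bracket X) Ys c'"
    by (rule slot_sum_cong[OF vf_bracket[OF assms(1)] assms(2,3)])
  then show ?thesis using assms(2)[OF assms(3)] by (simp add: lie_def)
qed

lemma ext_d_cong:
  assumes "\<And>Ys. set Ys \<subseteq> VF \<Longrightarrow> c Ys = c' Ys" "set Xs \<subseteq> VF"
  shows "ext_d Xs c = ext_d Xs c'"
  using assms
proof (induction Xs arbitrary: c c')
  case (Cons X Xs)
  have "ext_d Xs (\<lambda>Zs. c (X # Zs)) = ext_d Xs (\<lambda>Zs. c' (X # Zs))"
    using Cons.prems by (intro Cons.IH) simp_all
  moreover have "lie X c Xs = lie X c' Xs"
    using Cons.prems by (intro lie_cong) simp_all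
  ultimately show ?case by simp
qed simp

lemma ext_d_smooth:
  assumes "smooth_cochain c" "set Xs \<subseteq> VF"
  shows "ext_d Xs c \<in> SF"
  using assms
proof (induction Xs arbitrary: c)
  case Nil
  then show ?case by (simp add: smooth_const)
next
  case (Cons X Xs)
  have "ext_d Xs (\<lambda>Zs. c (X # Zs)) \<in> SF"
    using Cons.prems by (intro Cons.IH smooth_cochain_inner) simp_all
  moreover have "lie X c Xs \<in> SF"
    using Cons.prems by (intro smooth_cochainD[OF lie_smooth]) simp_all
  ultimately show ?case by (simp add: smooth_diff)
qed

lemma smooth_cochain_ext_d: "smooth_cochain c \<Longrightarrow> smooth_cochain (\<lambda>Xs. ext_d Xs c)"
  by (simp add: smooth_cochain_def[of "\<lambda>Xs. ext_d Xs c"] ext_d_smooth)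

lemma ext_d_lincomb:
  assumes "smooth_cochain c" "smooth_cochain c'" "set Xs \<subseteq> VF"
  shows "ext_d Xs (\<lambda>Zs x. a * c Zs x + b * c' Zs x) x = a * ext_d Xs c x + b * ext_d Xs c' x"
  using assms
proof (induction Xs arbitrary: c c')
  case (Cons X Xs)
  have "ext_d Xs (\<lambda>Zs x. a * c (X # Zs) x + b * c' (X # Zs) x) x = a * ext_d Xs (\<lambda>Zs. c (X # Zs)) x + b * ext_d Xs (\<lambda>Zs. c' (X # Zs)) x"
    using Cons.prems by (intro Cons.IH smooth_cochain_inner) simp_all
  moreover have "lie X (\<lambda>Zs x. a * c Zs x + b * c' Zs x) Xs x = a * lie X c Xs x + b * lie X c' Xs x"
    using Cons.prems by (intro lie_lincomb) simp_all
  ultimately show ?case by (simp add: algebra_simps)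
qed simp

lemma ext_d_diff:
  assumes "smooth_cochain c" "smooth_cochain c'" "set Xs \<subseteq> VF"
  shows "ext_d Xs (\<lambda>Zs x. c Zs x - c' Zs x) x = ext_d Xs c x - ext_d Xs c' x"
  using ext_d_lincomb[OF assms, of 1 "- 1" x] by simp

lemma ext_d_zero: "set Xs \<subseteq> VF \<Longrightarrow> ext_d Xs (\<lambda>Zs x. 0) x = 0"
  using ext_d_lincomb[of "\<lambda>Zs x. 0" "\<lambda>Zs x. 0" Xs 0 0 x] smooth_const[of 0] by (simp add: smooth_cochain_def)

lemma ext_d_mult:
  assumes "f \<in> SF" "smooth_cochain c" "set Xs \<subseteq> VF"
  shows "ext_d Xs (\<lambda>Zs x. f x * c Zs x) x = f x * ext_d Xs c x + wedge_d f Xs c x"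
  using assms(2,3)
proof (induction Xs arbitrary: c)
  case (Cons X Xs)
  have "ext_d Xs (\<lambda>Zs x. f x * c (X # Zs) x) x = f x * ext_d Xs (\<lambda>Zs. c (X # Zs)) x + wedge_d f Xs (\<lambda>Zs. c (X # Zs)) x"
    using Cons.prems by (intro Cons.IH smooth_cochain_inner) simp_all
  moreover have "lie X (\<lambda>Zs x. f x * c Zs x) Xs x = f x * lie X c Xs x + X x f * c Xs x"
    using Cons.prems by (intro lie_mult assms(1)) simp_all
  ultimately show ?case by (simp add: algebra_simps)
qed simp

lemma wedge_d_lincomb: "wedge_d f Xs (\<lambda>Zs x. a * c Zs x + b * c' Zs x) x = a * wedge_d f Xs c x + b * wedge_d f Xs c' x"
  by (induction Xs arbitrary: c c') (simp_all add: algebra_simps)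

lemma wedge_d_mult: "wedge_d f Xs (\<lambda>Zs x. h x * c Zs x) x = h x * wedge_d f Xs c x"
  by (induction Xs arbitrary: c) (simp_all add: algebra_simps)

lemma wedge_d_cong:
  assumes "\<And>Ys. set Ys \<subseteq> VF \<Longrightarrow> c Ys x = c' Ys x" "set Xs \<subseteq> VF"
  shows "wedge_d f Xs c x = wedge_d f Xs c' x"
  using assms
proof (induction Xs arbitrary: c c')
  case (Cons X Xs)
  have "wedge_d f Xs (\<lambda>Zs. c (X # Zs)) x = wedge_d f Xs (\<lambda>Zs. c' (X # Zs)) x"
    using Cons.prems by (intro Cons.IH) simp_all
  then show ?case using Cons.prems by simp
qed simp

lemma wedge_d_vanish:
  assumes "\<And>X. X \<in> VF \<Longrightarrow> X x f = 0" "set Xs \<subseteq> VF"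
  shows "wedge_d f Xs c x = 0"
  using assms(2) by (induction Xs arbitrary: c) (simp_all add: assms(1))

text \<open>Peeling the first argument off both iterated Lie derivatives produces bracket terms in
  that slot; they match by the Jacobi identity, and the rest is the statement for the contracted
  cochain.\<close>

lemma lie_commutator:
  assumes X: "X \<in> VF" and Y: "Y \<in> VF" and c: "tensorial c" and Zs: "set Zs \<subseteq> VF"
  shows "lie X (lie Y c) Zs x - lie Y (lie X c) Zs x = lie (bracket X Y) c Zs x"
  using c Zs
proof (induction Zs arbitrary: c)
  case Nil
  then show ?case by (simp add: lie_def bracket_def)
next
  case (Cons Z Zs)
  note c = Cons.prems(1)
  have Z: "Z \<in> VF" and Zs: "set Zs \<subseteq> VF" using Cons.prems(2) by auto
  let ?i = "\<lambda>W Ys. c (W # Ys)"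
  have sm: "smooth_cochain (?i W)" if "W \<in> VF" for W
    using smooth_cochain_inner[OF tensorial_smooth[OF c] that] .
  have key: "lie V (lie W c) (Z # Zs) x = lie V (lie W (?i Z)) Zs x - lie V (?i (bracket W Z)) Zs x
      - lie W (?i (bracket V Z)) Zs x + c (bracket W (bracket V Z) # Zs) x"
    if V: "V \<in> VF" and W: "W \<in> VF" for V W
  proof -
    have "lie V (lie W c) (Z # Zs) x = lie V (\<lambda>Ys. lie W c (Z # Ys)) Zs x - lie W c (bracket V Z # Zs) x"
      by (rule lie_Cons)
    also have "(\<lambda>Ys. lie W c (Z # Ys)) = (\<lambda>Ys x. lie W (?i Z) Ys x - ?i (bracket W Z) Ys x)"
      by (simp add: fun_eq_iff lie_Cons)
    also have "lie V (\<lambda>Ys x. lie W (?i Z) Ys x - ?i (bracket W Z) Ys x) Zs x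
        = lie V (lie W (?i Z)) Zs x - lie V (?i (bracket W Z)) Zs x"
      by (rule lie_diff[OF V lie_smooth[OF W sm[OF Z]] sm[OF vf_bracket[OF W Z]] Zs])
    finally show ?thesis by (simp add: lie_Cons)
  qed
  have "c (bracket (bracket X Y) Z # Zs) x = c (bracket X (bracket Y Z) # Zs) x - c (bracket Y (bracket X Z) # Zs) x"
  proof -
    have "bracket (bracket X Y) Z = (\<lambda>x. bracket X (bracket Y Z) x - bracket Y (bracket X Z) x)"
      by (rule ext) (rule jacobi[OF X Y Z])
    then show ?thesis
      using tensorial_diff[OF c _ _ _ Zs, of "[]" "bracket X (bracket Y Z)" "bracket Y (bracket X Z)" x]
      by (simp add: vf_bracket X Y Z)
  qed
  moreover have "lie X (lie Y (?i Z)) Zs x - lie Y (lie X (?i Z)) Zs x = lie (bracket X Y) (?i Z) Zs x"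
    by (rule Cons.IH[OF tensorial_inner[OF c Z] Zs])
  ultimately show ?case
    by (simp add: key[OF X Y] key[OF Y X] lie_Cons[of "bracket X Y"])
qed

text \<open>Contract both sides with the first argument Y. The Lie derivative along X fails to
  commute with this contraction by the contraction with [X, Y], and by Cartan's formula this failure
  is balanced by \<open>lie_commutator\<close>.\<close>

lemma lie_ext_d:
  assumes X: "X \<in> VF" and c: "tensorial c" and Ys: "set Ys \<subseteq> VF"
  shows "lie X (\<lambda>Zs. ext_d Zs c) Ys x = ext_d Ys (lie X c) x"
  using c Ys
proof (induction Ys arbitrary: c)
  case Nil
  then show ?case by (simp add: lie_def tangent_const[OF vfD[OF X]])
next
  case (Cons Y Ys)
  note c = Cons.prems(1)
  have Y: "Y \<in> VF" and Ys: "set Ys \<subseteq> VF" using Cons.prems(2) by auto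
  have sc: "smooth_cochain c" using tensorial_smooth[OF c] .
  let ?i = "\<lambda>W Ys. c (W # Ys)"
  have sm: "smooth_cochain (?i W)" if "W \<in> VF" for W
    using smooth_cochain_inner[OF sc that] .
  have "lie X (\<lambda>Zs. ext_d Zs c) (Y # Ys) x = lie X (\<lambda>Zs. ext_d (Y # Zs) c) Ys x - ext_d (bracket X Y # Ys) c x"
    by (rule lie_Cons)
  also have "(\<lambda>Zs. ext_d (Y # Zs) c) = (\<lambda>Zs x. lie Y c Zs x - ext_d Zs (?i Y) x)"
    by simp
  also have "lie X (\<lambda>Zs x. lie Y c Zs x - ext_d Zs (?i Y) x) Ys x = lie X (lie Y c) Ys x - lie X (\<lambda>Zs. ext_d Zs (?i Y)) Ys x"
    by (rule lie_diff[OF X lie_smooth[OF Y sc] smooth_cochain_ext_d[OF sm[OF Y]] Ys])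
  also have "lie X (\<lambda>Zs. ext_d Zs (?i Y)) Ys x = ext_d Ys (lie X (?i Y)) x"
    by (rule Cons.IH[OF tensorial_inner[OF c Y] Ys])
  finally have 1: "lie X (\<lambda>Zs. ext_d Zs c) (Y # Ys) x = lie X (lie Y c) Ys x - ext_d Ys (lie X (?i Y)) x
      - (lie (bracket X Y) c Ys x - ext_d Ys (?i (bracket X Y)) x)"
    by simp
  have "(\<lambda>Zs. lie X c (Y # Zs)) = (\<lambda>Zs x. lie X (?i Y) Zs x - ?i (bracket X Y) Zs x)"
    by (simp add: fun_eq_iff lie_Cons)
  then have "ext_d (Y # Ys) (lie X c) x = lie Y (lie X c) Ys x - (ext_d Ys (lie X (?i Y)) x - ext_d Ys (?i (bracket X Y)) x)"
    using ext_d_diff[OF lie_smooth[OF X sm[OF Y]] sm[OF vf_bracket[OF X Y]] Ys] by simp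
  then show ?case
    using 1 lie_commutator[OF X Y c Ys, of x] by linarith
qed

text \<open>Contracting d d with X gives L d - d L plus d d of the contraction, where L is the Lie
  derivative along X. The first two terms cancel by \<open>lie_ext_d\<close>, the last vanishes by
  induction.\<close>

lemma ext_d_ext_d:
  assumes c: "tensorial c" and Xs: "set Xs \<subseteq> VF"
  shows "ext_d Xs (\<lambda>Ys. ext_d Ys c) x = 0"
  using c Xs
proof (induction Xs arbitrary: c)
  case (Cons X Xs)
  note c = Cons.prems(1)
  have X: "X \<in> VF" and Xs: "set Xs \<subseteq> VF" using Cons.prems(2) by auto
  have sc: "smooth_cochain c" using tensorial_smooth[OF c] .
  have "ext_d Xs (\<lambda>Ys. ext_d (X # Ys) c) x = ext_d Xs (\<lambda>Ys x. lie X c Ys x - ext_d Ys (\<lambda>Zs. c (X # Zs)) x) x"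
    by simp
  also have "\<dots> = ext_d Xs (lie X c) x - ext_d Xs (\<lambda>Ys. ext_d Ys (\<lambda>Zs. c (X # Zs))) x"
    by (rule ext_d_diff[OF lie_smooth[OF X sc] smooth_cochain_ext_d[OF smooth_cochain_inner[OF sc X]] Xs])
  also have "ext_d Xs (\<lambda>Ys. ext_d Ys (\<lambda>Zs. c (X # Zs))) x = 0"
    by (rule Cons.IH[OF tensorial_inner[OF c X] Xs])
  finally have "ext_d Xs (\<lambda>Ys. ext_d (X # Ys) c) x = ext_d Xs (lie X c) x" by simp
  moreover have "ext_d (X # Xs) (\<lambda>Ys. ext_d Ys c) x = lie X (\<lambda>Ys. ext_d Ys c) Xs x - ext_d Xs (\<lambda>Ys. ext_d (X # Ys) c) x"
    by (simp only: ext_d.simps(2))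
  ultimately show ?case using lie_ext_d[OF X c Xs, of x] by linarith
qed simp

section \<open>The exterior derivative of a tensorial cochain is tensorial\<close>

lemma slot_sum_add_slot:
  assumes G: "\<And>Y. Y \<in> VF \<Longrightarrow> G Y \<in> VF" and c: "tensorial c"
    and GXY: "G (vadd X Y) = (vadd (G X) (G Y))"
    and us: "set us \<subseteq> VF" and X: "X \<in> VF" and Y: "Y \<in> VF" and ws: "set ws \<subseteq> VF"
  shows "slot_sum G (us @ (vadd X Y) # ws) c x = slot_sum G (us @ X # ws) c x + slot_sum G (us @ Y # ws) c x"
  using c us
proof (induction us arbitrary: c)
  case Nil
  have "(\<lambda>Zs. c ((vadd X Y) # Zs)) Zs = (\<lambda>x. 1 * c (X # Zs) x + 1 * c (Y # Zs) x)" if "set Zs \<subseteq> VF" for Zs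
    using tensorial_add[OF Nil.prems(1) _ X Y that, of "[]"] by simp
  then have "slot_sum G ws (\<lambda>Zs. c ((vadd X Y) # Zs)) = slot_sum G ws (\<lambda>Zs x. 1 * c (X # Zs) x + 1 * c (Y # Zs) x)"
    by (intro slot_sum_cong[OF G _ ws])
  then show ?case
    using tensorial_add[OF Nil.prems(1) _ G[OF X] G[OF Y] ws, of "[]"]
    by (simp add: GXY slot_sum_lincomb[where a = 1 and b = 1, simplified])
next
  case (Cons Z us)
  then show ?case
    using Cons.IH[OF tensorial_inner[OF Cons.prems(1)], of Z] tensorial_add[OF Cons.prems(1) _ X Y ws, of "G Z # us"] G[of Z]
    by simp
qed

lemma slot_sum_scale_slot:
  assumes V: "V \<in> VF" and f: "f \<in> SF" and c: "tensorial c"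
    and us: "set us \<subseteq> VF" and X: "X \<in> VF" and ws: "set ws \<subseteq> VF"
  shows "slot_sum (bracket V) (us @ (vmul f X) # ws) c x
    = f x * slot_sum (bracket V) (us @ X # ws) c x + V x f * c (us @ X # ws) x"
  using c us
proof (induction us arbitrary: c)
  case Nil
  note c = Nil.prems(1)
  have Vf: "(\<lambda>x. V x f) \<in> SF" using vf_smooth[OF V f] .
  have "(\<lambda>Zs. c ((vmul f X) # Zs)) Zs = (\<lambda>x. f x * c (X # Zs) x)" if "set Zs \<subseteq> VF" for Zs
    using tensorial_scale[OF c _ f X that, of "[]"] by simp
  then have 1: "slot_sum (bracket V) ws (\<lambda>Zs. c ((vmul f X) # Zs)) = slot_sum (bracket V) ws (\<lambda>Zs x. f x * c (X # Zs) x)"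
    by (intro slot_sum_cong[OF vf_bracket[OF V] _ ws])
  have "c (bracket V (vmul f X) # ws) x = f x * c (bracket V X # ws) x + V x f * c (X # ws) x"
    using tensorial_add[OF c _ vmul_VF[OF f vf_bracket[OF V X]] vmul_VF[OF Vf X] ws, of "[]"]
      tensorial_scale[OF c _ f vf_bracket[OF V X] ws, of "[]"] tensorial_scale[OF c _ Vf X ws, of "[]"]
    by (simp add: bracket_vmul_right[OF V X f])
  then show ?case using 1 by (simp add: slot_sum_mult algebra_simps)
next
  case (Cons Z us)
  then show ?case
    using Cons.IH[OF tensorial_inner[OF Cons.prems(1)], of Z] tensorial_scale[OF Cons.prems(1) _ f X ws, of "bracket V Z # us"]
      vf_bracket[OF V, of Z]
    by (simp add: algebra_simps)
qed

lemma slot_sum_alt: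
  assumes G: "\<And>Y. Y \<in> VF \<Longrightarrow> G Y \<in> VF" and c: "tensorial c"
    and us: "set us \<subseteq> VF" and X: "X \<in> VF" and ws: "set ws \<subseteq> VF"
  shows "slot_sum G (us @ X # X # ws) c x = 0"
  using c us
proof (induction us arbitrary: c)
  case Nil
  note c = Nil.prems(1)
  have "(\<lambda>Zs. c (X # X # Zs)) Zs = (\<lambda>x. 0 * c Zs x)" if "set Zs \<subseteq> VF" for Zs
    using tensorial_alt[OF c _ X that, of "[]"] by simp
  then have "slot_sum G ws (\<lambda>Zs. c (X # X # Zs)) = slot_sum G ws (\<lambda>Zs x. 0 * c Zs x)"
    by (intro slot_sum_cong[OF G _ ws])
  then show ?case
    using tensorial_swap[OF c _ G[OF X] X ws, of "[]" x] slot_sum_mult[of G ws "\<lambda>_. 0" c x] by simp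
next
  case (Cons Z us)
  then show ?case
    using Cons.IH[OF tensorial_inner[OF Cons.prems(1)], of Z] tensorial_alt[OF Cons.prems(1) _ X ws, of "G Z # us"] G[of Z]
    by simp
qed

text \<open>The contribution of the arguments to the rule that the Lie derivative along f V is f
  times the one along V plus df wedge the contraction with V. The alternation of \<open>c\<close> is
  used to move V to the front.\<close>

lemma slot_sum_scale_left:
  assumes V: "V \<in> VF" and f: "f \<in> SF" and c: "tensorial c" and Ys: "set Ys \<subseteq> VF"
  shows "slot_sum (bracket (vmul f V)) Ys c x
    = f x * slot_sum (bracket V) Ys c x - wedge_d f Ys (\<lambda>Zs. c (V # Zs)) x"
  using c Ys
proof (induction Ys arbitrary: c)
  case (Cons Y Ys)
  note c = Cons.prems(1)
  have Y: "Y \<in> VF" and Ys: "set Ys \<subseteq> VF" using Cons.prems(2) by auto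
  have Yf: "(\<lambda>x. Y x f) \<in> SF" using vf_smooth[OF Y f] .
  have "c (bracket (vmul f V) Y # Ys) x = f x * c (bracket V Y # Ys) x - Y x f * c (V # Ys) x"
    using tensorial_diff[OF c _ vmul_VF[OF f vf_bracket[OF V Y]] vmul_VF[OF Yf V] Ys, of "[]" x]
      tensorial_scale[OF c _ f vf_bracket[OF V Y] Ys, of "[]"] tensorial_scale[OF c _ Yf V Ys, of "[]"]
    by (simp add: bracket_vmul_left[OF Y V f])
  moreover have "wedge_d f Ys (\<lambda>Zs. c (Y # V # Zs)) x = - wedge_d f Ys (\<lambda>Zs. c (V # Y # Zs)) x"
  proof -
    have "c (Y # V # Zs) x = (- 1) * c (V # Y # Zs) x + 0 * c Zs x" if "set Zs \<subseteq> VF" for Zs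
      using tensorial_swap[OF c _ Y V that, of "[]" x] by simp
    then have "wedge_d f Ys (\<lambda>Zs. c (Y # V # Zs)) x = wedge_d f Ys (\<lambda>Zs x. (- 1) * c (V # Y # Zs) x + 0 * c Zs x) x"
      by (intro wedge_d_cong[OF _ Ys])
    then show ?thesis unfolding wedge_d_lincomb by simp
  qed
  ultimately show ?case
    using Cons.IH[OF tensorial_inner[OF c Y] Ys] by (simp add: algebra_simps)
qed simp

lemma slot_sum_add_left:
  assumes V: "V \<in> VF" and W: "W \<in> VF" and c: "tensorial c" and Ys: "set Ys \<subseteq> VF"
  shows "slot_sum (bracket (vadd V W)) Ys c x = slot_sum (bracket V) Ys c x + slot_sum (bracket W) Ys c x"
  using c Ys
proof (induction Ys arbitrary: c)
  case (Cons Y Ys)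
  note c = Cons.prems(1)
  have Y: "Y \<in> VF" and Ys: "set Ys \<subseteq> VF" using Cons.prems(2) by auto
  have "c (bracket (vadd V W) Y # Ys) x = c (bracket V Y # Ys) x + c (bracket W Y # Ys) x"
    using tensorial_add[OF c _ vf_bracket[OF V Y] vf_bracket[OF W Y] Ys, of "[]"]
    by (simp add: bracket_vadd_left[OF Y V W])
  then show ?case
    using Cons.IH[OF tensorial_inner[OF c Y] Ys] by simp
qed simp

lemma ext_d_add_slot:
  assumes c: "tensorial c" and us: "set us \<subseteq> VF" and X: "X \<in> VF" and Y: "Y \<in> VF" and ws: "set ws \<subseteq> VF"
  shows "ext_d (us @ (vadd X Y) # ws) c x = ext_d (us @ X # ws) c x + ext_d (us @ Y # ws) c x"
  using c us
proof (induction us arbitrary: c)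
  case Nil
  note c = Nil.prems(1)
  have sm: "smooth_cochain (\<lambda>Zs. c (W # Zs))" if "W \<in> VF" for W
    using smooth_cochain_inner[OF tensorial_smooth[OF c] that] .
  have "(\<lambda>Zs. c ((vadd X Y) # Zs)) Zs = (\<lambda>x. 1 * c (X # Zs) x + 1 * c (Y # Zs) x)" if "set Zs \<subseteq> VF" for Zs
    using tensorial_add[OF c _ X Y that, of "[]"] by simp
  then have "ext_d ws (\<lambda>Zs. c ((vadd X Y) # Zs)) = ext_d ws (\<lambda>Zs x. 1 * c (X # Zs) x + 1 * c (Y # Zs) x)"
    by (intro ext_d_cong[OF _ ws])
  then have "ext_d ws (\<lambda>Zs. c ((vadd X Y) # Zs)) x = ext_d ws (\<lambda>Zs. c (X # Zs)) x + ext_d ws (\<lambda>Zs. c (Y # Zs)) x"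
    using ext_d_lincomb[OF sm[OF X] sm[OF Y] ws, of 1 1 x] by simp
  then show ?case
    using vadd_apply[of X Y x "c ws"] by (simp add: lie_def slot_sum_add_left[OF X Y c ws])
next
  case (Cons Z us)
  note c = Cons.prems(1)
  have Z: "Z \<in> VF" and us: "set us \<subseteq> VF" using Cons.prems(2) by auto
  have sm: "c (us @ W # ws) \<in> SF" if "W \<in> VF" for W
    using smooth_cochainD[OF tensorial_smooth[OF c], of "us @ W # ws"] us ws that by simp
  have "lie Z c (us @ (vadd X Y) # ws) x = lie Z c (us @ X # ws) x + lie Z c (us @ Y # ws) x"
    using slot_sum_add_slot[OF vf_bracket[OF Z] c bracket_vadd_right[OF Z X Y] us X Y ws, of x]
      tangent_add[OF vfD[OF Z] sm[OF X] sm[OF Y], of x]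
    by (simp add: lie_def tensorial_add[OF c us X Y ws])
  then show ?case
    using Cons.IH[OF tensorial_inner[OF c Z] us] by simp
qed

text \<open>In the first slot both parts of Cartan's formula produce df wedge the contraction with
  X, with opposite signs. In a later slot the derivative of f coming from the field Z in front
  cancels against the one from its bracket with f X.\<close>

lemma ext_d_scale_slot:
  assumes f: "f \<in> SF" and c: "tensorial c" and us: "set us \<subseteq> VF" and X: "X \<in> VF" and ws: "set ws \<subseteq> VF"
  shows "ext_d (us @ (vmul f X) # ws) c x = f x * ext_d (us @ X # ws) c x"
  using c us
proof (induction us arbitrary: c)
  case Nil
  note c = Nil.prems(1)
  have "(\<lambda>Zs. c ((vmul f X) # Zs)) Zs = (\<lambda>x. f x * c (X # Zs) x)" if "set Zs \<subseteq> VF" for Zs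
    using tensorial_scale[OF c _ f X that, of "[]"] by simp
  then have "ext_d ws (\<lambda>Zs. c ((vmul f X) # Zs)) = ext_d ws (\<lambda>Zs x. f x * c (X # Zs) x)"
    by (intro ext_d_cong[OF _ ws])
  then show ?case
    using ext_d_mult[OF f smooth_cochain_inner[OF tensorial_smooth[OF c] X] ws, of x]
    using vmul_apply[of f X x "c ws"] by (simp add: lie_def slot_sum_scale_left[OF X f c ws] algebra_simps)
next
  case (Cons Z us)
  note c = Cons.prems(1)
  have Z: "Z \<in> VF" and us: "set us \<subseteq> VF" using Cons.prems(2) by auto
  have sm: "c (us @ X # ws) \<in> SF"
    using smooth_cochainD[OF tensorial_smooth[OF c], of "us @ X # ws"] us ws X by simp
  have "lie Z c (us @ (vmul f X) # ws) x = f x * lie Z c (us @ X # ws) x"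
    using slot_sum_scale_slot[OF Z f c us X ws, of x] tangent_mult[OF vfD[OF Z] f sm, of x]
    by (simp add: lie_def tensorial_scale[OF c us f X ws] algebra_simps)
  then show ?case
    using Cons.IH[OF tensorial_inner[OF c Z] us] by (simp add: algebra_simps)
qed

lemma ext_d_alt:
  assumes c: "tensorial c" and us: "set us \<subseteq> VF" and X: "X \<in> VF" and ws: "set ws \<subseteq> VF"
  shows "ext_d (us @ X # X # ws) c x = 0"
  using c us
proof (induction us arbitrary: c)
  case Nil
  note c = Nil.prems(1)
  have "(\<lambda>Zs. c (X # X # Zs)) Zs = (\<lambda>x. 0)" if "set Zs \<subseteq> VF" for Zs
    using tensorial_alt[OF c _ X that, of "[]"] by simp
  then have "ext_d ws (\<lambda>Zs. c (X # X # Zs)) = ext_d ws (\<lambda>Zs x. 0)"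
    by (intro ext_d_cong[OF _ ws])
  then show ?case
    using ext_d_zero[OF ws, of x] tensorial_zero_slot[OF c _ ws, of "[]" x]
    by (simp add: lie_Cons bracket_self)
next
  case (Cons Z us)
  note c = Cons.prems(1)
  have Z: "Z \<in> VF" and us: "set us \<subseteq> VF" using Cons.prems(2) by auto
  have "lie Z c (us @ X # X # ws) x = 0"
    using slot_sum_alt[where G = "bracket Z" and x = x, OF vf_bracket[OF Z] c us X ws] tangent_const[OF vfD[OF Z]]
    by (simp add: lie_def tensorial_alt[OF c us X ws])
  then show ?case
    using Cons.IH[OF tensorial_inner[OF c Z] us] by simp
qed

lemma tensorial_ext_d:
  assumes c: "tensorial c"
  shows "tensorial (\<lambda>Xs. ext_d Xs c)"
  unfolding tensorial_def
  using smooth_cochain_ext_d[OF tensorial_smooth[OF c]] ext_d_add_slot[OF c] ext_d_scale_slot[OF _ c] ext_d_alt[OF c]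
  by (simp add: fun_eq_iff)

section \<open>The exterior derivative\<close>

lemma tensorial_eval:
  assumes \<omega>: "\<omega> \<in> forms A"
  shows "tensorial (eval_form \<omega>)"
proof -
  note alt = formsD[OF \<omega>, unfolded cotensors_def]
  show ?thesis
    unfolding tensorial_def smooth_cochain_def
  proof (intro conjI allI impI)
    fix Xs assume "set Xs \<subseteq> VF"
    then show "eval_form \<omega> Xs \<in> SF" using forms_smooth[OF \<omega>] by (simp add: eval_form_def)
  next
    fix us ws :: "'m vfield list" and X Y
    assume "set us \<subseteq> VF" "X \<in> VF" "Y \<in> VF" "set ws \<subseteq> VF"
    then have "\<omega> x (vals us x @ (1 *\<^sub>R X x + 1 *\<^sub>R Y x) # vals ws x)
        = 1 *\<^sub>R \<omega> x (vals us x @ X x # vals ws x) + 1 *\<^sub>R \<omega> x (vals us x @ Y x # vals ws x)" for x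
      by (intro alt_lin[OF alt] vals_tangent vfD)
    then show "eval_form \<omega> (us @ vadd X Y # ws) = (\<lambda>x. eval_form \<omega> (us @ X # ws) x + eval_form \<omega> (us @ Y # ws) x)"
      by (simp add: eval_form_def vadd_def)
  next
    fix us ws :: "'m vfield list" and f X
    assume "set us \<subseteq> VF" "f \<in> SF" "X \<in> VF" "set ws \<subseteq> VF"
    then have "\<omega> x (vals us x @ (f x *\<^sub>R X x + 0 *\<^sub>R X x) # vals ws x)
        = f x *\<^sub>R \<omega> x (vals us x @ X x # vals ws x) + 0 *\<^sub>R \<omega> x (vals us x @ X x # vals ws x)" for x
      by (intro alt_lin[OF alt] vals_tangent vfD)
    then show "eval_form \<omega> (us @ vmul f X # ws) = (\<lambda>x. f x * eval_form \<omega> (us @ X # ws) x)"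
      by (simp add: eval_form_def vmul_def)
  next
    fix us ws :: "'m vfield list" and X
    show "eval_form \<omega> (us @ X # X # ws) = (\<lambda>_. 0)"
      using alt_repeat[OF alt, where vs = "[]"] by (simp add: eval_form_def)
  qed
qed

definition vsum :: "nat \<Rightarrow> (nat \<Rightarrow> 'm vfield) \<Rightarrow> 'm vfield" where
  "vsum r F = (\<lambda>y. \<Sum>j<r. F j y)"

lemma vsum_0: "vsum 0 F = (\<lambda>_. 0)"
  and vsum_Suc: "vsum (Suc r) F = vadd (vsum r F) (F r)"
  by (simp_all add: vsum_def vadd_def)

lemma vsum_VF: "(\<And>j. j < r \<Longrightarrow> F j \<in> VF) \<Longrightarrow> vsum r F \<in> VF"
  unfolding vsum_def by (rule vf_sum) simp

text \<open>A field that vanishes at \<open>x\<close> is near \<open>x\<close> a combination of frame fields whose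
  coefficients vanish at \<open>x\<close>; a bump function makes this a global identity.\<close>

lemma vanishing_expansion:
  assumes Z: "Z \<in> sections A (H i)" and Zx: "Z x = 0"
  obtains r f X bmp where "\<forall>j<r::nat. f j \<in> SF \<and> f j x = 0 \<and> X j \<in> sections A (H i)" "bmp \<in> SF"
    "\<forall>\<^sub>F y in nhds x. bmp y = 1" "vmul bmp Z = vsum r (\<lambda>j. vmul (f j) (X j))"
proof -
  obtain U r X where fr: "local_frame i U r X" and x: "x \<in> U" using H_frame .
  have ZV: "Z \<in> VF" using sections_vf[OF Z] .
  have ex: "\<exists>f. f \<in> SF \<and> (\<forall>\<^sub>F y in nhds x. f y = frame_coeff r X y j (Z y))" if "j < r" for j
    by (rule smooth_extension[OF local_frame_open[OF fr] x frame_coeff_smooth[OF fr _ ZV that]]) auto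
  then obtain f where f: "\<And>j. j < r \<Longrightarrow> f j \<in> SF" "\<And>j. j < r \<Longrightarrow> \<forall>\<^sub>F y in nhds x. f j y = frame_coeff r X y j (Z y)"
    by metis
  have "\<forall>\<^sub>F y in nhds x. \<forall>j\<in>{..<r}. f j y = frame_coeff r X y j (Z y)"
    using f(2) by (intro eventually_ball_finite) auto
  then have "\<forall>\<^sub>F y in nhds x. y \<in> U \<and> (\<forall>j\<in>{..<r}. f j y = frame_coeff r X y j (Z y))"
    using eventually_nhds_in_open[OF local_frame_open[OF fr] x] by eventually_elim simp
  then obtain W where W: "open W" "x \<in> W" "\<And>y. y \<in> W \<Longrightarrow> y \<in> U" "\<And>y j. y \<in> W \<Longrightarrow> j < r \<Longrightarrow> f j y = frame_coeff r X y j (Z y)"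
    unfolding eventually_nhds by auto
  obtain b1 where b1: "b1 \<in> SF" "\<forall>\<^sub>F y in nhds x. b1 y = 1" "\<forall>y. y \<notin> W \<longrightarrow> (\<forall>\<^sub>F z in nhds y. b1 z = 0)"
    using bump_function[OF W(1,2)] .
  have b0: "b1 y = 0" if "y \<notin> W" for y
    using eventually_nhds_x_imp_x[OF b1(3)[rule_format, OF that]] .
  have X_sec: "vmul b1 (X j) \<in> sections A (H i)" if j: "j < r" for j
  proof -
    have "vmul b1 (X j) y \<in> H i y" for y
    proof (cases "y \<in> W")
      case True
      have "X j y \<in> H i y"
        unfolding local_frame_span[OF fr W(3)[OF True]] using j by (intro span_base imageI) simp
      then show ?thesis unfolding vmul_def by (rule subspace_scale[OF H_subspace])
    next
      case False
      then show ?thesis unfolding vmul_def using b0[OF False] subspace_0[OF H_subspace] by simp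
    qed
    then show ?thesis using vmul_VF[OF b1(1) local_frame_vf[OF fr j]] by (simp add: sections_def)
  qed
  have fx: "f j x = 0" if j: "j < r" for j
  proof -
    have "0 = (\<Sum>l<r. (\<lambda>_. 0) l *\<^sub>R X l x)" by simp
    then have "frame_coeff r X x j 0 = 0" by (rule frame_coeff_eq[OF fr x j])
    then show ?thesis using W(4)[OF W(2) j] Zx by simp
  qed
  have bz: "b1 y *\<^sub>R Z y = (\<Sum>j<r. f j y *\<^sub>R (b1 y *\<^sub>R X j y))" for y
  proof (cases "y \<in> W")
    case True
    have "b1 y *\<^sub>R Z y = b1 y *\<^sub>R (\<Sum>j<r. frame_coeff r X y j (Z y) *\<^sub>R X j y)"
      using frame_expansion[OF fr W(3)[OF True] sections_H[OF Z]] by (rule arg_cong)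
    also have "\<dots> = (\<Sum>j<r. b1 y *\<^sub>R (frame_coeff r X y j (Z y) *\<^sub>R X j y))"
      by (rule scaleR_sum_right)
    also have "\<dots> = (\<Sum>j<r. f j y *\<^sub>R (b1 y *\<^sub>R X j y))"
      by (intro sum.cong refl) (simp only: W(4)[OF True] lessThan_iff scaleR_left_commute)
    finally show ?thesis .
  qed (simp add: b0)
  have "vmul b1 Z = vsum r (\<lambda>j. vmul (f j) (vmul b1 (X j)))"
    unfolding vmul_def vsum_def by (rule ext) (rule bz)
  then show ?thesis
    using that[of r f "\<lambda>j. vmul b1 (X j)" b1] f(1) fx X_sec b1(1,2) by simp
qed

section \<open>From tensorial cochains to differential forms\<close>

lemma tensorial_vsum:
  assumes c: "tensorial c" and us: "set us \<subseteq> VF" and ws: "set ws \<subseteq> VF"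
    and "\<And>j. j < r \<Longrightarrow> f j \<in> SF" "\<And>j. j < r \<Longrightarrow> X j \<in> VF"
  shows "c (us @ vsum r (\<lambda>j. vmul (f j) (X j)) # ws) x = (\<Sum>j<r. f j x * c (us @ X j # ws) x)"
  using assms(4,5)
proof (induction r)
  case 0
  show ?case by (simp only: vsum_0 tensorial_zero_slot[OF c us ws] lessThan_0 sum.empty)
next
  case (Suc r)
  have "c (us @ vsum (Suc r) (\<lambda>j. vmul (f j) (X j)) # ws) x
      = c (us @ vsum r (\<lambda>j. vmul (f j) (X j)) # ws) x + c (us @ vmul (f r) (X r) # ws) x"
    unfolding vsum_Suc using Suc.prems
    by (subst tensorial_add[OF c us vsum_VF vmul_VF ws]) (simp_all add: vmul_VF)
  moreover have "c (us @ vmul (f r) (X r) # ws) x = f r x * c (us @ X r # ws) x"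
    using Suc.prems by (subst tensorial_scale[OF c us _ _ ws]) simp_all
  ultimately show ?case using Suc by simp
qed

text \<open>By \<open>vanishing_expansion\<close> a multiple of the field is a combination with
  coefficients that vanish at \<open>x\<close>; the multiplier is 1 at \<open>x\<close> and drops
  out.\<close>

lemma tensorial_vanish_at:
  assumes c: "tensorial c" and us: "set us \<subseteq> VF" and Z: "Z \<in> VF" and ws: "set ws \<subseteq> VF" and Zx: "Z x = 0"
  shows "c (us @ Z # ws) x = 0"
proof -
  have Zs: "Z \<in> sections A (H s)" using Z by (simp add: sections_top)
  obtain r f X bmp where *: "\<forall>j<r::nat. f j \<in> SF \<and> f j x = 0 \<and> X j \<in> sections A (H s)" "bmp \<in> SF"
    "\<forall>\<^sub>F y in nhds x. bmp y = 1" "vmul bmp Z = vsum r (\<lambda>j. vmul (f j) (X j))"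
    using vanishing_expansion[where Z = Z and i = s and x = x, OF Zs Zx] by blast
  have "c (us @ vmul bmp Z # ws) x = (\<Sum>j<r. f j x * c (us @ X j # ws) x)"
    unfolding *(4) by (rule tensorial_vsum[OF c us ws]) (use *(1) sections_vf in auto)
  also have "\<dots> = 0" using *(1) by (intro sum.neutral) simp
  finally show ?thesis
    using tensorial_scale[OF c us *(2) Z ws] eventually_nhds_x_imp_x[OF *(3)] by simp
qed

lemma tensorial_pointwise:
  assumes c: "tensorial c" and "set us \<subseteq> VF" "set Xs \<subseteq> VF" "set Ys \<subseteq> VF" "vals Xs x = vals Ys x"
  shows "c (us @ Xs) x = c (us @ Ys) x"
  using assms(2-)
proof (induction Xs arbitrary: us Ys)
  case Nil
  then show ?case by simp
next
  case (Cons X Xs)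
  then obtain Y Zs where Y: "Ys = Y # Zs" "X x = Y x" "vals Xs x = vals Zs x" by (cases Ys) auto
  have VF: "X \<in> VF" "Y \<in> VF" "set Xs \<subseteq> VF" "set Zs \<subseteq> VF" using Cons.prems Y by auto
  have "c (us @ (\<lambda>x. X x - Y x) # Xs) x = 0"
    by (rule tensorial_vanish_at[OF c Cons.prems(1) vf_diff[OF VF(1,2)] VF(3)]) (simp add: Y(2))
  then have "c (us @ X # Xs) x = c (us @ Y # Xs) x"
    using tensorial_diff[OF c Cons.prems(1) VF(1,2,3), of x] by simp
  also have "\<dots> = c ((us @ [Y]) @ Zs) x"
    using Cons.IH[of "us @ [Y]" Zs] Cons.prems(1) VF Y(3) by simp
  finally show ?case by (simp add: Y(1))
qed

lemma tensorial_repeat: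
  assumes c: "tensorial c" and "set us \<subseteq> VF" and V: "V \<in> VF" and "set vs \<subseteq> VF" and ws: "set ws \<subseteq> VF"
  shows "c (us @ V # vs @ V # ws) x = 0"
  using assms(2,4)
proof (induction vs arbitrary: us)
  case Nil
  then show ?case using tensorial_alt[OF c Nil.prems(1) V ws] by simp
next
  case (Cons Z vs)
  then have "c (us @ V # Z # vs @ V # ws) x = - c (us @ Z # V # vs @ V # ws) x"
    using V ws by (intro tensorial_swap[OF c]) auto
  then show ?case using Cons.IH[of "us @ [Z]"] Cons.prems by simp
qed

text \<open>The vectors are extended to fields by an arbitrary choice; for a tensorial cochain the
  value does not depend on it, by \<open>tensorial_pointwise\<close>.\<close>

definition form_of :: "'m cochain \<Rightarrow> ('m, real) form" where
  "form_of c x vs = (if set vs \<subseteq> tangent A x then c (SOME Xs. set Xs \<subseteq> VF \<and> vals Xs x = vs) x else 0)"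

lemma form_of_vals:
  assumes c: "tensorial c" and Xs: "set Xs \<subseteq> VF"
  shows "form_of c x (vals Xs x) = c Xs x"
proof -
  let ?Ys = "SOME Ys. set Ys \<subseteq> VF \<and> vals Ys x = vals Xs x"
  have "set ?Ys \<subseteq> VF \<and> vals ?Ys x = vals Xs x"
    by (rule someI[of "\<lambda>Ys. set Ys \<subseteq> VF \<and> vals Ys x = vals Xs x" Xs]) (simp add: Xs)
  then have "c ([] @ ?Ys) x = c ([] @ Xs) x"
    by (intro tensorial_pointwise[OF c]) (simp_all add: Xs)
  then show ?thesis
    unfolding form_of_def using vals_tangent[OF Xs, of x] by simp
qed

lemma form_of_forms:
  assumes c: "tensorial c"
  shows "form_of c \<in> forms A"
proof (rule formsI)
  fix x Xs assume Xs: "set Xs \<subseteq> VF"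
  show "smooth_near A x (\<lambda>x. form_of c x (vals Xs x))"
    using smooth_near_of_smooth[OF smooth_cochainD[OF tensorial_smooth[OF c] Xs]] by (simp add: form_of_vals[OF c Xs])
next
  fix x
  show "form_of c x \<in> cotensors A x"
    unfolding cotensors_def
  proof (rule alt_formsI)
    fix us v v' ws r r'
    assume *: "set us \<subseteq> tangent A x" "v \<in> tangent A x" "v' \<in> tangent A x" "set ws \<subseteq> tangent A x"
    obtain Us where Us: "set Us \<subseteq> VF" "vals Us x = us" "length Us = length us" using vals_through[OF *(1)] .
    obtain Ws where Ws: "set Ws \<subseteq> VF" "vals Ws x = ws" "length Ws = length ws" using vals_through[OF *(4)] .
    obtain V where V: "V \<in> VF" "V x = v" using vf_through[OF *(2)] .
    obtain V' where V': "V' \<in> VF" "V' x = v'" using vf_through[OF *(3)] .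
    let ?Z = "vadd (vmul (\<lambda>_. r) V) (vmul (\<lambda>_. r') V')"
    have Z: "?Z \<in> VF" using V V' by (intro vadd_VF vmul_VF smooth_const)
    have Zx: "?Z x = r *\<^sub>R v + r' *\<^sub>R v'" unfolding vadd_def vmul_def using V V' by simp
    have at: "form_of c x (us @ Y x # ws) = c (Us @ Y # Ws) x" if "Y \<in> VF" for Y
      using form_of_vals[OF c, of "Us @ Y # Ws" x] Us Ws that by simp
    have "c (Us @ ?Z # Ws) x = r * c (Us @ V # Ws) x + r' * c (Us @ V' # Ws) x"
      using tensorial_add[OF c Us(1) vmul_VF[OF smooth_const[of r] V(1)] vmul_VF[OF smooth_const[of r'] V'(1)] Ws(1)]
        tensorial_scale[OF c Us(1) smooth_const[of r] V(1) Ws(1)] tensorial_scale[OF c Us(1) smooth_const[of r'] V'(1) Ws(1)]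
      by simp
    then show "form_of c x (us @ (r *\<^sub>R v + r' *\<^sub>R v') # ws) = r *\<^sub>R form_of c x (us @ v # ws) + r' *\<^sub>R form_of c x (us @ v' # ws)"
      using at[OF Z] at[OF V(1)] at[OF V'(1)] Zx V(2) V'(2) by simp
  next
    fix us v vs ws
    show "form_of c x (us @ v # vs @ v # ws) = 0"
    proof (cases "set (us @ v # vs @ ws) \<subseteq> tangent A x")
      case True
      obtain Us where Us: "set Us \<subseteq> VF" "vals Us x = us" "length Us = length us" using vals_through[of us x] True by auto
      obtain Vs where Vs: "set Vs \<subseteq> VF" "vals Vs x = vs" "length Vs = length vs" using vals_through[of vs x] True by auto
      obtain Ws where Ws: "set Ws \<subseteq> VF" "vals Ws x = ws" "length Ws = length ws" using vals_through[of ws x] True by auto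
      obtain V where V: "V \<in> VF" "V x = v" using vf_through[of v x] True by auto
      show ?thesis
        using form_of_vals[OF c, of "Us @ V # Vs @ V # Ws" x] tensorial_repeat[OF c Us(1) V(1) Vs(1) Ws(1), of x]
          Us Vs Ws V by simp
    qed (auto simp: form_of_def)
  next
    fix vs :: "'m tvec list" assume "set vs \<inter> {0} \<noteq> {}"
    then obtain us ws where vs: "vs = us @ 0 # ws" using split_list[of 0 vs] by auto
    show "form_of c x vs = 0"
    proof (cases "set vs \<subseteq> tangent A x")
      case True
      obtain Us where Us: "set Us \<subseteq> VF" "vals Us x = us" "length Us = length us" using vals_through[of us x] True vs by auto
      obtain Ws where Ws: "set Ws \<subseteq> VF" "vals Ws x = ws" "length Ws = length ws" using vals_through[of ws x] True vs by auto
      show ?thesis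
        using form_of_vals[OF c, of "Us @ (\<lambda>_. 0) # Ws" x] tensorial_zero_slot[OF c Us(1) Ws(1), of x] Us Ws vs vf_zero by simp
    qed (simp add: form_of_def)
  qed (simp add: form_of_def)
qed

text \<open>The expression in \<open>deRham_formula\<close> with an arbitrary cochain, so that an
  induction may contract with the first field, after which the cochain is no longer written as the
  evaluation of a form.\<close>

definition inv_formula :: "'m cochain \<Rightarrow> 'm vfield list \<Rightarrow> 'm \<Rightarrow> real" where
  "inv_formula c Xs x =
     (\<Sum>i<length Xs. (-1) ^ i * (Xs ! i) x (c (nths Xs (- {i})))) +
     (\<Sum>j<length Xs. \<Sum>i<j. (-1) ^ (i + j) * c (bracket (Xs ! i) (Xs ! j) # nths Xs (- {i, j})) x)"

lemma deRham_formula_eq: "deRham_formula \<omega> Xs x = inv_formula (eval_form \<omega>) Xs x"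
  by (simp add: deRham_formula_def inv_formula_def)

section \<open>Comparison with the invariant formula\<close>

lemma nths_Cons_remove:
  "nths (X # Xs) (- {0}) = Xs" "nths (X # Xs) (- {Suc i}) = X # nths Xs (- {i})"
  "nths (X # Xs) (- {0, Suc j}) = nths Xs (- {j})" "nths (X # Xs) (- {Suc i, Suc j}) = X # nths Xs (- {i, j})"
proof -
  have 1: "{j. Suc j \<in> - {0}} = UNIV" "{j. Suc j \<in> - {Suc i}} = - {i}"
    "{k. Suc k \<in> - {0, Suc j}} = - {j}" "{k. Suc k \<in> - {Suc i, Suc j}} = - {i, j}" by auto
  show "nths (X # Xs) (- {0}) = Xs" "nths (X # Xs) (- {Suc i}) = X # nths Xs (- {i})"
    "nths (X # Xs) (- {0, Suc j}) = nths Xs (- {j})" "nths (X # Xs) (- {Suc i, Suc j}) = X # nths Xs (- {i, j})"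
    unfolding nths_Cons 1 by (simp_all add: nths_all)
qed

lemma nths_VF: "set Xs \<subseteq> VF \<Longrightarrow> set (nths Xs I) \<subseteq> VF"
  using set_nths_subset[of Xs I] by blast

lemma slot_sum_formula:
  assumes G: "\<And>Y. Y \<in> VF \<Longrightarrow> G Y \<in> VF" and "tensorial c" "set Xs \<subseteq> VF"
  shows "slot_sum G Xs c x = (\<Sum>j<length Xs. (-1) ^ j * c (G (Xs ! j) # nths Xs (- {j})) x)"
  using assms(2,3)
proof (induction Xs arbitrary: c)
  case (Cons X Xs)
  note c = Cons.prems(1)
  have X: "X \<in> VF" and Xs: "set Xs \<subseteq> VF" using Cons.prems(2) by auto
  have "c (X # G (Xs ! j) # nths Xs (- {j})) x = - c (G (Xs ! j) # X # nths Xs (- {j})) x" if "j < length Xs" for j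
  proof -
    have "Xs ! j \<in> VF" using Xs that nth_mem by blast
    then show ?thesis
      using tensorial_swap[OF c _ X G nths_VF[OF Xs], of "[]" "Xs ! j" "- {j}" x] by simp
  qed
  then have "slot_sum G Xs (\<lambda>Zs. c (X # Zs)) x = (\<Sum>j<length Xs. (-1) ^ j * (- c (G (Xs ! j) # X # nths Xs (- {j})) x))"
    unfolding Cons.IH[OF tensorial_inner[OF c X] Xs] by (intro sum.cong refl) simp
  then show ?case
    by (simp add: sum.lessThan_Suc_shift nths_Cons_remove del: sum.lessThan_Suc)
qed simp

text \<open>The terms in which the index 0 is singled out make up the Lie derivative along the first
  field. In the others the first field is swapped past the bracket to the front, and the shifted
  signs give minus the formula for the contracted cochain.\<close>

lemma inv_formula_ext_d:
  assumes "tensorial c" "set Xs \<subseteq> VF"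
  shows "inv_formula c Xs x = ext_d Xs c x"
  using assms
proof (induction Xs arbitrary: c)
  case Nil
  then show ?case by (simp add: inv_formula_def)
next
  case (Cons X Xs)
  note c = Cons.prems(1)
  have X: "X \<in> VF" and Xs: "set Xs \<subseteq> VF" using Cons.prems(2) by auto
  let ?n = "length Xs"
  have 1: "(\<Sum>i<Suc ?n. (-1) ^ i * ((X # Xs) ! i) x (c (nths (X # Xs) (- {i}))))
      = X x (c Xs) - (\<Sum>i<?n. (-1) ^ i * (Xs ! i) x (c (X # nths Xs (- {i}))))"
    by (simp add: sum.lessThan_Suc_shift nths_Cons_remove sum_negf del: sum.lessThan_Suc)
  let ?t = "\<lambda>i j. (-1) ^ (i + j) * c (bracket ((X # Xs) ! i) ((X # Xs) ! j) # nths (X # Xs) (- {i, j})) x"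
  have 2: "(\<Sum>j<Suc ?n. \<Sum>i<j. ?t i j) = (\<Sum>j<?n. ?t 0 (Suc j)) + (\<Sum>j<?n. \<Sum>i<j. ?t (Suc i) (Suc j))"
    by (simp only: sum.lessThan_Suc_shift lessThan_0 sum.empty sum.distrib add_0_left)
  have s: "slot_sum (bracket X) Xs c x = (\<Sum>j<?n. (-1) ^ j * c (bracket X (Xs ! j) # nths Xs (- {j})) x)"
    by (rule slot_sum_formula[OF vf_bracket[OF X] c Xs])
  have 3: "(\<Sum>j<?n. ?t 0 (Suc j)) = - slot_sum (bracket X) Xs c x"
    by (simp add: s nths_Cons_remove sum_negf)
  have "?t (Suc i) (Suc j) = - ((-1) ^ (i + j) * c (X # bracket (Xs ! i) (Xs ! j) # nths Xs (- {i, j})) x)"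
    if "i < j" "j < ?n" for i j
  proof -
    have "i < ?n" using that by simp
    then have "Xs ! i \<in> VF" "Xs ! j \<in> VF" using Xs that nth_mem[of i Xs] nth_mem[of j Xs] by blast+
    then show ?thesis
      using tensorial_swap[OF c _ X vf_bracket nths_VF[OF Xs], of "[]" "Xs ! i" "Xs ! j" "- {i, j}" x]
      by (simp add: nths_Cons_remove)
  qed
  then have 4: "(\<Sum>j<?n. \<Sum>i<j. ?t (Suc i) (Suc j)) =
      - (\<Sum>j<?n. \<Sum>i<j. (-1) ^ (i + j) * c (X # bracket (Xs ! i) (Xs ! j) # nths Xs (- {i, j})) x)"
    unfolding sum_negf[symmetric] by (intro sum.cong refl) simp
  have "inv_formula c (X # Xs) x = X x (c Xs) - slot_sum (bracket X) Xs c x - inv_formula (\<lambda>Ys. c (X # Ys)) Xs x"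
    unfolding inv_formula_def length_Cons 1 2 3 4 by simp
  then show ?case
    using Cons.IH[OF tensorial_inner[OF c X] Xs] by (simp add: lie_def)
qed

abbreviation dR :: "('m, real) form \<Rightarrow> ('m, real) form" where
  "dR \<equiv> deRham A"

lemma dR_eq:
  assumes \<omega>: "\<omega> \<in> forms A"
  shows "dR \<omega> = form_of (\<lambda>Xs. ext_d Xs (eval_form \<omega>))"
proof -
  note t = tensorial_ext_d[OF tensorial_eval[OF \<omega>]]
  let ?\<eta> = "form_of (\<lambda>Xs. ext_d Xs (eval_form \<omega>))"
  have f: "deRham_formula \<omega> Xs = ext_d Xs (eval_form \<omega>)" if "set Xs \<subseteq> VF" for Xs
    using inv_formula_ext_d[OF tensorial_eval[OF \<omega>] that] by (simp add: fun_eq_iff deRham_formula_eq)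
  show ?thesis
    unfolding deRham_def
  proof (rule the_equality)
    show "?\<eta> \<in> forms A \<and> (\<forall>Xs. set Xs \<subseteq> VF \<longrightarrow> eval_form ?\<eta> Xs = deRham_formula \<omega> Xs)"
      using form_of_forms[OF t] form_of_vals[OF t] f by (simp add: fun_eq_iff eval_form_vals)
    fix \<eta> assume \<eta>: "\<eta> \<in> forms A \<and> (\<forall>Xs. set Xs \<subseteq> VF \<longrightarrow> eval_form \<eta> Xs = deRham_formula \<omega> Xs)"
    show "\<eta> = ?\<eta>"
    proof
      fix x
      show "\<eta> x = ?\<eta> x"
      proof (rule cotensor_eqI[OF formsD formsD[OF form_of_forms[OF t]]])
        fix Xs assume Xs: "set Xs \<subseteq> VF"
        have "eval_form \<eta> Xs x = ext_d Xs (eval_form \<omega>) x" using \<eta> Xs f by simp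
        then show "\<eta> x (vals Xs x) = ?\<eta> x (vals Xs x)"
          by (simp only: eval_form_vals form_of_vals[OF t Xs])
      qed (use \<eta> in simp)
    qed
  qed
qed

lemma dR_forms: "\<omega> \<in> forms A \<Longrightarrow> dR \<omega> \<in> forms A"
  by (simp only: dR_eq form_of_forms[OF tensorial_ext_d[OF tensorial_eval]])

lemma dR_vals: "\<omega> \<in> forms A \<Longrightarrow> set Xs \<subseteq> VF \<Longrightarrow> dR \<omega> x (vals Xs x) = ext_d Xs (eval_form \<omega>) x"
  by (simp only: dR_eq form_of_vals[OF tensorial_ext_d[OF tensorial_eval]])

lemma form_eqI:
  assumes "\<alpha> \<in> forms A" "\<beta> \<in> forms A" "\<And>Xs x. set Xs \<subseteq> VF \<Longrightarrow> \<alpha> x (vals Xs x) = \<beta> x (vals Xs x)"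
  shows "\<alpha> = \<beta>"
proof
  fix x
  show "\<alpha> x = \<beta> x"
    by (rule cotensor_eqI[OF formsD[OF assms(1)] formsD[OF assms(2)] assms(3)])
qed

lemmas forms_add = subspace_add[OF forms_subspace]
  and forms_diff = subspace_diff[OF forms_subspace]
  and forms_scale = subspace_scale[OF forms_subspace]
  and forms_zero = subspace_0[OF forms_subspace]

lemma eval_smooth: "\<omega> \<in> forms A \<Longrightarrow> smooth_cochain (eval_form \<omega>)"
  by (rule tensorial_smooth[OF tensorial_eval])

lemma dR_lincomb:
  assumes "\<alpha> \<in> forms A" "\<beta> \<in> forms A"
  shows "dR (a *\<^sub>R \<alpha> + b *\<^sub>R \<beta>) = a *\<^sub>R dR \<alpha> + b *\<^sub>R dR \<beta>"
proof (rule form_eqI)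
  have ab: "a *\<^sub>R \<alpha> + b *\<^sub>R \<beta> \<in> forms A" using assms by (intro forms_add forms_scale)
  show "dR (a *\<^sub>R \<alpha> + b *\<^sub>R \<beta>) \<in> forms A" by (rule dR_forms[OF ab])
  show "a *\<^sub>R dR \<alpha> + b *\<^sub>R dR \<beta> \<in> forms A" using assms by (intro forms_add forms_scale dR_forms)
  fix Xs x assume Xs: "set Xs \<subseteq> VF"
  have "eval_form (a *\<^sub>R \<alpha> + b *\<^sub>R \<beta>) = (\<lambda>Zs x. a * eval_form \<alpha> Zs x + b * eval_form \<beta> Zs x)"
    by (simp add: fun_eq_iff eval_form_def)
  then show "dR (a *\<^sub>R \<alpha> + b *\<^sub>R \<beta>) x (vals Xs x) = (a *\<^sub>R dR \<alpha> + b *\<^sub>R dR \<beta>) x (vals Xs x)"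
    using ext_d_lincomb[OF eval_smooth[OF assms(1)] eval_smooth[OF assms(2)] Xs, of a b x]
    by (simp add: dR_vals[OF ab Xs] dR_vals[OF assms(1) Xs] dR_vals[OF assms(2) Xs])
qed

lemma dR_dR:
  assumes "\<alpha> \<in> forms A"
  shows "dR (dR \<alpha>) = 0"
proof (rule form_eqI)
  show "dR (dR \<alpha>) \<in> forms A" by (intro dR_forms assms)
  show "0 \<in> forms A" by (rule forms_zero)
  fix Xs x assume Xs: "set Xs \<subseteq> VF"
  have "ext_d Xs (eval_form (dR \<alpha>)) x = ext_d Xs (\<lambda>Ys. ext_d Ys (eval_form \<alpha>)) x"
    using ext_d_cong[of "eval_form (dR \<alpha>)" "\<lambda>Ys. ext_d Ys (eval_form \<alpha>)" Xs] Xs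
    by (simp add: fun_eq_iff eval_form_vals dR_vals[OF assms])
  also have "\<dots> = 0" by (rule ext_d_ext_d[OF tensorial_eval[OF assms] Xs])
  finally show "dR (dR \<alpha>) x (vals Xs x) = 0 x (vals Xs x)"
    by (simp add: dR_vals[OF dR_forms[OF assms] Xs])
qed

text \<open>The commutator of d with multiplication by \<open>f\<close>, which is the wedge product
  with df. That it is algebraic gives the locality of d and later controls the commutators of the
  Laplacian with functions.\<close>

definition comm_d :: "('m \<Rightarrow> real) \<Rightarrow> ('m, real) form \<Rightarrow> ('m, real) form" where
  "comm_d f \<alpha> = dR (fmul f \<alpha>) - fmul f (dR \<alpha>)"

lemma comm_d_forms: "f \<in> SF \<Longrightarrow> \<alpha> \<in> forms A \<Longrightarrow> comm_d f \<alpha> \<in> forms A"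
  unfolding comm_d_def by (intro forms_diff dR_forms fmul_forms)

lemma comm_d_vals:
  assumes "f \<in> SF" "\<alpha> \<in> forms A" "set Xs \<subseteq> VF"
  shows "comm_d f \<alpha> x (vals Xs x) = wedge_d f Xs (eval_form \<alpha>) x"
proof -
  have "eval_form (fmul f \<alpha>) = (\<lambda>Zs x. f x * eval_form \<alpha> Zs x)"
    by (simp add: fun_eq_iff eval_form_def)
  then show ?thesis
    using ext_d_mult[OF assms(1) eval_smooth[OF assms(2)] assms(3), of x]
    by (simp add: comm_d_def dR_vals[OF fmul_forms[OF assms(1,2)] assms(3)] dR_vals[OF assms(2,3)])
qed

lemma comm_d_fmul:
  assumes "f \<in> SF" "h \<in> SF" "\<alpha> \<in> forms A"
  shows "comm_d f (fmul h \<alpha>) = fmul h (comm_d f \<alpha>)"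
proof (rule form_eqI)
  show "comm_d f (fmul h \<alpha>) \<in> forms A" "fmul h (comm_d f \<alpha>) \<in> forms A"
    using assms by (auto intro: comm_d_forms fmul_forms)
  fix Xs x assume Xs: "set Xs \<subseteq> VF"
  have "eval_form (fmul h \<alpha>) = (\<lambda>Zs x. h x * eval_form \<alpha> Zs x)"
    by (simp add: fun_eq_iff eval_form_def)
  then show "comm_d f (fmul h \<alpha>) x (vals Xs x) = fmul h (comm_d f \<alpha>) x (vals Xs x)"
    using wedge_d_mult[of f Xs h "eval_form \<alpha>" x]
    by (simp add: comm_d_vals[OF assms(1) fmul_forms[OF assms(2,3)] Xs] comm_d_vals[OF assms(1,3) Xs])
qed

lemma comm_d_zero_at:
  assumes f: "f \<in> SF" and \<alpha>: "\<alpha> \<in> forms A" and const: "\<forall>\<^sub>F y in nhds x. f y = k"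
  shows "comm_d f \<alpha> x = 0"
proof (rule cotensor_eqI[OF formsD[OF comm_d_forms[OF f \<alpha>]] subspace_0[OF cotensors_subspace]])
  fix Xs assume Xs: "set Xs \<subseteq> VF"
  have "X x f = 0" if X: "X \<in> VF" for X
    using tangent_cong_near[OF vfD[OF X] f smooth_const const] tangent_const[OF vfD[OF X]] by simp
  then show "comm_d f \<alpha> x (vals Xs x) = 0 (vals Xs x)"
    using wedge_d_vanish[of x f Xs "eval_form \<alpha>"] Xs by (simp add: comm_d_vals[OF f \<alpha> Xs])
qed

text \<open>For a bump function b with b \<alpha> = 0 and b = 1 near \<open>x\<close>, the
  derivative of \<alpha> at \<open>x\<close> is minus the commutator [d, b] applied to \<alpha>,
  which vanishes at \<open>x\<close> because b is constant nearby.\<close>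

lemma dR_local:
  assumes \<alpha>: "\<alpha> \<in> forms A" and ev: "\<forall>\<^sub>F y in nhds x. \<alpha> y = 0"
  shows "dR \<alpha> x = 0"
proof -
  obtain W where W: "open W" "x \<in> W" "\<And>y. y \<in> W \<Longrightarrow> \<alpha> y = 0"
    using ev unfolding eventually_nhds by blast
  obtain b where b: "b \<in> SF" "\<forall>\<^sub>F y in nhds x. b y = 1" "\<forall>y. y \<notin> W \<longrightarrow> (\<forall>\<^sub>F z in nhds y. b z = 0)"
    using bump_function[OF W(1,2)] .
  have "b y *\<^sub>R \<alpha> y = 0" for y
    using W(3)[of y] eventually_nhds_x_imp_x[OF b(3)[rule_format, of y]] by (cases "y \<in> W") auto
  then have "fmul b \<alpha> = 0" by (intro ext[of "fmul b \<alpha>" 0]) simp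
  moreover have "dR 0 = 0" using dR_lincomb[OF forms_zero forms_zero, of 0 0] by simp
  ultimately have "comm_d b \<alpha> x = - (b x *\<^sub>R dR \<alpha> x)" by (simp add: comm_d_def)
  then show ?thesis
    using comm_d_zero_at[OF b(1) \<alpha> b(2)] eventually_nhds_x_imp_x[OF b(2)] by simp
qed

section \<open>Degrees\<close>

text \<open>The projection to degree \<open>k\<close>. Degrees are integers, so that an operator of degree \<open>j\<close>
  intertwines the projections \<open>k\<close> and \<open>k + j\<close> for all \<open>k\<close>.\<close>

definition deg_proj :: "int \<Rightarrow> ('m, real) form \<Rightarrow> ('m, real) form" where
  "deg_proj k \<alpha> = (\<lambda>x vs. if int (length vs) = k then \<alpha> x vs else 0)"

lemma deg_proj_apply: "deg_proj k \<alpha> x vs = (if int (length vs) = k then \<alpha> x vs else 0)"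
  by (simp add: deg_proj_def)

lemma deg_proj_forms:
  assumes "\<alpha> \<in> forms A"
  shows "deg_proj k \<alpha> \<in> forms A"
proof (rule formsI)
  fix x
  note alt = formsD[OF assms, of x, unfolded cotensors_def]
  show "deg_proj k \<alpha> x \<in> cotensors A x"
    unfolding cotensors_def deg_proj_def
    by (rule alt_formsI)
       (auto simp: alt_outside[OF alt] alt_lin[OF alt, simplified] alt_repeat[OF alt] alt_null[OF alt])
  fix Xs assume "set Xs \<subseteq> VF"
  then show "smooth_near A x (\<lambda>x. deg_proj k \<alpha> x (vals Xs x))"
    by (cases "int (length Xs) = k")
       (simp_all add: deg_proj_def smooth_near_const smooth_near_of_smooth forms_smooth[OF assms])
qed

lemma slot_sum_cong_length:
  assumes "\<And>Y. Y \<in> VF \<Longrightarrow> G Y \<in> VF" "\<And>Ys. set Ys \<subseteq> VF \<Longrightarrow> length Ys = length Xs \<Longrightarrow> c Ys = c' Ys" "set Xs \<subseteq> VF"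
  shows "slot_sum G Xs c = slot_sum G Xs c'"
  using assms(2,3)
proof (induction Xs arbitrary: c c')
  case (Cons X Xs)
  have "slot_sum G Xs (\<lambda>Zs. c (X # Zs)) = slot_sum G Xs (\<lambda>Zs. c' (X # Zs))"
    using Cons.prems by (intro Cons.IH) simp_all
  then show ?case using Cons.prems assms(1)[of X] by simp
qed simp

lemma ext_d_cong_length:
  assumes "\<And>Ys. set Ys \<subseteq> VF \<Longrightarrow> Suc (length Ys) = length Xs \<Longrightarrow> c Ys = c' Ys" "set Xs \<subseteq> VF"
  shows "ext_d Xs c = ext_d Xs c'"
  using assms
proof (induction Xs arbitrary: c c')
  case (Cons X Xs)
  have X: "X \<in> VF" using Cons.prems by simp
  have "ext_d Xs (\<lambda>Zs. c (X # Zs)) = ext_d Xs (\<lambda>Zs. c' (X # Zs))"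
    using Cons.prems by (intro Cons.IH) simp_all
  moreover have "slot_sum (bracket X) Xs c = slot_sum (bracket X) Xs c'"
    using Cons.prems by (intro slot_sum_cong_length vf_bracket[OF X]) simp_all
  moreover have "c Xs = c' Xs" using Cons.prems by simp
  ultimately show ?case by (simp add: lie_def)
qed simp

lemma dR_deg_proj:
  assumes \<alpha>: "\<alpha> \<in> forms A"
  shows "dR (deg_proj k \<alpha>) = deg_proj (k + 1) (dR \<alpha>)"
proof (rule form_eqI)
  show "dR (deg_proj k \<alpha>) \<in> forms A" "deg_proj (k + 1) (dR \<alpha>) \<in> forms A"
    using \<alpha> by (auto intro: dR_forms deg_proj_forms)
  fix Xs x assume Xs: "set Xs \<subseteq> VF"
  have "ext_d Xs (eval_form (deg_proj k \<alpha>)) = ext_d Xs (if int (length Xs) = k + 1 then eval_form \<alpha> else (\<lambda>Zs x. 0))"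
    by (rule ext_d_cong_length[OF _ Xs]) (auto simp: fun_eq_iff eval_form_def deg_proj_def)
  then show "dR (deg_proj k \<alpha>) x (vals Xs x) = deg_proj (k + 1) (dR \<alpha>) x (vals Xs x)"
    using ext_d_zero[OF Xs, of x] Xs \<alpha> by (simp add: dR_vals deg_proj_forms deg_proj_apply)
qed

section \<open>Weights\<close>

definition graded_fields :: "('m vfield \<times> nat) list \<Rightarrow> bool" where
  "graded_fields P \<longleftrightarrow> (\<forall>(X, i)\<in>set P. X \<in> sections A (H i))"

abbreviation wsum :: "('m vfield \<times> nat) list \<Rightarrow> nat" where
  "wsum P \<equiv> sum_list (map snd P)"

lemma graded_fields_simps [simp]:
  "graded_fields []" "graded_fields ((X, i) # P) \<longleftrightarrow> X \<in> sections A (H i) \<and> graded_fields P"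
  "graded_fields (P @ Q) \<longleftrightarrow> graded_fields P \<and> graded_fields Q"
  by (auto simp: graded_fields_def)

lemma graded_fields_VF:
  assumes "graded_fields P"
  shows "set (map fst P) \<subseteq> VF"
proof
  fix X assume "X \<in> set (map fst P)"
  then obtain i where "(X, i) \<in> set P" by auto
  then have "X \<in> sections A (H i)" using assms by (auto simp: graded_fields_def)
  then show "X \<in> VF" by (rule sections_vf)
qed

text \<open>The filtration in a single fibre. The filtration of forms is global, whereas the
  resolvent needs the weight of a germ, that is, of the values near one point.\<close>

definition weight_ge :: "nat \<Rightarrow> 'm \<Rightarrow> ('m tvec list \<Rightarrow> real) set" where
  "weight_ge w x = {a. \<forall>P. graded_fields P \<longrightarrow> wsum P < w \<longrightarrow> a (vals (map fst P) x) = 0}"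

abbreviation "FW \<equiv> forms_weight_ge A H"

lemma weight_geD: "a \<in> weight_ge w x \<Longrightarrow> graded_fields P \<Longrightarrow> wsum P < w \<Longrightarrow> a (vals (map fst P) x) = 0"
  unfolding weight_ge_def by blast

lemma weight_geI: "(\<And>P. graded_fields P \<Longrightarrow> wsum P < w \<Longrightarrow> a (vals (map fst P) x) = 0) \<Longrightarrow> a \<in> weight_ge w x"
  unfolding weight_ge_def by blast

lemma FW_iff: "\<alpha> \<in> FW w \<longleftrightarrow> \<alpha> \<in> forms A \<and> (\<forall>x. \<alpha> x \<in> weight_ge w x)"
proof -
  have *: "list_all2 (\<lambda>X i. X \<in> sections A (H i)) Xs is \<longleftrightarrow> length Xs = length is \<and> graded_fields (zip Xs is)" for Xs "is"
    by (auto simp: list_all2_iff graded_fields_def)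
  have "(\<forall>Xs is. list_all2 (\<lambda>X i. X \<in> sections A (H i)) Xs is \<and> sum_list is < w \<longrightarrow> eval_form \<alpha> Xs = 0)
      \<longleftrightarrow> (\<forall>P. graded_fields P \<longrightarrow> wsum P < w \<longrightarrow> eval_form \<alpha> (map fst P) = 0)" (is "?L = ?R")
  proof
    assume L: ?L
    show ?R
    proof (intro allI impI)
      fix P assume P: "graded_fields P" "wsum P < w"
      have "list_all2 (\<lambda>X i. X \<in> sections A (H i)) (map fst P) (map snd P)"
        unfolding * zip_map_fst_snd using P(1) by simp
      then show "eval_form \<alpha> (map fst P) = 0" using L P(2) by blast
    qed
  next
    assume R: ?R
    show ?L
    proof (intro allI impI, elim conjE)
      fix Xs "is" assume l: "list_all2 (\<lambda>X i. X \<in> sections A (H i)) Xs is" "sum_list is < w"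
      then have "length Xs = length is" "graded_fields (zip Xs is)" unfolding * by auto
      then show "eval_form \<alpha> Xs = 0" using R[rule_format, of "zip Xs is"] l(2) by simp
    qed
  qed
  then show ?thesis
    by (auto simp: forms_weight_ge_def weight_ge_def fun_eq_iff eval_form_vals)
qed

lemma FW_forms: "\<alpha> \<in> FW w \<Longrightarrow> \<alpha> \<in> forms A"
  by (simp add: FW_iff)

lemma FW_weight: "\<alpha> \<in> FW w \<Longrightarrow> \<alpha> x \<in> weight_ge w x"
  by (simp add: FW_iff)

lemma weight_ge_subspace: "subspace (weight_ge w x)"
  by (rule subspaceI) (auto simp: weight_ge_def)

lemma FW_subspace: "subspace (FW w)"
  using subspace_0[OF weight_ge_subspace] subspace_add[OF weight_ge_subspace] subspace_scale[OF weight_ge_subspace]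
  by (intro subspaceI) (auto simp: FW_iff forms_zero forms_add forms_scale)

lemma weight_ge_mono: "v \<le> w \<Longrightarrow> weight_ge w x \<subseteq> weight_ge v x"
  unfolding weight_ge_def by fastforce

lemma FW_mono: "v \<le> w \<Longrightarrow> FW w \<subseteq> FW v"
  using weight_ge_mono by (fastforce simp: FW_iff)

lemma FW_0: "FW 0 = forms A"
  by (auto simp: FW_iff weight_ge_def)

lemma FW_fmul: "f \<in> SF \<Longrightarrow> \<alpha> \<in> FW w \<Longrightarrow> fmul f \<alpha> \<in> FW w"
  by (simp add: FW_iff fmul_forms subspace_scale[OF weight_ge_subspace])

text \<open>Near \<open>x\<close> an alternating form is determined by its values on at most
  \<open>r\<close> distinct frame fields, each of weight at most \<open>s\<close>, so weight beyond
  \<open>r * s\<close> forces it to vanish there. The bound holds on the whole domain of the frame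
  and for all forms at once, which makes Neumann series locally finite.\<close>

lemma FW_vanish:
  obtains W where "\<forall>\<^sub>F y in nhds x. \<forall>\<alpha>\<in>FW W. \<alpha> y = 0"
proof -
  obtain U r X where fr: "local_frame s U r X" and x: "x \<in> U" using H_frame .
  have "\<alpha> y = 0" if y: "y \<in> U" and \<alpha>: "\<alpha> \<in> FW (Suc (r * s))" for y \<alpha>
  proof (rule alt_forms_determined)
    show "\<alpha> y \<in> alt_forms (tangent A y) {0}"
      using formsD[OF FW_forms[OF \<alpha>]] by (simp add: cotensors_def)
    show "tangent A y = span ((\<lambda>j. X j y) ` {..<r})"
      using local_frame_span[OF fr y] H_top[of s y] by simp
    fix js assume js: "set js \<subseteq> {..<r}" "distinct js"
    let ?P = "map (\<lambda>j. (X j, s)) js"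
    have "length js \<le> r" using card_mono[OF _ js(1)] distinct_card[OF js(2)] by simp
    then have "wsum ?P < Suc (r * s)"
    proof -
      have "length js * s < Suc (r * s)"
        using mult_le_mono1[OF \<open>length js \<le> r\<close>, of s] by linarith
      then show ?thesis by (simp add: o_def sum_list_triv)
    qed
    moreover have "graded_fields ?P"
      using js(1) local_frame_vf[OF fr] by (auto simp: graded_fields_def sections_top)
    ultimately show "\<alpha> y (map (\<lambda>j. X j y) js) = 0"
      using weight_geD[OF FW_weight[OF \<alpha>], of ?P] by (simp add: o_def)
  qed simp
  then have *: "\<forall>y\<in>U. \<forall>\<alpha>\<in>FW (Suc (r * s)). \<alpha> y = 0" by blast
  have "\<forall>\<^sub>F y in nhds x. \<forall>\<alpha>\<in>FW (Suc (r * s)). \<alpha> y = 0"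
    by (rule eventually_mono[OF eventually_nhds_in_open[OF local_frame_open[OF fr] x]]) (rule bspec[OF *])
  then show ?thesis by (rule that)
qed

section \<open>The exterior derivative preserves the filtration\<close>

definition cochain_weight :: "nat \<Rightarrow> 'm cochain \<Rightarrow> bool" where
  "cochain_weight w c \<longleftrightarrow> (\<forall>P. graded_fields P \<longrightarrow> wsum P < w \<longrightarrow> c (map fst P) = (\<lambda>_. 0))"

lemma cochain_weight_inner:
  assumes "cochain_weight w c" "X \<in> sections A (H i)"
  shows "cochain_weight (w - i) (\<lambda>Ys. c (X # Ys))"
  unfolding cochain_weight_def
proof (intro allI impI)
  fix P assume "graded_fields P" "wsum P < w - i"
  then show "c (X # map fst P) = (\<lambda>_. 0)"
    using assms(1)[unfolded cochain_weight_def, rule_format, of "(X, i) # P"] assms(2) by simp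
qed

text \<open>Replacing a field of weight j by its bracket with X, of weight i + j, raises the total
  by exactly i, whichever slot is hit.\<close>

lemma slot_sum_weight:
  assumes X: "X \<in> sections A (H i)" and "cochain_weight w c" "graded_fields P" "i + wsum P < w"
  shows "slot_sum (bracket X) (map fst P) c x = 0"
  using assms(2-)
proof (induction P arbitrary: c w)
  case (Cons p P)
  obtain Y j where p: "p = (Y, j)" by (cases p)
  have Y: "Y \<in> sections A (H j)" and P: "graded_fields P" using Cons.prems p by auto
  have "c (map fst ((bracket X Y, i + j) # P)) = (\<lambda>_. 0)"
    using Cons.prems(1)[unfolded cochain_weight_def, rule_format, of "(bracket X Y, i + j) # P"]
      H_bracket[OF X Y] P Cons.prems(3) p by simp
  moreover have "slot_sum (bracket X) (map fst P) (\<lambda>Zs. c (Y # Zs)) x = 0"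
    using Cons.prems(3) p by (intro Cons.IH[OF cochain_weight_inner[OF Cons.prems(1) Y] P]) simp
  ultimately show ?case by (simp add: p)
qed simp

lemma ext_d_weight:
  assumes "cochain_weight w c" "graded_fields P" "wsum P < w"
  shows "ext_d (map fst P) c x = 0"
  using assms
proof (induction P arbitrary: c w)
  case (Cons p P)
  obtain X i where p: "p = (X, i)" by (cases p)
  have X: "X \<in> sections A (H i)" and P: "graded_fields P" using Cons.prems p by auto
  have "c (map fst P) = (\<lambda>_. 0)"
    using Cons.prems(1)[unfolded cochain_weight_def, rule_format, of P] P Cons.prems(3) p by simp
  moreover have "slot_sum (bracket X) (map fst P) c x = 0"
    using Cons.prems(3) p by (intro slot_sum_weight[OF X Cons.prems(1) P]) simp
  moreover have "ext_d (map fst P) (\<lambda>Zs. c (X # Zs)) x = 0"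
    using Cons.prems(3) p by (intro Cons.IH[OF cochain_weight_inner[OF Cons.prems(1) X] P]) simp
  ultimately show ?case
    by (simp add: p lie_def tangent_const[OF vfD[OF sections_vf[OF X]]])
qed simp

lemma cochain_weight_eval: "\<alpha> \<in> FW w \<Longrightarrow> cochain_weight w (eval_form \<alpha>)"
  unfolding cochain_weight_def
  by (intro allI impI ext) (simp only: eval_form_vals weight_geD[OF FW_weight])

lemma dR_weight:
  assumes "\<alpha> \<in> FW w"
  shows "dR \<alpha> \<in> FW w"
  unfolding FW_iff
proof (intro conjI allI weight_geI)
  show "dR \<alpha> \<in> forms A" by (rule dR_forms[OF FW_forms[OF assms]])
  fix x P assume P: "graded_fields P" "wsum P < w"
  show "dR \<alpha> x (vals (map fst P) x) = 0"
    using ext_d_weight[OF cochain_weight_eval[OF assms] P]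
    by (simp only: dR_vals[OF FW_forms[OF assms] graded_fields_VF[OF P(1)]])
qed

lemma weight_ge_Cons:
  assumes a: "a \<in> weight_ge w x" and z: "z \<in> H m x" and P: "graded_fields P" "m + wsum P < w"
  shows "a (z # vals (map fst P) x) = 0"
proof -
  obtain Z where "Z \<in> sections A (H m)" "Z x = z" using section_through[OF z] .
  then show ?thesis using weight_geD[OF a, of "(Z, m) # P"] P by simp
qed

section \<open>The osculating bracket and the symbol of the exterior derivative\<close>

lemma sections_0: "X \<in> sections A (H 0) \<Longrightarrow> X = (\<lambda>_. 0)"
  using sections_H[of X 0] H_0 by (auto simp: fun_eq_iff)

lemma bracket_vsum_left:
  assumes Y: "Y \<in> VF" and "\<And>j. j < r \<Longrightarrow> F j \<in> VF"
  shows "bracket (vsum r F) Y x = (\<Sum>j<r. bracket (F j) Y x)"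
  using assms(2)
proof (induction r)
  case 0
  show ?case by (simp only: vsum_0 bracket_zero[OF Y] lessThan_0 sum.empty)
next
  case (Suc r)
  have "bracket (vsum (Suc r) F) Y x = vadd (bracket (vsum r F) Y) (bracket (F r) Y) x"
    unfolding vsum_Suc using Suc.prems by (subst bracket_vadd_left[OF Y vsum_VF]) simp_all
  also have "\<dots> = bracket (vsum r F) Y x + bracket (F r) Y x"
    unfolding vadd_def by (rule refl)
  also have "bracket (vsum r F) Y x = (\<Sum>j<r. bracket (F j) Y x)"
    using Suc.prems by (intro Suc.IH) simp
  finally show ?case by (simp only: sum.lessThan_Suc)
qed

text \<open>Near \<open>x\<close> the field is a combination of sections X_k of \<open>H i\<close>
  with coefficients f_k vanishing at \<open>x\<close>, so the bracket at \<open>x\<close> is minus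
  the sum of the (Y f_k) X_k. This lies in \<open>H i\<close>, which is inside
  \<open>H (i + j - 1)\<close> as soon as j is positive. It is the reason why the osculating bracket
  does not depend on the fields chosen.\<close>

lemma bracket_vanish_at:
  assumes Z: "Z \<in> sections A (H i)" and Zx: "Z x = 0" and Y: "Y \<in> sections A (H j)" and ij: "i + j \<ge> 1"
  shows "bracket Z Y x \<in> H (i + j - 1) x"
proof (cases "j = 0")
  case True
  have "Y = (\<lambda>_. 0)" using sections_0 Y True by simp
  then have "bracket Z Y = (\<lambda>x. - bracket (\<lambda>_. 0) Z x)" by (simp only: bracket_anti[of Z])
  then have "bracket Z Y x = 0" by (simp add: bracket_zero[OF sections_vf[OF Z]])
  then show ?thesis using subspace_0[OF H_subspace] by simp
next
  case False
  obtain r f X b where *: "\<forall>k<r::nat. f k \<in> SF \<and> f k x = 0 \<and> X k \<in> sections A (H i)" "b \<in> SF"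
    "\<forall>\<^sub>F y in nhds x. b y = 1" "vmul b Z = vsum r (\<lambda>k. vmul (f k) (X k))"
    using vanishing_expansion[where Z = Z and i = i and x = x, OF Z Zx] by blast
  note YV = sections_vf[OF Y] and ZV = sections_vf[OF Z]
  have XV: "X k \<in> VF" if "k < r" for k using * that sections_vf by blast
  have "bracket (vmul b Z) Y x = b x *\<^sub>R bracket Z Y x - Y x b *\<^sub>R Z x"
    unfolding bracket_vmul_left[OF YV ZV *(2)] unfolding vmul_def by (rule refl)
  also have "\<dots> = bracket Z Y x"
    using eventually_nhds_x_imp_x[OF *(3)] Zx by simp
  finally have "bracket Z Y x = (\<Sum>k<r. bracket (vmul (f k) (X k)) Y x)"
    unfolding *(4) using *(1) XV by (subst (asm) bracket_vsum_left[OF YV]) (auto intro: vmul_VF)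
  also have "\<dots> = (\<Sum>k<r. - (Y x (f k)) *\<^sub>R X k x)"
  proof (intro sum.cong refl)
    fix k assume k: "k \<in> {..<r}"
    have "bracket (vmul (f k) (X k)) Y x = f k x *\<^sub>R bracket (X k) Y x - Y x (f k) *\<^sub>R X k x"
      using * k bracket_vmul_left[OF YV XV, of k "f k"] by (simp only: vmul_def lessThan_iff)
    then show "bracket (vmul (f k) (X k)) Y x = - (Y x (f k)) *\<^sub>R X k x"
      using * k by simp
  qed
  also have "\<dots> \<in> H i x"
    using *(1) sections_H by (intro subspace_sum[OF H_subspace] subspace_scale[OF H_subspace]) auto
  also have "H i x \<subseteq> H (i + j - 1) x" using False by (intro H_mono) simp
  finally show ?thesis .
qed

lemma bracket_independent:
  assumes X: "X \<in> sections A (H i)" "X' \<in> sections A (H i)" "X x = X' x"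
    and Y: "Y \<in> sections A (H j)" "Y' \<in> sections A (H j)" "Y x = Y' x" and ij: "i + j \<ge> 1"
  shows "bracket X Y x - bracket X' Y' x \<in> H (i + j - 1) x"
proof -
  note VF = X(1,2)[THEN sections_vf] Y(1,2)[THEN sections_vf]
  have diff: "(\<lambda>x. Z x - Z' x) \<in> sections A (H k)" if "Z \<in> sections A (H k)" "Z' \<in> sections A (H k)" for Z Z' k
    using that vf_diff subspace_diff[OF H_subspace] by (simp add: sections_def)
  have bd: "bracket (\<lambda>x. Z x - Z' x) V x = bracket Z V x - bracket Z' V x"
    if "Z \<in> VF" "Z' \<in> VF" "V \<in> VF" for Z Z' V
  proof -
    have "(\<lambda>x. Z x - Z' x) = vadd Z (vmul (\<lambda>_. - 1) Z')" by (simp add: vadd_def vmul_def)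
    then have "bracket (\<lambda>x. Z x - Z' x) V x = vadd (bracket Z V) (bracket (vmul (\<lambda>_. - 1) Z') V) x"
      by (simp only: bracket_vadd_left[OF that(3,1) vmul_VF[OF smooth_const that(2)]])
    also have "\<dots> = bracket Z V x + bracket (vmul (\<lambda>_. - 1) Z') V x"
      unfolding vadd_def by (rule refl)
    also have "bracket (vmul (\<lambda>_. - 1) Z') V x = (- 1) *\<^sub>R bracket Z' V x - V x (\<lambda>_. - 1) *\<^sub>R Z' x"
      unfolding bracket_vmul_left[OF that(3,2) smooth_const[of "- 1"]] unfolding vmul_def by (rule refl)
    finally show ?thesis
      by (simp only: tangent_const[OF vfD[OF that(3)]] scaleR_zero_left diff_0_right scaleR_minus1_left add_uminus_conv_diff)
  qed
  have "bracket (\<lambda>x. X x - X' x) Y x \<in> H (i + j - 1) x"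
    by (rule bracket_vanish_at[OF diff[OF X(1,2)] _ Y(1) ij]) (simp only: X(3) diff_self)
  then have 1: "bracket X Y x - bracket X' Y x \<in> H (i + j - 1) x"
    by (simp only: bd[OF VF(1,2,3)])
  have "j + i \<ge> 1" using ij by simp
  then have "bracket (\<lambda>x. Y x - Y' x) X' x \<in> H (j + i - 1) x"
    by (rule bracket_vanish_at[OF diff[OF Y(1,2)] _ X(2), rotated]) (simp only: Y(3) diff_self)
  then have "- (bracket Y X' x - bracket Y' X' x) \<in> H (i + j - 1) x"
    by (simp only: bd[OF VF(3,4,2)] subspace_neg[OF H_subspace] add.commute[of j i])
  moreover have "- (bracket Y X' x - bracket Y' X' x) = bracket X' Y x - bracket X' Y' x"
    by (simp add: bracket_anti[of X' Y] bracket_anti[of X' Y'])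
  ultimately have "bracket X' Y x - bracket X' Y' x \<in> H (i + j - 1) x" by (simp only:)
  from subspace_add[OF H_subspace 1 this] show ?thesis by simp
qed

lemma osc_bracket_hom_sections:
  assumes "v \<in> H i x" "w \<in> H j x"
  obtains X Y where "X \<in> sections A (H i)" "Y \<in> sections A (H j)" "X x = v" "Y x = w"
    "osc_bracket_hom A H x i j v w = bracket X Y x"
proof -
  obtain X where X: "X \<in> sections A (H i)" "X x = v" using section_through[OF assms(1)] .
  obtain Y where Y: "Y \<in> sections A (H j)" "Y x = w" using section_through[OF assms(2)] .
  have "\<exists>z. \<exists>X\<in>sections A (H i). \<exists>Y\<in>sections A (H j). X x = v \<and> Y x = w \<and> z = bracket X Y x"
    using X Y by blast
  from someI_ex[OF this] that show ?thesis
    unfolding osc_bracket_hom_def by blast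
qed

definition homog :: "'m \<Rightarrow> 'm vfield \<times> nat \<Rightarrow> 'm gvec" where
  "homog x p = (\<lambda>k. if k = snd p then fst p x else 0)"

lemma homog_total: "graded_fields P \<Longrightarrow> set (map (homog x) P) \<subseteq> gr_total H x"
  using sections_H subspace_0[OF H_subspace] by (fastforce simp: graded_fields_def gr_total_def homog_def)

lemma finite_weight_lists: "finite {js. length js = n \<and> sum_list js = (w::nat)}"
proof (rule finite_subset)
  show "{js. length js = n \<and> sum_list js = w} \<subseteq> {js. set js \<subseteq> {..w} \<and> length js = n}"
    using member_le_sum_list by fastforce
qed (rule finite_lists_length_eq, simp)

lemma map2_homog: "map2 (\<lambda>u i. u i) (map (homog x) P) (map snd P) = vals (map fst P) x"
  by (induction P) (simp_all add: homog_def)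

lemma map2_homog_zero:
  "length js = length P \<Longrightarrow> js \<noteq> map snd P \<Longrightarrow> 0 \<in> set (map2 (\<lambda>u i. u i) (map (homog x) P) js)"
proof (induction P arbitrary: js)
  case (Cons p P)
  then obtain j ks where "js = j # ks" by (cases js) auto
  then show ?case using Cons by (cases "j = snd p") (auto simp: homog_def)
qed simp

text \<open>On a homogeneous list only one term of the symbol survives. The head is left arbitrary
  in degrees other than its own, where the weight of \<open>\<alpha>\<close> makes it irrelevant.\<close>

lemma symbol_homog_Cons:
  assumes \<alpha>: "\<alpha> \<in> forms A" and P: "graded_fields P" and u: "u \<in> gr_total H x" and w: "m + wsum P = w"
  shows "symbol H w \<alpha> x (u # map (homog x) P) = \<alpha> x (u m # vals (map fst P) x)"
proof -
  let ?S = "{js. length js = length (u # map (homog x) P) \<and> sum_list js = w}"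
  let ?f = "\<lambda>js. \<alpha> x (map2 (\<lambda>u i. u i) (u # map (homog x) P) js)"
  have fin: "finite ?S" by (rule finite_weight_lists)
  have zero: "?f js = 0" if js: "js \<in> ?S - {m # map snd P}" for js
  proof -
    obtain k ks where k: "js = k # ks" "length ks = length P" using js by (cases js) auto
    have "ks \<noteq> map snd P" using js k w by auto
    then have "0 \<in> set (map2 (\<lambda>u i. u i) (u # map (homog x) P) js)"
      using map2_homog_zero[OF k(2)] k(1) by simp
    then show ?thesis
      using alt_null[OF formsD[OF \<alpha>, of x, unfolded cotensors_def]] by blast
  qed
  have "set (u # map (homog x) P) \<subseteq> gr_total H x" using u homog_total[OF P] by simp
  then have "symbol H w \<alpha> x (u # map (homog x) P) = (\<Sum>js\<in>?S. ?f js)"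
    by (simp add: symbol_def)
  also have "\<dots> = (\<Sum>js\<in>{m # map snd P}. ?f js)"
    by (rule sum.mono_neutral_right[OF fin]) (use zero w in auto)
  also have "\<dots> = \<alpha> x (u m # vals (map fst P) x)"
    using map2_homog[of x P] by simp
  finally show ?thesis .
qed

lemma symbol_homog:
  assumes \<alpha>: "\<alpha> \<in> forms A" and P: "graded_fields P" and w: "wsum P = w"
  shows "symbol H w \<alpha> x (map (homog x) P) = \<alpha> x (vals (map fst P) x)"
proof (cases P)
  case Nil
  have "{js :: nat list. js = [] \<and> sum_list js = w} = {[]}" using w Nil by auto
  then show ?thesis using Nil by (simp add: symbol_def)
next
  case (Cons p Q)
  have u: "homog x p \<in> gr_total H x" and Q: "graded_fields Q"
    using homog_total[OF P, of x] P Cons by (auto simp: graded_fields_def)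
  have "symbol H w \<alpha> x (homog x p # map (homog x) Q) = \<alpha> x (homog x p (snd p) # vals (map fst Q) x)"
    by (rule symbol_homog_Cons[OF \<alpha> Q u]) (use w Cons in simp)
  then show ?thesis using Cons by (simp add: homog_def)
qed

lemma osc_bracket_homog:
  assumes X: "X \<in> sections A (H i)" and Y: "Y \<in> sections A (H j)"
  shows "osc_bracket A H x (homog x (X, i)) (homog x (Y, j)) \<in> gr_total H x"
    and "osc_bracket A H x (homog x (X, i)) (homog x (Y, j)) (i + j) - bracket X Y x \<in> H (i + j - 1) x"
proof -
  let ?u = "homog x (X, i)" and ?v = "homog x (Y, j)"
  have uv: "?u k \<in> H k x" "?v k \<in> H k x" for k
    using sections_H[OF X] sections_H[OF Y] subspace_0[OF H_subspace] by (auto simp: homog_def)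
  have tm: "osc_bracket_hom A H x l m (?u l) (?v m) \<in> H (l + m) x" for l m
  proof -
    obtain X' Y' where "X' \<in> sections A (H l)" "Y' \<in> sections A (H m)" "X' x = ?u l" "Y' x = ?v m"
      "osc_bracket_hom A H x l m (?u l) (?v m) = bracket X' Y' x"
      using osc_bracket_hom_sections[OF uv] .
    then show ?thesis using sections_H[OF H_bracket] by metis
  qed
  show "osc_bracket A H x ?u ?v \<in> gr_total H x"
    unfolding gr_total_def osc_bracket_def
  proof (intro CollectI allI subspace_sum[OF H_subspace])
    fix k l :: nat assume "l \<in> {..k}"
    then show "osc_bracket_hom A H x l (k - l) (?u l) (?v (k - l)) \<in> H k x"
      using tm[of l "k - l"] by simp
  qed
  show "osc_bracket A H x ?u ?v (i + j) - bracket X Y x \<in> H (i + j - 1) x"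
  proof (cases "i + j \<ge> 1")
    case False
    then have ij: "i = 0" "j = 0" by auto
    have "bracket X Y x \<in> H (i + j) x" using sections_H[OF H_bracket[OF X Y]] .
    moreover have "osc_bracket A H x ?u ?v (i + j) \<in> H 0 x"
      using tm[of 0 0] by (simp add: osc_bracket_def ij)
    ultimately show ?thesis using subspace_diff[OF H_subspace] by (simp add: ij)
  next
    case True
    let ?t = "\<lambda>l. osc_bracket_hom A H x l (i + j - l) (?u l) (?v (i + j - l))"
    have main: "?t i - bracket X Y x \<in> H (i + j - 1) x"
    proof -
      obtain X' Y' where *: "X' \<in> sections A (H i)" "Y' \<in> sections A (H j)" "X' x = ?u i" "Y' x = ?v j"
        "osc_bracket_hom A H x i j (?u i) (?v j) = bracket X' Y' x"
        using osc_bracket_hom_sections[OF uv] .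
      then show ?thesis
        using bracket_independent[OF *(1) X _ *(2) Y _ True, of x] by (simp add: homog_def)
    qed
    \<comment> \<open>These components have a zero argument, but \<open>osc_bracket_hom\<close> may
      extend the zero vector by a nonzero field, so the terms need not vanish; they only lie one
      step lower in the filtration.\<close>
    have rest: "?t l \<in> H (i + j - 1) x" if l: "l \<in> {..i + j} - {i}" for l
    proof -
      obtain X' Y' where *: "X' \<in> sections A (H l)" "Y' \<in> sections A (H (i + j - l))" "X' x = ?u l" "Y' x = ?v (i + j - l)"
        "?t l = bracket X' Y' x"
        using osc_bracket_hom_sections[OF uv] .
      have "X' x = 0" using *(3) l by (simp add: homog_def)
      then show ?thesis
        using bracket_vanish_at[OF *(1) _ *(2)] l True *(5) by simp
    qed
    have "osc_bracket A H x ?u ?v (i + j) = ?t i + (\<Sum>l\<in>{..i + j} - {i}. ?t l)"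
      unfolding osc_bracket_def by (rule sum.remove) auto
    then have "osc_bracket A H x ?u ?v (i + j) - bracket X Y x = (?t i - bracket X Y x) + (\<Sum>l\<in>{..i + j} - {i}. ?t l)"
      by (simp only: add_diff_eq diff_add_eq)
    also have "\<dots> \<in> H (i + j - 1) x"
      by (intro subspace_add[OF H_subspace main] subspace_sum[OF H_subspace] rest)
    finally show ?thesis .
  qed
qed

lemma wsum_remove_two:
  "a < b \<Longrightarrow> b < length P \<Longrightarrow> snd (P ! a) + snd (P ! b) + wsum (nths P (- {a, b})) = wsum P"
proof (induction P arbitrary: a b)
  case (Cons p P)
  have one: "snd (Q ! c) + wsum (nths Q (- {c})) = wsum Q" if "c < length Q" for c and Q :: "('m vfield \<times> nat) list"
    using that
  proof (induction Q arbitrary: c)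
    case (Cons q Q)
    then show ?case by (cases c) (auto simp: nths_Cons_remove)
  qed simp
  obtain b' where b: "b = Suc b'" using Cons.prems by (cases b) auto
  show ?case
  proof (cases a)
    case 0
    then show ?thesis using one[of b' P] Cons.prems b by (simp add: nths_Cons_remove)
  next
    case (Suc a')
    then show ?thesis using Cons.IH[of a' b'] Cons.prems b by (simp add: nths_Cons_remove)
  qed
qed simp

text \<open>On graded fields of total weight w the derivative terms of the invariant formula drop
  out: omitting a field of positive weight leaves total weight below w, and a field of weight 0 is
  zero. The bracket terms remain, and replacing brackets by osculating ones changes the argument by
  a vector of lower weight, which \<alpha> does not see.\<close>

lemma symbol_dR:
  assumes \<alpha>: "\<alpha> \<in> FW w" and P: "graded_fields P" and w: "wsum P = w"
  shows "dR \<alpha> x (vals (map fst P) x) = osc_differential A H x (symbol H w \<alpha> x) (map (homog x) P)"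
proof -
  let ?Xs = "map fst P" and ?n = "length P"
  note f = FW_forms[OF \<alpha>]
  have sec: "fst (P ! a) \<in> sections A (H (snd (P ! a)))" if "a < ?n" for a
    using P nth_mem[OF that] by (auto simp: graded_fields_def split: prod.splits)
  have gf: "graded_fields (nths P I)" for I
    using P set_nths_subset[of P I] by (auto simp: graded_fields_def)
  have first: "(?Xs ! a) x (eval_form \<alpha> (nths ?Xs (- {a}))) = 0" if a: "a < ?n" for a
  proof (cases "snd (P ! a) = 0")
    case True
    then have "fst (P ! a) = (\<lambda>_. 0)" using sec[OF a] sections_0 by simp
    then show ?thesis using a by simp
  next
    case False
    have "snd (P ! a) + wsum (nths P (- {a})) = wsum P"
      using a
    proof (induction P arbitrary: a)
      case (Cons q Q)
      then show ?case by (cases a) (auto simp: nths_Cons_remove)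
    qed simp
    then have "wsum (nths P (- {a})) < w" using False w by simp
    then have "eval_form \<alpha> (map fst (nths P (- {a}))) = (\<lambda>_. 0)"
      using cochain_weight_eval[OF \<alpha>] gf unfolding cochain_weight_def by blast
    then have "eval_form \<alpha> (nths ?Xs (- {a})) = (\<lambda>_. 0)" by (simp add: nths_map)
    then show ?thesis
      using tangent_const[OF vfD[OF sections_vf[OF sec[OF a]]]] a by simp
  qed
  have second: "eval_form \<alpha> (bracket (?Xs ! a) (?Xs ! b) # nths ?Xs (- {a, b})) x =
      symbol H w \<alpha> x (osc_bracket A H x (map (homog x) P ! a) (map (homog x) P ! b) # nths (map (homog x) P) (- {a, b}))"
    if ab: "a < b" "b < ?n" for a b
  proof -
    have an: "a < ?n" using ab by simp
    obtain X i where Pa: "P ! a = (X, i)" by (cases "P ! a")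
    obtain Y j where Pb: "P ! b = (Y, j)" by (cases "P ! b")
    let ?Q = "nths P (- {a, b})"
    let ?o = "osc_bracket A H x (homog x (X, i)) (homog x (Y, j))"
    have X: "X \<in> sections A (H i)" and Y: "Y \<in> sections A (H j)" using sec[OF an] sec[OF ab(2)] Pa Pb by auto
    have sum: "(i + j) + wsum ?Q = w" using wsum_remove_two[OF ab] w Pa Pb by simp
    have "symbol H w \<alpha> x (?o # map (homog x) ?Q) = \<alpha> x (?o (i + j) # vals (map fst ?Q) x)"
      by (rule symbol_homog_Cons[OF f gf osc_bracket_homog(1)[OF X Y] sum])
    also have "\<dots> = \<alpha> x (bracket X Y x # vals (map fst ?Q) x)"
    proof -
      note alt = formsD[OF f, of x, unfolded cotensors_def]
      have t: "set (vals (map fst ?Q) x) \<subseteq> tangent A x" by (rule vals_tangent[OF graded_fields_VF[OF gf]])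
      have "?o (i + j) \<in> H (i + j) x" using osc_bracket_homog(1)[OF X Y, of x] by (simp add: gr_total_def)
      then have o: "?o (i + j) \<in> tangent A x" by (rule subsetD[OF H_tangent])
      have b: "bracket X Y x \<in> tangent A x" using vfD[OF sections_vf[OF H_bracket[OF X Y]]] .
      let ?z = "1 *\<^sub>R ?o (i + j) + (- 1) *\<^sub>R bracket X Y x"
      have "\<alpha> x ([] @ ?z # vals (map fst ?Q) x) = 1 *\<^sub>R \<alpha> x ([] @ ?o (i + j) # vals (map fst ?Q) x)
          + (- 1) *\<^sub>R \<alpha> x ([] @ bracket X Y x # vals (map fst ?Q) x)"
        by (rule alt_lin[OF alt _ o b t]) simp
      moreover have "\<alpha> x (?z # vals (map fst ?Q) x) = 0"
      proof (cases "i + j \<ge> 1")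
        case True
        have "?z \<in> H (i + j - 1) x" using osc_bracket_homog(2)[OF X Y, of x] by simp
        moreover have "i + j - 1 + wsum ?Q < w" using sum True by linarith
        ultimately show ?thesis by (rule weight_ge_Cons[OF FW_weight[OF \<alpha>] _ gf])
      next
        case False
        have "?z \<in> {0}" using osc_bracket_homog(2)[OF X Y, of x] False H_0 by simp
        then show ?thesis using alt_null[OF alt, of "?z # vals (map fst ?Q) x"] by auto
      qed
      ultimately show ?thesis by simp
    qed
    finally show ?thesis
      using an ab(2) Pa Pb by (simp add: eval_form_vals nths_map)
  qed
  have "dR \<alpha> x (vals ?Xs x) = inv_formula (eval_form \<alpha>) ?Xs x"
    by (simp only: dR_vals[OF f graded_fields_VF[OF P]] inv_formula_ext_d[OF tensorial_eval[OF f] graded_fields_VF[OF P]])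
  also have "\<dots> = (\<Sum>b<?n. \<Sum>a<b. (-1) ^ (a + b) *
        eval_form \<alpha> (bracket (?Xs ! a) (?Xs ! b) # nths ?Xs (- {a, b})) x)"
    unfolding inv_formula_def length_map using first by simp
  also have "\<dots> = (\<Sum>b<?n. \<Sum>a<b. (-1) ^ (a + b) *
        symbol H w \<alpha> x (osc_bracket A H x (map (homog x) P ! a) (map (homog x) P ! b) # nths (map (homog x) P) (- {a, b})))"
    by (intro sum.cong refl arg_cong2[of _ _ _ _ "(*)"] second) simp_all
  also have "\<dots> = osc_differential A H x (symbol H w \<alpha> x) (map (homog x) P)"
    unfolding osc_differential_def length_map using homog_total[OF P, of x] by (simp only: if_True)
  finally show ?thesis .
qed

section \<open>Filtered operators\<close>

text \<open>Local linear operators that raise the weight by \<open>w\<close> and the degree by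
  \<open>j\<close>. These properties are bundled because they survive composition, linear
  combination and inversion by \<open>neumann\<close>.\<close>

definition oper :: "nat \<Rightarrow> int \<Rightarrow> (('m, real) form \<Rightarrow> ('m, real) form) \<Rightarrow> bool" where
  "oper w j T \<longleftrightarrow> (\<forall>\<alpha>\<in>forms A. T \<alpha> \<in> forms A) \<and>
     (\<forall>\<alpha>\<in>forms A. \<forall>\<beta>\<in>forms A. \<forall>a b. T (a *\<^sub>R \<alpha> + b *\<^sub>R \<beta>) = a *\<^sub>R T \<alpha> + b *\<^sub>R T \<beta>) \<and>
     (\<forall>\<alpha>\<in>forms A. \<forall>x. (\<forall>\<^sub>F y in nhds x. \<alpha> y = 0) \<longrightarrow> T \<alpha> x = 0) \<and>
     (\<forall>v. \<forall>\<alpha>\<in>FW v. T \<alpha> \<in> FW (v + w)) \<and>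
     (\<forall>\<alpha>\<in>forms A. \<forall>k. T (deg_proj k \<alpha>) = deg_proj (k + j) (T \<alpha>))"

lemma operI:
  assumes "\<And>\<alpha>. \<alpha> \<in> forms A \<Longrightarrow> T \<alpha> \<in> forms A"
    and "\<And>\<alpha> \<beta> a b. \<alpha> \<in> forms A \<Longrightarrow> \<beta> \<in> forms A \<Longrightarrow> T (a *\<^sub>R \<alpha> + b *\<^sub>R \<beta>) = a *\<^sub>R T \<alpha> + b *\<^sub>R T \<beta>"
    and "\<And>\<alpha> x. \<alpha> \<in> forms A \<Longrightarrow> \<forall>\<^sub>F y in nhds x. \<alpha> y = 0 \<Longrightarrow> T \<alpha> x = 0"
    and "\<And>v \<alpha>. \<alpha> \<in> FW v \<Longrightarrow> T \<alpha> \<in> FW (v + w)"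
    and "\<And>\<alpha> k. \<alpha> \<in> forms A \<Longrightarrow> T (deg_proj k \<alpha>) = deg_proj (k + j) (T \<alpha>)"
  shows "oper w j T"
  using assms unfolding oper_def by blast

context
  fixes w j T assumes T: "oper w j T"
begin

lemma oper_forms: "\<alpha> \<in> forms A \<Longrightarrow> T \<alpha> \<in> forms A"
  and oper_lin: "\<alpha> \<in> forms A \<Longrightarrow> \<beta> \<in> forms A \<Longrightarrow> T (a *\<^sub>R \<alpha> + b *\<^sub>R \<beta>) = a *\<^sub>R T \<alpha> + b *\<^sub>R T \<beta>"
  and oper_local_zero: "\<alpha> \<in> forms A \<Longrightarrow> \<forall>\<^sub>F y in nhds x. \<alpha> y = 0 \<Longrightarrow> T \<alpha> x = 0"
  and oper_weight: "\<alpha> \<in> FW v \<Longrightarrow> T \<alpha> \<in> FW (v + w)"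
  and oper_deg: "\<alpha> \<in> forms A \<Longrightarrow> T (deg_proj k \<alpha>) = deg_proj (k + j) (T \<alpha>)"
  using T unfolding oper_def by blast+

lemma oper_add: "\<alpha> \<in> forms A \<Longrightarrow> \<beta> \<in> forms A \<Longrightarrow> T (\<alpha> + \<beta>) = T \<alpha> + T \<beta>"
  using oper_lin[of \<alpha> \<beta> 1 1] by (simp only: scaleR_one)

lemma oper_scale: "\<alpha> \<in> forms A \<Longrightarrow> T (a *\<^sub>R \<alpha>) = a *\<^sub>R T \<alpha>"
  using oper_lin[of \<alpha> \<alpha> a 0] by (simp only: scaleR_zero_left add_0_right)

lemma oper_zero: "T 0 = 0"
  using oper_scale[OF forms_zero, of 0] by (simp only: scaleR_zero_left)

lemma oper_diff: "\<alpha> \<in> forms A \<Longrightarrow> \<beta> \<in> forms A \<Longrightarrow> T (\<alpha> - \<beta>) = T \<alpha> - T \<beta>"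
  using oper_lin[of \<alpha> \<beta> 1 "- 1"] by (simp only: scaleR_one scaleR_minus1_left add_uminus_conv_diff)

lemma oper_local:
  assumes "\<alpha> \<in> forms A" "\<beta> \<in> forms A" "\<forall>\<^sub>F y in nhds x. \<alpha> y = \<beta> y"
  shows "\<forall>\<^sub>F y in nhds x. T \<alpha> y = T \<beta> y"
proof -
  have "\<forall>\<^sub>F y in nhds x. \<forall>\<^sub>F z in nhds y. \<alpha> z = \<beta> z"
    using assms(3) by (simp add: eventually_eventually)
  then show ?thesis
  proof (rule eventually_mono)
    fix y assume "\<forall>\<^sub>F z in nhds y. \<alpha> z = \<beta> z"
    then have "\<forall>\<^sub>F z in nhds y. (\<alpha> - \<beta>) z = 0" by (rule eventually_mono) simp
    then have "T (\<alpha> - \<beta>) y = 0" by (rule oper_local_zero[OF forms_diff[OF assms(1,2)]])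
    then show "T \<alpha> y = T \<beta> y" by (simp add: oper_diff[OF assms(1,2)])
  qed
qed

lemma oper_local_at:
  assumes "\<alpha> \<in> forms A" "\<beta> \<in> forms A" "\<forall>\<^sub>F y in nhds x. \<alpha> y = \<beta> y"
  shows "T \<alpha> x = T \<beta> x"
  using eventually_nhds_x_imp_x[OF oper_local[OF assms]] .

end

lemma oper_id: "oper 0 0 (\<lambda>\<alpha>. \<alpha>)"
  by (rule operI) (auto dest: eventually_nhds_x_imp_x)

lemma oper_comp:
  assumes S: "oper v i S" and T: "oper w j T"
  shows "oper (v + w) (i + j) (\<lambda>\<alpha>. S (T \<alpha>))"
proof (rule operI)
  fix \<alpha> x assume \<alpha>: "\<alpha> \<in> forms A" and "\<forall>\<^sub>F y in nhds x. \<alpha> y = 0"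
  then have "\<forall>\<^sub>F y in nhds x. \<alpha> y = (0 :: ('m, real) form) y" by (simp only: zero_fun_apply)
  then have "\<forall>\<^sub>F y in nhds x. T \<alpha> y = T 0 y" by (rule oper_local[OF T \<alpha> forms_zero])
  then have "\<forall>\<^sub>F y in nhds x. T \<alpha> y = 0" by (simp only: oper_zero[OF T] zero_fun_apply)
  then show "S (T \<alpha>) x = 0" by (rule oper_local_zero[OF S oper_forms[OF T \<alpha>]])
next
  fix u \<alpha> assume "\<alpha> \<in> FW u"
  then show "S (T \<alpha>) \<in> FW (u + (v + w))"
    using oper_weight[OF S oper_weight[OF T]] by (simp add: ac_simps)
next
  fix \<alpha> k assume "\<alpha> \<in> forms A"
  then show "S (T (deg_proj k \<alpha>)) = deg_proj (k + (i + j)) (S (T \<alpha>))"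
    using oper_deg[OF S oper_forms[OF T]] oper_deg[OF T] by (simp add: ac_simps)
qed (simp_all only: oper_forms[OF S] oper_forms[OF T] oper_lin[OF S] oper_lin[OF T])

lemma deg_proj_lin: "deg_proj k (a *\<^sub>R \<alpha> + b *\<^sub>R \<beta>) = a *\<^sub>R deg_proj k \<alpha> + b *\<^sub>R deg_proj k \<beta>"
  by (simp add: deg_proj_def fun_eq_iff)

lemma oper_lincomb:
  assumes S: "oper w j S" and T: "oper w j T"
  shows "oper w j (\<lambda>\<alpha>. p *\<^sub>R S \<alpha> + q *\<^sub>R T \<alpha>)"
proof (rule operI)
  fix \<alpha> assume "\<alpha> \<in> forms A"
  then show "p *\<^sub>R S \<alpha> + q *\<^sub>R T \<alpha> \<in> forms A"
    by (intro forms_add forms_scale oper_forms[OF S] oper_forms[OF T])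
next
  fix \<alpha> \<beta> a b assume *: "\<alpha> \<in> forms A" "\<beta> \<in> forms A"
  show "p *\<^sub>R S (a *\<^sub>R \<alpha> + b *\<^sub>R \<beta>) + q *\<^sub>R T (a *\<^sub>R \<alpha> + b *\<^sub>R \<beta>) = a *\<^sub>R (p *\<^sub>R S \<alpha> + q *\<^sub>R T \<alpha>) + b *\<^sub>R (p *\<^sub>R S \<beta> + q *\<^sub>R T \<beta>)"
    unfolding oper_lin[OF S *] oper_lin[OF T *] scaleR_add_right scaleR_scaleR
    by (simp only: ac_simps)
next
  fix \<alpha> x assume "\<alpha> \<in> forms A" "\<forall>\<^sub>F y in nhds x. \<alpha> y = 0"
  then have "S \<alpha> x = 0" "T \<alpha> x = 0" using oper_local_zero[OF S] oper_local_zero[OF T] by blast+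
  then show "(p *\<^sub>R S \<alpha> + q *\<^sub>R T \<alpha>) x = 0" by simp
next
  fix v \<alpha> assume "\<alpha> \<in> FW v"
  then show "p *\<^sub>R S \<alpha> + q *\<^sub>R T \<alpha> \<in> FW (v + w)"
    by (intro subspace_add[OF FW_subspace] subspace_scale[OF FW_subspace] oper_weight[OF S] oper_weight[OF T])
next
  fix \<alpha> k assume "\<alpha> \<in> forms A"
  then show "p *\<^sub>R S (deg_proj k \<alpha>) + q *\<^sub>R T (deg_proj k \<alpha>) = deg_proj (k + j) (p *\<^sub>R S \<alpha> + q *\<^sub>R T \<alpha>)"
    by (simp only: deg_proj_lin oper_deg[OF S] oper_deg[OF T])
qed

lemma oper_plus: "oper w j S \<Longrightarrow> oper w j T \<Longrightarrow> oper w j (\<lambda>\<alpha>. S \<alpha> + T \<alpha>)"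
  using oper_lincomb[of w j S T 1 1] by (simp only: scaleR_one)

lemma oper_minus: "oper w j S \<Longrightarrow> oper w j T \<Longrightarrow> oper w j (\<lambda>\<alpha>. S \<alpha> - T \<alpha>)"
  using oper_lincomb[of w j S T 1 "- 1"] by (simp only: scaleR_one scaleR_minus1_left add_uminus_conv_diff)

lemma oper_uminus: "oper w j S \<Longrightarrow> oper w j (\<lambda>\<alpha>. - S \<alpha>)"
  using oper_lincomb[of w j S S "- 1" 0] by (simp only: scaleR_zero_left scaleR_minus1_left add_0_right)

lemma oper_dR: "oper 0 1 dR"
  by (rule operI) (simp_all add: dR_forms dR_lincomb dR_local dR_weight dR_deg_proj)

lemma FW_Inter_zero:
  assumes "\<And>w. \<alpha> \<in> FW w"
  shows "\<alpha> = 0"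
proof
  fix x
  obtain W where "\<forall>\<^sub>F y in nhds x. \<forall>\<alpha>\<in>FW W. \<alpha> y = 0" using FW_vanish .
  then show "\<alpha> x = 0 x" using eventually_nhds_x_imp_x assms by fastforce
qed

text \<open>From \<alpha> = - T \<alpha> the weight of \<alpha> can be raised indefinitely, and only
  0 has every weight.\<close>

lemma oper_raising_injective:
  assumes T: "oper 1 j T" and \<alpha>: "\<alpha> \<in> forms A" and eq: "\<alpha> + T \<alpha> = 0"
  shows "\<alpha> = 0"
proof (rule FW_Inter_zero)
  fix w show "\<alpha> \<in> FW w"
  proof (induction w)
    case (Suc w)
    have "\<alpha> = (- 1) *\<^sub>R T \<alpha>" using eq by (simp only: scaleR_minus1_left eq_neg_iff_add_eq_0)
    moreover have "(- 1) *\<^sub>R T \<alpha> \<in> FW (w + 1)"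
      by (intro subspace_scale[OF FW_subspace] oper_weight[OF T] Suc)
    ultimately show ?case by simp
  qed (simp add: FW_0 \<alpha>)
qed

text \<open>The Neumann series is locally finite, since forms of high weight vanish locally.\<close>

theorem neumann:
  assumes T: "oper 1 0 T"
  obtains K where "oper 0 0 K" "\<And>\<alpha>. \<alpha> \<in> forms A \<Longrightarrow> K \<alpha> + T (K \<alpha>) = \<alpha>" "\<And>\<alpha>. \<alpha> \<in> forms A \<Longrightarrow> K (\<alpha> + T \<alpha>) = \<alpha>"
proof -
  define S where "S \<alpha> = - T \<alpha>" for \<alpha>
  have S: "oper 1 0 S" unfolding S_def[abs_def] by (rule oper_uminus[OF T])
  have Sp: "oper k 0 (S ^^ k)" for k
  proof (induction k)
    case 0
    show ?case using oper_id by (simp add: id_def)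
  next
    case (Suc k)
    then show ?case using oper_comp[OF S Suc] by (simp add: o_def)
  qed
  \<comment> \<open>The least weight bound that works at \<open>y\<close>. It varies with the point;
    \<open>Kx\<close> allows any larger bound, so near a given point one number of terms serves all
    points.\<close>
  define W where "W y = (LEAST W. \<forall>\<alpha>\<in>FW W. \<alpha> y = 0)" for y
  have W: "\<forall>\<alpha>\<in>FW (W y). \<alpha> y = 0" for y
  proof -
    obtain V where "\<forall>\<^sub>F z in nhds y. \<forall>\<alpha>\<in>FW V. \<alpha> z = 0" using FW_vanish .
    then have "\<forall>\<alpha>\<in>FW V. \<alpha> y = 0" by (rule eventually_nhds_x_imp_x)
    then show ?thesis unfolding W_def by (rule LeastI)
  qed
  define K where "K \<alpha> y = (\<Sum>k<W y. (S ^^ k) \<alpha> y)" for \<alpha> y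
  have Kx: "K \<alpha> y = (\<Sum>k<V. (S ^^ k) \<alpha> y)" if \<alpha>: "\<alpha> \<in> forms A" and V: "\<forall>\<alpha>\<in>FW V. \<alpha> y = 0" for \<alpha> y V
  proof -
    have "W y \<le> V" unfolding W_def by (rule Least_le) (rule V)
    have "(S ^^ k) \<alpha> y = 0" if "k \<ge> W y" for k
    proof -
      have "(S ^^ k) \<alpha> \<in> FW (0 + k)" by (rule oper_weight[OF Sp]) (simp add: FW_0 \<alpha>)
      then have "(S ^^ k) \<alpha> \<in> FW (W y)" using FW_mono[OF that] by auto
      then show ?thesis using W by blast
    qed
    then show ?thesis
      unfolding K_def using \<open>W y \<le> V\<close> by (intro sum.mono_neutral_left) auto
  qed
  have Knear: "\<exists>V. \<forall>\<^sub>F y in nhds x. \<forall>\<alpha>\<in>forms A. K \<alpha> y = (\<Sum>k<V. (S ^^ k) \<alpha>) y" for x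
  proof -
    obtain V where V: "\<forall>\<^sub>F y in nhds x. \<forall>\<alpha>\<in>FW V. \<alpha> y = 0" using FW_vanish .
    have "\<forall>\<^sub>F y in nhds x. \<forall>\<alpha>\<in>forms A. K \<alpha> y = (\<Sum>k<V. (S ^^ k) \<alpha>) y"
      using V by (rule eventually_mono) (intro ballI, simp only: Kx sum_fun_apply)
    then show ?thesis by blast
  qed
  have sum_forms: "(\<Sum>k<V. (S ^^ k) \<alpha>) \<in> forms A" if "\<alpha> \<in> forms A" for \<alpha> and V :: nat
    by (intro subspace_sum[OF forms_subspace] oper_forms[OF Sp that])
  have K_forms: "K \<alpha> \<in> forms A" if \<alpha>: "\<alpha> \<in> forms A" for \<alpha>
  proof (rule forms_glue)
    fix x
    obtain V where V: "\<forall>\<^sub>F y in nhds x. \<forall>\<alpha>\<in>forms A. K \<alpha> y = (\<Sum>k<V. (S ^^ k) \<alpha>) y" using Knear by blast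
    have "\<forall>\<^sub>F y in nhds x. (\<Sum>k<V. (S ^^ k) \<alpha>) y = K \<alpha> y"
      using V by (rule eventually_mono) (use \<alpha> in auto)
    then show "\<exists>\<eta>\<in>forms A. \<forall>\<^sub>F y in nhds x. \<eta> y = K \<alpha> y" using sum_forms[OF \<alpha>] by blast
  qed
  have telescope: "(\<Sum>k<V. (S ^^ k) \<alpha>) + T (\<Sum>k<V. (S ^^ k) \<alpha>) = \<alpha> - (S ^^ V) \<alpha>" if \<alpha>: "\<alpha> \<in> forms A" for \<alpha> V
  proof (induction V)
    case 0
    show ?case by (simp only: lessThan_0 sum.empty oper_zero[OF T] funpow_0 diff_self add_0_left)
  next
    case (Suc V)
    have "T (\<Sum>k<Suc V. (S ^^ k) \<alpha>) = T (\<Sum>k<V. (S ^^ k) \<alpha>) + T ((S ^^ V) \<alpha>)"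
      unfolding sum.lessThan_Suc by (rule oper_add[OF T sum_forms[OF \<alpha>] oper_forms[OF Sp \<alpha>]])
    moreover have "T ((S ^^ V) \<alpha>) = - (S ^^ Suc V) \<alpha>" by (simp only: funpow.simps o_apply S_def minus_minus)
    ultimately have "(\<Sum>k<Suc V. (S ^^ k) \<alpha>) + T (\<Sum>k<Suc V. (S ^^ k) \<alpha>)
        = ((\<Sum>k<V. (S ^^ k) \<alpha>) + T (\<Sum>k<V. (S ^^ k) \<alpha>)) + (S ^^ V) \<alpha> - (S ^^ Suc V) \<alpha>"
      unfolding sum.lessThan_Suc by (simp only: ac_simps diff_conv_add_uminus)
    then show ?case unfolding Suc by (simp only: diff_add_cancel)
  qed
  have K1: "K \<alpha> + T (K \<alpha>) = \<alpha>" if \<alpha>: "\<alpha> \<in> forms A" for \<alpha>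
  proof
    fix x
    obtain V where V: "\<forall>\<^sub>F y in nhds x. \<forall>\<alpha>\<in>FW V. \<alpha> y = 0" using FW_vanish .
    let ?\<eta> = "\<Sum>k<V. (S ^^ k) \<alpha>"
    have ev: "\<forall>\<^sub>F y in nhds x. K \<alpha> y = ?\<eta> y"
      using V by (rule eventually_mono) (simp only: Kx[OF \<alpha>] sum_fun_apply)
    have "(S ^^ V) \<alpha> \<in> FW (0 + V)" by (rule oper_weight[OF Sp]) (simp add: FW_0 \<alpha>)
    then have "(S ^^ V) \<alpha> \<in> FW V" by (simp only: add_0_left)
    then have SV: "(S ^^ V) \<alpha> x = 0" by (rule bspec[OF eventually_nhds_x_imp_x[OF V]])
    have "(K \<alpha> + T (K \<alpha>)) x = K \<alpha> x + T (K \<alpha>) x" by simp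
    also have "\<dots> = ?\<eta> x + T ?\<eta> x"
      using eventually_nhds_x_imp_x[OF ev] oper_local_at[OF T K_forms[OF \<alpha>] sum_forms[OF \<alpha>] ev] by (simp only:)
    also have "\<dots> = (\<alpha> - (S ^^ V) \<alpha>) x"
      unfolding telescope[OF \<alpha>, of V, symmetric] by simp
    also have "\<dots> = \<alpha> x" using SV by simp
    finally show "(K \<alpha> + T (K \<alpha>)) x = \<alpha> x" .
  qed
  \<comment> \<open>Solutions of the equation are unique, so linearity and the behaviour on degrees
    are checked on the equation and not on the series.\<close>
  have K_unique: "K \<alpha> = \<beta>" if "\<alpha> \<in> forms A" "\<beta> \<in> forms A" "\<beta> + T \<beta> = \<alpha>" for \<alpha> \<beta>
  proof -
    have "(K \<alpha> - \<beta>) + T (K \<alpha> - \<beta>) = (K \<alpha> + T (K \<alpha>)) - (\<beta> + T \<beta>)"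
      unfolding oper_diff[OF T K_forms[OF that(1)] that(2)] by (simp only: add_diff_add)
    then have "(K \<alpha> - \<beta>) + T (K \<alpha> - \<beta>) = 0" by (simp only: K1[OF that(1)] that(3) diff_self)
    then have "K \<alpha> - \<beta> = 0"
      by (rule oper_raising_injective[OF T forms_diff[OF K_forms[OF that(1)] that(2)]])
    then show ?thesis by (simp only: right_minus_eq)
  qed
  have K2: "K (\<alpha> + T \<alpha>) = \<alpha>" if "\<alpha> \<in> forms A" for \<alpha>
    by (rule K_unique[OF forms_add[OF that oper_forms[OF T that]] that refl])
  have "oper 0 0 K"
  proof (rule operI)
    fix \<alpha> \<beta> a b assume *: "\<alpha> \<in> forms A" "\<beta> \<in> forms A"
    have k: "K \<alpha> \<in> forms A" "K \<beta> \<in> forms A" using * K_forms by blast+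
    show "K (a *\<^sub>R \<alpha> + b *\<^sub>R \<beta>) = a *\<^sub>R K \<alpha> + b *\<^sub>R K \<beta>"
    proof (rule K_unique)
      have "(a *\<^sub>R K \<alpha> + b *\<^sub>R K \<beta>) + T (a *\<^sub>R K \<alpha> + b *\<^sub>R K \<beta>) = a *\<^sub>R (K \<alpha> + T (K \<alpha>)) + b *\<^sub>R (K \<beta> + T (K \<beta>))"
        unfolding oper_lin[OF T k] by (simp only: scaleR_add_right ac_simps)
      then show "(a *\<^sub>R K \<alpha> + b *\<^sub>R K \<beta>) + T (a *\<^sub>R K \<alpha> + b *\<^sub>R K \<beta>) = a *\<^sub>R \<alpha> + b *\<^sub>R \<beta>"
        by (simp only: K1[OF *(1)] K1[OF *(2)])
    qed (use * k in \<open>auto intro: forms_add forms_scale\<close>)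
  next
    fix \<alpha> x assume \<alpha>: "\<alpha> \<in> forms A" and z: "\<forall>\<^sub>F y in nhds x. \<alpha> y = 0"
    have "(S ^^ k) \<alpha> x = 0" for k by (rule oper_local_zero[OF Sp \<alpha> z])
    then show "K \<alpha> x = 0" unfolding K_def by (intro sum.neutral) simp
  next
    fix v \<alpha> assume \<alpha>: "\<alpha> \<in> FW v"
    have "K \<alpha> x \<in> weight_ge v x" for x
      unfolding K_def
    proof (rule subspace_sum[OF weight_ge_subspace])
      fix k
      have "(S ^^ k) \<alpha> \<in> FW (v + k)" by (rule oper_weight[OF Sp \<alpha>])
      then show "(S ^^ k) \<alpha> x \<in> weight_ge v x" by (rule subsetD[OF weight_ge_mono[OF le_add1] FW_weight])
    qed
    then show "K \<alpha> \<in> FW (v + 0)" using K_forms[OF FW_forms[OF \<alpha>]] by (simp add: FW_iff)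
  next
    fix \<alpha> k assume \<alpha>: "\<alpha> \<in> forms A"
    show "K (deg_proj k \<alpha>) = deg_proj (k + 0) (K \<alpha>)"
    proof (rule K_unique)
      have "deg_proj k (K \<alpha>) + T (deg_proj k (K \<alpha>)) = deg_proj k (1 *\<^sub>R K \<alpha> + 1 *\<^sub>R T (K \<alpha>))"
        unfolding deg_proj_lin oper_deg[OF T K_forms[OF \<alpha>]] by (simp only: scaleR_one add_0_right)
      then show "deg_proj (k + 0) (K \<alpha>) + T (deg_proj (k + 0) (K \<alpha>)) = deg_proj k \<alpha>"
        by (simp only: scaleR_one K1[OF \<alpha>] add_0_right)
    qed (use \<alpha> K_forms in \<open>auto intro: deg_proj_forms\<close>)
  qed (rule K_forms)
  then show ?thesis using that[OF _ K1 K2] by blast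
qed

lemma deg_proj_high:
  obtains M where "\<forall>k\<ge>M. \<forall>\<alpha>\<in>forms A. deg_proj (int k) \<alpha> x = 0"
proof -
  obtain U r X where fr: "local_frame s U r X" and x: "x \<in> U" using H_frame .
  have "deg_proj (int k) \<alpha> x = 0" if k: "k \<ge> Suc r" and \<alpha>: "\<alpha> \<in> forms A" for k \<alpha>
  proof (rule alt_forms_determined)
    show "deg_proj (int k) \<alpha> x \<in> alt_forms (tangent A x) {0}"
      using formsD[OF deg_proj_forms[OF \<alpha>]] by (simp add: cotensors_def)
    show "tangent A x = span ((\<lambda>j. X j x) ` {..<r})"
      using local_frame_span[OF fr x] H_top[of s x] by simp
    fix js assume js: "set js \<subseteq> {..<r}" "distinct js"
    have "length js \<le> r" using card_mono[OF _ js(1)] distinct_card[OF js(2)] by simp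
    then show "deg_proj (int k) \<alpha> x (map (\<lambda>j. X j x) js) = 0" using k by (simp add: deg_proj_apply)
  qed simp
  then show ?thesis using that[of "Suc r"] by blast
qed

section \<open>Bundle maps as filtered operators\<close>

lemma bundle_fibre:
  assumes "smooth_bundle_map A B" "a \<in> cotensors A x"
  shows "B x a \<in> cotensors A x"
  using assms unfolding smooth_bundle_map_def by blast

lemma bundle_lin:
  assumes "smooth_bundle_map A B" "a \<in> cotensors A x" "b \<in> cotensors A x"
  shows "B x (r *\<^sub>R a + t *\<^sub>R b) = r *\<^sub>R B x a + t *\<^sub>R B x b"
  using assms unfolding smooth_bundle_map_def by blast

lemma bundle_forms: "smooth_bundle_map A B \<Longrightarrow> \<alpha> \<in> forms A \<Longrightarrow> on_forms B \<alpha> \<in> forms A"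
  unfolding smooth_bundle_map_def by blast

lemma bundle_sum:
  assumes B: "smooth_bundle_map A B" and "\<And>i. i \<in> I \<Longrightarrow> a i \<in> cotensors A x"
  shows "B x (\<Sum>i\<in>I. c i *\<^sub>R a i) = (\<Sum>i\<in>I. c i *\<^sub>R B x (a i))"
  by (rule linear_on_subspace_sum[OF cotensors_subspace bundle_lin[OF B] assms(2)])

lemma bundle_zero: "smooth_bundle_map A B \<Longrightarrow> B x 0 = 0"
  using bundle_sum[of B "{}" "\<lambda>_. 0" x "\<lambda>_. 0"] by simp

lemma bundle_fmul:
  assumes B: "smooth_bundle_map A B" and "\<alpha> \<in> forms A"
  shows "on_forms B (fmul f \<alpha>) = fmul f (on_forms B \<alpha>)"
proof
  fix x
  show "on_forms B (fmul f \<alpha>) x = fmul f (on_forms B \<alpha>) x"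
    using bundle_lin[OF B formsD[OF assms(2)] formsD[OF assms(2)], of x "f x" 0] by (simp add: on_forms_def)
qed

text \<open>The hypothesis speaks of homogeneous forms only. In each fibre a form is a finite sum of
  its homogeneous components, by \<open>deg_proj_high\<close>, and fibrewise linearity does the
  rest.\<close>

lemma bundle_deg:
  assumes B: "smooth_bundle_map A B"
    and deg: "\<And>k \<alpha> x vs. \<alpha> \<in> forms_deg A k \<Longrightarrow> int (length vs) \<noteq> int k + j \<Longrightarrow> on_forms B \<alpha> x vs = 0"
    and \<alpha>: "\<alpha> \<in> forms A"
  shows "on_forms B (deg_proj K \<alpha>) = deg_proj (K + j) (on_forms B \<alpha>)"
proof (intro ext)
  fix x vs
  let ?G = "\<lambda>k. on_forms B (deg_proj (int k) \<alpha>) x vs"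
  obtain M where M: "\<forall>k\<ge>M. \<forall>\<alpha>\<in>forms A. deg_proj (int k) \<alpha> x = 0" using deg_proj_high .
  have "\<alpha> x = (\<Sum>k<M. 1 *\<^sub>R deg_proj (int k) \<alpha> x)"
  proof
    fix us
    have "(\<Sum>k<M. deg_proj (int k) \<alpha> x us) = (\<Sum>k<M. if k = length us then \<alpha> x us else 0)"
      by (intro sum.cong refl) (auto simp: deg_proj_apply)
    moreover have "\<alpha> x us = 0" if "\<not> length us < M"
    proof -
      have "deg_proj (int (length us)) \<alpha> x us = 0" using M that \<alpha> by simp
      then show ?thesis by (simp add: deg_proj_apply)
    qed
    ultimately show "\<alpha> x us = (\<Sum>k<M. 1 *\<^sub>R deg_proj (int k) \<alpha> x) us"
      by (auto simp: sum_fun_apply)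
  qed
  then have "on_forms B \<alpha> x = B x (\<Sum>k<M. 1 *\<^sub>R deg_proj (int k) \<alpha> x)" by (simp add: on_forms_def)
  also have "\<dots> = (\<Sum>k<M. 1 *\<^sub>R B x (deg_proj (int k) \<alpha> x))"
    by (rule bundle_sum[OF B formsD[OF deg_proj_forms[OF \<alpha>]]])
  finally have total: "on_forms B \<alpha> x vs = (\<Sum>k<M. ?G k)" by (simp add: sum_fun_apply on_forms_def)
  have G0: "?G k = 0" if "int (length vs) \<noteq> int k + j" for k
    by (rule deg[OF _ that]) (simp add: forms_deg_def deg_proj_forms \<alpha> has_degree_def deg_proj_apply)
  have GM: "?G k = 0" if "k \<ge> M" for k
    using M that \<alpha> bundle_zero[OF B, of x] by (simp add: on_forms_def)
  show "on_forms B (deg_proj K \<alpha>) x vs = deg_proj (K + j) (on_forms B \<alpha>) x vs"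
  proof (cases "K \<ge> 0")
    case True
    then obtain k where k: "K = int k" using nonneg_int_cases by blast
    show ?thesis
    proof (cases "int (length vs) = K + j")
      case False
      then show ?thesis using G0[of k] k by (simp add: deg_proj_apply)
    next
      case True
      have "(\<Sum>k'<M. ?G k') = (\<Sum>k'<M. if k' = k then ?G k else 0)"
        by (intro sum.cong refl) (use G0 True k in auto)
      then have "(\<Sum>k'<M. ?G k') = ?G k" using GM[of k] by (cases "k < M") simp_all
      then show ?thesis using total True k by (simp add: deg_proj_apply)
    qed
  next
    case False
    then have "deg_proj K \<alpha> x = 0" by (auto simp: deg_proj_def fun_eq_iff)
    then have "on_forms B (deg_proj K \<alpha>) x vs = 0" using bundle_zero[OF B, of x] by (simp add: on_forms_def)
    moreover have "?G k = 0" if "int (length vs) = K + j" for k using G0[of k] that False by auto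
    then have "deg_proj (K + j) (on_forms B \<alpha>) x vs = 0" using total by (simp add: deg_proj_apply)
    ultimately show ?thesis by simp
  qed
qed

lemma bundle_oper:
  assumes B: "smooth_bundle_map A B" and "respects_filtration A H (on_forms B)"
    and "\<And>k \<alpha> x vs. \<alpha> \<in> forms_deg A k \<Longrightarrow> int (length vs) \<noteq> int k + j \<Longrightarrow> on_forms B \<alpha> x vs = 0"
  shows "oper 0 j (on_forms B)"
proof (rule operI)
  fix \<alpha> \<beta> :: "('m, real) form" and a b assume *: "\<alpha> \<in> forms A" "\<beta> \<in> forms A"
  show "on_forms B (a *\<^sub>R \<alpha> + b *\<^sub>R \<beta>) = a *\<^sub>R on_forms B \<alpha> + b *\<^sub>R on_forms B \<beta>"
  proof
    fix x
    show "on_forms B (a *\<^sub>R \<alpha> + b *\<^sub>R \<beta>) x = (a *\<^sub>R on_forms B \<alpha> + b *\<^sub>R on_forms B \<beta>) x"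
      using bundle_lin[OF B formsD[OF *(1)] formsD[OF *(2)], of x a b]
      by (simp only: on_forms_def plus_fun_apply scaleR_fun_apply)
  qed
next
  fix \<alpha> :: "('m, real) form" and x assume "\<forall>\<^sub>F y in nhds x. \<alpha> y = 0"
  then show "on_forms B \<alpha> x = 0"
    unfolding on_forms_def by (simp only: eventually_nhds_x_imp_x[of "\<lambda>y. \<alpha> y = 0"] bundle_zero[OF B])
next
  fix v and \<alpha> :: "('m, real) form" assume "\<alpha> \<in> FW v"
  then show "on_forms B \<alpha> \<in> FW (v + 0)" using assms(2) by (auto simp: respects_filtration_def)
qed (use bundle_forms[OF B] bundle_deg[OF B assms(3)] in simp_all)

end

section \<open>Characteristic polynomials\<close>

text \<open>The adjugate proof carried out on vectors. The coefficients of column \<open>l\<close>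
  of the adjugate of z - B define vectors \<open>v i\<close>; comparing coefficients in the product
  of z - B with its adjugate writes coefficient i of the characteristic polynomial times
  \<open>b l\<close> as \<open>v (i - 1)\<close> minus \<open>L (v i)\<close>. Applying the i-th
  power of \<open>L\<close> and summing telescopes.\<close>

lemma cayley_hamilton_on_basis:
  fixes L :: "'a::real_vector \<Rightarrow> 'a" and b :: "nat \<Rightarrow> 'a"
  assumes V: "subspace V" and LV: "\<And>v. v \<in> V \<Longrightarrow> L v \<in> V"
    and L: "\<And>u v r t. u \<in> V \<Longrightarrow> v \<in> V \<Longrightarrow> L (r *\<^sub>R u + t *\<^sub>R v) = r *\<^sub>R L u + t *\<^sub>R L v"
    and b: "\<And>k. k < N \<Longrightarrow> b k \<in> V"
    and Lb: "\<And>k. k < N \<Longrightarrow> L (b k) = (\<Sum>j<N. F j k *\<^sub>R b j)" and l: "l < N"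
  shows "(\<Sum>i\<le>N. coeff (char_poly (mat N N (\<lambda>(j, k). F j k))) i *\<^sub>R (L ^^ i) (b l)) = 0"
proof -
  let ?B = "mat N N (\<lambda>(j, k). F j k)"
  let ?c = "char_poly ?B"
  define C where "C = mat N N (\<lambda>(j, k). [: - F j k, if j = k then 1 else 0 :])"
  have C: "char_poly_matrix ?B = C"
    unfolding C_def char_poly_matrix_def by (rule eq_matI) auto
  have Cc: "C \<in> carrier_mat N N" by (simp add: C_def)
  define M where "M i k = coeff (adj_mat C $$ (k, l)) i" for i k
  have rec: "(case i of 0 \<Rightarrow> 0 | Suc i' \<Rightarrow> M i' k) - (\<Sum>j<N. F k j * M i j) = (if k = l then coeff ?c i else 0)"
    if k: "k < N" for i k
  proof -
    have "(C * adj_mat C) $$ (k, l) = (\<Sum>j<N. C $$ (k, j) * adj_mat C $$ (j, l))"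
      by (rule mat_mult_entry[OF Cc adj_mat(1)[OF Cc] k l])
    moreover have "(C * adj_mat C) $$ (k, l) = (if k = l then ?c else 0)"
      using adj_mat(2)[OF Cc] k l by (simp add: char_poly_def C)
    ultimately have "coeff (if k = l then ?c else 0) i = (\<Sum>j<N. coeff (C $$ (k, j) * adj_mat C $$ (j, l)) i)"
      by (simp only: coeff_sum)
    also have "\<dots> = (\<Sum>j<N. (if k = j then (case i of 0 \<Rightarrow> 0 | Suc i' \<Rightarrow> M i' j) else 0) - F k j * M i j)"
      by (intro sum.cong refl) (use k in \<open>auto simp: C_def M_def coeff_pCons split: nat.splits\<close>)
    also have "\<dots> = (case i of 0 \<Rightarrow> 0 | Suc i' \<Rightarrow> M i' k) - (\<Sum>j<N. F k j * M i j)"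
      unfolding sum_subtractf using k by simp
    finally show ?thesis by (auto split: if_splits)
  qed
  define v where "v i = (\<Sum>k<N. M i k *\<^sub>R b k)" for i
  have vV: "v i \<in> V" for i unfolding v_def by (intro subspace_sum[OF V] subspace_scale[OF V] b) simp
  have Lv: "L (v i) = (\<Sum>k<N. (\<Sum>j<N. F k j * M i j) *\<^sub>R b k)" for i
  proof -
    have "L (v i) = (\<Sum>j<N. M i j *\<^sub>R L (b j))"
      unfolding v_def by (rule linear_on_subspace_sum[OF V L b]) auto
    also have "\<dots> = (\<Sum>j<N. \<Sum>k<N. (F k j * M i j) *\<^sub>R b k)"
      by (intro sum.cong refl) (simp add: Lb scaleR_sum_right mult.commute)
    also have "\<dots> = (\<Sum>k<N. \<Sum>j<N. (F k j * M i j) *\<^sub>R b k)" by (rule sum.swap)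
    finally show ?thesis by (simp add: scaleR_sum_left)
  qed
  have step: "coeff ?c i *\<^sub>R b l = (case i of 0 \<Rightarrow> 0 | Suc i' \<Rightarrow> v i') - L (v i)" for i
  proof -
    have "(case i of 0 \<Rightarrow> 0 | Suc i' \<Rightarrow> v i') = (\<Sum>k<N. (case i of 0 \<Rightarrow> 0 | Suc i' \<Rightarrow> M i' k) *\<^sub>R b k)"
      by (cases i) (simp_all add: v_def)
    then have "(case i of 0 \<Rightarrow> 0 | Suc i' \<Rightarrow> v i') - L (v i)
        = (\<Sum>k<N. ((case i of 0 \<Rightarrow> 0 | Suc i' \<Rightarrow> M i' k) - (\<Sum>j<N. F k j * M i j)) *\<^sub>R b k)"
      unfolding Lv by (simp add: sum_subtractf scaleR_diff_left)
    also have "\<dots> = (\<Sum>k<N. if k = l then coeff ?c i *\<^sub>R b l else 0)"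
      by (intro sum.cong refl) (use rec[of _ i] in auto)
    finally show ?thesis using l by simp
  qed
  have pow_V: "(L ^^ i) u \<in> V" if "u \<in> V" for i u using that LV by (induction i) auto
  have pow_lin: "(L ^^ i) (r *\<^sub>R u + t *\<^sub>R w) = r *\<^sub>R (L ^^ i) u + t *\<^sub>R (L ^^ i) w" if "u \<in> V" "w \<in> V" for i u w r t
    using that L pow_V by (induction i) auto
  have pow0: "(L ^^ i) 0 = 0" for i using pow_lin[of 0 0 i 0 0] subspace_0[OF V] by simp
  have tele: "(\<Sum>i\<le>n. coeff ?c i *\<^sub>R (L ^^ i) (b l)) = - (L ^^ Suc n) (v n)" for n
  proof (induction n)
    case 0
    show ?case using step[of 0] by simp
  next
    case (Suc n)
    have "coeff ?c (Suc n) *\<^sub>R (L ^^ Suc n) (b l) = (L ^^ Suc n) (coeff ?c (Suc n) *\<^sub>R b l)"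
      using pow_lin[of "b l" 0 "Suc n" "coeff ?c (Suc n)" 0] b[OF l] subspace_0[OF V] by simp
    also have "\<dots> = (L ^^ Suc n) (1 *\<^sub>R v n + (- 1) *\<^sub>R L (v (Suc n)))"
      using step[of "Suc n"] by simp
    also have "\<dots> = (L ^^ Suc n) (v n) - (L ^^ Suc n) (L (v (Suc n)))"
      using pow_lin[OF vV LV[OF vV], of "Suc n" 1 n "- 1" "Suc n"] by simp
    also have "(L ^^ Suc n) (L (v (Suc n))) = (L ^^ Suc (Suc n)) (v (Suc n))"
      by (simp only: funpow_swap1 funpow.simps o_apply)
    finally show ?case using Suc by (simp only: sum.atMost_Suc) simp
  qed
  \<comment> \<open>Beyond the degrees of all entries of the column, so that the last vector
    \<open>v n\<close> vanishes, and at least \<open>N\<close>, so that the added coefficients of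
    the characteristic polynomial are zero.\<close>
  define n where "n = N + (\<Sum>k<N. degree (adj_mat C $$ (k, l))) + 1"
  have "M n k = 0" if "k < N" for k
  proof -
    have "degree (adj_mat C $$ (k, l)) \<le> (\<Sum>k<N. degree (adj_mat C $$ (k, l)))"
      using that by (intro member_le_sum) auto
    then show ?thesis unfolding M_def n_def by (intro coeff_eq_0) simp
  qed
  then have "v n = 0" by (simp add: v_def)
  then have "(\<Sum>i\<le>n. coeff ?c i *\<^sub>R (L ^^ i) (b l)) = 0" using tele[of n] pow0[of "Suc n"] by simp
  moreover have "(\<Sum>i\<le>N. coeff ?c i *\<^sub>R (L ^^ i) (b l)) = (\<Sum>i\<le>n. coeff ?c i *\<^sub>R (L ^^ i) (b l))"
  proof (rule sum.mono_neutral_left)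
    have "degree ?c = N" using degree_monic_char_poly[of ?B N] by simp
    then show "\<forall>i\<in>{..n} - {..N}. coeff ?c i *\<^sub>R (L ^^ i) (b l) = 0"
      by (auto simp: coeff_eq_0)
  qed (auto simp: n_def)
  ultimately show ?thesis by simp
qed

text \<open>Up to sign the constant coefficient is the product of the roots; they are split off one
  at a time.\<close>

lemma monic_constant_term_bound:
  fixes q :: "complex poly"
  assumes "lead_coeff q = 1" "\<And>z. poly q z = 0 \<Longrightarrow> cmod z \<ge> e" "e \<ge> 0"
  shows "cmod (coeff q 0) \<ge> e ^ degree q"
  using assms(1,2)
proof (induction "degree q" arbitrary: q)
  case 0
  then show ?case by simp
next
  case (Suc n)
  have "\<not> constant (poly q)" unfolding constant_degree using Suc.hyps(2) by linarith
  from Fundamental_Theorem_Algebra.fundamental_theorem_of_algebra[OF this]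
  obtain z where z: "poly q z = 0" by (elim exE)
  then obtain p where q: "q = [:- z, 1:] * p" by (auto simp: poly_eq_0_iff_dvd elim: dvdE)
  have p0: "p \<noteq> 0" using Suc.prems(1) q by auto
  have deg: "degree q = Suc (degree p)" unfolding q using p0 by (subst degree_mult_eq) auto
  have "lead_coeff p = 1" using Suc.prems(1) unfolding q lead_coeff_mult by simp
  moreover have "cmod w \<ge> e" if "poly p w = 0" for w using Suc.prems(2)[of w] that q by simp
  ultimately have "cmod (coeff p 0) \<ge> e ^ degree p" using Suc.hyps deg by simp
  moreover have "cmod z \<ge> e" using Suc.prems(2)[OF z] .
  ultimately have "e * e ^ degree p \<le> cmod z * cmod (coeff p 0)" using \<open>e \<ge> 0\<close> by (intro mult_mono) auto
  moreover have "coeff q 0 = - z * coeff p 0" unfolding q by simp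
  ultimately show ?case using deg by (simp add: norm_mult)
qed

text \<open>This makes the multiplicity of the root \<open>0\<close> locally constant in families.\<close>

lemma lowest_coeff_bound:
  fixes p :: "complex poly"
  assumes monic: "lead_coeff p = 1" and e: "0 < e" "e \<le> 1"
    and roots: "\<And>z. 0 < cmod z \<Longrightarrow> cmod z \<le> e \<Longrightarrow> poly p z \<noteq> 0"
    and r: "coeff p r \<noteq> 0" "\<And>j. j < r \<Longrightarrow> coeff p j = 0"
  shows "cmod (coeff p r) \<ge> e ^ degree p"
proof -
  have "monom 1 r dvd p" using r(2) by (simp add: monom_1_dvd_iff')
  then obtain q where p: "p = monom 1 r * q" by (elim dvdE)
  have q0: "coeff q 0 = coeff p r" unfolding p by (simp add: coeff_monom_mult)
  have qn: "q \<noteq> 0" using monic p by auto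
  have deg: "degree p = r + degree q"
    unfolding p using qn by (subst degree_mult_eq) (auto simp: degree_monom_eq)
  have "lead_coeff q = 1" using monic unfolding p lead_coeff_mult by (simp add: degree_monom_eq)
  moreover have "cmod z \<ge> e" if z: "poly q z = 0" for z
  proof (rule ccontr)
    assume "\<not> cmod z \<ge> e"
    moreover have "z \<noteq> 0" using z r(1) q0 by (auto simp: poly_0_coeff_0)
    moreover have "poly p z = 0" using z p by simp
    ultimately show False using roots[of z] by auto
  qed
  ultimately have "e ^ degree q \<le> cmod (coeff q 0)"
    using monic_constant_term_bound[of q e] e by simp
  moreover have "e ^ degree p \<le> e ^ degree q" using e deg by (intro power_decreasing) auto
  ultimately show ?thesis using q0 by simp
qed

section \<open>The algebraic Laplacian\<close>

locale base_complex = filtered_manifold A H s g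
  for A :: "('m::{t2_space,second_countable_topology}, 'e::euclidean_space) chart set"
    and H :: "nat \<Rightarrow> 'm \<Rightarrow> 'm tvec set" and s :: nat
    and g :: "'m \<Rightarrow> 'm tvec \<Rightarrow> 'm tvec \<Rightarrow> real" +
  fixes d0 c0 :: "'m bundle_map"
  assumes base: "base_pair A H s g d0 c0" and radius: "locally_uniform_radius A d0 c0"
begin

abbreviation "D0 \<equiv> on_forms d0"
abbreviation "C0 \<equiv> on_forms c0"
abbreviation "bx \<equiv> box0 d0 c0"
abbreviation "B0 \<equiv> on_forms bx"

lemma d0_bundle: "smooth_bundle_map A d0"
  and c0_bundle: "smooth_bundle_map A c0"
  and D0_D0: "\<alpha> \<in> forms A \<Longrightarrow> D0 (D0 \<alpha>) = 0"
  and C0_C0: "\<alpha> \<in> forms A \<Longrightarrow> C0 (C0 \<alpha>) = 0"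
  and D0_deg: "\<alpha> \<in> forms_deg A k \<Longrightarrow> D0 \<alpha> \<in> forms_deg A (Suc k)"
  and C0_deg: "\<alpha> \<in> forms_deg A (Suc k) \<Longrightarrow> C0 \<alpha> \<in> forms_deg A k"
  and C0_deg_0: "\<alpha> \<in> forms_deg A 0 \<Longrightarrow> C0 \<alpha> = 0"
  and D0_filt: "respects_filtration A H D0"
  and C0_filt: "respects_filtration A H C0"
  and disjoint_D0: "\<alpha> \<in> forms A \<Longrightarrow> C0 (D0 \<alpha>) = 0 \<Longrightarrow> D0 \<alpha> = 0"
  and disjoint_C0: "\<alpha> \<in> forms A \<Longrightarrow> D0 (C0 \<alpha>) = 0 \<Longrightarrow> C0 \<alpha> = 0"
  and D0_gr: "gr_is A H D0 (osc_differential A H)"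
  using base unfolding base_pair_def by blast+

lemma oper_D0: "oper 0 1 D0"
proof (rule bundle_oper[OF d0_bundle D0_filt])
  fix k and \<alpha> :: "('m, real) form" and x and vs :: "'m tvec list"
  assume "\<alpha> \<in> forms_deg A k" "int (length vs) \<noteq> int k + 1"
  then show "D0 \<alpha> x vs = 0" using D0_deg[of \<alpha> k] by (simp add: forms_deg_def has_degree_def)
qed

lemma oper_C0: "oper 0 (- 1) C0"
proof (rule bundle_oper[OF c0_bundle C0_filt])
  fix k and \<alpha> :: "('m, real) form" and x and vs :: "'m tvec list"
  assume *: "\<alpha> \<in> forms_deg A k" "int (length vs) \<noteq> int k + - 1"
  then show "C0 \<alpha> x vs = 0"
  proof (cases k)
    case 0
    then show ?thesis using C0_deg_0 * by simp
  next
    case (Suc k')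
    then show ?thesis using C0_deg[of \<alpha> k'] * by (simp add: forms_deg_def has_degree_def)
  qed
qed

lemmas D0_forms = oper_forms[OF oper_D0] and C0_forms = oper_forms[OF oper_C0]

text \<open>On graded fields of total weight exactly v both operators are given by the osculating
  differential of the symbol, d by \<open>symbol_dR\<close> and d0 by the condition on gr(d0), so
  their difference vanishes there. Below v each vanishes separately.\<close>

lemma raising_weight:
  assumes \<alpha>: "\<alpha> \<in> FW v"
  shows "dR \<alpha> - D0 \<alpha> \<in> FW (v + 1)"
  unfolding FW_iff
proof (intro conjI allI weight_geI)
  note f = FW_forms[OF \<alpha>]
  have Da: "D0 \<alpha> \<in> FW (v + 0)" by (rule oper_weight[OF oper_D0 \<alpha>])
  show "dR \<alpha> - D0 \<alpha> \<in> forms A" by (intro forms_diff dR_forms D0_forms f)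
  fix x P assume P: "graded_fields P" "wsum P < v + 1"
  show "(dR \<alpha> - D0 \<alpha>) x (vals (map fst P) x) = 0"
  proof (cases "wsum P < v")
    case True
    then show ?thesis
      using weight_geD[OF FW_weight[OF dR_weight[OF \<alpha>]] P(1), of x] weight_geD[OF FW_weight[OF Da] P(1), of x] by simp
  next
    case False
    then have w: "wsum P = v" using P(2) by simp
    have "symbol H v (D0 \<alpha>) x = osc_differential A H x (symbol H v \<alpha> x)"
      using D0_gr \<alpha> unfolding gr_is_def by blast
    then have "D0 \<alpha> x (vals (map fst P) x) = dR \<alpha> x (vals (map fst P) x)"
      using symbol_homog[OF D0_forms[OF f] P(1) w, of x] symbol_dR[OF \<alpha> P(1) w, of x] by (simp only:)
    then show ?thesis by simp
  qed
qed

lemma oper_raising: "oper 1 1 (\<lambda>\<alpha>. dR \<alpha> - D0 \<alpha>)"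
proof -
  have o: "oper 0 1 (\<lambda>\<alpha>. dR \<alpha> - D0 \<alpha>)" by (rule oper_minus[OF oper_dR oper_D0])
  show ?thesis
    by (rule operI) (use oper_forms[OF o] oper_lin[OF o] oper_local_zero[OF o] oper_deg[OF o] raising_weight in simp_all)
qed

lemma B0_eq: "B0 \<alpha> = D0 (C0 \<alpha>) + C0 (D0 \<alpha>)"
proof
  fix x show "B0 \<alpha> x = (D0 (C0 \<alpha>) + C0 (D0 \<alpha>)) x"
    unfolding on_forms_def box0_def plus_fun_apply by (rule ext) (simp only: box0_def plus_fun_apply)
qed

lemma oper_B0: "oper 0 0 B0"
proof -
  have "oper (0 + 0) (1 + - 1) (\<lambda>\<alpha>. D0 (C0 \<alpha>))" "oper (0 + 0) (- 1 + 1) (\<lambda>\<alpha>. C0 (D0 \<alpha>))"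
    by (rule oper_comp[OF oper_D0 oper_C0], rule oper_comp[OF oper_C0 oper_D0])
  then have "oper 0 0 (\<lambda>\<alpha>. D0 (C0 \<alpha>) + C0 (D0 \<alpha>))" by (intro oper_plus) simp_all
  then show ?thesis unfolding B0_eq[abs_def] .
qed

lemmas B0_forms = oper_forms[OF oper_B0]

lemma bx_eq: "bx x a = d0 x (c0 x a) + c0 x (d0 x a)"
  by (rule ext) (simp only: box0_def plus_fun_apply)

lemma bx_fibre: "a \<in> cotensors A x \<Longrightarrow> bx x a \<in> cotensors A x"
  unfolding bx_eq by (intro subspace_add[OF cotensors_subspace] bundle_fibre[OF d0_bundle] bundle_fibre[OF c0_bundle])

lemma bx_lin:
  assumes "a \<in> cotensors A x" "b \<in> cotensors A x"
  shows "bx x (r *\<^sub>R a + t *\<^sub>R b) = r *\<^sub>R bx x a + t *\<^sub>R bx x b"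
  unfolding bx_eq bundle_lin[OF d0_bundle assms] bundle_lin[OF c0_bundle assms]
    bundle_lin[OF d0_bundle bundle_fibre[OF c0_bundle assms(1)] bundle_fibre[OF c0_bundle assms(2)]]
    bundle_lin[OF c0_bundle bundle_fibre[OF d0_bundle assms(1)] bundle_fibre[OF d0_bundle assms(2)]]
    scaleR_add_right by (simp only: ac_simps)

lemma bx_bundle: "smooth_bundle_map A bx"
  unfolding smooth_bundle_map_def using bx_fibre bx_lin B0_forms by blast

lemma bx_pow_fibre: "a \<in> cotensors A x \<Longrightarrow> (bx x ^^ j) a \<in> cotensors A x"
  by (induction j) (simp_all add: bx_fibre)

lemma bx_pow_lin:
  assumes "a \<in> cotensors A x" "b \<in> cotensors A x"
  shows "(bx x ^^ j) (r *\<^sub>R a + t *\<^sub>R b) = r *\<^sub>R (bx x ^^ j) a + t *\<^sub>R (bx x ^^ j) b"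
proof (induction j)
  case (Suc j)
  then show ?case using bx_lin[OF bx_pow_fibre[OF assms(1)] bx_pow_fibre[OF assms(2)]] by (simp only: funpow.simps o_apply)
qed (simp only: funpow_0)

lemma B0_pow: "(B0 ^^ j) \<alpha> x = (bx x ^^ j) (\<alpha> x)"
  by (induction j) (simp_all add: on_forms_def)

lemma B0_pow_forms: "\<alpha> \<in> forms A \<Longrightarrow> (B0 ^^ j) \<alpha> \<in> forms A"
  by (induction j) (simp_all add: B0_forms)

text \<open>Disjointness does the work of a positive inner product. Applying delta0 to the equation
  leaves delta0 d0 delta0 \<gamma> = 0; one use of disjointness removes the outer delta0 and the
  other then gives delta0 \<gamma> = 0, after which d0 \<gamma> is treated in the same way.\<close>

lemma B0_kernel:
  assumes \<gamma>: "\<gamma> \<in> forms A" and z: "B0 \<gamma> = 0"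
  shows "D0 \<gamma> = 0" "C0 \<gamma> = 0"
proof -
  note f = D0_forms[OF \<gamma>] C0_forms[OF \<gamma>]
  have "C0 (D0 (C0 \<gamma>)) = C0 (B0 \<gamma>) - C0 (C0 (D0 \<gamma>))"
    unfolding B0_eq oper_add[OF oper_C0 D0_forms[OF f(2)] C0_forms[OF f(1)]] by (simp only: add_diff_cancel_right')
  also have "\<dots> = 0" by (simp only: z C0_C0[OF f(1)] oper_zero[OF oper_C0] diff_self)
  finally have "D0 (C0 \<gamma>) = 0" by (rule disjoint_D0[OF f(2)])
  then show "C0 \<gamma> = 0" by (rule disjoint_C0[OF \<gamma>])
  then have "C0 (D0 \<gamma>) = 0" using z unfolding B0_eq by (simp only: oper_zero[OF oper_D0] add_0_left)
  then show "D0 \<gamma> = 0" by (rule disjoint_D0[OF \<gamma>])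
qed

text \<open>The eigenvalue 0 has no nilpotent part. This is what later makes the pole of the
  algebraic resolvent at 0 simple.\<close>

lemma B0_square:
  assumes \<gamma>: "\<gamma> \<in> forms A" and z: "B0 (B0 \<gamma>) = 0"
  shows "B0 \<gamma> = 0"
proof -
  note f = D0_forms[OF \<gamma>] C0_forms[OF \<gamma>]
  note k = B0_kernel[OF B0_forms[OF \<gamma>] z]
  have "D0 (C0 (D0 \<gamma>)) = D0 (B0 \<gamma>)"
    unfolding B0_eq oper_add[OF oper_D0 D0_forms[OF f(2)] C0_forms[OF f(1)]] by (simp only: D0_D0[OF f(2)] add_0_left)
  then have 1: "C0 (D0 \<gamma>) = 0" using k(1) by (intro disjoint_C0[OF f(1)]) (simp only:)
  have "C0 (D0 (C0 \<gamma>)) = C0 (B0 \<gamma>)"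
    unfolding B0_eq oper_add[OF oper_C0 D0_forms[OF f(2)] C0_forms[OF f(1)]] by (simp only: C0_C0[OF f(1)] add_0_right)
  then have 2: "D0 (C0 \<gamma>) = 0" using k(2) by (intro disjoint_D0[OF f(2)]) (simp only:)
  show ?thesis unfolding B0_eq 1 2 by (simp only: add_0_left)
qed

text \<open>Disjointness is assumed for global forms, while the characteristic polynomial gives
  information near one point. Algebraic operators commute with multiplication by functions, so a
  bump function turns vanishing on \<open>V\<close> into vanishing everywhere.\<close>

lemma B0_power_local:
  assumes \<gamma>: "\<gamma> \<in> forms A" and V: "open V" and z: "\<And>y. y \<in> V \<Longrightarrow> (B0 ^^ r) \<gamma> y = 0" and y: "y \<in> V"
  shows "B0 \<gamma> y = 0"
proof -
  obtain b where b: "b \<in> SF" "\<forall>\<^sub>F y in nhds y. b y = 1" "\<forall>y. y \<notin> V \<longrightarrow> (\<forall>\<^sub>F z in nhds y. b z = 0)"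
    using bump_function[OF V y] .
  have b0: "b w = 0" if "w \<notin> V" for w
    using eventually_nhds_x_imp_x[OF b(3)[rule_format, OF that]] .
  have pow_fmul: "(B0 ^^ k) (fmul b \<gamma>) = fmul b ((B0 ^^ k) \<gamma>)" for k
    by (induction k) (simp_all only: funpow.simps o_apply id_apply bundle_fmul[OF bx_bundle B0_pow_forms[OF \<gamma>]])
  have "b w *\<^sub>R (B0 ^^ r) \<gamma> w = 0" for w
    using z[of w] b0[of w] by (cases "w \<in> V") simp_all
  then have "(B0 ^^ r) (fmul b \<gamma>) = 0" unfolding pow_fmul
    by (intro HOL.ext) (simp only: fmul_apply scaleR_fun_apply zero_fun_apply fun_eq_iff)
  moreover have kern: "B0 \<eta> = 0" if "\<eta> \<in> forms A" "(B0 ^^ r) \<eta> = 0" for \<eta>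
    using that
  proof (induction r arbitrary: \<eta>)
    case 0
    then have "\<eta> = 0" by (simp only: funpow.simps id_apply)
    then show ?case by (simp only: oper_zero[OF oper_B0])
  next
    case (Suc r)
    have "(B0 ^^ r) (B0 \<eta>) = 0" using Suc.prems(2) by (simp only: funpow_swap1 funpow.simps o_apply)
    then have "B0 (B0 \<eta>) = 0" by (rule Suc.IH[OF B0_forms[OF Suc.prems(1)]])
    then show ?case by (rule B0_square[OF Suc.prems(1)])
  qed
  ultimately have "B0 (fmul b \<gamma>) = 0" by (intro kern fmul_forms[OF b(1) \<gamma>])
  then have "fmul b (B0 \<gamma>) y = 0" by (simp add: bundle_fmul[OF bx_bundle \<gamma>])
  then show ?thesis using eventually_nhds_x_imp_x[OF b(2)] by simp
qed

end

section \<open>Spectral projections\<close>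

text \<open>Cauchy's integral formula on each small circle. The value does not depend on the radius,
  which also gives uniqueness in the definite description.\<close>

lemma small_circle_integral_eq:
  assumes k: "k holomorphic_on ball 0 e" and e: "e > 0"
    and f: "\<And>z. 0 < cmod z \<Longrightarrow> cmod z < e \<Longrightarrow> f z = k z / z"
  shows "small_circle_integral f = k 0"
proof -
  have val: "contour_integral (circlepath 0 r) f / (2 * of_real pi * \<i>) = k 0" if r: "0 < r" "r < e" for r
  proof -
    have "k holomorphic_on cball 0 r" using k r by (auto intro: holomorphic_on_subset)
    then have "((\<lambda>u. k u / (u - 0)) has_contour_integral (2 * of_real pi * \<i> * k 0)) (circlepath 0 r)"
      using r by (intro Cauchy_integral_circlepath_simple) auto
    then have "contour_integral (circlepath 0 r) (\<lambda>u. k u / u) = 2 * of_real pi * \<i> * k 0"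
      by (simp add: contour_integral_unique)
    moreover have "contour_integral (circlepath 0 r) f = contour_integral (circlepath 0 r) (\<lambda>u. k u / u)"
      by (rule contour_integral_eq) (use r f in auto)
    ultimately show ?thesis by simp
  qed
  then have ev: "\<forall>\<^sub>F r in at_right 0. contour_integral (circlepath 0 r) f / (2 * of_real pi * \<i>) = k 0"
    using e by (auto simp: eventually_at_right_field)
  show ?thesis
    unfolding small_circle_integral_def
  proof (rule the_equality)
    show "\<forall>\<^sub>F r in at_right 0. contour_integral (circlepath 0 r) f / (2 * of_real pi * \<i>) = k 0" by (rule ev)
  next
    fix c assume "\<forall>\<^sub>F r in at_right 0. contour_integral (circlepath 0 r) f / (2 * of_real pi * \<i>) = c"
    then have "\<forall>\<^sub>F r in at_right (0 :: real). c = k 0" using ev by eventually_elim simp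
    then show "c = k 0" by simp
  qed
qed

lemma Re_sum_of_real:
  "(\<lambda>us. Re (\<Sum>i\<in>I. z i * of_real (a i us))) = (\<Sum>i\<in>I. Re (z i) *\<^sub>R a i)"
  "(\<lambda>us. Im (\<Sum>i\<in>I. z i * of_real (a i us))) = (\<Sum>i\<in>I. Im (z i) *\<^sub>R a i)"
  by (simp_all add: fun_eq_iff sum_fun_apply)

context filtered_manifold
begin

lemma cext_sum:
  assumes B: "smooth_bundle_map A B" and a: "\<And>i. i \<in> I \<Longrightarrow> a i \<in> cotensors A x"
  shows "cext (B x) (\<lambda>vs. \<Sum>i\<in>I. z i * of_real (a i vs)) = (\<lambda>vs. \<Sum>i\<in>I. z i * of_real (B x (a i) vs))"
proof -
  have "B x (\<lambda>us. Re (\<Sum>i\<in>I. z i * of_real (a i us))) = (\<Sum>i\<in>I. Re (z i) *\<^sub>R B x (a i))"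
    "B x (\<lambda>us. Im (\<Sum>i\<in>I. z i * of_real (a i us))) = (\<Sum>i\<in>I. Im (z i) *\<^sub>R B x (a i))"
    unfolding Re_sum_of_real by (rule bundle_sum[OF B a], assumption)+
  then show ?thesis
    unfolding cext_def by (intro HOL.ext) (simp only: sum_fun_apply scaleR_fun_apply, simp add: complex_eq_iff)
qed

lemma complex_cotensors_iff:
  "b \<in> cotensors A x \<longleftrightarrow> (\<lambda>vs. Re (b vs)) \<in> cotensors A x \<and> (\<lambda>vs. Im (b vs)) \<in> cotensors A x"
  for b :: "'m tvec list \<Rightarrow> complex"
  unfolding cotensors_def alt_forms_def mem_Collect_eq complex_eq_iff
  by (simp only: all_conj_distrib imp_conjR plus_complex.simps scaleR_complex.simps zero_complex.simps real_scaleR_def conj_ac)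

lemma complex_cotensors_sum:
  assumes a: "\<And>i. i \<in> I \<Longrightarrow> a i \<in> cotensors A x"
  shows "(\<lambda>vs. \<Sum>i\<in>I. z i * of_real (a i vs) :: complex) \<in> cotensors A x"
  unfolding complex_cotensors_iff Re_sum_of_real
  by (intro conjI subspace_sum[OF cotensors_subspace] subspace_scale[OF cotensors_subspace] a)

end

context base_complex
begin

definition bij_at :: "complex \<Rightarrow> 'm \<Rightarrow> bool" where
  "bij_at z y \<longleftrightarrow> bij_betw (z_minus_box0 d0 c0 z y) (cotensors A y) (cotensors A y)"

text \<open>The matrix entries are values of global forms on global fields, so the coefficients are
  smooth on the whole manifold, although they describe the Laplacian only over
  \<open>U\<close>.\<close>

lemma box0_char_poly:
  obtains U N c where "open U" "x \<in> U"
    "\<forall>i. (\<lambda>y. coeff (c y) i) \<in> SF"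
    "\<forall>y. lead_coeff (c y) = 1" "\<forall>y. degree (c y) = N"
    "\<forall>y\<in>U. \<forall>a\<in>cotensors A y. (\<Sum>i\<le>N. coeff (c y) i *\<^sub>R (bx y ^^ i) a) = 0"
    "\<forall>y\<in>U. \<forall>z. bij_at z y \<longrightarrow> poly (map_poly complex_of_real (c y)) z \<noteq> 0"
proof -
  obtain U N J \<beta> where U: "open U" "x \<in> U"
    and J: "\<forall>k<N::nat. set (J k) \<subseteq> VF" and \<beta>: "\<forall>k<N. \<beta> k \<in> forms A"
    and dual: "\<forall>y\<in>U. \<forall>k<N. \<forall>l<N. \<beta> k y (vals (J l) y) = (if k = l then 1 else 0)"
    and expand: "\<forall>y\<in>U. \<forall>a\<in>cotensors A y. a = (\<Sum>k<N. a (vals (J k) y) *\<^sub>R \<beta> k y)"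
    using forms_frame[of x] .
  define F where "F y j k = B0 (\<beta> k) y (vals (J j) y)" for y j k
  define B where "B y = mat N N (\<lambda>(j, k). F y j k)" for y
  define c where "c y = char_poly (B y)" for y
  have Bc: "B y \<in> carrier_mat N N" for y by (simp add: B_def)
  have F_SF: "(\<lambda>y. F y j k) \<in> SF" if "j < N" "k < N" for j k
    unfolding F_def by (rule forms_smooth[OF B0_forms]) (use \<beta> J that in auto)
  have c_SF: "(\<lambda>y. coeff (c y) i) \<in> SF" for i
  proof -
    let ?Q = "\<lambda>p. \<forall>i. (\<lambda>y. coeff (p y) i) \<in> SF"
    have C: "char_poly_matrix (B y) = mat N N (\<lambda>(j, k). [: - F y j k, if j = k then 1 else 0 :])" for y
      unfolding B_def char_poly_matrix_def by (rule eq_matI) auto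
    have "?Q (\<lambda>y. Determinant.det (mat N N (\<lambda>(j, k). [: - F y j k, if j = k then 1 else 0 :])))"
    proof (rule det_family[where Q = ?Q])
      fix j k assume jk: "j < N" "k < N"
      have co: "coeff [:p, q:] i = (if i = 0 then p else if i = 1 then q else 0)" for p q :: real and i
        by (auto simp: coeff_pCons split: nat.split)
      show "\<forall>i. (\<lambda>y. coeff [: - F y j k, if j = k then 1 else 0 :] i) \<in> SF"

      proof
        fix i :: nat
        consider "i = 0" | "i = 1" | "i \<noteq> 0" "i \<noteq> 1" by blast
        then show "(\<lambda>y. coeff [: - F y j k, if j = k then 1 else 0 :] i) \<in> SF"
          unfolding co by cases (simp_all add: smooth_const smooth_uminus[OF F_SF[OF jk]])
      qed
    next
      fix c :: int
      have co: "coeff (of_int c :: real poly) i = (if i = 0 then of_int c else 0)" for i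
        by (auto simp: of_int_poly coeff_pCons split: nat.split)
      show "\<forall>i. (\<lambda>y. coeff (of_int c) i) \<in> SF" unfolding co by (simp add: smooth_const)
    qed (simp_all add: coeff_mult smooth_add smooth_mult smooth_sum)
    then show ?thesis by (simp add: c_def char_poly_def C)
  qed
  have monic: "lead_coeff (c y) = 1" and degc: "degree (c y) = N" for y
    unfolding c_def using degree_monic_char_poly[OF Bc[of y]] by auto
  have bt: "\<beta> k y \<in> cotensors A y" if "k < N" for k y using formsD[of "\<beta> k"] \<beta> that by auto
  have bxb: "bx y (\<beta> k y) = (\<Sum>j<N. F y j k *\<^sub>R \<beta> j y)" if "y \<in> U" "k < N" for y k
    using bspec[OF bspec[OF expand that(1)] bx_fibre[OF bt[OF that(2)]]] by (simp add: F_def on_forms_def)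
  have CH: "(\<Sum>i\<le>N. coeff (c y) i *\<^sub>R (bx y ^^ i) a) = 0" if y: "y \<in> U" and a: "a \<in> cotensors A y" for y a
  proof -
    let ?h = "\<lambda>a. \<Sum>i\<le>N. coeff (c y) i *\<^sub>R (bx y ^^ i) a"
    have lin: "?h (r *\<^sub>R u + t *\<^sub>R v) = r *\<^sub>R ?h u + t *\<^sub>R ?h v" if "u \<in> cotensors A y" "v \<in> cotensors A y" for u v r t
      by (simp only: bx_pow_lin[OF that] scaleR_add_right sum.distrib scaleR_sum_right scaleR_scaleR mult.commute)
    have "?h (\<beta> l y) = 0" if l: "l < N" for l
      unfolding c_def B_def
      by (rule cayley_hamilton_on_basis[OF cotensors_subspace bx_fibre bx_lin, where b = "\<lambda>k. \<beta> k y"])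
        (use bt bxb[OF y] l in auto)
    then have "?h (\<Sum>k<N. a (vals (J k) y) *\<^sub>R \<beta> k y) = 0"
      using linear_on_subspace_sum[where h = ?h and V = "cotensors A y" and I = "{..<N}" and F = "\<lambda>k. \<beta> k y" and c = "\<lambda>k. a (vals (J k) y)",
          OF cotensors_subspace lin] bt
      by simp
    then show ?thesis by (simp only: bspec[OF bspec[OF expand y] a, symmetric])
  qed
  \<comment> \<open>A root gives a complex eigenvector of the matrix, hence a nonzero complex
    cotensor annihilated by \<open>z_minus_box0\<close>, against injectivity.\<close>
  have nz: "poly (map_poly complex_of_real (c y)) z \<noteq> 0" if y: "y \<in> U" and z: "bij_at z y" for y z
  proof
    let ?M = "map_mat complex_of_real (B y)"
    have Mc: "?M \<in> carrier_mat N N" using Bc by simp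
    assume "poly (map_poly complex_of_real (c y)) z = 0"
    then have "eigenvalue ?M z"
      unfolding eigenvalue_root_char_poly[OF Mc] of_real_hom.char_poly_hom[OF Bc] c_def .
    then obtain v where v: "v \<in> carrier_vec N" "v \<noteq> 0\<^sub>v N" "?M *\<^sub>v v = z \<cdot>\<^sub>v v"
      unfolding eigenvalue_def eigenvector_def using Mc by auto
    let ?v = "vec_index v"
    have ev: "(\<Sum>k<N. of_real (F y j k) * ?v k) = z * ?v j" if j: "j < N" for j
    proof -
      have "vec_index (?M *\<^sub>v v) j = (\<Sum>k<N. of_real (F y j k) * ?v k)"
        using j v(1) Bc[of y] unfolding B_def
        by (simp add: scalar_prod_def lessThan_atLeast0)
      then show ?thesis using v(1,3) j by simp
    qed
    let ?b = "\<lambda>vs. \<Sum>k<N. ?v k * complex_of_real (\<beta> k y vs)"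
    have b: "?b \<in> cotensors A y" by (rule complex_cotensors_sum) (use bt in auto)
    have "z_minus_box0 d0 c0 z y ?b = (\<lambda>vs. 0)"
    proof
      fix vs
      have "cext (bx y) ?b vs = (\<Sum>k<N. ?v k * of_real (bx y (\<beta> k y) vs))"
        by (subst cext_sum[OF bx_bundle]) (use bt in auto)
      also have "\<dots> = (\<Sum>k<N. \<Sum>j<N. (of_real (F y j k) * ?v k) * of_real (\<beta> j y vs))"
        by (intro sum.cong refl) (simp add: bxb[OF y] sum_fun_apply sum_distrib_left mult_ac)
      also have "\<dots> = (\<Sum>j<N. (\<Sum>k<N. of_real (F y j k) * ?v k) * of_real (\<beta> j y vs))"
        by (subst sum.swap) (simp add: sum_distrib_right)
      also have "\<dots> = z * ?b vs" by (simp add: ev sum_distrib_left mult.assoc)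
      finally show "z_minus_box0 d0 c0 z y ?b vs = 0" by (simp add: z_minus_box0_def)
    qed
    moreover have z0: "z_minus_box0 d0 c0 z y (\<lambda>vs. 0) = (\<lambda>vs. 0)"
      using cext_sum[OF bx_bundle, of "{}" "\<lambda>_::nat. 0" y "\<lambda>_. 0"] by (simp add: z_minus_box0_def fun_eq_iff)
    moreover have zc: "(\<lambda>vs. 0 :: complex) \<in> cotensors A y"
      using complex_cotensors_sum[of "{}" "\<lambda>_::nat. 0" y "\<lambda>_. 0"] by simp
    moreover have inj: "inj_on (z_minus_box0 d0 c0 z y) (cotensors A y)"
      using z unfolding bij_at_def by (rule bij_betw_imp_inj_on)
    ultimately have b0: "?b = (\<lambda>vs. 0)" by (intro inj_onD[OF inj _ b zc]) (simp only:)
    have "?v k = 0" if k: "k < N" for k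
    proof -
      have "?b (vals (J k) y) = (\<Sum>l<N. if l = k then ?v k else 0)"
        using dual y k by (intro sum.cong refl) auto
      then show ?thesis using fun_cong[OF b0, of "vals (J k) y"] k by simp
    qed
    then have "v = 0\<^sub>v N" using v(1) by (intro eq_vecI) auto
    then show False using v(2) by simp
  qed
  show ?thesis
    by (rule that[OF U, of c N], intro allI, rule c_SF, intro allI, rule monic, intro allI, rule degc,
        intro ballI, erule (1) CH, intro ballI allI impI, erule (1) nz)
qed

text \<open>\<open>u\<close> is the characteristic polynomial with the factor z^r removed, where r
  is the multiplicity of the root 0 at \<open>x\<close>. Near \<open>x\<close> the multiplicity
  remains r because the uniform radius keeps the other roots out of a fixed disc, and semisimplicity
  of 0 reduces the remaining r-th power of the Laplacian to the first.\<close>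

lemma annihilator:
  obtains u N e where "\<forall>j::nat. u j \<in> SF" "\<forall>j>N. \<forall>y. u j y = 0" "e > 0"
    "\<forall>\<^sub>F y in nhds x. \<forall>a\<in>cotensors A y. (\<Sum>j\<le>N. u j y *\<^sub>R (bx y ^^ Suc j) a) = 0"
    "\<forall>\<^sub>F y in nhds x. \<forall>z. cmod z \<le> e \<longrightarrow> (\<Sum>j\<le>N. of_real (u j y) * z ^ j) \<noteq> 0"
    "\<forall>\<^sub>F y in nhds x. \<forall>z. 0 < cmod z \<and> cmod z \<le> e \<longrightarrow> bij_at z y"
proof -
  obtain U N c where U: "open U" "x \<in> U"
    and c: "\<forall>i. (\<lambda>y. coeff (c y) i) \<in> SF"
    and monic: "\<forall>y. lead_coeff (c y) = 1" and degc: "\<forall>y. degree (c y) = N"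
    and CH: "\<forall>y\<in>U. \<forall>a\<in>cotensors A y. (\<Sum>i\<le>N. coeff (c y) i *\<^sub>R (bx y ^^ i) a) = 0"
    and nz: "\<forall>y\<in>U. \<forall>z. bij_at z y \<longrightarrow> poly (map_poly complex_of_real (c y)) z \<noteq> 0"
    using box0_char_poly[of x] .
  obtain e0 :: real where e0: "e0 > 0" "\<forall>\<^sub>F y in nhds x. \<forall>z. 0 < cmod z \<and> cmod z \<le> e0 \<longrightarrow> bij_at z y"
    using spec[OF radius[unfolded locally_uniform_radius_def bij_at_def[symmetric]], of x] by (elim exE conjE)
  define e where "e = min e0 1"
  have e: "0 < e" "e \<le> 1" "e \<le> e0" using e0 by (auto simp: e_def)
  let ?p = "\<lambda>y. map_poly complex_of_real (c y)"
  define r where "r = (LEAST i. coeff (c x) i \<noteq> 0)"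
  have "coeff (c y) N = 1" for y using monic[rule_format, of y] unfolding degc[rule_format] .
  then have cN: "coeff (c y) N \<noteq> 0" for y by (simp only: one_neq_zero not_False_eq_True)
  have r: "coeff (c x) r \<noteq> 0" unfolding r_def by (rule LeastI[of "\<lambda>i. coeff (c x) i \<noteq> 0", OF cN])
  have r_less: "coeff (c x) j = 0" if "j < r" for j
    using not_less_Least[OF that[unfolded r_def]] by (simp only: not_not)
  have cont: "isCont (\<lambda>y. coeff (c y) i) x" for i
    by (rule smooth_near_isCont[OF smooth_near_of_smooth]) (rule spec[OF c])
  have U_ev: "\<forall>\<^sub>F y in nhds x. y \<in> U" by (rule eventually_nhds_in_open[OF U])
  have tend: "((\<lambda>y. coeff (c y) i) \<longlongrightarrow> coeff (c x) i) (nhds x)" for i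
    using tendsto_at_iff_tendsto_nhds[where g = "\<lambda>y. coeff (c y) i" and l = x] cont[of i] unfolding isCont_def by blast
  have r_ev: "\<forall>\<^sub>F y in nhds x. coeff (c y) r \<noteq> 0" by (rule tendsto_imp_eventually_ne[OF tend r])
  \<comment> \<open>By \<open>lowest_coeff_bound\<close> the lowest nonvanishing coefficient has
    modulus at least \<open>e ^ N\<close>. The coefficients below r vanish at \<open>x\<close>, so
    near \<open>x\<close> they are too small to be that one.\<close>
  have small: "\<forall>\<^sub>F y in nhds x. \<forall>j\<in>{..<r}. \<bar>coeff (c y) j\<bar> < e ^ N"
  proof (rule eventually_ball_finite)
    show "\<forall>j\<in>{..<r}. \<forall>\<^sub>F y in nhds x. \<bar>coeff (c y) j\<bar> < e ^ N"
    proof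
      fix j assume "j \<in> {..<r}"
      then show "\<forall>\<^sub>F y in nhds x. \<bar>coeff (c y) j\<bar> < e ^ N"
        using tendstoD[OF tend[of j], of "e ^ N"] r_less[of j] e by (simp add: dist_real_def)
    qed
  qed simp
  have low: "\<forall>\<^sub>F y in nhds x. y \<in> U \<and> (\<forall>j<r. coeff (c y) j = 0) \<and> coeff (c y) r \<noteq> 0 \<and>
      (\<forall>z. 0 < cmod z \<and> cmod z \<le> e \<longrightarrow> bij_at z y)"
    using U_ev small r_ev e0(2)
  proof eventually_elim
    case (elim y)
    have bij: "bij_at z y" if "0 < cmod z" "cmod z \<le> e" for z using elim(4) that e by auto
    define r' where "r' = (LEAST i. coeff (c y) i \<noteq> 0)"
    have r'1: "coeff (c y) r' \<noteq> 0" unfolding r'_def by (rule LeastI[of "\<lambda>i. coeff (c y) i \<noteq> 0", OF cN])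
    have r'2: "coeff (c y) j = 0" if "j < r'" for j
      using not_less_Least[OF that[unfolded r'_def]] by (simp only: not_not)
    have "cmod (coeff (?p y) r') \<ge> e ^ degree (?p y)"
    proof (rule lowest_coeff_bound[OF _ e(1,2)])
      show "poly (?p y) z \<noteq> 0" if "0 < cmod z" "cmod z \<le> e" for z
        by (rule mp[OF spec[OF bspec[OF nz elim(1)]] bij[OF that]])
    qed (use r'1 r'2 monic in \<open>simp_all add: coeff_map_poly degree_map_poly\<close>)
    moreover have "degree (?p y) = N" using degc[rule_format, of y] by (simp add: degree_map_poly)
    ultimately have "e ^ N \<le> \<bar>coeff (c y) r'\<bar>" by (simp add: coeff_map_poly)
    then have "r \<le> r'" using elim(2) by (meson not_le lessThan_iff)
    then show ?case using elim(1,3) r'2 bij by (meson less_le_trans)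
  qed
  obtain V where V: "open V" "x \<in> V" and Vl: "\<And>y. y \<in> V \<Longrightarrow> y \<in> U \<and> (\<forall>j<r. coeff (c y) j = 0) \<and> coeff (c y) r \<noteq> 0 \<and>
      (\<forall>z. 0 < cmod z \<and> cmod z \<le> e \<longrightarrow> bij_at z y)"
    using low unfolding eventually_nhds by blast
  have V_ev: "\<forall>\<^sub>F y in nhds x. y \<in> V" by (rule eventually_nhds_in_open[OF V])
  define u where "u j y = coeff (c y) (j + r)" for j y
  have u_SF: "u j \<in> SF" for j using c by (simp add: u_def[abs_def])
  have u0: "u j y = 0" if "j > N" for j y unfolding u_def using degc that by (intro coeff_eq_0) simp
  have shift: "(\<Sum>i\<le>N. coeff (c y) i *\<^sub>R G i) = (\<Sum>j\<le>N. u j y *\<^sub>R G (j + r))"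
    if "y \<in> V" for y and G :: "nat \<Rightarrow> 'z::real_vector"
  proof -
    have "(\<Sum>i\<le>N. coeff (c y) i *\<^sub>R G i) = (\<Sum>i\<in>{r..N+r}. coeff (c y) i *\<^sub>R G i)"
    proof -
      have "(\<Sum>i\<le>N. coeff (c y) i *\<^sub>R G i) = (\<Sum>i\<in>{r..N}. coeff (c y) i *\<^sub>R G i)"
        using Vl[OF that] by (intro sum.mono_neutral_right) auto
      also have "\<dots> = (\<Sum>i\<in>{r..N+r}. coeff (c y) i *\<^sub>R G i)"
        using degc by (intro sum.mono_neutral_left) (auto simp: coeff_eq_0)
      finally show ?thesis .
    qed
    also have "\<dots> = (\<Sum>j\<in>{0..N}. u j y *\<^sub>R G (j + r))"
      using sum.shift_bounds_cl_nat_ivl[of "\<lambda>i. coeff (c y) i *\<^sub>R G i" 0 r N] by (simp add: u_def)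
    finally show ?thesis by (simp add: atMost_atLeast0)
  qed
  \<comment> \<open>Cayley-Hamilton shows that the r-th power of the Laplacian kills \<gamma>, the
    value of the polynomial u on a form through \<open>a\<close>. A form is needed instead of the
    fibre element \<open>a\<close>, because \<open>B0_power_local\<close> speaks of forms near
    \<open>y\<close>.\<close>
  have ann: "(\<Sum>j\<le>N. u j y *\<^sub>R (bx y ^^ Suc j) a) = 0" if y: "y \<in> V" and a: "a \<in> cotensors A y" for y a
  proof -
    obtain \<alpha> where \<alpha>: "\<alpha> \<in> forms A" "\<alpha> y = a" using form_through[OF a] .
    define \<gamma> where "\<gamma> = (\<Sum>j\<le>N. fmul (u j) ((B0 ^^ j) \<alpha>))"
    have \<gamma>: "\<gamma> \<in> forms A"
      unfolding \<gamma>_def by (intro subspace_sum[OF forms_subspace] fmul_forms u_SF B0_pow_forms \<alpha>(1))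
    have \<gamma>_at: "\<gamma> w = (\<Sum>j\<le>N. u j w *\<^sub>R (bx w ^^ j) (\<alpha> w))" for w
      by (simp only: \<gamma>_def sum_fun_apply fmul_apply B0_pow)
    have pow: "(bx w ^^ i) (\<gamma> w) = (\<Sum>j\<le>N. u j w *\<^sub>R (bx w ^^ (j + i)) (\<alpha> w))" for i w
    proof -
      have "(bx w ^^ i) (\<gamma> w) = (\<Sum>j\<le>N. u j w *\<^sub>R (bx w ^^ i) ((bx w ^^ j) (\<alpha> w)))"
        unfolding \<gamma>_at
        by (rule linear_on_subspace_sum[OF cotensors_subspace bx_pow_lin bx_pow_fibre[OF formsD[OF \<alpha>(1)]]])
      then show ?thesis by (simp only: funpow_add o_apply add.commute[of _ i])
    qed
    have "(B0 ^^ r) \<gamma> w = 0" if w: "w \<in> V" for w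
    proof -
      have "(B0 ^^ r) \<gamma> w = (\<Sum>i\<le>N. coeff (c w) i *\<^sub>R (bx w ^^ i) (\<alpha> w))"
        unfolding B0_pow pow by (rule shift[OF w, symmetric])
      also have "\<dots> = 0" using CH Vl[OF w] formsD[OF \<alpha>(1)] by blast
      finally show ?thesis .
    qed
    then have "B0 \<gamma> y = 0" by (rule B0_power_local[OF \<gamma> V(1) _ y])
    then show ?thesis using pow[of 1 y] \<alpha>(2) by (simp add: on_forms_def)
  qed
  have nonv: "(\<Sum>j\<le>N. of_real (u j y) * z ^ j) \<noteq> 0" if y: "y \<in> V" and z: "cmod z \<le> e" for y z
  proof (cases "z = 0")
    case True
    have "(\<Sum>j\<le>N. of_real (u j y) * z ^ j) = (\<Sum>j\<le>N. if j = 0 then complex_of_real (u 0 y) else 0)"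
      by (intro sum.cong refl) (auto simp: True)
    then show ?thesis using Vl[OF y] by (simp add: u_def)
  next
    case False
    have "poly (?p y) z = (\<Sum>i\<le>N. of_real (coeff (c y) i) * z ^ i)"
      using degc by (simp add: poly_altdef coeff_map_poly degree_map_poly)
    also have "\<dots> = (\<Sum>j\<le>N. of_real (u j y) * z ^ (j + r))"
      using shift[OF y, of "\<lambda>i. z ^ i"] by (simp add: scaleR_conv_of_real)
    also have "\<dots> = (\<Sum>j\<le>N. of_real (u j y) * z ^ j) * z ^ r"
      by (simp add: power_add sum_distrib_right mult.assoc)
    finally have "poly (?p y) z = (\<Sum>j\<le>N. of_real (u j y) * z ^ j) * z ^ r" .
    moreover have "poly (?p y) z \<noteq> 0" using nz Vl[OF y] z False by auto
    ultimately show ?thesis by auto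
  qed
  show ?thesis
    by (rule that[of u N e, OF allI[OF u_SF] _ e(1)])
      (use u0 in blast, (rule eventually_mono[OF V_ev], use ann nonv Vl in blast)+)
qed

text \<open>For \<open>u(z) = \<Sum>\<^sub>j u\<^sub>j z\<^sup>j\<close> with \<open>u(\<box>\<^sub>0)\<box>\<^sub>0 = 0\<close> this is
  \<open>z u(z) (z - \<box>\<^sub>0)\<^sup>-\<^sup>1\<close>, a polynomial in \<open>z\<close>.\<close>

definition res_num :: "(nat \<Rightarrow> real) \<Rightarrow> nat \<Rightarrow> complex \<Rightarrow> 'm \<Rightarrow> ('m tvec list \<Rightarrow> real) \<Rightarrow> 'm tvec list \<Rightarrow> complex" where
  "res_num u N z y a = (\<lambda>vs. \<Sum>(n, j)\<in>(SIGMA n:{..N}. {..n}).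
     of_real (u n) * z ^ (n - j) * of_real ((bx y ^^ j) a vs))"

lemma res_num_eq: "res_num u N z y a vs = (\<Sum>n\<le>N. \<Sum>j\<le>n. of_real (u n) * z ^ (n - j) * of_real ((bx y ^^ j) a vs))"
  unfolding res_num_def by (subst sum.Sigma) auto

text \<open>With L the Laplacian, the inner sum telescopes to z^(n+1) - L^(n+1). Summed against the
  coefficients this is z u(z) - L u(L), and the hypothesis removes the second term.\<close>

lemma res_num_solves:
  assumes ann: "(\<Sum>j\<le>N. u j *\<^sub>R (bx y ^^ Suc j) a) = 0"
  shows "z * res_num u N z y a vs - res_num u N z y (bx y a) vs = z * (\<Sum>j\<le>N. of_real (u j) * z ^ j) * of_real (a vs)"
proof -
  let ?t = "\<lambda>n j. z ^ (Suc n - j) * of_real ((bx y ^^ j) a vs)"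
  have "z * res_num u N z y a vs - res_num u N z y (bx y a) vs
      = (\<Sum>n\<le>N. of_real (u n) * (\<Sum>j\<le>n. ?t n j - ?t n (Suc j)))"
    unfolding res_num_eq sum_distrib_left sum_subtractf[symmetric]
  proof (intro sum.cong refl)
    fix n j assume "n \<in> {..N}" "j \<in> {..n}"
    then have "z ^ (Suc n - j) = z * z ^ (n - j)" by (simp add: Suc_diff_le)
    then show "z * (of_real (u n) * z ^ (n - j) * of_real ((bx y ^^ j) a vs))
        - of_real (u n) * z ^ (n - j) * of_real ((bx y ^^ j) (bx y a) vs)
        = of_real (u n) * (?t n j - ?t n (Suc j))"
      by (simp add: funpow_swap1 algebra_simps)
  qed
  also have "\<dots> = (\<Sum>n\<le>N. of_real (u n) * (z * z ^ n * of_real (a vs) - of_real ((bx y ^^ Suc n) a vs)))"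
  proof (intro sum.cong refl)
    fix n
    have "(\<Sum>j\<le>n. ?t n j - ?t n (Suc j)) = ?t n 0 - ?t n (Suc n)" by (rule sum_telescope)
    then show "of_real (u n) * (\<Sum>j\<le>n. ?t n j - ?t n (Suc j))
        = of_real (u n) * (z * z ^ n * of_real (a vs) - of_real ((bx y ^^ Suc n) a vs))"
      by (simp del: funpow.simps)
  qed
  also have "\<dots> = z * (\<Sum>j\<le>N. of_real (u j) * z ^ j) * of_real (a vs) - of_real ((\<Sum>j\<le>N. u j *\<^sub>R (bx y ^^ Suc j) a) vs)"
    by (simp add: right_diff_distrib sum_subtractf sum_distrib_left sum_distrib_right mult_ac sum_fun_apply del: funpow.simps)
  finally show ?thesis unfolding ann zero_fun_apply of_real_0 diff_zero .
qed

lemma res_num_holomorphic: "(\<lambda>z. res_num u N z y a vs) holomorphic_on S"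
  unfolding res_num_eq by (intro holomorphic_intros)

text \<open>For small z the resolvent is \<open>res_num\<close> divided by z u(z), with u(z)
  nonzero: a simple pole. At z = 0 only the terms with j = n of \<open>res_num\<close> survive, so
  the residue is the polynomial u of the Laplacian over u(0).\<close>

lemma Pi0_formula:
  assumes e: "e > 0" and u: "\<forall>a\<in>cotensors A y. (\<Sum>j\<le>N. u j *\<^sub>R (bx y ^^ Suc j) a) = 0"
    "\<forall>z. cmod z \<le> e \<longrightarrow> (\<Sum>j\<le>N. of_real (u j) * z ^ j) \<noteq> 0"
    "\<forall>z. 0 < cmod z \<and> cmod z \<le> e \<longrightarrow> bij_at z y"
    and a: "a \<in> cotensors A y"
  shows "Pi0 A d0 c0 y a = (\<Sum>j\<le>N. (u j / u 0) *\<^sub>R (bx y ^^ j) a)"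
proof
  fix vs
  let ?U = "\<lambda>z. \<Sum>j\<le>N. of_real (u j) * z ^ j"
  have res: "resolvent0 A d0 c0 z y a vs = (res_num u N z y a vs / ?U z) / z" if z: "0 < cmod z" "cmod z < e" for z
  proof -
    have nz: "z * ?U z \<noteq> 0" using u(2) z by auto
    let ?b = "\<lambda>vs. res_num u N z y a vs / (z * ?U z)"
    let ?I = "SIGMA n:{..N}. {..n}"
    have b_eq: "?b = (\<lambda>vs. \<Sum>p\<in>?I. (of_real (u (fst p)) * z ^ (fst p - snd p) / (z * ?U z)) * of_real ((bx y ^^ snd p) a vs))"
      unfolding res_num_def case_prod_unfold sum_divide_distrib by (intro HOL.ext sum.cong refl) simp
    have b: "?b \<in> cotensors A y" unfolding b_eq by (intro complex_cotensors_sum bx_pow_fibre a)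
    have "cext (bx y) ?b = (\<lambda>vs. \<Sum>p\<in>?I. (of_real (u (fst p)) * z ^ (fst p - snd p) / (z * ?U z)) * of_real (bx y ((bx y ^^ snd p) a) vs))"
      unfolding b_eq by (rule cext_sum[OF bx_bundle bx_pow_fibre[OF a]])
    then have cb: "cext (bx y) ?b = (\<lambda>vs. res_num u N z y (bx y a) vs / (z * ?U z))"
      unfolding res_num_def case_prod_unfold sum_divide_distrib by (simp add: funpow_swap1)
    have eq: "z_minus_box0 d0 c0 z y ?b = (\<lambda>vs. of_real (a vs))"
    proof
      fix vs
      have "z_minus_box0 d0 c0 z y ?b vs = (z * res_num u N z y a vs - res_num u N z y (bx y a) vs) / (z * ?U z)"
        unfolding z_minus_box0_def cb by (simp add: diff_divide_distrib)
      also have "\<dots> = of_real (a vs)"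
        unfolding res_num_solves[OF bspec[OF u(1) a]] using nz by simp
      finally show "z_minus_box0 d0 c0 z y ?b vs = of_real (a vs)" .
    qed
    have "inj_on (z_minus_box0 d0 c0 z y) (cotensors A y)"
      using u(3) z unfolding bij_at_def by (intro bij_betw_imp_inj_on) auto
    then have "resolvent0 A d0 c0 z y a = ?b"
      unfolding resolvent0_def
    proof (intro the_equality conjI)
      fix b' assume "b' \<in> cotensors A y \<and> z_minus_box0 d0 c0 z y b' = (\<lambda>vs. of_real (a vs))"
      then show "b' = ?b" using inj_onD[OF \<open>inj_on (z_minus_box0 d0 c0 z y) (cotensors A y)\<close>, of b' ?b] b eq by (simp only:)
    qed (rule b, rule eq)
    then show ?thesis by (simp add: mult.commute)
  qed
  have "(\<lambda>z. res_num u N z y a vs / ?U z) holomorphic_on ball 0 e"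
    by (intro holomorphic_on_divide res_num_holomorphic holomorphic_intros) (use u(2) in auto)
  then have "small_circle_integral (\<lambda>z. resolvent0 A d0 c0 z y a vs) = res_num u N 0 y a vs / ?U 0"
    by (rule small_circle_integral_eq[OF _ e res])
  also have "res_num u N 0 y a vs = (\<Sum>n\<le>N. of_real (u n) * of_real ((bx y ^^ n) a vs))"
  proof -
    have "(\<Sum>j\<le>n. of_real (u n) * (0::complex) ^ (n - j) * of_real ((bx y ^^ j) a vs))
        = (\<Sum>j\<le>n. if j = n then of_real (u n) * of_real ((bx y ^^ n) a vs) else 0)" for n
      by (intro sum.cong refl) auto
    then show ?thesis unfolding res_num_eq by simp
  qed
  also have "?U 0 = (\<Sum>j\<le>N. if j = 0 then complex_of_real (u 0) else 0)" by (intro sum.cong refl) auto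
  finally show "Pi0 A d0 c0 y a vs = (\<Sum>j\<le>N. (u j / u 0) *\<^sub>R (bx y ^^ j) a) vs"
    by (simp add: Pi0_def sum_fun_apply sum_divide_distrib Re_divide_of_real)
qed

end

text \<open>\<open>S\<close> is the projection onto the kernel of \<open>L\<close> that kills its
  image. \<open>G\<close> comes from F(z) = (u(z) - u(0)) / (u(0) z), now with u as a polynomial: L
  F(L) = S - 1, so - F(L) inverts \<open>L\<close> up to \<open>S\<close>. Since S F(L) is
  \<open>u 1 / u 0\<close> times \<open>S\<close>, adding this multiple of \<open>S\<close> to -
  F(L) achieves S G = 0, the normalisation that makes the solution unique.\<close>

lemma spectral_splitting:
  fixes L :: "'a::real_vector \<Rightarrow> 'a" and u :: "nat \<Rightarrow> real" and N :: nat
  defines "S \<equiv> \<lambda>a. \<Sum>j\<le>N. (u j / u 0) *\<^sub>R (L ^^ j) a"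
    and "G \<equiv> \<lambda>a. \<Sum>j\<le>N. (u 1 / u 0 * (u j / u 0) - u (Suc j) / u 0) *\<^sub>R (L ^^ j) a"
  assumes V: "subspace V" and LV_ball: "\<forall>v\<in>V. L v \<in> V"
    and lin_ball: "\<forall>u\<in>V. \<forall>v\<in>V. \<forall>r t. L (r *\<^sub>R u + t *\<^sub>R v) = r *\<^sub>R L u + t *\<^sub>R L v"
    and ann_ball: "\<forall>a\<in>V. (\<Sum>j\<le>N. u j *\<^sub>R (L ^^ Suc j) a) = 0"
    and u0: "u 0 \<noteq> 0" and uN: "u (Suc N) = 0" and a: "a \<in> V"
  shows "L (S a) = 0" "S (L a) = 0" "L a = 0 \<Longrightarrow> S a = a"
    and "G a \<in> V" "L (G a) = a - S a" "S (G a) = 0"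
    and "\<And>b. b \<in> V \<Longrightarrow> L b = a - S a \<Longrightarrow> S b = 0 \<Longrightarrow> b = G a"
proof -
  note LV = bspec[OF LV_ball] and lin = bspec[OF bspec[OF lin_ball], rule_format] and ann = bspec[OF ann_ball]
  have powV: "(L ^^ j) v \<in> V" if "v \<in> V" for j v using that LV by (induction j) auto
  have L_sum: "L (\<Sum>j\<in>I. c j *\<^sub>R (L ^^ j) v) = (\<Sum>j\<in>I. c j *\<^sub>R (L ^^ Suc j) v)" if "v \<in> V" for c I v
    using linear_on_subspace_sum[where h = L, OF V lin, of I "\<lambda>j. (L ^^ j) v" c] powV[OF that] by simp
  have pow_lin: "(L ^^ i) (r *\<^sub>R v + t *\<^sub>R w) = r *\<^sub>R (L ^^ i) v + t *\<^sub>R (L ^^ i) w" if "v \<in> V" "w \<in> V" for i v w r t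
    using that lin powV by (induction i) auto
  have S_lin: "S (r *\<^sub>R v + t *\<^sub>R w) = r *\<^sub>R S v + t *\<^sub>R S w" if "v \<in> V" "w \<in> V" for v w r t
    unfolding S_def using that by (simp add: pow_lin scaleR_add_right sum.distrib scaleR_sum_right mult.commute)
  have SV: "S v \<in> V" if "v \<in> V" for v unfolding S_def using that by (intro subspace_sum[OF V] subspace_scale[OF V] powV)
  have ann': "(\<Sum>j\<le>N. (u j / u 0) *\<^sub>R (L ^^ Suc j) v) = 0" if "v \<in> V" for v
  proof -
    have "(\<Sum>j\<le>N. (u j / u 0) *\<^sub>R (L ^^ Suc j) v) = (1 / u 0) *\<^sub>R (\<Sum>j\<le>N. u j *\<^sub>R (L ^^ Suc j) v)"
      by (simp add: scaleR_sum_right del: funpow.simps)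
    then show ?thesis using ann[OF that] by (simp del: funpow.simps)
  qed
  have LS: "L (S v) = 0" if "v \<in> V" for v unfolding S_def L_sum[OF that] by (rule ann'[OF that])
  have SL: "S (L v) = 0" if "v \<in> V" for v
    using ann'[OF that] unfolding S_def by (simp only: funpow_Suc_right o_apply)
  have L0: "L 0 = 0" using lin[of 0 0 0 0] subspace_0[OF V] by simp
  have ker: "S v = v" if "v \<in> V" "L v = 0" for v
  proof -
    have "(L ^^ Suc j) v = 0" for j using that(2) L0 by (induction j) simp_all
    then have "(u (Suc j) / u 0) *\<^sub>R (L ^^ Suc j) v = 0" for j by (simp only: scaleR_zero_right)
    then have "(u j / u 0) *\<^sub>R (L ^^ j) v = (if j = 0 then v else 0)" for j
      using u0 by (cases j) (simp_all del: funpow.simps add: funpow_0)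
    then show ?thesis by (simp add: S_def)
  qed
  have SS: "S (S v) = S v" if "v \<in> V" for v by (rule ker[OF SV LS]) (use that in auto)
  let ?F = "\<lambda>a. \<Sum>j\<le>N. (u (Suc j) / u 0) *\<^sub>R (L ^^ j) a"
  have FV: "?F a \<in> V" by (intro subspace_sum[OF V] subspace_scale[OF V] powV a)
  have G: "G a = (u 1 / u 0) *\<^sub>R S a + (- 1) *\<^sub>R ?F a"
    by (simp add: G_def S_def scaleR_diff_left sum_subtractf scaleR_sum_right flip: sum_negf)
  show GV: "G a \<in> V" unfolding G by (intro subspace_add[OF V] subspace_scale[OF V] SV FV a)
  have "(\<Sum>j\<le>Suc N. (u j / u 0) *\<^sub>R (L ^^ j) a) = S a" by (simp add: S_def uN)
  moreover have "(\<Sum>j\<le>Suc N. (u j / u 0) *\<^sub>R (L ^^ j) a) = a + L (?F a)"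
    unfolding sum.atMost_Suc_shift L_sum[OF a] using u0 by (simp del: sum.atMost_Suc)
  ultimately have LF: "L (?F a) = S a - a" by (simp add: algebra_simps)
  show LG: "L (G a) = a - S a"
    unfolding G lin[OF SV[OF a] FV] LS[OF a] LF by simp
  have "S (?F a) = (\<Sum>j\<le>N. (u (Suc j) / u 0) *\<^sub>R S ((L ^^ j) a))"
    by (rule linear_on_subspace_sum[where h = S, OF V S_lin powV[OF a]])
  also have "\<dots> = (\<Sum>j\<le>N. if j = 0 then (u 1 / u 0) *\<^sub>R S a else 0)"
  proof (intro sum.cong refl)
    fix j show "(u (Suc j) / u 0) *\<^sub>R S ((L ^^ j) a) = (if j = 0 then (u 1 / u 0) *\<^sub>R S a else 0)"
      using SL[OF powV[OF a]] by (cases j) auto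
  qed
  finally show SG: "S (G a) = 0" unfolding G S_lin[OF SV[OF a] FV] by (simp add: SS[OF a])
  show "L (S a) = 0" "S (L a) = 0" "L a = 0 \<Longrightarrow> S a = a" using LS SL ker a by blast+
  fix b assume b: "b \<in> V" "L b = a - S a" "S b = 0"
  have bG: "b - G a \<in> V" by (rule subspace_diff[OF V b(1) GV])
  have "L (b - G a) = 0" using lin[OF b(1) GV, of 1 "- 1"] LG b(2) by simp
  then have "b - G a = S (b - G a)" using ker[OF bG] by simp
  also have "\<dots> = 0" using S_lin[OF b(1) GV, of 1 "- 1"] SG b(3) by simp
  finally show "b = G a" by simp
qed

context base_complex
begin

text \<open>Near each point a polynomial in the algebraic Laplacian with smooth coefficients, both
  depending on the point. This form gives at once smoothness, weight 0, degree 0 and commutation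
  with whatever commutes with the Laplacian.\<close>

definition local_poly :: "'m bundle_map \<Rightarrow> bool" where
  "local_poly T \<longleftrightarrow> (\<forall>x. \<exists>N f. (\<forall>j::nat. f j \<in> SF) \<and>
     (\<forall>\<^sub>F y in nhds x. \<forall>a\<in>cotensors A y. T y a = (\<Sum>j\<le>N. f j y *\<^sub>R (bx y ^^ j) a)))"

lemma oper_B0_pow: "oper 0 0 (B0 ^^ j)"
proof (induction j)
  case 0
  have "(B0 ^^ 0) = (\<lambda>\<alpha>. \<alpha>)" by (rule HOL.ext) (simp only: funpow.simps id_apply)
  then show ?case by (simp only: oper_id)
next
  case (Suc j)
  have "oper (0 + 0) (0 + 0) (\<lambda>\<alpha>. B0 ((B0 ^^ j) \<alpha>))" by (rule oper_comp[OF oper_B0 Suc])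
  moreover have "(B0 ^^ Suc j) = (\<lambda>\<alpha>. B0 ((B0 ^^ j) \<alpha>))" by (rule HOL.ext) (simp only: funpow.simps o_apply)
  ultimately show ?case by (simp only: add_0_left)
qed

lemma oper_degree_zero:
  assumes T: "oper w j T" and \<alpha>: "\<alpha> \<in> forms_deg A k" and vs: "int (length vs) \<noteq> int k + j"
  shows "T \<alpha> x vs = 0"
proof -
  have f: "\<alpha> \<in> forms A" using \<alpha> by (simp add: forms_deg_def)
  have "deg_proj (int k) \<alpha> = \<alpha>"
    using \<alpha> by (intro HOL.ext) (auto simp: deg_proj_apply forms_deg_def has_degree_def)
  then have "T \<alpha> = deg_proj (int k + j) (T \<alpha>)" using oper_deg[OF T f, of "int k"] by (simp only:)
  then have "T \<alpha> x vs = deg_proj (int k + j) (T \<alpha>) x vs" by (rule arg_cong)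
  then show ?thesis using vs by (simp add: deg_proj_apply)
qed

context
  fixes T :: "'m bundle_map" assumes T: "local_poly T"
begin

lemma local_poly_at:
  obtains N c where "\<forall>a\<in>cotensors A y. T y a = (\<Sum>j\<le>N::nat. c j *\<^sub>R (bx y ^^ j) a)"
proof -
  obtain N f where "\<forall>\<^sub>F z in nhds y. \<forall>a\<in>cotensors A z. T z a = (\<Sum>j\<le>N. (f :: nat \<Rightarrow> 'm \<Rightarrow> real) j z *\<^sub>R (bx z ^^ j) a)"
    using T[unfolded local_poly_def, rule_format, of y] by (elim exE conjE)
  from eventually_nhds_x_imp_x[OF this] show ?thesis by (rule that)
qed

lemma local_poly_bundle: "smooth_bundle_map A T"
  unfolding smooth_bundle_map_def
proof (intro conjI allI ballI)
  fix y and a :: "'m tvec list \<Rightarrow> real" assume a: "a \<in> cotensors A y"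
  obtain N c where c: "\<forall>a\<in>cotensors A y. T y a = (\<Sum>j\<le>N::nat. c j *\<^sub>R (bx y ^^ j) a)" using local_poly_at .
  show "T y a \<in> cotensors A y"
    unfolding bspec[OF c a] by (intro subspace_sum[OF cotensors_subspace] subspace_scale[OF cotensors_subspace] bx_pow_fibre a)
  fix b :: "'m tvec list \<Rightarrow> real" and r t :: real assume b: "b \<in> cotensors A y"
  have ab: "r *\<^sub>R a + t *\<^sub>R b \<in> cotensors A y"
    by (intro subspace_add[OF cotensors_subspace] subspace_scale[OF cotensors_subspace] a b)
  show "T y (r *\<^sub>R a + t *\<^sub>R b) = r *\<^sub>R T y a + t *\<^sub>R T y b"
    unfolding bspec[OF c a] bspec[OF c b] bspec[OF c ab] bx_pow_lin[OF a b]
    by (simp only: scaleR_add_right sum.distrib scaleR_sum_right scaleR_scaleR mult.commute)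
next
  fix \<alpha> :: "('m, real) form" assume \<alpha>: "\<alpha> \<in> forms A"
  show "on_forms T \<alpha> \<in> forms A"
  proof (rule forms_glue)
    fix x
    obtain N and f :: "nat \<Rightarrow> 'm \<Rightarrow> real" where f: "\<forall>j. f j \<in> SF"
      "\<forall>\<^sub>F y in nhds x. \<forall>a\<in>cotensors A y. T y a = (\<Sum>j\<le>N. f j y *\<^sub>R (bx y ^^ j) a)"
      using T[unfolded local_poly_def, rule_format, of x] by (elim exE conjE)
    let ?\<eta> = "\<Sum>j\<le>N. fmul (f j) ((B0 ^^ j) \<alpha>)"
    have "?\<eta> \<in> forms A"
      using f(1) by (intro subspace_sum[OF forms_subspace] fmul_forms B0_pow_forms \<alpha>) simp
    moreover have "\<forall>\<^sub>F y in nhds x. ?\<eta> y = on_forms T \<alpha> y"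
      using f(2)
    proof (rule eventually_mono)
      fix y assume *: "\<forall>a\<in>cotensors A y. T y a = (\<Sum>j\<le>N. f j y *\<^sub>R (bx y ^^ j) a)"
      show "?\<eta> y = on_forms T \<alpha> y"
        unfolding on_forms_def[of T] bspec[OF * formsD[OF \<alpha>]] by (simp only: sum_fun_apply fmul_apply B0_pow)
    qed
    ultimately show "\<exists>\<eta>\<in>forms A. \<forall>\<^sub>F y in nhds x. \<eta> y = on_forms T \<alpha> y" by (intro bexI[of _ ?\<eta>])
  qed
qed

lemma on_forms_local_poly:
  obtains N c where "\<forall>\<alpha>\<in>forms A. on_forms T \<alpha> y = (\<Sum>j\<le>N::nat. c j *\<^sub>R (B0 ^^ j) \<alpha> y)"
proof -
  obtain N c where c: "\<forall>a\<in>cotensors A y. T y a = (\<Sum>j\<le>N::nat. c j *\<^sub>R (bx y ^^ j) a)" using local_poly_at .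
  have "on_forms T \<alpha> y = (\<Sum>j\<le>N. c j *\<^sub>R (B0 ^^ j) \<alpha> y)" if "\<alpha> \<in> forms A" for \<alpha>
    unfolding B0_pow on_forms_def[of T] by (rule bspec[OF c formsD[OF that]])
  then show ?thesis by (intro that ballI)
qed

lemma local_poly_oper: "oper 0 0 (on_forms T)"
proof (rule bundle_oper[OF local_poly_bundle])
  show "respects_filtration A H (on_forms T)"
    unfolding respects_filtration_def
  proof (intro allI image_subsetI)
    fix w and \<alpha> :: "('m, real) form" assume \<alpha>: "\<alpha> \<in> FW w"
    have "on_forms T \<alpha> y \<in> weight_ge w y" for y
    proof -
      obtain N c where c: "\<forall>\<alpha>\<in>forms A. on_forms T \<alpha> y = (\<Sum>j\<le>N::nat. c j *\<^sub>R (B0 ^^ j) \<alpha> y)" using on_forms_local_poly .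
      have "(B0 ^^ j) \<alpha> \<in> FW w" for j using oper_weight[OF oper_B0_pow \<alpha>, of j] by (simp only: add_0_right)
      then show ?thesis
        unfolding bspec[OF c FW_forms[OF \<alpha>]]
        by (intro subspace_sum[OF weight_ge_subspace] subspace_scale[OF weight_ge_subspace] FW_weight)
    qed
    then show "on_forms T \<alpha> \<in> FW w"
      by (simp add: FW_iff bundle_forms[OF local_poly_bundle FW_forms[OF \<alpha>]])
  qed
next
  fix k and \<alpha> :: "('m, real) form" and x and vs :: "'m tvec list"
  assume \<alpha>: "\<alpha> \<in> forms_deg A k" and vs: "int (length vs) \<noteq> int k + 0"
  obtain N c where c: "\<forall>\<alpha>\<in>forms A. on_forms T \<alpha> x = (\<Sum>j\<le>N::nat. c j *\<^sub>R (B0 ^^ j) \<alpha> x)" using on_forms_local_poly .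
  have f: "\<alpha> \<in> forms A" using \<alpha> by (simp add: forms_deg_def)
  show "on_forms T \<alpha> x vs = 0"
    unfolding bspec[OF c f] sum_fun_apply scaleR_fun_apply oper_degree_zero[OF oper_B0_pow \<alpha> vs] by simp
qed

lemma local_poly_commute:
  assumes S: "smooth_bundle_map A S" and c: "\<And>y a. a \<in> cotensors A y \<Longrightarrow> bx y (S y a) = S y (bx y a)" and \<alpha>: "\<alpha> \<in> forms A"
  shows "on_forms T (on_forms S \<alpha>) = on_forms S (on_forms T \<alpha>)"
proof
  fix y
  obtain N k where k: "\<forall>a\<in>cotensors A y. T y a = (\<Sum>j\<le>N::nat. k j *\<^sub>R (bx y ^^ j) a)" using local_poly_at .
  note a = formsD[OF \<alpha>, of y]
  have "(bx y ^^ j) (S y (\<alpha> y)) = S y ((bx y ^^ j) (\<alpha> y))" for j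
  proof (induction j)
    case (Suc j)
    then show ?case using c[OF bx_pow_fibre[OF a]] by (simp only: funpow.simps o_apply)
  qed (simp only: funpow_0)
  then have "T y (S y (\<alpha> y)) = (\<Sum>j\<le>N. k j *\<^sub>R S y ((bx y ^^ j) (\<alpha> y)))"
    unfolding bspec[OF k bundle_fibre[OF S a]] by (simp only:)
  also have "\<dots> = S y (T y (\<alpha> y))"
    unfolding bspec[OF k a] by (rule bundle_sum[OF S bx_pow_fibre[OF a], symmetric])
  finally show "on_forms T (on_forms S \<alpha>) y = on_forms S (on_forms T \<alpha>) y" by (simp only: on_forms_def)
qed

end

section \<open>The spectral projection and the Green operator of the algebraic Laplacian\<close>

abbreviation "pi0 \<equiv> Pi0 A d0 c0"
abbreviation "Prj \<equiv> on_forms pi0"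

text \<open>The Green operator, normalised to vanish under the projection. It is fixed by equations
  because the polynomial in \<open>spectral_splitting\<close> depends on a local choice of
  \<open>u\<close>.\<close>

definition q0 :: "'m bundle_map" where
  "q0 y a = (THE b. b \<in> cotensors A y \<and> bx y b = a - pi0 y a \<and> pi0 y b = 0)"

abbreviation "Q0 \<equiv> on_forms q0"

lemma local_splitting:
  obtains u N v where "\<forall>j::nat. u j \<in> SF" "v \<in> SF"
    "\<forall>\<^sub>F y in nhds x. u 0 y \<noteq> 0 \<and> v y = 1 / u 0 y \<and> u (Suc N) y = 0 \<and>
      (\<forall>a\<in>cotensors A y. (\<Sum>j\<le>N. u j y *\<^sub>R (bx y ^^ Suc j) a) = 0) \<and>
      (\<forall>a\<in>cotensors A y. pi0 y a = (\<Sum>j\<le>N. (u j y / u 0 y) *\<^sub>R (bx y ^^ j) a))"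
proof -
  obtain u N e where u: "\<forall>j::nat. u j \<in> SF" "\<forall>j>N. \<forall>y. u j y = 0" "e > 0"
    "\<forall>\<^sub>F y in nhds x. \<forall>a\<in>cotensors A y. (\<Sum>j\<le>N. u j y *\<^sub>R (bx y ^^ Suc j) a) = 0"
    "\<forall>\<^sub>F y in nhds x. \<forall>z. cmod z \<le> e \<longrightarrow> (\<Sum>j\<le>N. of_real (u j y) * z ^ j) \<noteq> 0"
    "\<forall>\<^sub>F y in nhds x. \<forall>z. 0 < cmod z \<and> cmod z \<le> e \<longrightarrow> bij_at z y"
    using annihilator[of x] .
  have u0: "\<forall>\<^sub>F y in nhds x. u 0 y \<noteq> 0"
    using u(5)
  proof (rule eventually_mono)
    fix y assume nz: "\<forall>z. cmod z \<le> e \<longrightarrow> (\<Sum>j\<le>N. of_real (u j y) * z ^ j) \<noteq> 0"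
    have "(\<Sum>j\<le>N. of_real (u j y) * (0::complex) ^ j) = (\<Sum>j\<le>N. if j = 0 then of_real (u 0 y) else 0)"
      by (intro sum.cong refl) auto
    then show "u 0 y \<noteq> 0" using spec[OF nz, of 0] u(3) by auto
  qed
  obtain W where W: "open W" "x \<in> W" "\<And>y. y \<in> W \<Longrightarrow> u 0 y \<noteq> 0" using u0 unfolding eventually_nhds by blast
  have "smooth_near A y (\<lambda>y. inverse (u 0 y))" if "y \<in> W" for y
    by (rule smooth_near_inverse[OF smooth_near_of_smooth[OF spec[OF u(1)]] W(3)[OF that]])
  then obtain v where v: "v \<in> SF" "\<forall>\<^sub>F y in nhds x. v y = inverse (u 0 y)"
    using smooth_extension[OF W(1,2)] by blast
  have uSN: "u (Suc N) y = 0" for y by (rule u(2)[rule_format]) simp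
  show ?thesis
  proof (rule that[OF u(1) v(1)])
    show "\<forall>\<^sub>F y in nhds x. u 0 y \<noteq> 0 \<and> v y = 1 / u 0 y \<and> u (Suc N) y = 0 \<and>
      (\<forall>a\<in>cotensors A y. (\<Sum>j\<le>N. u j y *\<^sub>R (bx y ^^ Suc j) a) = 0) \<and>
      (\<forall>a\<in>cotensors A y. pi0 y a = (\<Sum>j\<le>N. (u j y / u 0 y) *\<^sub>R (bx y ^^ j) a))"
      using u0 v(2) u(4,5,6)
    proof eventually_elim
      case (elim y)
      have "pi0 y a = (\<Sum>j\<le>N. (u j y / u 0 y) *\<^sub>R (bx y ^^ j) a)" if "a \<in> cotensors A y" for a
        by (rule Pi0_formula[OF u(3) elim(3-5) that])
      then show ?case using elim(1-3) by (intro conjI ballI uSN) (simp_all add: inverse_eq_divide)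
    qed
  qed
qed

text \<open>The first six claims need one admissible \<open>u\<close> at \<open>y\<close>, which
  \<open>local_splitting\<close> provides. The last is stated for every admissible \<open>u\<close>,
  so that a single family of smooth coefficients describes \<open>q0\<close> on a whole
  neighbourhood.\<close>

lemma splitting_at:
  assumes a: "a \<in> cotensors A y"
  shows "bx y (pi0 y a) = 0" "pi0 y (bx y a) = 0" "bx y a = 0 \<Longrightarrow> pi0 y a = a"
    and "q0 y a \<in> cotensors A y" "bx y (q0 y a) = a - pi0 y a" "pi0 y (q0 y a) = 0"
    and "u 0 y \<noteq> 0 \<Longrightarrow> u (Suc N) y = 0 \<Longrightarrow> \<forall>a\<in>cotensors A y. (\<Sum>j\<le>N. u j y *\<^sub>R (bx y ^^ Suc j) a) = 0 \<Longrightarrow>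
      \<forall>a\<in>cotensors A y. pi0 y a = (\<Sum>j\<le>N. (u j y / u 0 y) *\<^sub>R (bx y ^^ j) a) \<Longrightarrow>
      q0 y a = (\<Sum>j\<le>N. (u 1 y / u 0 y * (u j y / u 0 y) - u (Suc j) y / u 0 y) *\<^sub>R (bx y ^^ j) a)"
proof -
  have main: "bx y (pi0 y a) = 0 \<and> pi0 y (bx y a) = 0 \<and> (bx y a = 0 \<longrightarrow> pi0 y a = a) \<and>
      q0 y a \<in> cotensors A y \<and> bx y (q0 y a) = a - pi0 y a \<and> pi0 y (q0 y a) = 0 \<and>
      q0 y a = (\<Sum>j\<le>N. (u 1 y / u 0 y * (u j y / u 0 y) - u (Suc j) y / u 0 y) *\<^sub>R (bx y ^^ j) a)"
    if u: "u 0 y \<noteq> 0" "u (Suc N) y = 0" "\<forall>a\<in>cotensors A y. (\<Sum>j\<le>N. u j y *\<^sub>R (bx y ^^ Suc j) a) = 0"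
      "\<forall>a\<in>cotensors A y. pi0 y a = (\<Sum>j\<le>N. (u j y / u 0 y) *\<^sub>R (bx y ^^ j) a)" for u :: "nat \<Rightarrow> 'm \<Rightarrow> real" and N
  proof -
    let ?G = "\<Sum>j\<le>N. (u 1 y / u 0 y * (u j y / u 0 y) - u (Suc j) y / u 0 y) *\<^sub>R (bx y ^^ j) a"
    let ?S = "\<lambda>a. \<Sum>j\<le>N. (u j y / u 0 y) *\<^sub>R (bx y ^^ j) a"
    have bxf: "\<forall>v\<in>cotensors A y. bx y v \<in> cotensors A y" by (intro ballI bx_fibre)
    have bxl: "\<forall>u\<in>cotensors A y. \<forall>v\<in>cotensors A y. \<forall>r t. bx y (r *\<^sub>R u + t *\<^sub>R v) = r *\<^sub>R bx y u + t *\<^sub>R bx y v"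
      by (intro ballI allI bx_lin)
    note split = spectral_splitting[where V = "cotensors A y" and L = "bx y" and u = "\<lambda>j. u j y" and N = N and a = a,
        OF cotensors_subspace bxf bxl u(3,1,2) a]
    have S: "pi0 y b = ?S b" if "b \<in> cotensors A y" for b by (rule bspec[OF u(4) that])
    have q: "q0 y a = ?G"
      unfolding q0_def
    proof (rule the_equality)
      show "?G \<in> cotensors A y \<and> bx y ?G = a - pi0 y a \<and> pi0 y ?G = 0"
        unfolding S[OF a] S[OF split(4)] by (intro conjI split(4-6))
      fix b assume b: "b \<in> cotensors A y \<and> bx y b = a - pi0 y a \<and> pi0 y b = 0"
      then have "bx y b = a - ?S a" "?S b = 0" using S[OF a] S[of b] by (simp_all only:)
      then show "b = ?G" using b by (intro split(7)) (simp_all only:)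
    qed
    show ?thesis
      unfolding S[OF a] S[OF bx_fibre[OF a]] q S[OF split(4)] by (intro conjI impI split(1-6) refl)
  qed
  obtain u N v where "\<forall>j::nat. u j \<in> SF" "v \<in> SF" and ev: "\<forall>\<^sub>F y in nhds y. u 0 y \<noteq> 0 \<and> v y = 1 / u 0 y \<and> u (Suc N) y = 0 \<and>
      (\<forall>a\<in>cotensors A y. (\<Sum>j\<le>N. u j y *\<^sub>R (bx y ^^ Suc j) a) = 0) \<and>
      (\<forall>a\<in>cotensors A y. pi0 y a = (\<Sum>j\<le>N. (u j y / u 0 y) *\<^sub>R (bx y ^^ j) a))"
    using local_splitting[of y] .
  note uv = eventually_nhds_x_imp_x[OF ev]
  note m = main[where u = u and N = N, OF conjunct1[OF uv] conjunct1[OF conjunct2[OF conjunct2[OF uv]]]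
    conjunct1[OF conjunct2[OF conjunct2[OF conjunct2[OF uv]]]] conjunct2[OF conjunct2[OF conjunct2[OF conjunct2[OF uv]]]]]
  note m2 = conjunct2[OF m] note m3 = conjunct2[OF m2] note m4 = conjunct2[OF m3]
  note m5 = conjunct2[OF m4] note m6 = conjunct2[OF m5]
  show "bx y (pi0 y a) = 0" "pi0 y (bx y a) = 0" by (rule conjunct1[OF m], rule conjunct1[OF m2])
  show "q0 y a \<in> cotensors A y" "bx y (q0 y a) = a - pi0 y a" "pi0 y (q0 y a) = 0"
    by (rule conjunct1[OF m4], rule conjunct1[OF m5], rule conjunct1[OF m6])
  show "pi0 y a = a" if "bx y a = 0" by (rule mp[OF conjunct1[OF m3] that])
  show "q0 y a = (\<Sum>j\<le>N. (u 1 y / u 0 y * (u j y / u 0 y) - u (Suc j) y / u 0 y) *\<^sub>R (bx y ^^ j) a)"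
    if "u 0 y \<noteq> 0" "u (Suc N) y = 0" "\<forall>a\<in>cotensors A y. (\<Sum>j\<le>N. u j y *\<^sub>R (bx y ^^ Suc j) a) = 0"
      "\<forall>a\<in>cotensors A y. pi0 y a = (\<Sum>j\<le>N. (u j y / u 0 y) *\<^sub>R (bx y ^^ j) a)" for u :: "nat \<Rightarrow> 'm \<Rightarrow> real" and N
    using main[where u = u and N = N, OF that] by (elim conjE)
qed

lemma pi0_local_poly: "local_poly pi0" and q0_local_poly: "local_poly q0"
proof -
  have "(\<exists>N f. (\<forall>j::nat. f j \<in> SF) \<and> (\<forall>\<^sub>F y in nhds x. \<forall>a\<in>cotensors A y. pi0 y a = (\<Sum>j\<le>N. f j y *\<^sub>R (bx y ^^ j) a))) \<and>
    (\<exists>N f. (\<forall>j::nat. f j \<in> SF) \<and> (\<forall>\<^sub>F y in nhds x. \<forall>a\<in>cotensors A y. q0 y a = (\<Sum>j\<le>N. f j y *\<^sub>R (bx y ^^ j) a)))" for x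
  proof -
    obtain u N v where u: "\<forall>j::nat. u j \<in> SF" and v: "v \<in> SF" and ev: "\<forall>\<^sub>F y in nhds x. u 0 y \<noteq> 0 \<and> v y = 1 / u 0 y \<and> u (Suc N) y = 0 \<and>
        (\<forall>a\<in>cotensors A y. (\<Sum>j\<le>N. u j y *\<^sub>R (bx y ^^ Suc j) a) = 0) \<and>
        (\<forall>a\<in>cotensors A y. pi0 y a = (\<Sum>j\<le>N. (u j y / u 0 y) *\<^sub>R (bx y ^^ j) a))"
      using local_splitting[of x] .
    have us: "u j \<in> SF" for j using u by (rule spec)
    let ?f = "\<lambda>j y. u j y * v y" and ?g = "\<lambda>j y. u 1 y * v y * (u j y * v y) - u (Suc j) y * v y"
    have "?f j \<in> SF" "?g j \<in> SF" for j by (intro smooth_mult smooth_diff us v)+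
    moreover have "\<forall>\<^sub>F y in nhds x. \<forall>a\<in>cotensors A y. pi0 y a = (\<Sum>j\<le>N. ?f j y *\<^sub>R (bx y ^^ j) a)"
      using ev
    proof (rule eventually_mono, elim conjE)
      fix y assume h: "v y = 1 / u 0 y" "\<forall>a\<in>cotensors A y. pi0 y a = (\<Sum>j\<le>N. (u j y / u 0 y) *\<^sub>R (bx y ^^ j) a)"
      have "u j y * v y = u j y / u 0 y" for j by (simp add: h(1))
      then show "\<forall>a\<in>cotensors A y. pi0 y a = (\<Sum>j\<le>N. ?f j y *\<^sub>R (bx y ^^ j) a)" using h(2) by (simp only:)
    qed
    moreover have "\<forall>\<^sub>F y in nhds x. \<forall>a\<in>cotensors A y. q0 y a = (\<Sum>j\<le>N. ?g j y *\<^sub>R (bx y ^^ j) a)"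
      using ev
    proof (rule eventually_mono, elim conjE)
      fix y assume h: "v y = 1 / u 0 y" and w: "u 0 y \<noteq> 0" "u (Suc N) y = 0"
          "\<forall>a\<in>cotensors A y. (\<Sum>j\<le>N. u j y *\<^sub>R (bx y ^^ Suc j) a) = 0"
          "\<forall>a\<in>cotensors A y. pi0 y a = (\<Sum>j\<le>N. (u j y / u 0 y) *\<^sub>R (bx y ^^ j) a)"
      have "u j y * v y = u j y / u 0 y" for j by (simp add: h)
      then show "\<forall>a\<in>cotensors A y. q0 y a = (\<Sum>j\<le>N. ?g j y *\<^sub>R (bx y ^^ j) a)"
        using splitting_at(7)[where u = u and N = N, OF _ w] by (intro ballI) (simp only:)
    qed
    ultimately show ?thesis by (intro conjI exI[of _ N]) (rule exI[of _ ?f], blast, rule exI[of _ ?g], blast)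
  qed
  then show "local_poly pi0" "local_poly q0" unfolding local_poly_def by blast+
qed

lemmas oper_Pi = local_poly_oper[OF pi0_local_poly] and oper_Q0 = local_poly_oper[OF q0_local_poly]

lemma bx_commute:
  assumes a: "a \<in> cotensors A y"
  shows "bx y (c0 y a) = c0 y (bx y a)" "bx y (d0 y a) = d0 y (bx y a)"
proof -
  have "c0 y (c0 y b) = 0 \<and> d0 y (d0 y b) = 0" if b: "b \<in> cotensors A y" for b
  proof -
    obtain \<beta> where \<beta>: "\<beta> \<in> forms A" "\<beta> y = b" using form_through[OF b] .
    have "C0 (C0 \<beta>) y = 0" "D0 (D0 \<beta>) y = 0" using C0_C0[OF \<beta>(1)] D0_D0[OF \<beta>(1)] by (simp_all only: zero_fun_apply)
    then show ?thesis unfolding on_forms_def \<beta>(2) ..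
  qed
  note cd = this
  note f = bundle_fibre[OF c0_bundle a] bundle_fibre[OF d0_bundle a]
  have add: "B y (p + q) = B y p + B y q" if "smooth_bundle_map A B" "p \<in> cotensors A y" "q \<in> cotensors A y" for B p q
    using bundle_lin[OF that, of 1 1] by (simp only: scaleR_one)
  show "bx y (c0 y a) = c0 y (bx y a)"
    unfolding bx_eq add[OF c0_bundle bundle_fibre[OF d0_bundle f(1)] bundle_fibre[OF c0_bundle f(2)]]
    by (simp only: cd[OF a] cd[OF f(2)] bundle_zero[OF d0_bundle] add_0_left add_0_right)
  show "bx y (d0 y a) = d0 y (bx y a)"
    unfolding bx_eq add[OF d0_bundle bundle_fibre[OF d0_bundle f(1)] bundle_fibre[OF c0_bundle f(2)]]
    by (simp only: cd[OF a] cd[OF f(1)] bundle_zero[OF c0_bundle] add_0_left add_0_right)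
qed

lemma Pi_C0: "\<alpha> \<in> forms A \<Longrightarrow> Prj (C0 \<alpha>) = C0 (Prj \<alpha>)"
  and Q0_C0: "\<alpha> \<in> forms A \<Longrightarrow> Q0 (C0 \<alpha>) = C0 (Q0 \<alpha>)"
  and Q0_D0: "\<alpha> \<in> forms A \<Longrightarrow> Q0 (D0 \<alpha>) = D0 (Q0 \<alpha>)"
  by (rule local_poly_commute[OF pi0_local_poly c0_bundle bx_commute(1)], assumption+,
      rule local_poly_commute[OF q0_local_poly c0_bundle bx_commute(1)], assumption+,
      rule local_poly_commute[OF q0_local_poly d0_bundle bx_commute(2)], assumption+)

lemmas Pi_forms = oper_forms[OF oper_Pi] and Q0_forms = oper_forms[OF oper_Q0]

lemma B0_Pi: "\<alpha> \<in> forms A \<Longrightarrow> B0 (Prj \<alpha>) = 0"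
proof
  fix x assume \<alpha>: "\<alpha> \<in> forms A"
  show "B0 (Prj \<alpha>) x = 0 x"
    unfolding on_forms_def splitting_at(1)[OF formsD[OF \<alpha>]] zero_fun_apply by (rule refl)
qed

lemma B0_Q0: "\<alpha> \<in> forms A \<Longrightarrow> B0 (Q0 \<alpha>) = \<alpha> - Prj \<alpha>"
proof
  fix x assume \<alpha>: "\<alpha> \<in> forms A"
  show "B0 (Q0 \<alpha>) x = (\<alpha> - Prj \<alpha>) x"
    unfolding on_forms_def splitting_at(5)[OF formsD[OF \<alpha>]] by (rule HOL.ext) simp
qed

lemma Pi_fixed: "\<alpha> \<in> forms A \<Longrightarrow> B0 \<alpha> = 0 \<Longrightarrow> Prj \<alpha> = \<alpha>"
proof (rule HOL.ext)
  fix x assume \<alpha>: "\<alpha> \<in> forms A" and "B0 \<alpha> = 0"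
  then have "B0 \<alpha> x = 0" by (simp only: zero_fun_apply)
  then have "bx x (\<alpha> x) = 0" by (simp only: on_forms_def)
  from splitting_at(3)[OF formsD[OF \<alpha>] this] show "Prj \<alpha> x = \<alpha> x" by (simp only: on_forms_def)
qed

lemmas D0_Pi = B0_kernel(1)[OF Pi_forms B0_Pi] and C0_Pi = B0_kernel(2)[OF Pi_forms B0_Pi]

end

section \<open>Homological perturbation\<close>

text \<open>The operator \<open>K\<close> inverts \<open>1 + Q (d - D) C\<close>; then \<open>h = C K Q\<close> satisfies
  \<open>h d C = C\<close> and \<open>C d h = C\<close>, so that \<open>1 - h d - d h\<close> is the spectral projection of
  \<open>d C + C d\<close>.\<close>

locale perturbation =
  fixes V :: "'a::real_vector set" and d D C Q S K :: "'a \<Rightarrow> 'a"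
  assumes V: "subspace V"
    and V_closed [simp]: "x \<in> V \<Longrightarrow> d x \<in> V" "x \<in> V \<Longrightarrow> D x \<in> V" "x \<in> V \<Longrightarrow> C x \<in> V"
      "x \<in> V \<Longrightarrow> Q x \<in> V" "x \<in> V \<Longrightarrow> S x \<in> V" "x \<in> V \<Longrightarrow> K x \<in> V"
    and add: "x \<in> V \<Longrightarrow> y \<in> V \<Longrightarrow> d (x + y) = d x + d y" "x \<in> V \<Longrightarrow> y \<in> V \<Longrightarrow> D (x + y) = D x + D y"
      "x \<in> V \<Longrightarrow> y \<in> V \<Longrightarrow> C (x + y) = C x + C y" "x \<in> V \<Longrightarrow> y \<in> V \<Longrightarrow> Q (x + y) = Q x + Q y"
      "x \<in> V \<Longrightarrow> y \<in> V \<Longrightarrow> S (x + y) = S x + S y" "x \<in> V \<Longrightarrow> y \<in> V \<Longrightarrow> K (x + y) = K x + K y"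
    and dd [simp]: "x \<in> V \<Longrightarrow> d (d x) = 0" and CC [simp]: "x \<in> V \<Longrightarrow> C (C x) = 0"
    and CS [simp]: "x \<in> V \<Longrightarrow> C (S x) = 0" and SC [simp]: "x \<in> V \<Longrightarrow> S (C x) = 0"
    and SS [simp]: "x \<in> V \<Longrightarrow> S (S x) = S x"
    and QC: "x \<in> V \<Longrightarrow> Q (C x) = C (Q x)" and QD: "x \<in> V \<Longrightarrow> Q (D x) = D (Q x)"
    and BQ: "x \<in> V \<Longrightarrow> D (C (Q x)) + C (D (Q x)) = x - S x"
    and K1: "x \<in> V \<Longrightarrow> K x + Q (d (C (K x)) - D (C (K x))) = x"
    and K2: "x \<in> V \<Longrightarrow> K (x + Q (d (C x) - D (C x))) = x"
begin

lemma V_ops [simp]: "0 \<in> V" "x \<in> V \<Longrightarrow> y \<in> V \<Longrightarrow> x + y \<in> V" "x \<in> V \<Longrightarrow> y \<in> V \<Longrightarrow> x - y \<in> V"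
  by (rule subspace_0[OF V], rule subspace_add[OF V], assumption+, rule subspace_diff[OF V])

lemma additive_diff:
  assumes "\<And>x y. x \<in> V \<Longrightarrow> y \<in> V \<Longrightarrow> T (x + y) = T x + T y" "x \<in> V" "y \<in> V"
  shows "T (x - y) = T x - (T y :: 'a)"
  using assms(1)[of "x - y" y] assms(2,3) by simp

lemma diff: "x \<in> V \<Longrightarrow> y \<in> V \<Longrightarrow> d (x - y) = d x - d y" "x \<in> V \<Longrightarrow> y \<in> V \<Longrightarrow> D (x - y) = D x - D y"
  "x \<in> V \<Longrightarrow> y \<in> V \<Longrightarrow> C (x - y) = C x - C y" "x \<in> V \<Longrightarrow> y \<in> V \<Longrightarrow> Q (x - y) = Q x - Q y"
  "x \<in> V \<Longrightarrow> y \<in> V \<Longrightarrow> S (x - y) = S x - S y" "x \<in> V \<Longrightarrow> y \<in> V \<Longrightarrow> K (x - y) = K x - K y"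
  using additive_diff add by blast+

lemma at_0 [simp]: "d 0 = 0" "D 0 = 0" "C 0 = 0" "Q 0 = 0" "S 0 = 0" "K 0 = 0"
  using diff[of 0 0] by simp_all

lemma KC [simp]: "x \<in> V \<Longrightarrow> K (C x) = C x"
  using K2[of "C x"] by simp

lemma KS [simp]: "x \<in> V \<Longrightarrow> K (S x) = S x"
  using K2[of "S x"] by simp

definition "h x = C (K (Q x))"

lemma h_closed [simp]: "x \<in> V \<Longrightarrow> h x \<in> V"
  by (simp add: h_def)

lemma h_add: "x \<in> V \<Longrightarrow> y \<in> V \<Longrightarrow> h (x + y) = h x + h y"
  by (simp add: h_def add)

lemma h_diff: "x \<in> V \<Longrightarrow> y \<in> V \<Longrightarrow> h (x - y) = h x - h y"
  by (simp add: h_def diff)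

lemma h_0 [simp]: "h 0 = 0"
  by (simp add: h_def)

lemma Ch [simp]: "x \<in> V \<Longrightarrow> C (h x) = 0"
  by (simp add: h_def)

lemma hC [simp]: "x \<in> V \<Longrightarrow> h (C x) = 0"
  by (simp add: h_def QC)

text \<open>The identity for D C Q + C D Q turns Q D C into 1 - S - C Q D. What remains of Q d C is
  the perturbation, so the operator inverted by \<open>K\<close> appears in front.\<close>

lemma QdC:
  assumes x: "x \<in> V"
  shows "Q (d (C x)) = (x + Q (d (C x) - D (C x))) - S x - C (Q (D x))"
proof -
  have "Q (D (C x)) = x - S x - C (Q (D x))"
    using BQ[OF x] x by (simp add: QC QD algebra_simps)
  then show ?thesis using x by (simp add: diff)
qed

lemma KQdC: "x \<in> V \<Longrightarrow> K (Q (d (C x))) = x - S x - C (Q (D x))"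
  by (subst QdC) (simp_all add: diff(6) K2)

lemma hdC [simp]: "x \<in> V \<Longrightarrow> h (d (C x)) = C x"
  by (simp add: h_def KQdC diff(3))

text \<open>In this order \<open>K\<close> does not cancel directly. With y = K Q x, the element w =
  C d C y satisfies Q w = C Q x, and since S w = 0 the identity D C Q + C D Q = 1 - S recovers w
  from Q w; the result simplifies to C x.\<close>

lemma Cdh [simp]:
  assumes x: "x \<in> V"
  shows "C (d (h x)) = C x"
proof -
  define y where "y = K (Q x)"
  have y: "y \<in> V" "y + Q (d (C y) - D (C y)) = Q x" using x K1[of "Q x"] by (simp_all add: y_def)
  let ?w = "C (d (C y))"
  have "Q ?w = C (Q (d (C y)))" using y(1) by (simp add: QC)
  also have "\<dots> = C (Q x)" unfolding QdC[OF y(1)] y(2) using x y(1) by (simp add: diff(3))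
  finally have Qw: "Q ?w = C (Q x)" .
  have "?w = D (C (Q ?w)) + C (D (Q ?w))" using BQ[of ?w] y(1) by simp
  also have "\<dots> = C (D (C (Q x)))" unfolding Qw using x by simp
  also have "D (C (Q x)) = x - S x - C (D (Q x))" using BQ[OF x] by (simp add: algebra_simps)
  finally show ?thesis using x by (simp add: h_def y_def diff(3))
qed

lemma hh [simp]: "x \<in> V \<Longrightarrow> h (h x) = 0"
  using hC[of "K (Q x)"] by (simp add: h_def)

lemma hdh [simp]: "x \<in> V \<Longrightarrow> h (d (h x)) = h x"
  using hdC[of "K (Q x)"] by (simp add: h_def)

text \<open>The facts \<open>hh\<close> and \<open>hdh\<close> make this map, chain homotopic to the
  identity, idempotent; \<open>hdC\<close> and \<open>Cdh\<close> make it vanish on the image of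
  \<open>C\<close> and map into the kernel of \<open>C\<close>. Therefore it is killed by d C + C d
  on either side.\<close>

definition "P x = x - h (d x) - d (h x)"

lemma P_closed [simp]: "x \<in> V \<Longrightarrow> P x \<in> V"
  by (simp add: P_def)

lemma P_diff: "x \<in> V \<Longrightarrow> y \<in> V \<Longrightarrow> P (x - y) = P x - P y"
  by (simp add: P_def diff h_diff)

lemma P_add: "x \<in> V \<Longrightarrow> y \<in> V \<Longrightarrow> P (x + y) = P x + P y"
  by (simp add: P_def add h_add)

lemma Ph [simp]: "x \<in> V \<Longrightarrow> P (h x) = 0"
  by (simp add: P_def)

lemma dP: "x \<in> V \<Longrightarrow> d (P x) = P (d x)"
  by (simp add: P_def diff)

lemma PP [simp]:
  assumes "x \<in> V"
  shows "P (P x) = P x"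
proof -
  have "P (P x) = P (x - h (d x) - d (h x))" by (simp only: P_def[of x])
  then show ?thesis using assms by (simp add: P_diff dP[symmetric])
qed

lemma PC [simp]: "x \<in> V \<Longrightarrow> P (C x) = 0"
  by (simp add: P_def)

lemma CP [simp]: "x \<in> V \<Longrightarrow> C (P x) = 0"
  by (simp add: P_def diff)

text \<open>The reduced resolvent at 0 of box = d C + C d: box R = 1 - P and P R = 0. The first
  summand alone already satisfies the first equation, because C d h = C turns its two halves into h
  d and d h. Subtracting its image under \<open>P\<close> gives the second equation without
  disturbing the first, as box P = 0.\<close>

definition "R x = (h (K (Q (d x))) + d (h (K (Q x)))) - P (h (K (Q (d x))) + d (h (K (Q x))))"

lemma R_closed [simp]: "x \<in> V \<Longrightarrow> R x \<in> V"
  by (simp add: R_def)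

lemma PR: "x \<in> V \<Longrightarrow> P (R x) = 0"
  by (simp add: R_def P_diff)

lemma box_P: "x \<in> V \<Longrightarrow> d (C (P x)) + C (d (P x)) = 0"
  by (simp add: dP)

lemma box_R:
  assumes x: "x \<in> V"
  shows "d (C (R x)) + C (d (R x)) = x - P x"
proof -
  define R0 where "R0 = h (K (Q (d x))) + d (h (K (Q x)))"
  have R0: "R0 \<in> V" using x by (simp add: R0_def)
  have "C R0 = h x" "C (d R0) = h (d x)" using x by (simp_all add: R0_def add) (simp_all add: h_def)
  then have box_R0: "d (C R0) + C (d R0) = x - P x" by (simp add: P_def)
  have "R x = R0 - P R0" by (simp add: R_def R0_def)
  then have "d (C (R x)) + C (d (R x)) = (d (C R0) + C (d R0)) - (d (C (P R0)) + C (d (P R0)))"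
    using R0 by (simp add: diff)
  then show ?thesis using box_R0 box_P[OF R0] by simp
qed

text \<open>Substituting K = 1 - Q (d - D) C K into \<open>P\<close> and comparing with 1 - S = D C
  Q + C Q D leaves only terms with a factor d - D. In the application to forms each of them raises
  the weight.\<close>

lemma P_minus_S:
  assumes x: "x \<in> V"
  shows "P x - S x = (C (Q (d (C (K (Q (d x)))) - D (C (K (Q (d x)))))) + d (C (Q (d (C (K (Q x))) - D (C (K (Q x)))))))
    - (C (Q (d x - D x)) + (d (C (Q x)) - D (C (Q x))))"
proof -
  have K: "K y = y - Q (d (C (K y)) - D (C (K y)))" if "y \<in> V" for y
    using K1[OF that] by (simp add: algebra_simps)
  have h: "h y = C (Q y) - C (Q (d (C (K (Q y))) - D (C (K (Q y)))))" if "y \<in> V" for y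
  proof -
    have "h y = C (Q y - Q (d (C (K (Q y))) - D (C (K (Q y)))))"
      unfolding h_def by (subst K) (use that in simp_all)
    then show ?thesis using that by (simp add: diff(3))
  qed
  have "x - S x = D (C (Q x)) + C (Q (D x))" using BQ[OF x] x by (simp add: QD)
  moreover have "P x = x - (C (Q (d x)) - C (Q (d (C (K (Q (d x)))) - D (C (K (Q (d x)))))))
      - (d (C (Q x)) - d (C (Q (d (C (K (Q x))) - D (C (K (Q x)))))))"
    unfolding P_def h[OF x] h[OF V_closed(1)[OF x]] using x by (subst diff(1)) simp_all
  ultimately show ?thesis using x by (simp add: diff algebra_simps)
qed

definition "L x = P (S x) + ((x - S x) - P (x - S x))"

lemma PL: "x \<in> V \<Longrightarrow> P (L x) = P (S x)"
  by (simp add: L_def P_add P_diff)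

lemma LS: "x \<in> V \<Longrightarrow> S x = x \<Longrightarrow> L x = P x"
  using P_diff[of x x] by (simp add: L_def)

text \<open>In operator form L = 1 + (P - S) (2 S - 1), arranged so that every correction has the
  weight-raising factor P - S and \<open>neumann\<close> applies.\<close>

lemma L_eq: "x \<in> V \<Longrightarrow> L x = x + ((P (S x) - S (S x)) + (P (S x) - S (S x)) - (P x - S x))"
  by (simp add: L_def P_diff algebra_simps)

end

context base_complex
begin

lemma oper_cong:
  assumes T: "oper w j T" and eq: "\<And>\<alpha>. \<alpha> \<in> forms A \<Longrightarrow> T' \<alpha> = T \<alpha>"
  shows "oper w j T'"
proof (rule operI)
  fix \<alpha> \<beta> :: "('m, real) form" and a b assume *: "\<alpha> \<in> forms A" "\<beta> \<in> forms A"
  show "T' (a *\<^sub>R \<alpha> + b *\<^sub>R \<beta>) = a *\<^sub>R T' \<alpha> + b *\<^sub>R T' \<beta>"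
    unfolding eq[OF *(1)] eq[OF *(2)] eq[OF forms_add[OF forms_scale[OF *(1)] forms_scale[OF *(2)]]] by (rule oper_lin[OF T *])
next
  fix \<alpha> :: "('m, real) form" and x assume *: "\<alpha> \<in> forms A" "\<forall>\<^sub>F y in nhds x. \<alpha> y = 0"
  show "T' \<alpha> x = 0" unfolding eq[OF *(1)] by (rule oper_local_zero[OF T *])
next
  fix v and \<alpha> :: "('m, real) form" assume *: "\<alpha> \<in> FW v"
  show "T' \<alpha> \<in> FW (v + w)" unfolding eq[OF FW_forms[OF *]] by (rule oper_weight[OF T *])
next
  fix \<alpha> :: "('m, real) form" and k assume *: "\<alpha> \<in> forms A"
  show "T' (deg_proj k \<alpha>) = deg_proj (k + j) (T' \<alpha>)"
    unfolding eq[OF *] eq[OF deg_proj_forms[OF *]] by (rule oper_deg[OF T *])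
next
  fix \<alpha> :: "('m, real) form" assume *: "\<alpha> \<in> forms A"
  show "T' \<alpha> \<in> forms A" unfolding eq[OF *] by (rule oper_forms[OF T *])
qed

section \<open>The perturbation lemma for differential forms\<close>

abbreviation "Raise \<equiv> \<lambda>\<alpha>. dR \<alpha> - D0 \<alpha>"

lemma oper_comp0: "oper 0 i S \<Longrightarrow> oper w j T \<Longrightarrow> i + j = k \<Longrightarrow> oper w k (\<lambda>\<alpha>. S (T \<alpha>))"
  using oper_comp[of 0 i S w j T] by (simp only: add_0_left)

lemma oper_comp1: "oper 1 i S \<Longrightarrow> oper 0 j T \<Longrightarrow> i + j = k \<Longrightarrow> oper 1 k (\<lambda>\<alpha>. S (T \<alpha>))"
  using oper_comp[of 1 i S 0 j T] by (simp only: add_0_right)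

lemma oper_T: "oper 1 0 (\<lambda>\<alpha>. Q0 (Raise (C0 \<alpha>)))"
proof -
  have "oper 1 0 (\<lambda>\<alpha>. Raise (C0 \<alpha>))" by (rule oper_comp1[OF oper_raising oper_C0]) simp
  then show ?thesis by (intro oper_comp0[OF oper_Q0]) simp_all
qed

definition Kop :: "('m, real) form \<Rightarrow> ('m, real) form" where
  "Kop = (SOME K. oper 0 0 K \<and> (\<forall>\<alpha>\<in>forms A. K \<alpha> + Q0 (Raise (C0 (K \<alpha>))) = \<alpha>) \<and>
    (\<forall>\<alpha>\<in>forms A. K (\<alpha> + Q0 (Raise (C0 \<alpha>))) = \<alpha>))"

lemma Kop: "oper 0 0 Kop" "\<alpha> \<in> forms A \<Longrightarrow> Kop \<alpha> + Q0 (Raise (C0 (Kop \<alpha>))) = \<alpha>"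
  "\<alpha> \<in> forms A \<Longrightarrow> Kop (\<alpha> + Q0 (Raise (C0 \<alpha>))) = \<alpha>"
proof -
  let ?P = "\<lambda>K. oper 0 0 K \<and> (\<forall>\<alpha>\<in>forms A. K \<alpha> + Q0 (Raise (C0 (K \<alpha>))) = \<alpha>) \<and>
    (\<forall>\<alpha>\<in>forms A. K (\<alpha> + Q0 (Raise (C0 \<alpha>))) = \<alpha>)"
  obtain K where K: "oper 0 0 K" "\<And>\<alpha>. \<alpha> \<in> forms A \<Longrightarrow> K \<alpha> + Q0 (Raise (C0 (K \<alpha>))) = \<alpha>"
    "\<And>\<alpha>. \<alpha> \<in> forms A \<Longrightarrow> K (\<alpha> + Q0 (Raise (C0 \<alpha>))) = \<alpha>"
    using neumann[OF oper_T] by metis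
  have "?P Kop" unfolding Kop_def by (rule someI[where P = ?P and x = K]) (intro conjI ballI K)
  note k = this
  show "oper 0 0 Kop" by (rule conjunct1[OF k])
  show "Kop \<alpha> + Q0 (Raise (C0 (Kop \<alpha>))) = \<alpha>" "Kop (\<alpha> + Q0 (Raise (C0 \<alpha>))) = \<alpha>" if "\<alpha> \<in> forms A"
    by (rule bspec[OF conjunct1[OF conjunct2[OF k]] that], rule bspec[OF conjunct2[OF conjunct2[OF k]] that])
qed

lemmas Kop_forms = oper_forms[OF Kop(1)]

sublocale pert: perturbation "forms A" dR D0 C0 Q0 Prj Kop
proof
  show "subspace (forms A)" by (rule forms_subspace)
  fix x y :: "('m, real) form" assume x: "x \<in> forms A"
  show "dR x \<in> forms A" "D0 x \<in> forms A" "C0 x \<in> forms A" "Q0 x \<in> forms A" "Prj x \<in> forms A" "Kop x \<in> forms A"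
    by (rule dR_forms[OF x], rule D0_forms[OF x], rule C0_forms[OF x], rule Q0_forms[OF x], rule Pi_forms[OF x], rule Kop_forms[OF x])
  show "dR (dR x) = 0" "C0 (C0 x) = 0" "C0 (Prj x) = 0"
    by (rule dR_dR[OF x], rule C0_C0[OF x], rule C0_Pi[OF x x])
  show "Prj (C0 x) = 0" unfolding Pi_C0[OF x] by (rule C0_Pi[OF x x])
  show "Prj (Prj x) = Prj x" by (rule Pi_fixed[OF Pi_forms[OF x] B0_Pi[OF x]])
  show "Q0 (C0 x) = C0 (Q0 x)" "Q0 (D0 x) = D0 (Q0 x)" by (rule Q0_C0[OF x], rule Q0_D0[OF x])
  show "D0 (C0 (Q0 x)) + C0 (D0 (Q0 x)) = x - Prj x" using B0_Q0[OF x] unfolding B0_eq .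
  show "Kop x + Q0 (dR (C0 (Kop x)) - D0 (C0 (Kop x))) = x" "Kop (x + Q0 (dR (C0 x) - D0 (C0 x))) = x"
    by (rule Kop(2)[OF x], rule Kop(3)[OF x])
  assume y: "y \<in> forms A"
  show "dR (x + y) = dR x + dR y" by (rule oper_add[OF oper_dR x y])
  show "D0 (x + y) = D0 x + D0 y" by (rule oper_add[OF oper_D0 x y])
  show "C0 (x + y) = C0 x + C0 y" by (rule oper_add[OF oper_C0 x y])
  show "Q0 (x + y) = Q0 x + Q0 y" by (rule oper_add[OF oper_Q0 x y])
  show "Prj (x + y) = Prj x + Prj y" by (rule oper_add[OF oper_Pi x y])
  show "Kop (x + y) = Kop x + Kop y" by (rule oper_add[OF Kop(1) x y])
qed

lemma oper_h: "oper 0 (- 1) pert.h"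
proof -
  have "oper 0 0 (\<lambda>\<alpha>. Kop (Q0 \<alpha>))" by (rule oper_comp0[OF Kop(1) oper_Q0]) simp
  then have "oper 0 (- 1) (\<lambda>\<alpha>. C0 (Kop (Q0 \<alpha>)))" by (intro oper_comp0[OF oper_C0]) simp_all
  then show ?thesis by (rule oper_cong) (simp only: pert.h_def)
qed

lemma oper_P: "oper 0 0 pert.P"
proof -
  have "oper 0 0 (\<lambda>\<alpha>. pert.h (dR \<alpha>))" by (rule oper_comp0[OF oper_h oper_dR]) simp
  moreover have "oper 0 0 (\<lambda>\<alpha>. dR (pert.h \<alpha>))" by (rule oper_comp0[OF oper_dR oper_h]) simp
  ultimately have "oper 0 0 (\<lambda>\<alpha>. \<alpha> - pert.h (dR \<alpha>) - dR (pert.h \<alpha>))" by (intro oper_minus oper_id)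
  then show ?thesis by (rule oper_cong) (simp only: pert.P_def)
qed

lemma oper_R: "oper 0 0 pert.R"
proof -
  have k: "oper 0 (- 1) (\<lambda>\<alpha>. pert.h (Kop (Q0 \<alpha>)))"
    by (rule oper_comp0[OF oper_h oper_comp0[OF Kop(1) oper_Q0 refl]]) simp
  have "oper 0 0 (\<lambda>\<alpha>. pert.h (Kop (Q0 (dR \<alpha>))))" by (rule oper_comp0[OF k oper_dR]) simp
  moreover have "oper 0 0 (\<lambda>\<alpha>. dR (pert.h (Kop (Q0 \<alpha>))))" by (rule oper_comp0[OF oper_dR k]) simp
  ultimately have s: "oper 0 0 (\<lambda>\<alpha>. pert.h (Kop (Q0 (dR \<alpha>))) + dR (pert.h (Kop (Q0 \<alpha>))))" by (rule oper_plus)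
  have "oper 0 0 (\<lambda>\<alpha>. pert.P (pert.h (Kop (Q0 (dR \<alpha>))) + dR (pert.h (Kop (Q0 \<alpha>)))))"
    by (rule oper_comp0[OF oper_P s]) simp
  from oper_minus[OF s this] show ?thesis by (rule oper_cong) (simp only: pert.R_def)
qed

lemma oper_P_minus_Pi: "oper 1 0 (\<lambda>\<alpha>. pert.P \<alpha> - Prj \<alpha>)"
proof -
  have cq: "oper 0 (- 1) (\<lambda>\<alpha>. C0 (Q0 \<alpha>))" by (rule oper_comp0[OF oper_C0 oper_Q0]) simp
  have kq: "oper 0 0 (\<lambda>\<alpha>. Kop (Q0 \<alpha>))" by (rule oper_comp0[OF Kop(1) oper_Q0]) simp
  have "oper 1 0 (\<lambda>\<alpha>. Q0 (Raise (C0 (Kop (Q0 \<alpha>)))))" by (rule oper_comp1[OF oper_T kq]) simp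
  then have e: "oper 1 (- 1) (\<lambda>\<alpha>. C0 (Q0 (Raise (C0 (Kop (Q0 \<alpha>))))))" by (intro oper_comp0[OF oper_C0]) simp_all
  have 1: "oper 1 0 (\<lambda>\<alpha>. C0 (Q0 (Raise (C0 (Kop (Q0 (dR \<alpha>)))))))" by (rule oper_comp1[OF e oper_dR]) simp
  have 2: "oper 1 0 (\<lambda>\<alpha>. dR (C0 (Q0 (Raise (C0 (Kop (Q0 \<alpha>)))))))" by (rule oper_comp0[OF oper_dR e]) simp
  have 3: "oper 1 0 (\<lambda>\<alpha>. C0 (Q0 (Raise \<alpha>)))" by (rule oper_comp0[OF cq oper_raising]) simp
  have 4: "oper 1 0 (\<lambda>\<alpha>. Raise (C0 (Q0 \<alpha>)))" by (rule oper_comp1[OF oper_raising cq]) simp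
  show ?thesis by (rule oper_cong[OF oper_minus[OF oper_plus[OF 1 2] oper_plus[OF 3 4]]]) (rule pert.P_minus_S)
qed

lemma L_bij:
  obtains M where "oper 0 0 M" "\<And>\<alpha>. \<alpha> \<in> forms A \<Longrightarrow> pert.L (M \<alpha>) = \<alpha>" "\<And>\<alpha>. \<alpha> \<in> forms A \<Longrightarrow> M (pert.L \<alpha>) = \<alpha>"
proof -
  let ?S = "\<lambda>\<alpha>. pert.P \<alpha> - Prj \<alpha>"
  let ?U = "\<lambda>\<alpha>. (?S (Prj \<alpha>) + ?S (Prj \<alpha>)) - ?S \<alpha>"
  have s: "oper 1 0 (\<lambda>\<alpha>. ?S (Prj \<alpha>))" by (rule oper_comp1[OF oper_P_minus_Pi oper_Pi]) simp
  have U: "oper 1 0 ?U" by (rule oper_minus[OF oper_plus[OF s s] oper_P_minus_Pi])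
  have L: "pert.L \<alpha> = \<alpha> + ?U \<alpha>" if "\<alpha> \<in> forms A" for \<alpha> by (rule pert.L_eq[OF that])
  obtain M where M: "oper 0 0 M" "\<And>\<alpha>. \<alpha> \<in> forms A \<Longrightarrow> M \<alpha> + ?U (M \<alpha>) = \<alpha>" "\<And>\<alpha>. \<alpha> \<in> forms A \<Longrightarrow> M (\<alpha> + ?U \<alpha>) = \<alpha>"
    using neumann[OF U] by metis
  show ?thesis
  proof (rule that[OF M(1)])
    fix \<alpha> :: "('m, real) form" assume \<alpha>: "\<alpha> \<in> forms A"
    show "pert.L (M \<alpha>) = \<alpha>" unfolding L[OF oper_forms[OF M(1) \<alpha>]] by (rule M(2)[OF \<alpha>])
    show "M (pert.L \<alpha>) = \<alpha>" unfolding L[OF \<alpha>] by (rule M(3)[OF \<alpha>])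
  qed
qed

text \<open>The spectral projection has the kernel of the algebraic Laplacian as its image, and by
  \<open>B0_kernel\<close> that kernel is the intersection of the kernels of d0 and delta0.\<close>

lemma E0_iff: "\<alpha> \<in> E0 A d0 c0 k \<longleftrightarrow> \<alpha> \<in> forms_deg A k \<and> Prj \<alpha> = \<alpha>"
proof
  assume "\<alpha> \<in> E0 A d0 c0 k"
  then have *: "\<alpha> \<in> forms_deg A k" "D0 \<alpha> = 0" "C0 \<alpha> = 0" unfolding E0_def by simp_all
  have f: "\<alpha> \<in> forms A" using *(1) by (simp add: forms_deg_def)
  have "B0 \<alpha> = 0" unfolding B0_eq *(2,3) by (simp only: oper_zero[OF oper_C0] oper_zero[OF oper_D0] add_0_left)
  then show "\<alpha> \<in> forms_deg A k \<and> Prj \<alpha> = \<alpha>" using *(1) Pi_fixed[OF f] by (intro conjI)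
next
  assume *: "\<alpha> \<in> forms_deg A k \<and> Prj \<alpha> = \<alpha>"
  then have f: "\<alpha> \<in> forms A" by (simp add: forms_deg_def)
  have "D0 (Prj \<alpha>) = 0" "C0 (Prj \<alpha>) = 0" by (rule D0_Pi[OF f f], rule C0_Pi[OF f f])
  then show "\<alpha> \<in> E0 A d0 c0 k" unfolding E0_def using * by (intro CollectI conjI) (simp_all only:)
qed

section \<open>The resolvent on germs\<close>

definition cx :: "(('m, real) form \<Rightarrow> ('m, real) form) \<Rightarrow> ('m, complex) form \<Rightarrow> ('m, complex) form" where
  "cx T \<beta> = (\<lambda>x vs. Complex (T (\<lambda>y us. Re (\<beta> y us)) x vs) (T (\<lambda>y us. Im (\<beta> y us)) x vs))"

definition cf :: "('m \<Rightarrow> complex) \<Rightarrow> ('m, real) form \<Rightarrow> ('m, complex) form" where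
  "cf f \<gamma> = (\<lambda>x vs. f x * complex_of_real (\<gamma> x vs))"

definition SFc :: "('m \<Rightarrow> complex) set" where
  "SFc = {f. (\<lambda>y. Re (f y)) \<in> SF \<and> (\<lambda>y. Im (f y)) \<in> SF}"

abbreviation "bxd \<equiv> box A c0"
abbreviation "cforms \<equiv> complex_forms A"

lemma box_complex_eq: "box_complex A c0 = cx bxd"
  by (intro HOL.ext) (simp add: box_complex_def cx_def)

lemma SFc_const: "(\<lambda>_. c) \<in> SFc"
  by (simp add: SFc_def smooth_const)

lemma SFc_of_real: "f \<in> SF \<Longrightarrow> (\<lambda>y. of_real (f y)) \<in> SFc"
  by (simp add: SFc_def smooth_const)

lemma SFc_mult: "f \<in> SFc \<Longrightarrow> q \<in> SFc \<Longrightarrow> (\<lambda>y. f y * q y) \<in> SFc"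
  by (simp add: SFc_def smooth_add smooth_diff smooth_mult)

lemma SFc_power: "f \<in> SFc \<Longrightarrow> (\<lambda>y. f y ^ n) \<in> SFc"
  by (induction n) (simp_all add: SFc_const SFc_mult)

lemma SFc_sum: "(\<And>i. i \<in> I \<Longrightarrow> F i \<in> SFc) \<Longrightarrow> (\<lambda>y. \<Sum>i\<in>I. F i y) \<in> SFc"
  by (simp add: SFc_def smooth_sum)

lemma Re_Im_cf: "(\<lambda>y us. Re (cf f \<gamma> y us)) = fmul (\<lambda>y. Re (f y)) \<gamma>" "(\<lambda>y us. Im (cf f \<gamma> y us)) = fmul (\<lambda>y. Im (f y)) \<gamma>"
  by (intro HOL.ext, simp add: cf_def)+

lemma cf_forms: "f \<in> SFc \<Longrightarrow> \<gamma> \<in> forms A \<Longrightarrow> cf f \<gamma> \<in> cforms"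
  unfolding complex_forms_def mem_Collect_eq Re_Im_cf by (simp add: SFc_def fmul_forms)

lemma cx_cf: "cx T (cf f \<gamma>) x vs = Complex (T (fmul (\<lambda>y. Re (f y)) \<gamma>) x vs) (T (fmul (\<lambda>y. Im (f y)) \<gamma>) x vs)"
  unfolding cx_def Re_Im_cf ..

lemma cforms_D: "\<beta> \<in> cforms \<Longrightarrow> (\<lambda>y us. Re (\<beta> y us)) \<in> forms A" "\<beta> \<in> cforms \<Longrightarrow> (\<lambda>y us. Im (\<beta> y us)) \<in> forms A"
  by (simp_all add: complex_forms_def)

lemma Re_Im_sum:
  "(\<lambda>y us. Re (\<Sum>i\<in>I. z i * \<beta> i y us)) =
    1 *\<^sub>R (\<Sum>i\<in>I. Re (z i) *\<^sub>R (\<lambda>y us. Re (\<beta> i y us))) + (- 1) *\<^sub>R (\<Sum>i\<in>I. Im (z i) *\<^sub>R (\<lambda>y us. Im (\<beta> i y us)))"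
  "(\<lambda>y us. Im (\<Sum>i\<in>I. z i * \<beta> i y us)) =
    1 *\<^sub>R (\<Sum>i\<in>I. Re (z i) *\<^sub>R (\<lambda>y us. Im (\<beta> i y us))) + 1 *\<^sub>R (\<Sum>i\<in>I. Im (z i) *\<^sub>R (\<lambda>y us. Re (\<beta> i y us)))"
  by (intro HOL.ext, simp add: sum_fun_apply sum_subtractf sum.distrib)+

lemma cforms_sum:
  assumes "\<And>i. i \<in> I \<Longrightarrow> \<beta> i \<in> cforms"
  shows "(\<lambda>y us. \<Sum>i\<in>I. z i * \<beta> i y us) \<in> cforms"
  unfolding complex_forms_def mem_Collect_eq Re_Im_sum
  by (intro conjI forms_add forms_scale subspace_sum[OF forms_subspace] cforms_D assms)

lemma cx_sum:
  assumes T: "oper w j T" and \<beta>: "\<And>i. i \<in> I \<Longrightarrow> \<beta> i \<in> cforms"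
  shows "cx T (\<lambda>y us. \<Sum>i\<in>I. z i * \<beta> i y us) x vs = (\<Sum>i\<in>I. z i * cx T (\<beta> i) x vs)"
proof -
  have f: "(\<Sum>i\<in>I. c i *\<^sub>R (\<lambda>y us. Re (\<beta> i y us))) \<in> forms A" "(\<Sum>i\<in>I. c i *\<^sub>R (\<lambda>y us. Im (\<beta> i y us))) \<in> forms A" for c
    by (intro forms_scale subspace_sum[OF forms_subspace] cforms_D \<beta>, assumption)+
  have s: "T (\<Sum>i\<in>I. c i *\<^sub>R \<gamma> i) = (\<Sum>i\<in>I. c i *\<^sub>R T (\<gamma> i))" if "\<And>i. i \<in> I \<Longrightarrow> \<gamma> i \<in> forms A" for c \<gamma>
    by (rule linear_on_subspace_sum[OF forms_subspace oper_lin[OF T] that])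
  have "T (\<Sum>i\<in>I. c i *\<^sub>R (\<lambda>y us. Re (\<beta> i y us))) = (\<Sum>i\<in>I. c i *\<^sub>R T (\<lambda>y us. Re (\<beta> i y us)))"
    "T (\<Sum>i\<in>I. c i *\<^sub>R (\<lambda>y us. Im (\<beta> i y us))) = (\<Sum>i\<in>I. c i *\<^sub>R T (\<lambda>y us. Im (\<beta> i y us)))" for c
    by (rule s, rule cforms_D[OF \<beta>], assumption)+
  then show ?thesis
    unfolding cx_def Re_Im_sum oper_lin[OF T f(1) f(2)] oper_lin[OF T f(2) f(1)]
    by (simp only: plus_fun_apply scaleR_fun_apply sum_fun_apply)
      (simp add: complex_eq_iff sum_subtractf sum.distrib)
qed

lemma cx_add:
  assumes T: "oper w j T" and "\<beta> \<in> cforms" "\<gamma> \<in> cforms"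
  shows "cx T (\<lambda>y us. z * \<beta> y us + t * \<gamma> y us) x vs = z * cx T \<beta> x vs + t * cx T \<gamma> x vs"
    and "(\<lambda>y us. z * \<beta> y us + t * \<gamma> y us) \<in> cforms"
proof -
  let ?z = "\<lambda>b :: bool. if b then z else t" and ?b = "\<lambda>b :: bool. if b then \<beta> else \<gamma>"
  have "(if i then \<beta> else \<gamma>) \<in> cforms" for i :: bool using assms by simp
  note * = cx_sum[where \<beta> = ?b and I = UNIV and z = ?z, OF T this] cforms_sum[where \<beta> = ?b and I = UNIV and z = ?z, OF this]
  show "cx T (\<lambda>y us. z * \<beta> y us + t * \<gamma> y us) x vs = z * cx T \<beta> x vs + t * cx T \<gamma> x vs"
    using *(1) by (simp add: UNIV_bool add.commute)
  show "(\<lambda>y us. z * \<beta> y us + t * \<gamma> y us) \<in> cforms"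
    using *(2) by (simp add: UNIV_bool add.commute)
qed

lemma cx_local:
  assumes T: "oper w j T" and \<beta>: "\<beta> \<in> cforms" "\<gamma> \<in> cforms" and eq: "\<forall>\<^sub>F y in nhds x. \<beta> y = \<gamma> y"
  shows "\<forall>\<^sub>F y in nhds x. cx T \<beta> y = cx T \<gamma> y"
proof -
  have "\<forall>\<^sub>F y in nhds x. T (\<lambda>y us. Re (\<beta> y us)) y = T (\<lambda>y us. Re (\<gamma> y us)) y"
    by (rule oper_local[OF T cforms_D(1)[OF \<beta>(1)] cforms_D(1)[OF \<beta>(2)] eventually_mono[OF eq]]) (simp only:)
  moreover have "\<forall>\<^sub>F y in nhds x. T (\<lambda>y us. Im (\<beta> y us)) y = T (\<lambda>y us. Im (\<gamma> y us)) y"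
    by (rule oper_local[OF T cforms_D(2)[OF \<beta>(1)] cforms_D(2)[OF \<beta>(2)] eventually_mono[OF eq]]) (simp only:)
  ultimately show ?thesis by eventually_elim (simp only: cx_def)
qed

section \<open>Commutators of the Laplacian with functions\<close>

lemma bxd_eq: "bxd \<alpha> = dR (C0 \<alpha>) + C0 (dR \<alpha>)"
  by (simp only: box_def)

lemma oper_bxd: "oper 0 0 bxd"
proof -
  have "oper 0 0 (\<lambda>\<alpha>. dR (C0 \<alpha>))" "oper 0 0 (\<lambda>\<alpha>. C0 (dR \<alpha>))"
    by (rule oper_comp0[OF oper_dR oper_C0], simp, rule oper_comp0[OF oper_C0 oper_dR], simp)
  from oper_plus[OF this] show ?thesis by (rule oper_cong) (simp only: bxd_eq)
qed

lemma oper_bxd_diff: "oper 1 0 (\<lambda>\<alpha>. bxd \<alpha> - B0 \<alpha>)"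
proof -
  have "oper 1 0 (\<lambda>\<alpha>. Raise (C0 \<alpha>))" "oper 1 0 (\<lambda>\<alpha>. C0 (Raise \<alpha>))"
    by (rule oper_comp1[OF oper_raising oper_C0], simp, rule oper_comp0[OF oper_C0 oper_raising], simp)
  from oper_plus[OF this] show ?thesis
  proof (rule oper_cong)
    fix \<alpha> :: "('m, real) form" assume \<alpha>: "\<alpha> \<in> forms A"
    show "bxd \<alpha> - B0 \<alpha> = Raise (C0 \<alpha>) + C0 (Raise \<alpha>)"
      unfolding bxd_eq B0_eq oper_diff[OF oper_C0 dR_forms[OF \<alpha>] D0_forms[OF \<alpha>]]
      by (simp only: diff_conv_add_uminus minus_add_distrib ac_simps)
  qed
qed

text \<open>A commutator with multiplication by a function. It is algebraic, since [d, f] is the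
  wedge product with df and delta0 commutes with functions; this is what makes it a derivation in
  \<open>f\<close>.\<close>

definition com :: "('m \<Rightarrow> real) \<Rightarrow> ('m, real) form \<Rightarrow> ('m, real) form" where
  "com f \<gamma> = bxd (fmul f \<gamma>) - fmul f (bxd \<gamma>)"

lemma fmul_add: "fmul f (\<alpha> + \<beta>) = fmul f \<alpha> + fmul f \<beta>" and fmul_diff: "fmul f (\<alpha> - \<beta>) = fmul f \<alpha> - fmul f \<beta>"
  and fmul_plus: "fmul (\<lambda>y. f y + q y) \<alpha> = fmul f \<alpha> + fmul q \<alpha>"
  and fmul_minus: "fmul (\<lambda>y. f y - q y) \<alpha> = fmul f \<alpha> - fmul q \<alpha>"
  and fmul_times: "fmul (\<lambda>y. f y * q y) \<alpha> = fmul f (fmul q \<alpha>)"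
  by (intro HOL.ext, simp add: algebra_simps)+

lemma com_eq:
  assumes f: "f \<in> SF" and \<gamma>: "\<gamma> \<in> forms A"
  shows "com f \<gamma> = comm_d f (C0 \<gamma>) + C0 (comm_d f \<gamma>)"
proof -
  have "C0 (comm_d f \<gamma>) = C0 (dR (fmul f \<gamma>)) - fmul f (C0 (dR \<gamma>))"
    unfolding comm_d_def oper_diff[OF oper_C0 dR_forms[OF fmul_forms[OF f \<gamma>]] fmul_forms[OF f dR_forms[OF \<gamma>]]]
      bundle_fmul[OF c0_bundle dR_forms[OF \<gamma>]] ..
  then show ?thesis
    unfolding com_def bxd_eq fmul_add comm_d_def[of f "C0 \<gamma>"] bundle_fmul[OF c0_bundle \<gamma>]
    by (simp only: diff_conv_add_uminus minus_add_distrib ac_simps)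
qed

lemma com_fmul:
  assumes f: "f \<in> SF" and q: "q \<in> SF" and \<gamma>: "\<gamma> \<in> forms A"
  shows "com f (fmul q \<gamma>) = fmul q (com f \<gamma>)"
  unfolding com_eq[OF f \<gamma>] com_eq[OF f fmul_forms[OF q \<gamma>]] bundle_fmul[OF c0_bundle \<gamma>]
    comm_d_fmul[OF f q \<gamma>] comm_d_fmul[OF f q C0_forms[OF \<gamma>]] bundle_fmul[OF c0_bundle comm_d_forms[OF f \<gamma>]] fmul_add ..

lemma com_times:
  assumes f: "f \<in> SF" and q: "q \<in> SF" and \<gamma>: "\<gamma> \<in> forms A"
  shows "com (\<lambda>y. f y * q y) \<gamma> = fmul q (com f \<gamma>) + fmul f (com q \<gamma>)"
  unfolding com_fmul[OF f q \<gamma>, symmetric]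
  unfolding com_def fmul_times fmul_diff by (simp only: diff_add_cancel add_diff_eq)

lemma com_plus:
  assumes f: "f \<in> SF" and q: "q \<in> SF" and \<gamma>: "\<gamma> \<in> forms A"
  shows "com (\<lambda>y. f y + q y) \<gamma> = com f \<gamma> + com q \<gamma>"
  unfolding com_def fmul_plus oper_add[OF oper_bxd fmul_forms[OF f \<gamma>] fmul_forms[OF q \<gamma>]] by (simp only: add_diff_add)

lemma com_minus:
  assumes f: "f \<in> SF" and q: "q \<in> SF" and \<gamma>: "\<gamma> \<in> forms A"
  shows "com (\<lambda>y. f y - q y) \<gamma> = com f \<gamma> - com q \<gamma>"
  unfolding com_def fmul_minus oper_diff[OF oper_bxd fmul_forms[OF f \<gamma>] fmul_forms[OF q \<gamma>]]
  by (simp only: diff_conv_add_uminus minus_add_distrib minus_minus ac_simps)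

text \<open>Multiplication by \<open>f\<close> commutes with the algebraic Laplacian, so the
  commutator is that of the weight-raising difference of the two Laplacians.\<close>

lemma com_weight:
  assumes f: "f \<in> SF" and \<gamma>: "\<gamma> \<in> FW w"
  shows "com f \<gamma> \<in> FW (w + 1)"
proof -
  let ?N = "\<lambda>\<alpha>. bxd \<alpha> - B0 \<alpha>"
  have "com f \<gamma> = ?N (fmul f \<gamma>) - fmul f (?N \<gamma>)"
    unfolding com_def fmul_diff bundle_fmul[OF bx_bundle FW_forms[OF \<gamma>]]
    by (simp only: diff_conv_add_uminus minus_add_distrib minus_minus add.assoc) (simp only: ac_simps add.right_inverse add_0_left add.left_neutral add_minus_cancel minus_add_cancel)
  then show ?thesis
    using subspace_diff[OF FW_subspace oper_weight[OF oper_bxd_diff FW_fmul[OF f \<gamma>]] FW_fmul[OF f oper_weight[OF oper_bxd_diff \<gamma>]]]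
    by (simp only:)
qed

definition ccom :: "('m \<Rightarrow> complex) \<Rightarrow> ('m, real) form \<Rightarrow> ('m, complex) form" where
  "ccom f \<gamma> = (\<lambda>y vs. cx bxd (cf f \<gamma>) y vs - f y * of_real (bxd \<gamma> y vs))"

lemma ccom_eq: "ccom f \<gamma> y vs = Complex (com (\<lambda>y. Re (f y)) \<gamma> y vs) (com (\<lambda>y. Im (f y)) \<gamma> y vs)"
  unfolding ccom_def cx_cf com_def by (simp add: complex_eq_iff)

lemma ccom_times:
  assumes f: "f \<in> SFc" and q: "q \<in> SFc" and \<gamma>: "\<gamma> \<in> forms A"
  shows "ccom (\<lambda>y. f y * q y) \<gamma> y vs = q y * ccom f \<gamma> y vs + f y * ccom q \<gamma> y vs"
proof -
  have r: "(\<lambda>y. Re (f y)) \<in> SF" "(\<lambda>y. Im (f y)) \<in> SF" "(\<lambda>y. Re (q y)) \<in> SF" "(\<lambda>y. Im (q y)) \<in> SF"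
    using f q by (simp_all add: SFc_def)
  have 1: "com (\<lambda>y. Re (f y * q y)) \<gamma> = com (\<lambda>y. Re (f y) * Re (q y)) \<gamma> - com (\<lambda>y. Im (f y) * Im (q y)) \<gamma>"
    by (simp only: times_complex.simps) (rule com_minus; intro smooth_mult r \<gamma>)
  have 2: "com (\<lambda>y. Im (f y * q y)) \<gamma> = com (\<lambda>y. Re (f y) * Im (q y)) \<gamma> + com (\<lambda>y. Im (f y) * Re (q y)) \<gamma>"
    by (simp only: times_complex.simps) (rule com_plus; intro smooth_mult r \<gamma>)
  show ?thesis
    unfolding ccom_eq 1 2 com_times[OF r(1,3) \<gamma>] com_times[OF r(2,4) \<gamma>] com_times[OF r(1,4) \<gamma>] com_times[OF r(2,3) \<gamma>]
    by (simp add: complex_eq_iff algebra_simps)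
qed

lemma ccom_const: "\<gamma> \<in> forms A \<Longrightarrow> ccom (\<lambda>_. 1) \<gamma> y vs = 0"
proof -
  assume \<gamma>: "\<gamma> \<in> forms A"
  have "fmul (\<lambda>_. c) \<eta> = c *\<^sub>R \<eta>" for c and \<eta> :: "('m, real) form" by (intro HOL.ext) simp
  then have "com (\<lambda>_. c) \<gamma> = 0" for c unfolding com_def by (simp only: oper_scale[OF oper_bxd \<gamma>] diff_self)
  then show ?thesis unfolding ccom_eq by (simp add: zero_complex.code)
qed

lemma ccom_local:
  assumes f: "f \<in> SFc" and q: "q \<in> SFc" and \<gamma>: "\<gamma> \<in> forms A" and eq: "\<forall>\<^sub>F y in nhds x. f y = q y"
  shows "\<forall>\<^sub>F y in nhds x. ccom f \<gamma> y = ccom q \<gamma> y"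
proof -
  have "\<forall>\<^sub>F y in nhds x. cf f \<gamma> y = cf q \<gamma> y" using eq by (rule eventually_mono) (simp only: cf_def)
  from eq cx_local[OF oper_bxd cf_forms[OF f \<gamma>] cf_forms[OF q \<gamma>] this] show ?thesis
    by eventually_elim (simp only: ccom_def)
qed

text \<open>The commutator with \<open>d \<delta>\<^sub>0 + \<delta>\<^sub>0 d\<close> is a derivation, hence differentiates
  inverse powers of a function as usual.\<close>

lemma ccom_inverse_power:
  assumes v: "v \<in> SFc" and U: "U \<in> SFc" and \<gamma>: "\<gamma> \<in> forms A" and inv: "\<forall>\<^sub>F y in nhds x. v y * U y = 1"
  shows "\<forall>\<^sub>F y in nhds x. \<forall>vs. ccom (\<lambda>y. v y ^ n) \<gamma> y vs = - of_nat n * v y ^ Suc n * ccom U \<gamma> y vs"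
proof -
  have vU: "\<forall>\<^sub>F y in nhds x. ccom (\<lambda>y. v y * U y) \<gamma> y = ccom (\<lambda>_. 1) \<gamma> y"
    by (rule ccom_local[OF SFc_mult[OF v U] SFc_const \<gamma> inv])
  have base: "\<forall>\<^sub>F y in nhds x. \<forall>vs. ccom v \<gamma> y vs = - (v y ^ 2) * ccom U \<gamma> y vs"
    using inv vU
  proof eventually_elim
    case (elim y)
    show ?case
    proof
      fix vs
      have "U y * ccom v \<gamma> y vs + v y * ccom U \<gamma> y vs = 0"
        using fun_cong[OF elim(2), of vs] unfolding ccom_times[OF v U \<gamma>] ccom_const[OF \<gamma>] .
      then have "v y * (U y * ccom v \<gamma> y vs + v y * ccom U \<gamma> y vs) = 0" by simp
      moreover have "v y * (U y * ccom v \<gamma> y vs + v y * ccom U \<gamma> y vs)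
          = (v y * U y) * ccom v \<gamma> y vs + v y ^ 2 * ccom U \<gamma> y vs" by (simp add: algebra_simps power2_eq_square)
      ultimately show "ccom v \<gamma> y vs = - (v y ^ 2) * ccom U \<gamma> y vs" using elim(1) by (simp add: eq_neg_iff_add_eq_0)
    qed
  qed
  show ?thesis
  proof (induction n)
    case 0
    show ?case by (simp add: ccom_const[OF \<gamma>])
  next
    case (Suc n)
    from Suc base show ?case
    proof eventually_elim
      case (elim y)
      have "ccom (\<lambda>y. v y ^ Suc n) \<gamma> y vs = v y ^ n * ccom v \<gamma> y vs + v y * ccom (\<lambda>y. v y ^ n) \<gamma> y vs" for vs
        unfolding power_Suc by (rule ccom_times[OF v SFc_power[OF v] \<gamma>])
      then show ?case using elim by (simp add: algebra_simps power2_eq_square)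
    qed
  qed
qed

lemma ccom_polynomial:
  assumes u: "\<And>i. i \<le> N \<Longrightarrow> u i \<in> SF" and \<gamma>: "\<gamma> \<in> forms A"
  shows "ccom (\<lambda>y. \<Sum>i\<le>N::nat. of_real (u i y) * z ^ i) \<gamma> y vs = (\<Sum>i\<le>N. z ^ i * of_real (com (u i) \<gamma> y vs))"
proof -
  have c: "cf (\<lambda>y. of_real (u i y)) \<gamma> \<in> cforms" if "i \<in> {..N}" for i using that by (intro cf_forms SFc_of_real u \<gamma>) simp
  have "cf (\<lambda>y. \<Sum>i\<le>N. of_real (u i y) * z ^ i) \<gamma> = (\<lambda>y us. \<Sum>i\<le>N. z ^ i * cf (\<lambda>y. of_real (u i y)) \<gamma> y us)"
    by (intro HOL.ext) (simp add: cf_def sum_distrib_left mult_ac)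
  then have "cx bxd (cf (\<lambda>y. \<Sum>i\<le>N. of_real (u i y) * z ^ i) \<gamma>) y vs
      = (\<Sum>i\<le>N. z ^ i * cx bxd (cf (\<lambda>y. of_real (u i y)) \<gamma>) y vs)"
    using cx_sum[where \<beta> = "\<lambda>i. cf (\<lambda>y. of_real (u i y)) \<gamma>" and I = "{..N}" and z = "\<lambda>i. z ^ i", OF oper_bxd c]
    by (simp only:)
  moreover have "cx bxd (cf (\<lambda>y. of_real (u i y)) \<gamma>) y vs = of_real (bxd (fmul (u i) \<gamma>) y vs)" for i
  proof -
    have "fmul (\<lambda>_. 0) \<gamma> = 0" by (intro HOL.ext) simp
    then show ?thesis unfolding cx_cf Re_complex_of_real Im_complex_of_real
      by (simp only: oper_zero[OF oper_bxd] zero_fun_apply) (simp add: complex_eq_iff)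
  qed
  ultimately show ?thesis
    unfolding ccom_def com_def by (simp add: sum_distrib_left sum_subtractf algebra_simps)
qed

section \<open>Uniqueness and existence of the resolvent on germs\<close>

lemma germ_weight:
  assumes \<alpha>: "\<alpha> \<in> forms A" and w: "\<forall>\<^sub>F y in nhds x. \<alpha> y \<in> weight_ge w y"
  obtains \<alpha>' where "\<alpha>' \<in> FW w" "\<forall>\<^sub>F y in nhds x. \<alpha>' y = \<alpha> y"
proof -
  obtain V where V: "open V" "x \<in> V" "\<And>y. y \<in> V \<Longrightarrow> \<alpha> y \<in> weight_ge w y"
    using w unfolding eventually_nhds by blast
  obtain b where b: "b \<in> SF" "\<forall>\<^sub>F y in nhds x. b y = 1" "\<forall>y. y \<notin> V \<longrightarrow> (\<forall>\<^sub>F z in nhds y. b z = 0)"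
    using bump_function[OF V(1,2)] .
  have "fmul b \<alpha> y \<in> weight_ge w y" for y
  proof (cases "y \<in> V")
    case True
    then show ?thesis unfolding fmul_apply by (intro subspace_scale[OF weight_ge_subspace] V(3))
  next
    case False
    then have "b y = 0" using eventually_nhds_x_imp_x[OF b(3)[rule_format, OF False]] by simp
    then show ?thesis unfolding fmul_apply by (simp only: scaleR_zero_left subspace_0[OF weight_ge_subspace])
  qed
  then have "fmul b \<alpha> \<in> FW w" by (simp only: FW_iff fmul_forms[OF b(1) \<alpha>]) simp
  moreover have "\<forall>\<^sub>F y in nhds x. fmul b \<alpha> y = \<alpha> y"
    using b(2) by (rule eventually_mono) (simp only: fmul_apply scaleR_one)
  ultimately show ?thesis by (rule that)
qed

lemma oper_germ_weight:
  assumes T: "oper r j T" and \<alpha>: "\<alpha> \<in> forms A" and w: "\<forall>\<^sub>F y in nhds x. \<alpha> y \<in> weight_ge w y"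
  shows "\<forall>\<^sub>F y in nhds x. T \<alpha> y \<in> weight_ge (w + r) y"
proof -
  obtain \<alpha>' where \<alpha>': "\<alpha>' \<in> FW w" "\<forall>\<^sub>F y in nhds x. \<alpha>' y = \<alpha> y" using germ_weight[OF \<alpha> w] .
  from oper_local[OF T FW_forms[OF \<alpha>'(1)] \<alpha> \<alpha>'(2)] show ?thesis
  proof (rule eventually_mono)
    fix y assume "T \<alpha>' y = T \<alpha> y"
    then show "T \<alpha> y \<in> weight_ge (w + r) y" using FW_weight[OF oper_weight[OF T \<alpha>'(1)], of y] by (simp only:)
  qed
qed

text \<open>Written as (z - box0) \<beta> = (box - box0) \<beta>, the equation expresses \<beta>
  near \<open>x\<close> through forms of higher weight. By induction the germ has every weight, and
  germs of large weight vanish.\<close>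

lemma resolvent_unique:
  assumes u: "\<forall>j::nat. u j \<in> SF"
    and ann: "\<forall>\<^sub>F y in nhds x. \<forall>a\<in>cotensors A y. (\<Sum>j\<le>N. u j y *\<^sub>R (bx y ^^ Suc j) a) = 0"
    and nz: "\<forall>\<^sub>F y in nhds x. (\<Sum>j\<le>N. of_real (u j y) * z ^ j) \<noteq> 0" and z: "z \<noteq> 0"
    and \<beta>: "\<beta> \<in> cforms" and eq: "\<forall>\<^sub>F y in nhds x. \<forall>vs. z * \<beta> y vs - cx bxd \<beta> y vs = 0"
  shows "\<beta> x = (\<lambda>vs. 0)"
proof -
  let ?a = "\<lambda>y us. Re (\<beta> y us)" and ?b = "\<lambda>y us. Im (\<beta> y us)"
  let ?N = "\<lambda>\<alpha>. bxd \<alpha> - B0 \<alpha>"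
  note ab = cforms_D[OF \<beta>]
  let ?I = "SIGMA n:{..N}. {..n}"
  \<comment> \<open>The inverse of z - box0 is applied explicitly through \<open>res_num\<close>. It
    acts on the real and imaginary parts of the right-hand side separately, since \<open>bx\<close>
    is defined on real cotensors.\<close>
  have key: "\<beta> y vs = (\<Sum>p\<in>?I. (k p / (z * U)) * of_real ((bx y ^^ snd p) (?N ?a y) vs)) +
      (\<Sum>p\<in>?I. (\<i> * k p / (z * U)) * of_real ((bx y ^^ snd p) (?N ?b y) vs))"
    if y: "\<forall>a\<in>cotensors A y. (\<Sum>j\<le>N. u j y *\<^sub>R (bx y ^^ Suc j) a) = 0" "U \<noteq> 0"
      "\<forall>vs. z * \<beta> y vs - cx bxd \<beta> y vs = 0"
      and U: "U = (\<Sum>j\<le>N. of_real (u j y) * z ^ j)" and k: "k = (\<lambda>(n, j). of_real (u n y) * z ^ (n - j))" for y vs U k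
  proof -
    note fa = formsD[OF ab(1), of y] and fb = formsD[OF ab(2), of y]
    let ?F = "\<lambda>a. \<Sum>p\<in>?I. k p * of_real ((bx y ^^ snd p) a vs)"
    have F: "?F a = res_num (\<lambda>j. u j y) N z y a vs" for a
      unfolding res_num_def k case_prod_unfold by (simp add: mult.assoc)
    have F_lin: "?F (r *\<^sub>R a + t *\<^sub>R b) = r * ?F a + t * ?F b" if "a \<in> cotensors A y" "b \<in> cotensors A y" for r t a b
      unfolding bx_pow_lin[OF that] by (simp add: sum_distrib_left sum.distrib algebra_simps)
    have Fsol: "z * ?F a - ?F (bx y a) = z * U * of_real (a vs)" if "a \<in> cotensors A y" for a
      unfolding F U by (rule res_num_solves[OF bspec[OF y(1) that]])
    have B: "B0 ?a y = bx y (?a y)" "B0 ?b y = bx y (?b y)" by (simp_all only: on_forms_def)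
    have Na: "?N ?a y = 1 *\<^sub>R (Re z *\<^sub>R ?a y + (- Im z) *\<^sub>R ?b y) + (- 1) *\<^sub>R bx y (?a y)"
    proof
      fix vs
      have "Re (z * \<beta> y vs) = Re (cx bxd \<beta> y vs)" using y(3) by simp
      then show "?N ?a y vs = (1 *\<^sub>R (Re z *\<^sub>R ?a y + (- Im z) *\<^sub>R ?b y) + (- 1) *\<^sub>R bx y (?a y)) vs"
        using fun_cong[OF B(1), of vs] by (simp add: cx_def)
    qed
    have Nb: "?N ?b y = 1 *\<^sub>R (Re z *\<^sub>R ?b y + Im z *\<^sub>R ?a y) + (- 1) *\<^sub>R bx y (?b y)"
    proof
      fix vs
      have "Im (z * \<beta> y vs) = Im (cx bxd \<beta> y vs)" using y(3) by simp
      then show "?N ?b y vs = (1 *\<^sub>R (Re z *\<^sub>R ?b y + Im z *\<^sub>R ?a y) + (- 1) *\<^sub>R bx y (?b y)) vs"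
        using fun_cong[OF B(2), of vs] by (simp add: cx_def)
    qed
    note sub = subspace_add[OF cotensors_subspace subspace_scale[OF cotensors_subspace] subspace_scale[OF cotensors_subspace]]
    have "?F (?N ?a y) + \<i> * ?F (?N ?b y) = (z * ?F (?a y) - ?F (bx y (?a y))) + \<i> * (z * ?F (?b y) - ?F (bx y (?b y)))"
      unfolding Na Nb F_lin[OF sub[OF fa fb] bx_fibre[OF fa]] F_lin[OF sub[OF fb fa] bx_fibre[OF fb]] F_lin[OF fa fb] F_lin[OF fb fa]
      by (subst (3 4) complex_eq[of z]) (simp add: algebra_simps)
    also have "\<dots> = z * U * \<beta> y vs"
      unfolding Fsol[OF fa] Fsol[OF fb] by (subst (3) complex_eq[of "\<beta> y vs"]) (simp add: algebra_simps)
    finally have "\<beta> y vs = (?F (?N ?a y) + \<i> * ?F (?N ?b y)) / (z * U)" using z y(2) by simp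
    then show ?thesis by (simp add: add_divide_distrib sum_divide_distrib sum_distrib_left mult.assoc)
  qed
  have weights: "(\<forall>\<^sub>F y in nhds x. ?a y \<in> weight_ge w y) \<and> (\<forall>\<^sub>F y in nhds x. ?b y \<in> weight_ge w y)" for w
  proof (induction w)
    case 0
    show ?case by (simp add: weight_ge_def)
  next
    case (Suc w)
    have "\<forall>\<^sub>F y in nhds x. \<forall>j\<in>{..N}. (bx y ^^ j) (?N c y) \<in> weight_ge (Suc w) y"
      if "c \<in> forms A" "\<forall>\<^sub>F y in nhds x. c y \<in> weight_ge w y" for c
    proof (rule eventually_ball_finite)
      show "\<forall>j\<in>{..N}. \<forall>\<^sub>F y in nhds x. (bx y ^^ j) (?N c y) \<in> weight_ge (Suc w) y"
      proof
        fix j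
        have "\<forall>\<^sub>F y in nhds x. (B0 ^^ j) (?N c) y \<in> weight_ge (w + 1 + 0) y"
          by (rule oper_germ_weight[OF oper_B0_pow oper_forms[OF oper_bxd_diff that(1)] oper_germ_weight[OF oper_bxd_diff that]])
        then show "\<forall>\<^sub>F y in nhds x. (bx y ^^ j) (?N c y) \<in> weight_ge (Suc w) y"
          by (simp only: B0_pow add_0_right Suc_eq_plus1)
      qed
    qed simp
    from this[OF ab(1)] this[OF ab(2)] Suc
    have "\<forall>\<^sub>F y in nhds x. \<forall>j\<in>{..N}. (bx y ^^ j) (?N ?a y) \<in> weight_ge (Suc w) y"
      "\<forall>\<^sub>F y in nhds x. \<forall>j\<in>{..N}. (bx y ^^ j) (?N ?b y) \<in> weight_ge (Suc w) y" by (simp_all only: simp_thms)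
    then have "\<forall>\<^sub>F y in nhds x. ?a y \<in> weight_ge (Suc w) y \<and> ?b y \<in> weight_ge (Suc w) y"
      using ann nz eq
    proof eventually_elim
      case (elim y)
      let ?k = "\<lambda>(n, j). of_real (u n y) * z ^ (n - j)" and ?U = "\<Sum>j\<le>N. of_real (u j y) * z ^ j"
      note k = key[OF elim(3-5) refl refl]
      let ?c = "\<lambda>p. ?k p / (z * ?U)" and ?c' = "\<lambda>p. \<i> * ?k p / (z * ?U)"
      have "?a y = (\<Sum>p\<in>?I. Re (?c p) *\<^sub>R (bx y ^^ snd p) (?N ?a y)) + (\<Sum>p\<in>?I. Re (?c' p) *\<^sub>R (bx y ^^ snd p) (?N ?b y))"
        unfolding Re_sum_of_real[symmetric] by (rule HOL.ext) (simp only: k plus_complex.simps plus_fun_apply)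
      moreover have "?b y = (\<Sum>p\<in>?I. Im (?c p) *\<^sub>R (bx y ^^ snd p) (?N ?a y)) + (\<Sum>p\<in>?I. Im (?c' p) *\<^sub>R (bx y ^^ snd p) (?N ?b y))"
        unfolding Re_sum_of_real[symmetric] by (rule HOL.ext) (simp only: k plus_complex.simps plus_fun_apply)
      moreover have "(\<Sum>p\<in>?I. r p *\<^sub>R (bx y ^^ snd p) (?N ?a y)) + (\<Sum>p\<in>?I. t p *\<^sub>R (bx y ^^ snd p) (?N ?b y)) \<in> weight_ge (Suc w) y" for r t
        by (intro subspace_add[OF weight_ge_subspace] subspace_sum[OF weight_ge_subspace] subspace_scale[OF weight_ge_subspace])
          (use elim(1,2) in auto)
      ultimately show ?case by (simp only:)
    qed
    then show ?case by (simp only: eventually_conj_iff)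
  qed
  obtain W where W: "\<forall>\<^sub>F y in nhds x. \<forall>\<alpha>\<in>FW W. \<alpha> y = 0" using FW_vanish .
  have zero: "c x = 0" if c: "c \<in> forms A" "\<forall>\<^sub>F y in nhds x. c y \<in> weight_ge W y" for c
  proof -
    obtain c' where c': "c' \<in> FW W" "\<forall>\<^sub>F y in nhds x. c' y = c y" using germ_weight[OF c] .
    show ?thesis using eventually_nhds_x_imp_x[OF c'(2)] bspec[OF eventually_nhds_x_imp_x[OF W] c'(1)] by (simp only:)
  qed
  have "?a x = 0" "?b x = 0" using zero[OF ab(1)] zero[OF ab(2)] weights[of W] by blast+
  then show ?thesis by (auto simp: fun_eq_iff complex_eq_iff)
qed

lemma SFc_inverse:
  assumes f: "f \<in> SFc" and nz: "\<forall>\<^sub>F y in nhds x. f y \<noteq> 0"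
  shows "\<exists>v\<in>SFc. \<forall>\<^sub>F y in nhds x. v y * f y = 1"
proof -
  obtain W where W: "open W" "x \<in> W" "\<And>y. y \<in> W \<Longrightarrow> f y \<noteq> 0" using nz unfolding eventually_nhds by blast
  have r: "smooth_near A y (\<lambda>y. Re (f y))" "smooth_near A y (\<lambda>y. Im (f y))" for y
    using f by (simp_all add: SFc_def smooth_near_of_smooth)
  let ?d = "\<lambda>y. Re (f y) * Re (f y) + Im (f y) * Im (f y)"
  have d: "smooth_near A y (\<lambda>y. inverse (?d y))" if "y \<in> W" for y
  proof (rule smooth_near_inverse)
    show "smooth_near A y ?d" by (intro smooth_near_add smooth_near_mult r)
    show "?d y \<noteq> 0" using W(3)[OF that] by (simp add: sum_squares_eq_zero_iff complex_eq_iff)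
  qed
  obtain a where a: "a \<in> SF" "\<forall>\<^sub>F y in nhds x. a y = Re (f y) * inverse (?d y)"
    using smooth_extension[OF W(1,2) smooth_near_mult[OF r(1) d]] by blast
  obtain b where b: "b \<in> SF" "\<forall>\<^sub>F y in nhds x. b y = Im (f y) * inverse (?d y)"
    using smooth_extension[OF W(1,2) smooth_near_mult[OF r(2) d]] by blast
  show ?thesis
  proof (rule bexI[of _ "\<lambda>y. Complex (a y) (- b y)"])
    show "(\<lambda>y. Complex (a y) (- b y)) \<in> SFc" by (simp add: SFc_def a(1) smooth_uminus[OF b(1)])
    show "\<forall>\<^sub>F y in nhds x. Complex (a y) (- b y) * f y = 1"
      using a(2) b(2) nz
    proof eventually_elim
      case (elim y)
      have "?d y \<noteq> 0" using elim(3) by (simp add: sum_squares_eq_zero_iff complex_eq_iff)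
      then have "?d y * inverse (?d y) = 1" by simp
      then show ?case unfolding elim(1,2) by (simp add: complex_eq_iff algebra_simps)
    qed
  qed
qed

text \<open>Let v be the inverse of u(z) near \<open>x\<close>. A multiple of the polynomial
  \<open>res_num\<close> solves the equation for the algebraic Laplacian. For the full one two
  errors arise, from the difference of the Laplacians and from the commutator with the power of v in
  front. Both raise the weight, so the recursion ends once germs vanish. Each round costs one factor
  z in the denominator, which bounds the order of the pole independently of \<alpha>.\<close>

lemma resolvent_exists:
  assumes u: "\<forall>j::nat. u j \<in> SF" and e: "e > 0"
    and ann: "\<forall>\<^sub>F y in nhds x. \<forall>a\<in>cotensors A y. (\<Sum>j\<le>N. u j y *\<^sub>R (bx y ^^ Suc j) a) = 0"
    and nz: "\<forall>\<^sub>F y in nhds x. \<forall>z. cmod z \<le> e \<longrightarrow> (\<Sum>j\<le>N. of_real (u j y) * z ^ j) \<noteq> 0"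
  obtains k :: nat where "k > 0"
    "\<forall>\<alpha>\<in>forms A. \<exists>\<beta> h. (\<forall>z. 0 < cmod z \<and> cmod z < e \<longrightarrow> \<beta> z \<in> cforms \<and>
        (\<forall>\<^sub>F y in nhds x. \<forall>vs. z * \<beta> z y vs - cx bxd (\<beta> z) y vs = of_real (\<alpha> y vs)) \<and>
        (\<forall>vs. z ^ k * \<beta> z x vs = h vs z)) \<and> (\<forall>vs. h vs holomorphic_on ball 0 e)"
proof -
  let ?U = "\<lambda>z y. \<Sum>j\<le>N. of_real (u j y) * z ^ j"
  have us: "u j \<in> SF" for j using u by (rule spec)
  have U_SFc: "?U z \<in> SFc" for z by (intro SFc_sum SFc_mult SFc_of_real us SFc_const)
  have "\<forall>z. \<exists>v. cmod z < e \<longrightarrow> v \<in> SFc \<and> (\<forall>\<^sub>F y in nhds x. v y * ?U z y = 1)"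
  proof
    fix z show "\<exists>v. cmod z < e \<longrightarrow> v \<in> SFc \<and> (\<forall>\<^sub>F y in nhds x. v y * ?U z y = 1)"
    proof (cases "cmod z < e")
    case True
    have "\<forall>\<^sub>F y in nhds x. ?U z y \<noteq> 0" using nz by (rule eventually_mono) (use True in simp)
    from SFc_inverse[OF U_SFc this] show ?thesis by blast
    qed simp
  qed
  \<comment> \<open>The smooth inverses are chosen for each z separately, so nothing is known about
    their dependence on z. Only their values at \<open>x\<close> enter the holomorphic data
    \<open>h\<close>, and those are forced to be \<open>vx z\<close>.\<close>
  from choice[OF this] obtain v where
    v0: "\<forall>z. cmod z < e \<longrightarrow> v z \<in> SFc \<and> (\<forall>\<^sub>F y in nhds x. v z y * ?U z y = 1)" by (elim exE)
  have v: "v z \<in> SFc" "\<forall>\<^sub>F y in nhds x. v z y * ?U z y = 1" if "cmod z < e" for z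
    by (rule conjunct1[OF mp[OF spec[OF v0] that]], rule conjunct2[OF mp[OF spec[OF v0] that]])
  define vx :: "complex \<Rightarrow> complex" where "vx z = 1 / ?U z x" for z
  have Ux: "?U z x \<noteq> 0" if "cmod z < e" for z using eventually_nhds_x_imp_x[OF nz] that by simp
  have vx: "v z x = vx z" if "cmod z < e" for z
    using eventually_nhds_x_imp_x[OF v(2)[OF that]] Ux[OF that] by (simp add: vx_def field_simps)
  have vx_hol: "vx holomorphic_on ball 0 e"
    unfolding vx_def by (intro holomorphic_intros) (use Ux in auto)
  obtain W where W: "\<forall>\<^sub>F y in nhds x. \<forall>\<alpha>\<in>FW W. \<alpha> y = 0" using FW_vanish .
  \<comment> \<open>The right-hand side carries a power of \<open>v\<close> because the errors of
    each round do; the recursion closes only when \<open>n\<close> is arbitrary. The number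
    \<open>k\<close> bounds the order of the pole.\<close>
  define sol where "sol \<alpha> n k \<beta> h \<longleftrightarrow> (\<forall>z. 0 < cmod z \<and> cmod z < e \<longrightarrow> \<beta> z \<in> cforms \<and>
        (\<forall>\<^sub>F y in nhds x. \<forall>vs. z * \<beta> z y vs - cx bxd (\<beta> z) y vs = v z y ^ n * of_real (\<alpha> y vs)) \<and>
        (\<forall>vs. z ^ k * \<beta> z x vs = h vs z)) \<and> (\<forall>vs. h vs holomorphic_on ball 0 e)"
    for \<alpha> :: "('m, real) form" and n k :: nat and \<beta> :: "complex \<Rightarrow> ('m, complex) form" and h :: "'m tvec list \<Rightarrow> complex \<Rightarrow> complex"
  let ?N = "\<lambda>\<alpha>. bxd \<alpha> - B0 \<alpha>"
  have claim: "\<exists>\<beta> h. sol \<alpha> n k \<beta> h" if "w + k \<ge> W" "\<alpha> \<in> FW w" for w k n \<alpha>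
    using that
  proof (induction k arbitrary: w n \<alpha>)
    case 0
    have \<alpha>: "\<alpha> \<in> FW W" using 0 FW_mono[of W w] by auto
    have ev: "\<forall>\<^sub>F y in nhds x. \<alpha> y = 0" using W by (rule eventually_mono) (rule bspec[OF _ \<alpha>])
    have zc: "(\<lambda>y us. 0) \<in> cforms" using cforms_sum[of "{}" "\<lambda>_::nat. \<lambda>y us. 0"] by simp
    have c0: "cx bxd (\<lambda>y us. 0) y vs = 0" for y vs
      using cx_sum[OF oper_bxd, of "{}" "\<lambda>_::nat. \<lambda>y us. 0" "\<lambda>_. 0"] by simp
    have "sol \<alpha> n 0 (\<lambda>z y us. 0) (\<lambda>vs z. 0)"
      unfolding sol_def
    proof (intro conjI allI impI)
      fix z
      show "\<forall>\<^sub>F y in nhds x. \<forall>vs. z * 0 - cx bxd (\<lambda>y us. 0) y vs = v z y ^ n * of_real (\<alpha> y vs)"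
        using ev by (rule eventually_mono) (simp add: c0)
    qed (simp_all add: zc)
    then show ?case by (rule exI[where x = "\<lambda>z y us. 0", OF exI[where x = "\<lambda>vs z. 0"]])
  next
    case (Suc k)
    let ?I = "SIGMA m:{..N}. {..m}"
    let ?J = "?I \<times> {..N}"
    note \<alpha> = FW_forms[OF Suc.prems(2)]
    define q where "q p = fst p - snd p" for p :: "nat \<times> nat"
    define \<gamma> where "\<gamma> p = fmul (u (fst p)) ((B0 ^^ snd p) \<alpha>)" for p
    have \<gamma>w: "\<gamma> p \<in> FW w" for p
      using FW_fmul[OF us oper_weight[OF oper_B0_pow Suc.prems(2)]] by (simp only: \<gamma>_def add_0_right)
    note \<gamma>f = FW_forms[OF \<gamma>w]
    \<comment> \<open>Both errors with the common factor \<open>v z y ^ (n + 2)\<close>. The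
      commutator has it by \<open>ccom_inverse_power\<close>; the other error has one factor fewer
      and is multiplied by 1 = v u(z). Expanding u(z) in powers of z, with index
      \<open>snd t\<close>, leaves forms that do not depend on z, as the induction hypothesis
      requires.\<close>
    define \<eta> where "\<eta> t = fmul (u (snd t)) (?N (\<gamma> (fst t))) - real (Suc n) *\<^sub>R com (u (snd t)) (\<gamma> (fst t))" for t
    have "\<eta> t \<in> FW (w + 1)" for t
      unfolding \<eta>_def
      by (intro subspace_diff[OF FW_subspace] subspace_scale[OF FW_subspace] FW_fmul us com_weight \<gamma>w oper_weight[OF oper_bxd_diff])
    then have "\<exists>\<beta> h. sol (\<eta> t) (n + 2) k \<beta> h" for t using Suc.IH[of "w + 1" "\<eta> t"] Suc.prems(1) by simp
    then obtain \<theta> hh where th: "\<And>t. sol (\<eta> t) (n + 2) k (\<theta> t) (hh t)" by metis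
    define f where "f z y = v z y ^ Suc n" for z :: complex and y
    define \<beta> where "\<beta> z = (\<lambda>y us. inverse z * (\<Sum>p\<in>?I. z ^ q p * cf (f z) (\<gamma> p) y us) +
        inverse z * (\<Sum>t\<in>?J. z ^ (q (fst t) + snd t) * \<theta> t z y us))" for z :: complex
    define h where "h vs z = z ^ k * (\<Sum>p\<in>?I. z ^ q p * (vx z ^ Suc n * of_real (\<gamma> p x vs))) +
        (\<Sum>t\<in>?J. z ^ (q (fst t) + snd t) * hh t vs z)" for vs and z :: complex
    have "sol \<alpha> n (Suc k) \<beta> h"
      unfolding sol_def
    proof (rule conjI, intro allI impI, elim conjE)
      fix z assume z: "0 < cmod z" "cmod z < e"
      note vz = v(1)[OF z(2)]
      have fz: "f z \<in> SFc" unfolding f_def by (rule SFc_power[OF vz])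
      have c1: "cf (f z) (\<gamma> p) \<in> cforms" for p by (rule cf_forms[OF fz \<gamma>f])
      have th_z: "\<theta> t z \<in> cforms" "\<forall>\<^sub>F y in nhds x. \<forall>vs. z * \<theta> t z y vs - cx bxd (\<theta> t z) y vs = v z y ^ (n + 2) * of_real (\<eta> t y vs)"
        "z ^ k * \<theta> t z x vs = hh t vs z" for t vs
        using th[of t] z unfolding sol_def by blast+
      note cI = cforms_sum[where \<beta> = "\<lambda>p. cf (f z) (\<gamma> p)" and I = ?I and z = "\<lambda>p. z ^ q p", OF c1]
      note cJ = cforms_sum[where \<beta> = "\<lambda>t. \<theta> t z" and I = ?J and z = "\<lambda>t. z ^ (q (fst t) + snd t)", OF th_z(1)]
      have \<beta>c: "\<beta> z \<in> cforms" unfolding \<beta>_def by (rule cx_add(2)[OF oper_bxd cI cJ])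
      have cx\<beta>: "cx bxd (\<beta> z) y vs = inverse z * (\<Sum>p\<in>?I. z ^ q p * cx bxd (cf (f z) (\<gamma> p)) y vs) +
          inverse z * (\<Sum>t\<in>?J. z ^ (q (fst t) + snd t) * cx bxd (\<theta> t z) y vs)" for y vs
        unfolding \<beta>_def cx_add(1)[OF oper_bxd cI cJ]
          cx_sum[where \<beta> = "\<lambda>p. cf (f z) (\<gamma> p)" and I = ?I and z = "\<lambda>p. z ^ q p", OF oper_bxd c1]
          cx_sum[where \<beta> = "\<lambda>t. \<theta> t z" and I = ?J and z = "\<lambda>t. z ^ (q (fst t) + snd t)", OF oper_bxd th_z(1)] ..
      have ev1: "\<forall>\<^sub>F y in nhds x. \<forall>p\<in>?I. \<forall>vs. ccom (f z) (\<gamma> p) y vs = - of_nat (Suc n) * v z y ^ Suc (Suc n) * ccom (?U z) (\<gamma> p) y vs"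
        unfolding f_def by (intro eventually_ball_finite ballI ccom_inverse_power[OF vz U_SFc \<gamma>f v(2)[OF z(2)]]) simp
      have ev2: "\<forall>\<^sub>F y in nhds x. \<forall>t\<in>?J. \<forall>vs. z * \<theta> t z y vs - cx bxd (\<theta> t z) y vs = v z y ^ (n + 2) * of_real (\<eta> t y vs)"
        by (intro eventually_ball_finite ballI th_z(2)) simp
      have eq: "\<forall>\<^sub>F y in nhds x. \<forall>vs. z * \<beta> z y vs - cx bxd (\<beta> z) y vs = v z y ^ n * of_real (\<alpha> y vs)"
        using ann v(2)[OF z(2)] ev1 ev2
      proof eventually_elim
        case (elim y)
        show ?case
        proof
          fix vs
          let ?v = "v z y"
          have cxp: "cx bxd (cf (f z) (\<gamma> p)) y vs = ccom (f z) (\<gamma> p) y vs + ?v ^ Suc n * (of_real (B0 (\<gamma> p) y vs) + of_real (?N (\<gamma> p) y vs))" for p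
            unfolding ccom_def f_def by (simp add: algebra_simps)
          have inner: "(\<Sum>i\<le>N. z ^ i * (?v ^ (n + 2) * of_real (\<eta> (p, i) y vs)))
              = ?v ^ Suc n * of_real (?N (\<gamma> p) y vs) + ccom (f z) (\<gamma> p) y vs" if p: "p \<in> ?I" for p
          proof -
            define nn where "nn = ?N (\<gamma> p) y vs"
            have "(\<Sum>i\<le>N. z ^ i * (?v ^ (n + 2) * of_real (\<eta> (p, i) y vs)))
                = ?v ^ (n + 2) * (?U z y * of_real nn - of_nat (Suc n) * (\<Sum>i\<le>N. z ^ i * of_real (com (u i) (\<gamma> p) y vs)))"
            proof -
              have e: "\<eta> (p, i) y vs = u i y * nn - real (Suc n) * com (u i) (\<gamma> p) y vs" for i
                by (simp add: \<eta>_def nn_def)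
              have "z ^ i * (?v ^ (n + 2) * of_real (\<eta> (p, i) y vs)) = ?v ^ (n + 2) * ((of_real (u i y) * z ^ i) * of_real nn
                  - of_nat (Suc n) * (z ^ i * of_real (com (u i) (\<gamma> p) y vs)))" for i
                unfolding e by (simp add: algebra_simps del: of_nat_Suc power_Suc)
              then show ?thesis by (simp only: sum_distrib_left[symmetric] sum_subtractf sum_distrib_right[symmetric])
            qed
            also have "(\<Sum>i\<le>N. z ^ i * of_real (com (u i) (\<gamma> p) y vs)) = ccom (?U z) (\<gamma> p) y vs"
              by (rule ccom_polynomial[OF us \<gamma>f, symmetric])
            also have "?v ^ (n + 2) * (?U z y * of_real nn - of_nat (Suc n) * ccom (?U z) (\<gamma> p) y vs)
                = (?v * ?U z y) * ?v ^ Suc n * of_real nn + (- of_nat (Suc n) * ?v ^ Suc (Suc n) * ccom (?U z) (\<gamma> p) y vs)"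
              by (simp add: algebra_simps del: of_nat_Suc)
            also have "\<dots> = ?v ^ Suc n * of_real (?N (\<gamma> p) y vs) + ccom (f z) (\<gamma> p) y vs"
              unfolding spec[OF bspec[OF elim(3) p]] elim(2) mult_1_left nn_def ..
            finally show ?thesis .
          qed
          have main: "(\<Sum>p\<in>?I. z ^ q p * (z * of_real (\<gamma> p y vs) - of_real (B0 (\<gamma> p) y vs))) = z * ?U z y * of_real (\<alpha> y vs)"
          proof -
            have "\<gamma> p y vs = u (fst p) y * (bx y ^^ snd p) (\<alpha> y) vs" for p
              unfolding \<gamma>_def fmul_apply scaleR_fun_apply B0_pow by simp
            moreover have "B0 (\<gamma> p) y vs = u (fst p) y * (bx y ^^ snd p) (bx y (\<alpha> y)) vs" for p
            proof -
              have "B0 (\<gamma> p) y = u (fst p) y *\<^sub>R (B0 ^^ Suc (snd p)) \<alpha> y"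
                unfolding \<gamma>_def bundle_fmul[OF bx_bundle B0_pow_forms[OF \<alpha>]] fmul_apply by (simp only: funpow.simps o_apply)
              then show ?thesis unfolding B0_pow unfolding funpow_Suc_right by (simp only: scaleR_fun_apply o_apply real_scaleR_def)
            qed
            ultimately have "(\<Sum>p\<in>?I. z ^ q p * (z * of_real (\<gamma> p y vs) - of_real (B0 (\<gamma> p) y vs)))
                = z * res_num (\<lambda>j. u j y) N z y (\<alpha> y) vs - res_num (\<lambda>j. u j y) N z y (bx y (\<alpha> y)) vs"
              unfolding res_num_def case_prod_unfold q_def by (simp add: sum_distrib_left sum_subtractf algebra_simps)
            then show ?thesis using res_num_solves[OF bspec[OF elim(1) formsD[OF \<alpha>]]] by simp
          qed
          have "(\<Sum>t\<in>?J. z ^ (q (fst t) + snd t) * (z * \<theta> t z y vs - cx bxd (\<theta> t z) y vs))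
              = (\<Sum>t\<in>?J. z ^ (q (fst t) + snd t) * (?v ^ (n + 2) * of_real (\<eta> t y vs)))"
          proof (rule sum.cong[OF refl])
            fix t assume t: "t \<in> ?J"
            show "z ^ (q (fst t) + snd t) * (z * \<theta> t z y vs - cx bxd (\<theta> t z) y vs)
                = z ^ (q (fst t) + snd t) * (?v ^ (n + 2) * of_real (\<eta> t y vs))"
              unfolding spec[OF bspec[OF elim(4) t]] ..
          qed
          also have "\<dots> = (\<Sum>p\<in>?I. \<Sum>i\<le>N. z ^ (q p + i) * (?v ^ (n + 2) * of_real (\<eta> (p, i) y vs)))"
            unfolding sum.cartesian_product by (intro sum.cong refl) auto
          also have "\<dots> = (\<Sum>p\<in>?I. z ^ q p * (\<Sum>i\<le>N. z ^ i * (?v ^ (n + 2) * of_real (\<eta> (p, i) y vs))))"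
            by (simp add: sum_distrib_left power_add mult.assoc)
          also have "\<dots> = (\<Sum>p\<in>?I. z ^ q p * (?v ^ Suc n * of_real (?N (\<gamma> p) y vs) + ccom (f z) (\<gamma> p) y vs))"
            by (intro sum.cong refl) (simp only: inner)
          finally have J: "(\<Sum>t\<in>?J. z ^ (q (fst t) + snd t) * (z * \<theta> t z y vs - cx bxd (\<theta> t z) y vs))
              = (\<Sum>p\<in>?I. z ^ q p * (?v ^ Suc n * of_real (?N (\<gamma> p) y vs) + ccom (f z) (\<gamma> p) y vs))" .
          have "z * \<beta> z y vs - cx bxd (\<beta> z) y vs =
              inverse z * ((\<Sum>p\<in>?I. z ^ q p * (z * cf (f z) (\<gamma> p) y vs - cx bxd (cf (f z) (\<gamma> p)) y vs)) +
                (\<Sum>t\<in>?J. z ^ (q (fst t) + snd t) * (z * \<theta> t z y vs - cx bxd (\<theta> t z) y vs)))"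
          proof -
            have "\<beta> z y vs = inverse z * (\<Sum>p\<in>?I. z ^ q p * cf (f z) (\<gamma> p) y vs) +
                inverse z * (\<Sum>t\<in>?J. z ^ (q (fst t) + snd t) * \<theta> t z y vs)" by (simp only: \<beta>_def)
            then show ?thesis unfolding cx\<beta> by (simp add: sum_distrib_left sum_subtractf algebra_simps)
          qed
          also have "\<dots> = inverse z * (\<Sum>p\<in>?I. ?v ^ Suc n * (z ^ q p * (z * of_real (\<gamma> p y vs) - of_real (B0 (\<gamma> p) y vs))))"
            unfolding J sum.distrib[symmetric]
            by (intro arg_cong[where f = "\<lambda>c. inverse z * c"] sum.cong refl, unfold cxp) (simp add: cf_def f_def algebra_simps)
          also have "\<dots> = inverse z * (?v ^ Suc n * (z * ?U z y * of_real (\<alpha> y vs)))"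
            unfolding sum_distrib_left[symmetric] main ..
          also have "\<dots> = (inverse z * z) * (?v * ?U z y) * ?v ^ n * of_real (\<alpha> y vs)" by (simp add: mult_ac)
          also have "\<dots> = ?v ^ n * of_real (\<alpha> y vs)" using elim(2) z by simp
          finally show "z * \<beta> z y vs - cx bxd (\<beta> z) y vs = ?v ^ n * of_real (\<alpha> y vs)" .
        qed
      qed
      have "z ^ Suc k * \<beta> z x vs = h vs z" for vs
      proof -
        have "z ^ Suc k * \<beta> z x vs = (z * inverse z) * (z ^ k * (\<Sum>p\<in>?I. z ^ q p * cf (f z) (\<gamma> p) x vs) +
            (\<Sum>t\<in>?J. z ^ (q (fst t) + snd t) * (z ^ k * \<theta> t z x vs)))"
          unfolding \<beta>_def by (simp add: sum_distrib_left algebra_simps)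
        also have "\<dots> = h vs z" unfolding th_z(3) h_def using z by (simp add: cf_def f_def vx)
        finally show ?thesis .
      qed
      then show "\<beta> z \<in> cforms \<and> (\<forall>\<^sub>F y in nhds x. \<forall>vs. z * \<beta> z y vs - cx bxd (\<beta> z) y vs = v z y ^ n * of_real (\<alpha> y vs)) \<and>
          (\<forall>vs. z ^ Suc k * \<beta> z x vs = h vs z)" using \<beta>c eq by (intro conjI allI)
    next
      have "hh t vs holomorphic_on ball 0 e" for t vs using th[of t] unfolding sol_def by blast
      then show "\<forall>vs. h vs holomorphic_on ball 0 e"
        unfolding h_def by (intro allI holomorphic_intros vx_hol)
    qed
    then show ?case by (rule exI[where x = \<beta>, OF exI[where x = h]])
  qed
  show ?thesis
  \<comment> \<open>Starting from weight 0 the recursion needs \<open>W\<close> rounds; the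
    successor ensures a positive order.\<close>
  proof (rule that[of "Suc W"], simp, intro ballI)
    fix \<alpha> :: "('m, real) form" assume "\<alpha> \<in> forms A"
    then have "\<exists>\<beta> h. sol \<alpha> 0 (Suc W) \<beta> h" by (intro claim[of 0]) (simp_all add: FW_0)
    then show "\<exists>\<beta> h. (\<forall>z. 0 < cmod z \<and> cmod z < e \<longrightarrow> \<beta> z \<in> cforms \<and>
        (\<forall>\<^sub>F y in nhds x. \<forall>vs. z * \<beta> z y vs - cx bxd (\<beta> z) y vs = of_real (\<alpha> y vs)) \<and>
        (\<forall>vs. z ^ Suc W * \<beta> z x vs = h vs z)) \<and> (\<forall>vs. h vs holomorphic_on ball 0 e)"
      unfolding sol_def power_0 mult_1 .
  qed
qed

text \<open>Since box P = 0, box R = 1 - P and P R = 0, the sum of P/z, of - z^i R^(i+1) for i < k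
  and of z^k (z - box)^(-1) R^k is the resolvent. With k from \<open>resolvent_exists\<close> the
  last term is holomorphic at 0 although the resolvent in it is known only to have a pole of order
  at most k, so the residue is P.\<close>

lemma P_proj_eq:
  assumes \<alpha>: "\<alpha> \<in> forms A"
  shows "P_proj A c0 \<alpha> = pert.P \<alpha>"
proof (intro HOL.ext)
  fix x vs
  obtain u N e where u: "\<forall>j::nat. u j \<in> SF" "\<forall>j>N. \<forall>y. u j y = 0" "e > 0"
    and ann: "\<forall>\<^sub>F y in nhds x. \<forall>a\<in>cotensors A y. (\<Sum>j\<le>N. u j y *\<^sub>R (bx y ^^ Suc j) a) = 0"
    and nz: "\<forall>\<^sub>F y in nhds x. \<forall>z. cmod z \<le> e \<longrightarrow> (\<Sum>j\<le>N. of_real (u j y) * z ^ j) \<noteq> 0"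
    and "\<forall>\<^sub>F y in nhds x. \<forall>z. 0 < cmod z \<and> cmod z \<le> e \<longrightarrow> bij_at z y"
    using annihilator[of x] .
  obtain k :: nat where k: "k > 0" and ex: "\<forall>\<alpha>\<in>forms A. \<exists>\<beta> h. (\<forall>z. 0 < cmod z \<and> cmod z < e \<longrightarrow> \<beta> z \<in> cforms \<and>
        (\<forall>\<^sub>F y in nhds x. \<forall>vs. z * \<beta> z y vs - cx bxd (\<beta> z) y vs = of_real (\<alpha> y vs)) \<and>
        (\<forall>vs. z ^ k * \<beta> z x vs = h vs z)) \<and> (\<forall>vs. h vs holomorphic_on ball 0 e)"
    using resolvent_exists[OF u(1,3) ann nz] .
  define Rp where "Rp i = (pert.R ^^ i) \<alpha>" for i
  have Rp: "Rp i \<in> forms A" for i unfolding Rp_def using \<alpha> oper_forms[OF oper_R] by (induction i) simp_all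
  have Rp_Suc: "Rp (Suc i) = pert.R (Rp i)" for i by (simp only: Rp_def funpow.simps o_apply)
  obtain \<beta> h where \<beta>0: "\<forall>z. 0 < cmod z \<and> cmod z < e \<longrightarrow> \<beta> z \<in> cforms \<and>
        (\<forall>\<^sub>F y in nhds x. \<forall>vs. z * \<beta> z y vs - cx bxd (\<beta> z) y vs = of_real (Rp k y vs)) \<and>
        (\<forall>vs. z ^ k * \<beta> z x vs = h vs z)" and h_hol: "\<forall>vs. h vs holomorphic_on ball 0 e"
    using bspec[OF ex Rp[of k]] by (elim exE conjE)
  have \<beta>: "\<beta> z \<in> cforms" "\<forall>\<^sub>F y in nhds x. \<forall>vs. z * \<beta> z y vs - cx bxd (\<beta> z) y vs = of_real (Rp k y vs)"
    "z ^ k * \<beta> z x vs = h vs z" if "0 < cmod z" "cmod z < e" for z vs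
  proof -
    note c = mp[OF spec[OF \<beta>0] conjI[OF that]]
    show "\<beta> z \<in> cforms" "\<forall>\<^sub>F y in nhds x. \<forall>vs. z * \<beta> z y vs - cx bxd (\<beta> z) y vs = of_real (Rp k y vs)" "z ^ k * \<beta> z x vs = h vs z"
      by (rule conjunct1[OF c], rule conjunct1[OF conjunct2[OF c]], rule spec[OF conjunct2[OF conjunct2[OF c]]])
  qed
  define one where "one \<gamma> = cf (\<lambda>_. 1) \<gamma>" for \<gamma>
  have one_c: "one \<gamma> \<in> cforms" if "\<gamma> \<in> forms A" for \<gamma> unfolding one_def by (rule cf_forms[OF SFc_const that])
  have cx_one: "cx bxd (one \<gamma>) y vs = of_real (bxd \<gamma> y vs)" if "\<gamma> \<in> forms A" for \<gamma> y vs
    using ccom_const[OF that, of y vs] by (simp add: one_def ccom_def)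
  have one_at: "one \<gamma> y vs = of_real (\<gamma> y vs)" for \<gamma> y vs by (simp add: one_def cf_def)
  note Pf = pert.P_closed[OF \<alpha>]
  let ?c = "\<lambda>z i. - (z ^ i)"
  have res: "resolvent A c0 z \<alpha> x vs = (of_real (pert.P \<alpha> x vs) - z * (\<Sum>i<k. z ^ i * of_real (Rp (Suc i) x vs)) + z * h vs z) / z"
    if z: "0 < cmod z" "cmod z < e" for z
  proof -
    define S where "S = (\<lambda>y us. \<Sum>i<k. ?c z i * one (Rp (Suc i)) y us)"
    define S2 where "S2 = (\<lambda>y us. inverse z * one (pert.P \<alpha>) y us + 1 * S y us)"
    define \<tau> where "\<tau> = (\<lambda>y us. 1 * S2 y us + z ^ k * \<beta> z y us)"
    have S: "S \<in> cforms" unfolding S_def by (rule cforms_sum) (rule one_c[OF Rp])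
    have S2: "S2 \<in> cforms" unfolding S2_def by (rule cx_add(2)[OF oper_bxd one_c[OF Pf] S])
    have \<tau>: "\<tau> \<in> cforms" unfolding \<tau>_def by (rule cx_add(2)[OF oper_bxd S2 \<beta>(1)[OF z]])
    have cx\<tau>: "cx bxd \<tau> y vs = (inverse z * of_real (bxd (pert.P \<alpha>) y vs) + (\<Sum>i<k. ?c z i * of_real (bxd (Rp (Suc i)) y vs))) + z ^ k * cx bxd (\<beta> z) y vs" for y vs
    proof -
      have "cx bxd S y vs = (\<Sum>i<k. ?c z i * cx bxd (one (Rp (Suc i))) y vs)"
        unfolding S_def by (rule cx_sum[OF oper_bxd]) (rule one_c[OF Rp])
      then show ?thesis
        unfolding \<tau>_def cx_add(1)[OF oper_bxd S2 \<beta>(1)[OF z]]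
        unfolding S2_def cx_add(1)[OF oper_bxd one_c[OF Pf] S] by (simp add: cx_one Rp Pf)
    qed
    have bP: "bxd (pert.P \<alpha>) = 0" unfolding bxd_eq by (rule pert.box_P[OF \<alpha>])
    have bR: "bxd (Rp (Suc i)) = Rp i - (if i = 0 then pert.P \<alpha> else 0)" for i
    proof -
      have "bxd (Rp (Suc i)) = Rp i - pert.P (Rp i)" unfolding bxd_eq Rp_Suc by (rule pert.box_R[OF Rp])
      moreover have "pert.P (Rp i) = (if i = 0 then pert.P \<alpha> else 0)"
      proof (cases i)
        case 0
        then show ?thesis by (simp only: Rp_def funpow.simps id_apply if_True simp_thms)
      next
        case (Suc i')
        have "pert.P (Rp (Suc i')) = 0" unfolding Rp_Suc by (rule pert.PR[OF Rp])
        then show ?thesis unfolding Suc by (simp only: nat.distinct if_False simp_thms)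
      qed
      ultimately show ?thesis by (simp only:)
    qed
    have sol: "\<forall>\<^sub>F y in nhds x. \<forall>vs. z * \<tau> y vs - box_complex A c0 \<tau> y vs = of_real (\<alpha> y vs)"
      using \<beta>(2)[OF z]
    proof (rule eventually_mono, intro allI)
      fix y vs assume b: "\<forall>vs. z * \<beta> z y vs - cx bxd (\<beta> z) y vs = of_real (Rp k y vs)"
      let ?r = "\<lambda>i. complex_of_real (Rp i y vs)" and ?P = "complex_of_real (pert.P \<alpha> y vs)"
      have bR': "complex_of_real (bxd (Rp (Suc i)) y vs) = ?r i - (if i = 0 then ?P else 0)" for i
        unfolding bR by simp
      have P1: "(\<Sum>i<k. z ^ i * (if i = 0 then ?P else 0)) = ?P"
      proof -
        have "(\<Sum>i<k. z ^ i * (if i = 0 then ?P else 0)) = (\<Sum>i<k. if i = 0 then ?P else 0)" by (intro sum.cong refl) simp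
        then show ?thesis using k by simp
      qed
      \<comment> \<open>The terms with R cancel between neighbouring powers of z; what survives is
        \<alpha> minus z^k R^k \<alpha>, and the remainder term supplies the latter.\<close>
      have "(\<Sum>i<k. z ^ Suc i * ?r (Suc i) - z ^ i * ?r i) = z ^ k * ?r k - z ^ 0 * ?r 0"
        by (rule sum_lessThan_telescope)
      then have tel: "(\<Sum>i<k. z ^ i * ?r i) - z * (\<Sum>i<k. z ^ i * ?r (Suc i)) = ?r 0 - z ^ k * ?r k"
        by (simp add: sum_subtractf sum_distrib_left algebra_simps)
      have "z * \<tau> y vs - cx bxd \<tau> y vs = (z * inverse z) * ?P - z * (\<Sum>i<k. z ^ i * ?r (Suc i))
          + (\<Sum>i<k. z ^ i * (?r i - (if i = 0 then ?P else 0))) + z ^ k * (z * \<beta> z y vs - cx bxd (\<beta> z) y vs)"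
      proof -
        have t: "\<tau> y vs = inverse z * ?P - (\<Sum>i<k. z ^ i * ?r (Suc i)) + z ^ k * \<beta> z y vs"
          unfolding \<tau>_def S2_def S_def one_at by (simp add: sum_negf)
        have neg: "(\<Sum>i<k. ?c z i * (?r i - (if i = 0 then ?P else 0))) = - (\<Sum>i<k. z ^ i * (?r i - (if i = 0 then ?P else 0)))"
          by (simp only: mult_minus_left sum_negf)
        show ?thesis unfolding cx\<tau> bP bR' neg t by (simp add: algebra_simps)
      qed
      also have "\<dots> = ?P + ((\<Sum>i<k. z ^ i * ?r i) - z * (\<Sum>i<k. z ^ i * ?r (Suc i)))
          - (\<Sum>i<k. z ^ i * (if i = 0 then ?P else 0)) + z ^ k * ?r k"
        unfolding b[rule_format] right_diff_distrib sum_subtractf using z by (simp add: algebra_simps)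
      also have "\<dots> = ?r 0" unfolding tel P1 by simp
      finally show "z * \<tau> y vs - box_complex A c0 \<tau> y vs = of_real (\<alpha> y vs)"
        unfolding box_complex_eq by (simp add: Rp_def)
    qed
    have zn: "z \<noteq> 0" using z by auto
    have nz_z: "\<forall>\<^sub>F y in nhds x. (\<Sum>j\<le>N. of_real (u j y) * z ^ j) \<noteq> 0"
      using nz by (rule eventually_mono) (use z in simp)
    have "resolvent A c0 z \<alpha> x = \<tau> x"
      unfolding resolvent_def
    proof (rule the_equality)
      show "\<exists>\<beta>\<in>cforms. \<tau> x = \<beta> x \<and> (\<forall>\<^sub>F y in nhds x. \<forall>vs. z * \<beta> y vs - box_complex A c0 \<beta> y vs = of_real (\<alpha> y vs))"
        by (rule bexI[OF _ \<tau>]) (intro conjI refl sol)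
      fix b assume "\<exists>\<beta>\<in>cforms. b = \<beta> x \<and> (\<forall>\<^sub>F y in nhds x. \<forall>vs. z * \<beta> y vs - box_complex A c0 \<beta> y vs = of_real (\<alpha> y vs))"
      then obtain \<sigma> where \<sigma>: "\<sigma> \<in> cforms" "b = \<sigma> x" "\<forall>\<^sub>F y in nhds x. \<forall>vs. z * \<sigma> y vs - box_complex A c0 \<sigma> y vs = of_real (\<alpha> y vs)"
        by (elim bexE conjE)
      define \<delta> where "\<delta> = (\<lambda>y us. 1 * \<sigma> y us + (- 1) * \<tau> y us)"
      have "\<delta> \<in> cforms" unfolding \<delta>_def by (rule cx_add(2)[OF oper_bxd \<sigma>(1) \<tau>])
      moreover have "\<forall>\<^sub>F y in nhds x. \<forall>vs. z * \<delta> y vs - cx bxd \<delta> y vs = 0"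
        using sol \<sigma>(3)
      proof eventually_elim
        case (elim y)
        show ?case
          unfolding \<delta>_def cx_add(1)[OF oper_bxd \<sigma>(1) \<tau>]
          using elim unfolding box_complex_eq by (simp add: algebra_simps)
      qed
      ultimately have "\<delta> x = (\<lambda>vs. 0)" by (rule resolvent_unique[OF u(1) ann nz_z zn])
      then show "b = \<tau> x" unfolding \<sigma>(2) \<delta>_def by (simp add: fun_eq_iff)
    qed
    then have "resolvent A c0 z \<alpha> x vs = \<tau> x vs" by (rule fun_cong)
    also have "\<dots> = inverse z * of_real (pert.P \<alpha> x vs) - (\<Sum>i<k. z ^ i * of_real (Rp (Suc i) x vs)) + z ^ k * \<beta> z x vs"
      unfolding \<tau>_def S2_def S_def one_at by (simp add: sum_negf)
    finally show ?thesis unfolding \<beta>(3)[OF z] using zn by (simp add: field_simps)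
  qed
  have "small_circle_integral (\<lambda>z. resolvent A c0 z \<alpha> x vs)
      = of_real (pert.P \<alpha> x vs) - 0 * (\<Sum>i<k. 0 ^ i * of_real (Rp (Suc i) x vs)) + 0 * h vs 0"
    by (rule small_circle_integral_eq[OF _ u(3) res]) (intro holomorphic_intros spec[OF h_hol])
  then show "P_proj A c0 \<alpha> x vs = pert.P \<alpha> x vs" by (simp add: P_proj_def)
qed

end

section \<open>The isomorphism in cohomology\<close>

lemma coset_eq_iff:
  assumes "subspace B"
  shows "coset B a = coset B b \<longleftrightarrow> a - b \<in> B"
proof
  assume "coset B a = coset B b"
  moreover have "a \<in> coset B a" using subspace_0[OF assms] by (force simp: coset_def)
  ultimately show "a - b \<in> B" by (auto simp: coset_def)
next
  assume ab: "a - b \<in> B"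
  have "coset B c \<subseteq> coset B c'" if "c - c' \<in> B" for c c'
  proof
    fix x assume "x \<in> coset B c"
    then obtain y where "y \<in> B" "x = c + y" by (auto simp: coset_def)
    then show "x \<in> coset B c'"
      unfolding coset_def using subspace_add[OF assms that, of y] by (intro image_eqI[of _ _ "(c - c') + y"]) auto
  qed
  from this[OF ab] this[of b a] show "coset B a = coset B b"
    using subspace_neg[OF assms ab] by auto
qed

lemma quotients_isomorphicI:
  fixes f :: "'a::real_vector \<Rightarrow> 'b::real_vector"
  assumes Z: "subspace Z" and B: "subspace B" and B': "subspace B'"
    and fZ: "\<And>a. a \<in> Z \<Longrightarrow> f a \<in> Z'"
    and lin: "\<And>a b r t. a \<in> Z \<Longrightarrow> b \<in> Z \<Longrightarrow> f (r *\<^sub>R a + t *\<^sub>R b) = r *\<^sub>R f a + t *\<^sub>R f b"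
    and inj: "\<And>a. a \<in> Z \<Longrightarrow> f a \<in> B' \<longleftrightarrow> a \<in> B"
    and surj: "\<And>b. b \<in> Z' \<Longrightarrow> \<exists>a\<in>Z. b - f a \<in> B'"
  shows "quotients_isomorphic Z B Z' B'"
proof -
  define F where "F X = coset B' (f (SOME a. a \<in> Z \<and> X = coset B a))" for X
  have diff: "f (a - b) = f a - f b" if "a \<in> Z" "b \<in> Z" for a b using lin[OF that, of 1 "- 1"] by simp
  have F: "F (coset B a) = coset B' (f a)" if a: "a \<in> Z" for a
  proof -
    let ?b = "SOME b. b \<in> Z \<and> coset B a = coset B b"
    have b: "?b \<in> Z \<and> coset B a = coset B ?b" by (rule someI[of _ a]) (simp add: a)
    then have "a - ?b \<in> B" using coset_eq_iff[OF B] by blast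
    moreover have "a - ?b \<in> Z" using subspace_diff[OF Z a] b by blast
    ultimately have "f a - f ?b \<in> B'" using inj diff[OF a] b by metis
    then show ?thesis unfolding F_def using coset_eq_iff[OF B'] by metis
  qed
  have "bij_betw F (coset B ` Z) (coset B' ` Z')"
    unfolding bij_betw_def
  proof
    show "inj_on F (coset B ` Z)"
    proof (rule inj_onI, elim imageE)
      fix X Y a b assume *: "F X = F Y" "X = coset B a" "a \<in> Z" "Y = coset B b" "b \<in> Z"
      then have "f a - f b \<in> B'" using F coset_eq_iff[OF B'] by metis
      then have "a - b \<in> B" using inj[OF subspace_diff[OF Z *(3,5)]] diff[OF *(3,5)] by simp
      then show "X = Y" using * coset_eq_iff[OF B] by simp
    qed
    show "F ` coset B ` Z = coset B' ` Z'"
    proof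
      show "F ` coset B ` Z \<subseteq> coset B' ` Z'" using F fZ by auto
      show "coset B' ` Z' \<subseteq> F ` coset B ` Z"
      proof
        fix Y assume "Y \<in> coset B' ` Z'"
        then obtain b where b: "b \<in> Z'" "Y = coset B' b" by blast
        obtain a where a: "a \<in> Z" "b - f a \<in> B'" using surj[OF b(1)] by blast
        then have "Y = F (coset B a)" using b(2) F coset_eq_iff[OF B'] by simp
        then show "Y \<in> F ` coset B ` Z" using a(1) by blast
      qed
    qed
  qed
  moreover have "F (coset B (r *\<^sub>R a + t *\<^sub>R b)) = coset B' (r *\<^sub>R a' + t *\<^sub>R b')"
    if "a \<in> Z" "b \<in> Z" "F (coset B a) = coset B' a'" "F (coset B b) = coset B' b'" for a b a' b' r t
  proof -
    have "f a - a' \<in> B'" "f b - b' \<in> B'" using that F coset_eq_iff[OF B'] by metis+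
    then have "r *\<^sub>R (f a - a') + t *\<^sub>R (f b - b') \<in> B'"
      by (intro subspace_add[OF B'] subspace_scale[OF B'])
    moreover have "r *\<^sub>R (f a - a') + t *\<^sub>R (f b - b') = f (r *\<^sub>R a + t *\<^sub>R b) - (r *\<^sub>R a' + t *\<^sub>R b')"
      by (simp add: lin[OF that(1,2)] algebra_simps)
    moreover have "r *\<^sub>R a + t *\<^sub>R b \<in> Z" by (intro subspace_add[OF Z] subspace_scale[OF Z] that)
    ultimately show ?thesis using F coset_eq_iff[OF B'] by simp
  qed
  ultimately show ?thesis unfolding quotients_isomorphic_def by (intro exI[of _ F]) blast
qed

lemma linear_image_subspace:
  assumes E: "subspace E" and lin: "\<And>a b r t. a \<in> E \<Longrightarrow> b \<in> E \<Longrightarrow> T (r *\<^sub>R a + t *\<^sub>R b) = r *\<^sub>R T a + t *\<^sub>R T b"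
  shows "T 0 = 0" "subspace (T ` E)"
proof -
  show T0: "T 0 = 0" using lin[of 0 0 0 0] subspace_0[OF E] by simp
  show "subspace (T ` E)"
  proof (rule subspaceI)
    show "0 \<in> T ` E" using T0 subspace_0[OF E] by (metis imageI)
    fix x y r assume "x \<in> T ` E"
    then obtain a where a: "a \<in> E" "x = T a" by blast
    have "T (r *\<^sub>R a) = r *\<^sub>R T a" using lin[OF a(1) a(1), of r 0] by simp
    then show "r *\<^sub>R x \<in> T ` E" using a subspace_scale[OF E a(1), of r] by (metis imageI)
    assume "y \<in> T ` E"
    then obtain b where b: "b \<in> E" "y = T b" by blast
    have "T (a + b) = T a + T b" using lin[OF a(1) b(1), of 1 1] by simp
    then show "x + y \<in> T ` E" using a b subspace_add[OF E a(1) b(1)] by (metis imageI)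
  qed
qed

lemma coboundaries_subspace:
  assumes "\<And>k. subspace (C k)" "\<And>k a b r t. a \<in> C k \<Longrightarrow> b \<in> C k \<Longrightarrow> D (r *\<^sub>R a + t *\<^sub>R b) = r *\<^sub>R D a + t *\<^sub>R D b"
  shows "subspace (coboundaries C D k)"
  by (cases k) (simp_all add: coboundaries_def linear_image_subspace(2)[OF assms] subspace_single_0)

lemma cocycles_subspace:
  assumes C: "\<And>k. subspace (C k)" and lin: "\<And>k a b r t. a \<in> C k \<Longrightarrow> b \<in> C k \<Longrightarrow> D (r *\<^sub>R a + t *\<^sub>R b) = r *\<^sub>R D a + t *\<^sub>R D b"
  shows "subspace (cocycles C D k)"
proof (rule subspaceI)
  show "0 \<in> cocycles C D k"
    using linear_image_subspace(1)[OF C lin] subspace_0[OF C] by (simp add: cocycles_def)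
  fix a b r assume a: "a \<in> cocycles C D k"
  then show "r *\<^sub>R a \<in> cocycles C D k"
    using lin[of a k a r 0] subspace_scale[OF C, of a k r] by (simp add: cocycles_def)
  assume "b \<in> cocycles C D k"
  then show "a + b \<in> cocycles C D k"
    using a lin[of a k b 1 1] subspace_add[OF C, of a k b] by (simp add: cocycles_def)
qed

context base_complex
begin

lemma L_op_eq: "\<alpha> \<in> forms A \<Longrightarrow> L_op A d0 c0 \<alpha> = pert.L \<alpha>"
  unfolding L_op_def Let_def pert.L_def
  by (simp only: P_proj_eq[OF Pi_forms] P_proj_eq[OF forms_diff[OF _ Pi_forms]])

lemma deg_subspace: "subspace (forms_deg A k)"
proof (rule subspaceI)
  show "0 \<in> forms_deg A k" by (simp add: forms_deg_def forms_zero has_degree_def)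
qed (simp_all add: forms_deg_def forms_add forms_scale has_degree_def)

lemma oper_maps_deg:
  assumes T: "oper w j T" and \<alpha>: "\<alpha> \<in> forms_deg A k" and l: "int l = int k + j"
  shows "T \<alpha> \<in> forms_deg A l"
  unfolding forms_deg_def has_degree_def
proof (intro CollectI conjI allI impI)
  show "T \<alpha> \<in> forms A" using oper_forms[OF T] \<alpha> by (simp add: forms_deg_def)
  show "T \<alpha> x vs = 0" if "length vs \<noteq> l" for x vs
    by (rule oper_degree_zero[OF T \<alpha>]) (use that l in simp)
qed

text \<open>On \<open>E0\<close> the operator \<open>L\<close> coincides with \<open>P\<close>, so L
  D = d P there and \<open>P\<close> is a chain map from \<open>E0\<close> to the de Rham complex
  that can be inverted on its image through \<open>M\<close>. The homotopy 1 - P = h d + d h makes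
  every closed form cohomologous to one in that image.\<close>

lemma cohomology_iso:
  "quotients_isomorphic
     (cocycles (E0 A d0 c0) (D_op A d0 c0) k) (coboundaries (E0 A d0 c0) (D_op A d0 c0) k)
     (cocycles (forms_deg A) dR k) (coboundaries (forms_deg A) dR k)"
proof -
  let ?L = "pert.L" and ?P = "pert.P" and ?h = "pert.h" and ?D = "D_op A d0 c0"
  obtain M where M: "oper 0 0 M" "\<And>\<alpha>. \<alpha> \<in> forms A \<Longrightarrow> ?L (M \<alpha>) = \<alpha>" "\<And>\<alpha>. \<alpha> \<in> forms A \<Longrightarrow> M (?L \<alpha>) = \<alpha>"
    using L_bij by blast
  note Mf = oper_forms[OF M(1)] and Pf = pert.P_closed and hf = pert.h_closed
  have Ef: "\<alpha> \<in> forms A" if "\<alpha> \<in> E0 A d0 c0 i" for \<alpha> i using that by (simp add: E0_def forms_deg_def)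
  have Ed: "\<alpha> \<in> forms_deg A i" if "\<alpha> \<in> E0 A d0 c0 i" for \<alpha> i using that by (simp add: E0_def)
  have EPi: "Prj \<alpha> = \<alpha>" if "\<alpha> \<in> E0 A d0 c0 i" for \<alpha> i using that by (simp only: E0_iff)
  have LE: "?L \<alpha> = ?P \<alpha>" if "\<alpha> \<in> E0 A d0 c0 i" for \<alpha> i by (rule pert.LS[OF Ef[OF that] EPi[OF that]])
  have inv: "inv_into (forms A) (L_op A d0 c0) \<beta> = M \<beta>" if \<beta>: "\<beta> \<in> forms A" for \<beta>
  proof (rule inv_into_f_eq)
    show "inj_on (L_op A d0 c0) (forms A)"
    proof (rule inj_onI)
      fix \<alpha> \<beta> assume ab: "\<alpha> \<in> forms A" "\<beta> \<in> forms A" and "L_op A d0 c0 \<alpha> = L_op A d0 c0 \<beta>"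
      then have "M (?L \<alpha>) = M (?L \<beta>)" by (simp only: L_op_eq)
      then show "\<alpha> = \<beta>" by (simp only: M(3)[OF ab(1)] M(3)[OF ab(2)])
    qed
    show "M \<beta> \<in> forms A" by (rule Mf[OF \<beta>])
    show "L_op A d0 c0 (M \<beta>) = \<beta>" unfolding L_op_eq[OF Mf[OF \<beta>]] by (rule M(2)[OF \<beta>])
  qed
  have D: "?D \<alpha> = M (dR (?P \<alpha>))" if "\<alpha> \<in> E0 A d0 c0 i" for \<alpha> i
    unfolding D_op_def EPi[OF that] L_op_eq[OF Ef[OF that]] LE[OF that] by (rule inv[OF dR_forms[OF Pf[OF Ef[OF that]]]])
  have D_lin: "?D (r *\<^sub>R \<alpha> + t *\<^sub>R \<beta>) = r *\<^sub>R ?D \<alpha> + t *\<^sub>R ?D \<beta>"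
    if ab: "\<alpha> \<in> E0 A d0 c0 i" "\<beta> \<in> E0 A d0 c0 i" and c: "r *\<^sub>R \<alpha> + t *\<^sub>R \<beta> \<in> E0 A d0 c0 i" for \<alpha> \<beta> r t i
    unfolding D[OF ab(1)] D[OF ab(2)] D[OF c] oper_lin[OF oper_P Ef[OF ab(1)] Ef[OF ab(2)]]
      oper_lin[OF oper_dR Pf[OF Ef[OF ab(1)]] Pf[OF Ef[OF ab(2)]]]
    by (rule oper_lin[OF M(1) dR_forms[OF Pf[OF Ef[OF ab(1)]]] dR_forms[OF Pf[OF Ef[OF ab(2)]]]])
  have E_sub: "subspace (E0 A d0 c0 i)" for i
  proof (rule subspaceI)
    show "0 \<in> E0 A d0 c0 i" unfolding E0_iff by (intro conjI subspace_0[OF deg_subspace] oper_zero[OF oper_Pi])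
    fix \<alpha> \<beta> r assume a: "\<alpha> \<in> E0 A d0 c0 i"
    show "r *\<^sub>R \<alpha> \<in> E0 A d0 c0 i"
      unfolding E0_iff oper_scale[OF oper_Pi Ef[OF a]] EPi[OF a] by (intro conjI subspace_scale[OF deg_subspace] Ed[OF a] refl)
    assume b: "\<beta> \<in> E0 A d0 c0 i"
    show "\<alpha> + \<beta> \<in> E0 A d0 c0 i"
      unfolding E0_iff oper_add[OF oper_Pi Ef[OF a] Ef[OF b]] EPi[OF a] EPi[OF b]
      by (intro conjI subspace_add[OF deg_subspace] Ed[OF a] Ed[OF b] refl)
  qed
  have E_lin: "r *\<^sub>R \<alpha> + t *\<^sub>R \<beta> \<in> E0 A d0 c0 i" if "\<alpha> \<in> E0 A d0 c0 i" "\<beta> \<in> E0 A d0 c0 i" for \<alpha> \<beta> r t i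
    by (intro subspace_add[OF E_sub] subspace_scale[OF E_sub] that)
  \<comment> \<open>By P L = P Pi0, projecting \<open>M \<omega>\<close> to \<open>E0\<close> does
    not change what \<open>P\<close> makes of it, and P L (M \<omega>) = P \<omega> =
    \<omega>.\<close>
  have lift: "\<exists>\<alpha>\<in>E0 A d0 c0 i. ?P \<alpha> = \<omega>" if w: "\<omega> \<in> forms_deg A i" "?P \<omega> = \<omega>" for \<omega> i
  proof -
    have wf: "\<omega> \<in> forms A" using w(1) by (simp add: forms_deg_def)
    let ?\<alpha> = "Prj (M \<omega>)"
    have d: "?\<alpha> \<in> forms_deg A i" by (rule oper_maps_deg[OF oper_Pi oper_maps_deg[OF M(1) w(1)]]) simp_all
    have E: "?\<alpha> \<in> E0 A d0 c0 i" unfolding E0_iff by (intro conjI d pert.SS Mf wf)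
    have "?P ?\<alpha> = ?P (?L (M \<omega>))" by (rule pert.PL[OF Mf[OF wf], symmetric])
    also have "\<dots> = \<omega>" unfolding M(2)[OF wf] by (rule w(2))
    finally have eq: "?P ?\<alpha> = \<omega>" .
    show ?thesis by (rule bexI[where x = ?\<alpha>], rule eq, rule E)
  qed
  have Pdeg: "?P \<alpha> \<in> forms_deg A i" if "\<alpha> \<in> forms_deg A i" for \<alpha> i
    by (rule oper_maps_deg[OF oper_P that]) simp
  have D_zero: "?D \<alpha> = 0 \<longleftrightarrow> dR (?P \<alpha>) = 0" if a: "\<alpha> \<in> E0 A d0 c0 i" for \<alpha> i
  proof
    assume "?D \<alpha> = 0"
    then have "?L (M (dR (?P \<alpha>))) = ?L 0" unfolding D[OF a] by (rule arg_cong)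
    moreover have "?L 0 = 0" using pert.LS[OF forms_zero] by (simp only: oper_zero[OF oper_Pi] oper_zero[OF oper_P])
    ultimately show "dR (?P \<alpha>) = 0" unfolding M(2)[OF dR_forms[OF Pf[OF Ef[OF a]]]] by (simp only:)
  next
    assume "dR (?P \<alpha>) = 0"
    then show "?D \<alpha> = 0" unfolding D[OF a] by (simp only: oper_zero[OF M(1)])
  qed
  show ?thesis
  proof (rule quotients_isomorphicI[where f = ?P])
    show "subspace (cocycles (E0 A d0 c0) ?D k)"
      by (rule cocycles_subspace[OF E_sub]) (rule D_lin[OF _ _ E_lin])
    show "subspace (coboundaries (E0 A d0 c0) ?D k)"
      by (rule coboundaries_subspace[OF E_sub]) (rule D_lin[OF _ _ E_lin])
    show "subspace (coboundaries (forms_deg A) dR k)"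
      by (rule coboundaries_subspace[OF deg_subspace]) (rule oper_lin[OF oper_dR]; simp add: forms_deg_def)
  next
    fix a assume "a \<in> cocycles (E0 A d0 c0) ?D k"
    then have a: "a \<in> E0 A d0 c0 k" "?D a = 0" by (simp_all add: cocycles_def)
    have Pa: "?P a \<in> forms_deg A k" by (rule Pdeg[OF Ed[OF a(1)]])
    show "?P a \<in> cocycles (forms_deg A) dR k"
      unfolding cocycles_def mem_Collect_eq using Pa a(2) unfolding D_zero[OF a(1)] by (rule conjI)
    show "?P a \<in> coboundaries (forms_deg A) dR k \<longleftrightarrow> a \<in> coboundaries (E0 A d0 c0) ?D k"
    proof (cases k)
      case 0
      have "M (?L a) = M 0" if "?P a = 0" unfolding LE[OF a(1)] that ..
      then have "a = 0" if "?P a = 0" unfolding M(3)[OF Ef[OF a(1)]] oper_zero[OF M(1)] using that .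
      moreover have "?P a = 0" if "a = 0" unfolding that by (rule oper_zero[OF oper_P])
      ultimately show ?thesis unfolding 0 coboundaries_def nat.case singleton_iff by (rule iffI)
    next
      case (Suc j)
      show ?thesis
        unfolding Suc coboundaries_def nat.case
      proof
        assume "?P a \<in> dR ` forms_deg A j"
        then obtain \<omega> where w: "?P a = dR \<omega>" "\<omega> \<in> forms_deg A j" by (rule imageE)
        have wf: "\<omega> \<in> forms A" using w(2) by (simp add: forms_deg_def)
        \<comment> \<open>A primitive \<omega> of \<open>?P a\<close> may be replaced by
          \<open>?P \<omega>\<close>, as \<open>P\<close> commutes with d and fixes
          \<open>?P a\<close>; this one lifts to \<open>E0\<close>.\<close>
        obtain b where b: "b \<in> E0 A d0 c0 j" "?P b = ?P \<omega>"
          using lift[OF Pdeg[OF w(2)] pert.PP[OF wf]] by (elim bexE)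
        have "?D b = M (?P (dR \<omega>))" unfolding D[OF b(1)] b(2) pert.dP[OF wf] ..
        also have "\<dots> = M (?L a)" unfolding w(1)[symmetric] pert.PP[OF Ef[OF a(1)]] LE[OF a(1)] ..
        also have "\<dots> = a" by (rule M(3)[OF Ef[OF a(1)]])
        finally show "a \<in> ?D ` E0 A d0 c0 j" using b(1) by (rule image_eqI[OF sym])
      next
        assume "a \<in> ?D ` E0 A d0 c0 j"
        then obtain b where b: "a = ?D b" "b \<in> E0 A d0 c0 j" by (rule imageE)
        have "?P a = ?L (M (dR (?P b)))" unfolding LE[OF a(1), symmetric] unfolding b(1) D[OF b(2)] ..
        also have "\<dots> = dR (?P b)" by (rule M(2)[OF dR_forms[OF Pf[OF Ef[OF b(2)]]]])
        finally show "?P a \<in> dR ` forms_deg A j"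
          using oper_maps_deg[OF oper_P Ed[OF b(2)]] by (intro image_eqI) simp_all
      qed
    qed
    fix b r t assume "b \<in> cocycles (E0 A d0 c0) ?D k"
    then have b: "b \<in> E0 A d0 c0 k" by (simp add: cocycles_def)
    show "?P (r *\<^sub>R a + t *\<^sub>R b) = r *\<^sub>R ?P a + t *\<^sub>R ?P b" by (rule oper_lin[OF oper_P Ef[OF a(1)] Ef[OF b]])
  next
    fix \<omega> assume "\<omega> \<in> cocycles (forms_deg A) dR k"
    then have w: "\<omega> \<in> forms_deg A k" "dR \<omega> = 0" by (simp_all add: cocycles_def)
    have wf: "\<omega> \<in> forms A" using w(1) by (simp add: forms_deg_def)
    obtain a where a: "a \<in> E0 A d0 c0 k" "?P a = ?P \<omega>"
      using lift[OF Pdeg[OF w(1)] pert.PP[OF wf]] by (elim bexE)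
    have "dR (?P a) = 0" unfolding a(2) pert.dP[OF wf] w(2) by (rule oper_zero[OF oper_P])
    then have ac: "a \<in> cocycles (E0 A d0 c0) ?D k" using a(1) D_zero[OF a(1)] by (simp add: cocycles_def)
    have diff: "\<omega> - ?P a = dR (?h \<omega>)"
      unfolding a(2)
      unfolding pert.P_def w(2) pert.h_0 by (simp only: diff_0_right diff_diff_eq2 add_diff_cancel_left')
    have "\<omega> - ?P a \<in> coboundaries (forms_deg A) dR k"
    proof (cases k)
      case 0
      \<comment> \<open>In degree 0 the homotopy would land in degree -1, where no list has the
        required length.\<close>
      have "?h \<omega> = 0"
        by (intro HOL.ext) (simp add: oper_degree_zero[OF oper_h w(1)] 0)
      then have "\<omega> - ?P a = 0" unfolding diff by (simp only: oper_zero[OF oper_dR])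
      then show ?thesis unfolding 0 coboundaries_def nat.case by (rule iffD2[OF singleton_iff])
    next
      case (Suc j)
      have "?h \<omega> \<in> forms_deg A j" by (rule oper_maps_deg[OF oper_h w(1)]) (simp add: Suc)
      then show ?thesis unfolding diff Suc coboundaries_def nat.case by (rule imageI)
    qed
    then show "\<exists>a\<in>cocycles (E0 A d0 c0) ?D k. \<omega> - ?P a \<in> coboundaries (forms_deg A) dR k" using ac by (rule bexI)
  qed
qed

end

theorem corollary4p9:
  fixes A :: "('m::{t2_space,second_countable_topology}, 'e::euclidean_space) chart set"
    and H :: "nat \<Rightarrow> 'm \<Rightarrow> 'm tvec set"
    and s :: nat
    and g :: "'m \<Rightarrow> 'm tvec \<Rightarrow> 'm tvec \<Rightarrow> real"
    and d\<^sub>0 \<delta>\<^sub>0 :: "'m bundle_map"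
  assumes "smooth_atlas A"
    and "filtration A H s"
    and "riemannian_metric A g"
    and "base_pair A H s g d\<^sub>0 \<delta>\<^sub>0"
    and "locally_uniform_radius A d\<^sub>0 \<delta>\<^sub>0"
  shows "\<forall>k. quotients_isomorphic
           (cocycles (E0 A d\<^sub>0 \<delta>\<^sub>0) (D_op A d\<^sub>0 \<delta>\<^sub>0) k) (coboundaries (E0 A d\<^sub>0 \<delta>\<^sub>0) (D_op A d\<^sub>0 \<delta>\<^sub>0) k)
           (cocycles (forms_deg A) (deRham A) k) (coboundaries (forms_deg A) (deRham A) k)"
proof
  fix k
  interpret base_complex A H s g d\<^sub>0 \<delta>\<^sub>0
    using assms by unfold_locales
  show "quotients_isomorphic
      (cocycles (E0 A d\<^sub>0 \<delta>\<^sub>0) (D_op A d\<^sub>0 \<delta>\<^sub>0) k) (coboundaries (E0 A d\<^sub>0 \<delta>\<^sub>0) (D_op A d\<^sub>0 \<delta>\<^sub>0) k)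
      (cocycles (forms_deg A) (deRham A) k) (coboundaries (forms_deg A) (deRham A) k)"
    by (rule cohomology_iso)
qed

end
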